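(* Let $r\in\mathbb{N}$. There exists a constant $C_r>0$, depending only on $r$ and the fixed domain $\Omega$, such that for all $1\le q\le p\le\infty$, $f\in L^p(\Omega)$ and $n\in\mathbb{N}$, $$\tau_r(f,n^{-1})_{p,q}\le C_r\,n^{-r}\sum_{s=0}^n(s+1)^{r-1}E_s(f)_p .$$
   Context: Let $d\ge1$ be an integer; $\|\cdot\|$ is the Euclidean norm, $|E|$ Lebesgue measure, $\mathrm{dist}(\xi,E)=\inf_{\eta\in E}\|\xi-\eta\|$. A bounded domain $\Omega_0\subset\mathbb{R}^{d+1}$ is $C^2$ if there exist $\delta>0$, $M>0$ and a finite cover of its boundary $\Gamma$ by connected open sets $U_1,\dots,U_J$ such that (i) for every $x\in\Omega_0$ with $\mathrm{dist}(x,\Gamma)<\delta$ there is $j$ with $x\in U_j$ and $\mathrm{dist}(x,\partial U_j)>\delta$; (ii) for each $j$ there is a Cartesian coordinate system $(\xi_{j,1},\dots,\xi_{j,d+1})$ in $U_j$ in which $\Omega_0\cap U_j$ is represented by $\xi_{j,d+1}\le f_j(\xi_{j,1},\dots,\xi_{j,d})$ with $f_j:\mathbb{R}^d\to\mathbb{R}$ of class $C^2$ and $\max_{i,k}\|\partial_i\partial_kf_j\|_\infty\le M$. $\Omega$ is a fixed closure of an open, connected, bounded $C^2$-domain in $\mathbb{R}^{d+1}$, with boundary $\Gamma=\partial\Omega$. $L^p(\Omega)$, $0<p<\infty$, is with respect to Lebesgue measure; $L^\infty(\Omega)$ means $C(\Omega)$ with the uniform norm. $\Pi_n^{d+1}$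 is the space of real polynomials on $\mathbb{R}^{d+1}$ of total degree $\le n$, and $E_n(f)_p=\inf\{\|f-Q\|_{L^p(\Omega)}:Q\in\Pi_n^{d+1}\}$. $\triangle_\xi^rf(\eta)=\sum_{j=0}^r(-1)^{r+j}\binom rjf(\eta+j\xi)$; $\triangle_\xi^r(f,\Omega,\eta)=\triangle_\xi^rf(\eta)$ if the segment $[\eta,\eta+r\xi]\subset\Omega$, and $0$ otherwise. $\rho_\Omega(\xi,\eta)=\|\xi-\eta\|+|\sqrt{\mathrm{dist}(\xi,\Gamma)}-\sqrt{\mathrm{dist}(\eta,\Gamma)}|$, $U(\xi,t)=\{\eta\in\Omega:\rho_\Omega(\xi,\eta)\le t\}$, $$w_r(f,\xi,\delta)_q=\Big(\frac1{|U(\xi,\delta)|}\int_{U(\xi,\delta)}|\triangle^r_{(\eta-\xi)/r}(f,\Omega,\xi)|^q\,d\eta\Big)^{1/q}\ (q<\infty),\quad w_r(f,\xi,\delta)_\infty=\sup_{\eta\in U(\xi,\delta)}|\triangle^r_{(\eta-\xi)/r}(f,\Omega,\xi)|,$$ and $\tau_r(f,\delta)_{p,q}=\|w_r(f,\cdot,\delta)_q\|_{L^p(\Omega)}$. *)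

theory Defs
  imports "HOL-Analysis.Analysis"
begin

text \<open>
  The ambient space \<open>\<real>\<^bsup>d+1\<^esup>\<close> is the type \<open>(real ^ 'd) \<times> real\<close> with \<open>d = CARD('d) \<ge> 1\<close>; its library norm
  is the Euclidean one. Norms, moduli and approximation errors take values in \<open>ennreal\<close>, so that
  divergent integrals and unbounded suprema are \<open>\<infinity>\<close> rather than a default real number.
\<close>

section \<open>Domains of class \<open>C\<^sup>2\<close>\<close>

definition partial :: "'d \<Rightarrow> (real ^ 'd \<Rightarrow> real) \<Rightarrow> real ^ 'd \<Rightarrow> real" where
  "partial i f x = deriv (\<lambda>t. f (x + t *\<^sub>R axis i 1)) 0"

text \<open>Class \<open>C\<^sup>k\<close>: all partial derivatives up to order \<open>k\<close> exist and are continuous.\<close>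

primrec class_C :: "nat \<Rightarrow> (real ^ 'd \<Rightarrow> real) \<Rightarrow> bool" where
  "class_C 0 f \<longleftrightarrow> continuous_on UNIV f"
| "class_C (Suc k) f \<longleftrightarrow> continuous_on UNIV f \<and>
     (\<forall>i. (\<forall>x. (\<lambda>t. f (x + t *\<^sub>R axis i 1)) differentiable (at 0)) \<and> class_C k (partial i f))"

text \<open>
  \<open>subgraph_on G U f\<close>: in the Cartesian coordinates \<open>\<xi> = A (x - a)\<close>, with \<open>A\<close> orthogonal, the part of
  the domain \<open>G\<close> in \<open>U\<close> lies below the graph of \<open>f\<close>. For an open \<open>G\<close> the non-strict
  inequality \<open>\<xi>\<^bsub>d+1\<^esub> \<le> f (\<xi>\<^sub>1, \<dots>, \<xi>\<^sub>d)\<close> would force the graph to avoid \<open>U\<close>, so \<open>G\<close> is given by the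
  strict one; its closure is then given by the non-strict one, see \<open>closure_subgraph\<close>.
\<close>

definition subgraph_on ::
  "((real ^ 'd) \<times> real) set \<Rightarrow> ((real ^ 'd) \<times> real) set \<Rightarrow> (real ^ 'd \<Rightarrow> real) \<Rightarrow> bool" where
  "subgraph_on G U f \<longleftrightarrow> (\<exists>A a. orthogonal_transformation A \<and>
     G \<inter> U = {x \<in> U. snd (A (x - a)) < f (fst (A (x - a)))})"

lemma closure_subgraph:
  fixes f :: "real ^ 'd \<Rightarrow> real" and G U :: "((real ^ 'd) \<times> real) set"
  assumes A: "orthogonal_transformation A" and U: "open U" and f: "continuous_on UNIV f"
    and G: "G \<inter> U = {x \<in> U. snd (A (x - a)) < f (fst (A (x - a)))}"
  shows "closure G \<inter> U = {x \<in> U. snd (A (x - a)) \<le> f (fst (A (x - a)))}"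
proof (intro equalityI subsetI)
  have linA: "linear A" using A by (simp add: orthogonal_transformation_linear)
  have contA: "continuous_on UNIV A"
    by (rule linear_continuous_on[OF linear_conv_bounded_linear[THEN iffD1, OF linA]])
  have cA: "continuous_on UNIV (\<lambda>x. A (x - a))"
    by (rule continuous_on_compose2[OF contA]) (auto intro!: continuous_intros)
  have cf: "continuous_on UNIV (\<lambda>x. f (fst (A (x - a))))"
    by (rule continuous_on_compose2[OF f]) (auto intro!: continuous_intros cA)
  have cl: "closed {x. snd (A (x - a)) \<le> f (fst (A (x - a)))}"
    by (rule closed_Collect_le) (auto intro!: continuous_intros cA cf)
  fix x
  {
    assume x: "x \<in> closure G \<inter> U"
    then have "x \<in> closure (G \<inter> U)"
      using open_Int_closure_subset[OF U, of G] by (auto simp: Int_commute)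
    moreover have "closure (G \<inter> U) \<subseteq> {x. snd (A (x - a)) \<le> f (fst (A (x - a)))}"
      by (rule closure_minimal[OF _ cl]) (use G in auto)
    ultimately show "x \<in> {x \<in> U. snd (A (x - a)) \<le> f (fst (A (x - a)))}" using x by auto
  }
  {
    assume x: "x \<in> {x \<in> U. snd (A (x - a)) \<le> f (fst (A (x - a)))}"
    obtain v where v: "A v = (0, 1)"
      using orthogonal_transformation_surj[OF A] by (metis surjD)
    have lim: "((\<lambda>t. x - t *\<^sub>R v) \<longlongrightarrow> x) (at_right 0)"
      by (auto intro!: tendsto_eq_intros)
    have "\<forall>\<^sub>F t in at_right 0. x - t *\<^sub>R v \<in> U"
      using topological_tendstoD[OF lim U] x by auto
    moreover have "\<forall>\<^sub>F t::real in at_right 0. 0 < t" by (simp add: eventually_at_right_less)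
    ultimately have "\<forall>\<^sub>F t in at_right 0. x - t *\<^sub>R v \<in> closure G"
    proof eventually_elim
      case (elim t)
      have "A (x - t *\<^sub>R v - a) = A (x - a) - t *\<^sub>R (0, 1)"
        using linA v by (simp add: linear_diff linear_add linear_scale algebra_simps)
      then have "x - t *\<^sub>R v \<in> G \<inter> U" unfolding G using elim x by auto
      then show ?case using closure_subset by auto
    qed
    then have "x \<in> closure G"
      by (intro Lim_in_closed_set[OF closed_closure _ _ lim]) auto
    then show "x \<in> closure G \<inter> U" using x by auto
  }
qed

text \<open>
  In the last conjunct \<open>infdist\<close> of the empty set (which is \<open>0\<close> in the library) plays no role:
  \<open>frontier (U j) = {}\<close> with \<open>x \<in> U j\<close> would mean \<open>U j = UNIV\<close>, making \<open>G\<close> a full, unbounded subgraph.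
\<close>

definition C2_domain :: "((real ^ 'd) \<times> real) set \<Rightarrow> bool" where
  "C2_domain G \<longleftrightarrow> open G \<and> connected G \<and> bounded G \<and> G \<noteq> {} \<and>
     (\<exists>\<delta>>0. \<exists>M>0. \<exists>(J::nat) U f.
        frontier G \<subseteq> (\<Union>j\<in>{1..J}. U j) \<and>
        (\<forall>j\<in>{1..J}. open (U j) \<and> connected (U j) \<and> class_C 2 (f j) \<and>
           (\<forall>i k x. \<bar>partial i (partial k (f j)) x\<bar> \<le> M) \<and> subgraph_on G (U j) (f j)) \<and>
        (\<forall>x\<in>G. infdist x (frontier G) < \<delta> \<longrightarrow>
           (\<exists>j\<in>{1..J}. x \<in> U j \<and> infdist x (frontier (U j)) > \<delta>)))"


section \<open>\<open>L\<^sup>p\<close> spaces and polynomial approximation\<close>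

definition ennpowr :: "ennreal \<Rightarrow> real \<Rightarrow> ennreal" where
  "ennpowr x a = (if x = \<infinity> then \<infinity> else ennreal (enn2real x powr a))"

text \<open>The exponent \<open>p = \<infinity>\<close> means the uniform norm (a genuine, not an essential, supremum).\<close>

definition Lnorm :: "ennreal \<Rightarrow> 'a::euclidean_space set \<Rightarrow> ('a \<Rightarrow> ennreal) \<Rightarrow> ennreal" where
  "Lnorm p \<Omega> g =
     (if p = \<infinity> then (SUP x\<in>\<Omega>. g x)
      else ennpowr (\<integral>\<^sup>+x\<in>\<Omega>. ennpowr (g x) (enn2real p) \<partial>lebesgue) (1 / enn2real p))"

text \<open>Functions are total; only their values on \<open>\<Omega>\<close> matter. \<open>L\<^sup>\<infinity>(\<Omega>)\<close> means \<open>C(\<Omega>)\<close>.\<close>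

definition Lspace :: "ennreal \<Rightarrow> 'a::euclidean_space set \<Rightarrow> ('a \<Rightarrow> real) set" where
  "Lspace p \<Omega> =
     (if p = \<infinity> then {f. continuous_on \<Omega> f}
      else {f. f \<in> borel_measurable (lebesgue_on \<Omega>) \<and> Lnorm p \<Omega> (\<lambda>x. ennreal \<bar>f x\<bar>) < \<infinity>})"

text \<open>Polynomials of total degree at most \<open>n\<close>, as combinations of monomials with multi-indices \<open>\<alpha>\<close>.\<close>

definition multi_indices :: "nat \<Rightarrow> ('a::euclidean_space \<Rightarrow> nat) set" where
  "multi_indices n = {\<alpha> \<in> Basis \<rightarrow>\<^sub>E UNIV. (\<Sum>b\<in>Basis. \<alpha> b) \<le> n}"

definition Polys :: "nat \<Rightarrow> ('a::euclidean_space \<Rightarrow> real) set" where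
  "Polys n = {\<lambda>x. \<Sum>\<alpha>\<in>multi_indices n. c \<alpha> * (\<Prod>b\<in>Basis. (x \<bullet> b) ^ \<alpha> b) | c. True}"

lemma finite_multi_indices: "finite (multi_indices n :: ('a::euclidean_space \<Rightarrow> nat) set)"
proof (rule finite_subset)
  show "multi_indices n \<subseteq> (Basis \<rightarrow>\<^sub>E {..n} :: ('a \<Rightarrow> nat) set)"
  proof
    fix \<alpha> :: "'a \<Rightarrow> nat"
    assume \<alpha>: "\<alpha> \<in> multi_indices n"
    have "\<alpha> b \<le> n" if "b \<in> Basis" for b
    proof -
      have "\<alpha> b \<le> (\<Sum>b\<in>Basis. \<alpha> b)" by (rule member_le_sum[OF that]) simp_all
      then show ?thesis using \<alpha> by (simp add: multi_indices_def)
    qed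
    then show "\<alpha> \<in> Basis \<rightarrow>\<^sub>E {..n}"
      using \<alpha> by (simp add: multi_indices_def PiE_iff)
  qed
qed (simp add: finite_PiE)

definition best_approx :: "'a::euclidean_space set \<Rightarrow> nat \<Rightarrow> ennreal \<Rightarrow> ('a \<Rightarrow> real) \<Rightarrow> ennreal" where
  "best_approx \<Omega> n p f = (INF Q\<in>Polys n. Lnorm p \<Omega> (\<lambda>x. ennreal \<bar>f x - Q x\<bar>))"


section \<open>Averaged moduli of smoothness\<close>

definition fdiff :: "nat \<Rightarrow> 'a::euclidean_space \<Rightarrow> ('a \<Rightarrow> real) \<Rightarrow> 'a \<Rightarrow> real" where
  "fdiff r \<xi> f \<eta> = (\<Sum>j=0..r. (-1) ^ (r + j) * real (r choose j) * f (\<eta> + real j *\<^sub>R \<xi>))"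

definition fdiff_on ::
  "nat \<Rightarrow> 'a::euclidean_space \<Rightarrow> ('a \<Rightarrow> real) \<Rightarrow> 'a set \<Rightarrow> 'a \<Rightarrow> real" where
  "fdiff_on r \<xi> f \<Omega> \<eta> =
     (if closed_segment \<eta> (\<eta> + real r *\<^sub>R \<xi>) \<subseteq> \<Omega> then fdiff r \<xi> f \<eta> else 0)"

definition rho :: "'a::euclidean_space set \<Rightarrow> 'a \<Rightarrow> 'a \<Rightarrow> real" where
  "rho \<Omega> \<xi> \<eta> =
     norm (\<xi> - \<eta>) + \<bar>sqrt (infdist \<xi> (frontier \<Omega>)) - sqrt (infdist \<eta> (frontier \<Omega>))\<bar>"

definition rho_ball :: "'a::euclidean_space set \<Rightarrow> 'a \<Rightarrow> real \<Rightarrow> 'a set" where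
  "rho_ball \<Omega> \<xi> t = {\<eta> \<in> \<Omega>. rho \<Omega> \<xi> \<eta> \<le> t}"

definition local_modulus ::
  "'a::euclidean_space set \<Rightarrow> nat \<Rightarrow> ('a \<Rightarrow> real) \<Rightarrow> 'a \<Rightarrow> real \<Rightarrow> ennreal \<Rightarrow> ennreal" where
  "local_modulus \<Omega> r f \<xi> \<delta> q =
     (let U = rho_ball \<Omega> \<xi> \<delta>;
          D = (\<lambda>\<eta>. ennreal \<bar>fdiff_on r ((1 / real r) *\<^sub>R (\<eta> - \<xi>)) f \<Omega> \<xi>\<bar>)
      in if q = \<infinity> then (SUP \<eta>\<in>U. D \<eta>)
         else ennpowr ((\<integral>\<^sup>+\<eta>\<in>U. ennpowr (D \<eta>) (enn2real q) \<partial>lebesgue) / emeasure lebesgue U)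
                (1 / enn2real q))"

definition tau ::
  "'a::euclidean_space set \<Rightarrow> nat \<Rightarrow> ('a \<Rightarrow> real) \<Rightarrow> real \<Rightarrow> ennreal \<Rightarrow> ennreal \<Rightarrow> ennreal" where
  "tau \<Omega> r f \<delta> p q = Lnorm p \<Omega> (\<lambda>\<xi>. local_modulus \<Omega> r f \<xi> \<delta> q)"

end

theory Submission
  imports Defs
begin

text \<open>
  Telescope \<open>f = (f - Q\<^sub>m) + \<Sum>(Q\<^sub>k - Q\<^bsub>k-1\<^esub>) + Q\<^sub>0\<close> with near-best polynomials of dyadic degree. The average of a
  difference of \<open>f - Q\<^sub>m\<close> is controlled node by node: in coordinates adapted to the boundary, the node
  \<open>\<xi> + (j/r)(\<eta> - \<xi>)\<close> has a bounded density with respect to Lebesgue measure. For a polynomial \<open>P\<close> of degree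
  \<open>N\<close> the one-variable polynomial \<open>z \<mapsto> P (\<xi> + z(\<eta> - \<xi>))\<close> is bounded on the complex disc of radius \<open>e/(tN)\<close> by a
  weighted mean of \<open>\<bar>P\<bar>\<close> over a curved rectangle inside the domain that touches the boundary, so
  Cauchy's estimates produce the factor \<open>(tN)\<^sup>r\<close>. The mean comes from substituting sines and cosines
  for the tangential coordinate and the depth, the latter absorbing the square root of the distance to
  the boundary, and from a localised Nikolskii inequality on the circle. Its kernels have bounded
  marginals, so it acts boundedly on every \<open>L\<^sup>p\<close>, uniformly in \<open>p\<close>.
\<close>

section \<open>Polynomials on the unit circle\<close>

text \<open>One constant has to serve every p, and the number of dyadic levels grows like log n.
  Hence the sum over the levels is estimated by an exact Minkowski inequality, and structural
  constants are arranged to be at least 1: then K <= K powr p lets them enter the p-th power without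
  a dependence on p. The plain Nikolskii inequality on the circle has a kernel of mass of order n.
  Multiplying first by the fourth power of a peak polynomial costs a fixed factor in the degree and
  makes the mass bounded. In the depth variable the kernel also carries the ratio of sin \<theta> to
  sin \<alpha> + 1 / n; as the sine is the Jacobian of the substitution, both marginals are bounded,
  as in a Schur test. The rectangle is curved because a bound on second derivatives keeps a
  paraboloid, but not a tangent plane, below the graph; its quadratic term only doubles the
  tangential degree. The values of f at nodes need care, since f is only Lebesgue measurable. As
  nodes have a bounded density, f can be replaced by a Borel function, and the exceptional null set
  is charged to a majorant with value infinity.\<close>

definition circ :: "(real \<Rightarrow> real) \<Rightarrow> ennreal" where
  "circ f = (\<integral>\<^sup>+\<theta>. ennreal (f \<theta>) * indicator {-pi..pi} \<theta> \<partial>lborel)"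

section \<open>Fourier coefficients and Nikolskii inequalities without localisation\<close>

lemma has_integral_cis_int:
  "((\<lambda>\<theta>. cis (of_int m * \<theta>)) has_integral (if m = 0 then 2 * pi else 0)) {-pi..pi}"
proof (cases "m = 0")
  case True
  then show ?thesis
    using has_integral_const_real[of "1::complex" "-pi" pi] by (simp add: scaleR_conv_of_real)
next
  case False
  define F where "F \<theta> = cis (of_int m * \<theta>) / (\<i> * of_int m)" for \<theta>
  have "((\<lambda>\<theta>. cis (of_int m * \<theta>)) has_integral (F pi - F (-pi))) {-pi..pi}"
  proof (rule fundamental_theorem_of_calculus)
    fix x :: real
    have *: "((\<lambda>\<theta>. exp (\<i> * of_int m * of_real \<theta>)) has_vector_derivative
       exp (\<i> * of_int m * of_real x) * (\<i> * of_int m)) (at x within {-pi..pi})"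
      by (rule has_vector_derivative_real_field)
         (auto intro!: derivative_eq_intros)
    have "((\<lambda>\<theta>. exp (\<i> * of_int m * of_real \<theta>) * (1 / (\<i> * of_int m))) has_vector_derivative
       exp (\<i> * of_int m * of_real x) * (\<i> * of_int m) * (1 / (\<i> * of_int m))) (at x within {-pi..pi})"
      by (rule has_vector_derivative_mult_left[OF *])
    then show "(F has_vector_derivative cis (of_int m * x)) (at x within {-pi..pi})"
      using False by (simp add: F_def [abs_def] cis_conv_exp mult_ac)
  qed auto
  moreover have "F pi = F (-pi)"
    by (simp add: F_def cis.ctr mult.commute[of "of_int m"])
  ultimately show ?thesis using False by simp
qed

lemma cis_mult_power: "cis \<theta> ^ i * cis (- (real k * \<theta>)) = cis (of_int (int i - int k) * \<theta>)"
  by (simp add: Complex.DeMoivre cis_mult algebra_simps)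

lemma has_integral_coeff:
  fixes p :: "complex poly"
  shows "((\<lambda>\<theta>. poly p (cis \<theta>) * cis (- (real k * \<theta>))) has_integral (2 * pi * coeff p k)) {-pi..pi}"
proof -
  have "((\<lambda>\<theta>. \<Sum>i\<le>degree p. coeff p i * cis (of_int (int i - int k) * \<theta>)) has_integral
      (\<Sum>i\<le>degree p. coeff p i * (if int i - int k = 0 then 2 * pi else 0))) {-pi..pi}"
    by (intro has_integral_sum has_integral_mult_right has_integral_cis_int) auto
  moreover have "(\<Sum>i\<le>degree p. coeff p i * (if int i - int k = 0 then 2 * pi else 0)) = 2 * pi * coeff p k"
  proof (cases "k \<le> degree p")
    case True
    then show ?thesis by (simp add: if_distrib mult.commute cong: if_cong)
  next
    case False
    then show ?thesis by (simp add: coeff_eq_0 if_distrib cong: if_cong)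
  qed
  moreover have "poly p (cis \<theta>) * cis (- (real k * \<theta>)) =
    (\<Sum>i\<le>degree p. coeff p i * cis (of_int (int i - int k) * \<theta>))" for \<theta>
    unfolding poly_altdef sum_distrib_right mult.assoc cis_mult_power ..
  ultimately show ?thesis by simp
qed

lemma circ_eq:
  assumes "continuous_on {-pi..pi} f" "\<And>x. 0 \<le> f x"
  shows "circ f = ennreal (integral {-pi..pi} f)"
proof -
  have "f integrable_on {-pi..pi}" using assms by (intro integrable_continuous_interval)
  then have "(f has_integral integral {-pi..pi} f) {-pi..pi}" by (simp add: has_integral_integral)
  then have "integral\<^sup>N lborel (\<lambda>x. indicator {-pi..pi} x * f x) = integral {-pi..pi} f"
    by (intro nn_integral_has_integral_lebesgue assms)
  moreover have "(\<lambda>x. ennreal (indicator {-pi..pi} x * f x)) = (\<lambda>x. ennreal (f x) * indicator {-pi..pi} x)"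
    by (auto simp: fun_eq_iff indicator_def)
  ultimately show ?thesis unfolding circ_def by simp
qed

lemma cmod_coeff_le:
  fixes p :: "complex poly"
  shows "2 * pi * cmod (coeff p k) \<le> integral {-pi..pi} (\<lambda>\<theta>. cmod (poly p (cis \<theta>)))"
proof -
  have "cmod (integral {-pi..pi} (\<lambda>\<theta>. poly p (cis \<theta>) * cis (- (real k * \<theta>)))) \<le>
     integral {-pi..pi} (\<lambda>\<theta>. cmod (poly p (cis \<theta>)))"
    by (intro integral_norm_bound_integral integrable_continuous_interval continuous_intros)
       (auto simp: norm_mult)
  then show ?thesis using integral_unique[OF has_integral_coeff[of p k]] by (simp add: norm_mult)
qed

lemma cmod_poly_le:
  fixes p :: "complex poly"
  assumes "degree p \<le> n" and a: "\<And>k. k \<le> n \<Longrightarrow> cmod (coeff p k) \<le> B"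
  shows "cmod (poly p z) \<le> (real n + 1) * max 1 (cmod z) ^ n * B"
proof -
  have B: "0 \<le> B" using a[of 0] norm_ge_zero order_trans by blast
  have "poly p z = (\<Sum>i\<le>n. coeff p i * z ^ i)"
    unfolding poly_altdef using assms(1) by (intro sum.mono_neutral_left) (auto simp: coeff_eq_0)
  also have "cmod \<dots> \<le> (\<Sum>i\<le>n. cmod (coeff p i * z ^ i))" by (rule norm_sum)
  also have "\<dots> \<le> (\<Sum>i\<le>n. B * max 1 (cmod z) ^ n)"
  proof (rule sum_mono)
    fix i assume i: "i \<in> {..n}"
    have "cmod z ^ i \<le> max 1 (cmod z) ^ i" by (intro power_mono) auto
    also have "\<dots> \<le> max 1 (cmod z) ^ n" using i by (intro power_increasing) auto
    finally show "cmod (coeff p i * z ^ i) \<le> B * max 1 (cmod z) ^ n"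
      using a[of i] i B by (simp add: norm_mult norm_power mult_mono)
  qed
  also have "\<dots> = (real n + 1) * max 1 (cmod z) ^ n * B" by simp
  finally show ?thesis .
qed

lemma circ_nikolskii:
  fixes p :: "complex poly"
  assumes "degree p \<le> n"
  shows "ennreal (cmod (poly p z)) \<le> ennreal ((real n +
    1) * max 1 (cmod z) ^ n) * circ (\<lambda>\<theta>. cmod (poly p (cis \<theta>)))"
proof -
  let ?I = "integral {-pi..pi} (\<lambda>\<theta>. cmod (poly p (cis \<theta>)))"
  have I0: "0 \<le> ?I" using cmod_coeff_le[of p 0] by (smt (verit) mult_nonneg_nonneg norm_ge_zero pi_gt_zero)
  have "cmod (coeff p k) \<le> ?I" for k
  proof -
    have "cmod (coeff p k) \<le> 2 * pi * cmod (coeff p k)"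
      using pi_ge_two mult_right_mono[of 1 "2 * pi" "cmod (coeff p k)"] by simp
    then show ?thesis using cmod_coeff_le[of p k] by linarith
  qed
  then have "cmod (poly p z) \<le> (real n + 1) * max 1 (cmod z) ^ n * ?I"
    by (intro cmod_poly_le assms)
  moreover have "circ (\<lambda>\<theta>. cmod (poly p (cis \<theta>))) = ennreal ?I"
    by (intro circ_eq continuous_intros) auto
  ultimately show ?thesis using I0 by (simp add: ennreal_mult[symmetric])
qed

lemma cmod_cis_sq: "cmod (cis \<theta> ^ 2 - 1) = 2 * \<bar>sin \<theta>\<bar>"
proof -
  have "cis \<theta> * cis (-\<theta>) = 1" by (simp add: cis_mult)
  then have "cis \<theta> ^ 2 - 1 = cis \<theta> * (cis \<theta> - cis (-\<theta>))"
    by (simp add: power2_eq_square algebra_simps)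
  moreover have "cis \<theta> - cis (-\<theta>) = 2 * \<i> * of_real (sin \<theta>)"
    by (simp add: complex_eq_iff)
  ultimately show ?thesis by (simp add: norm_mult)
qed

lemma circ_cmult:
  assumes "f \<in> borel_measurable borel" "0 \<le> c"
  shows "circ (\<lambda>\<theta>. c * f \<theta>) = ennreal c * circ f"
  unfolding circ_def using assms
  by (subst nn_integral_cmult[symmetric]) (auto simp: ennreal_mult' mult.assoc)

text \<open>On the circle the modulus of z^2 - 1 is twice that of the sine, so the sine weight is
  the polynomial factor z^2 - 1. There are two ways to undo it: leave it on the left-hand side,
  which is good away from 1 and -1, or solve for the coefficients of p, which costs another power of
  n but is good near these points.\<close>

lemma circ_nikolskii_sin:
  fixes p :: "complex poly"
  assumes n: "degree p \<le> n"
  shows "ennreal (cmod (poly p z)) \<le>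
      ennreal (2 * (real n + 1) ^ 2 * max 1 (cmod z) ^ n) * circ (\<lambda>\<theta>. cmod (poly p (cis \<theta>)) * \<bar>sin \<theta>\<bar>)" (is ?A)
    and "ennreal (cmod (poly p z) * cmod (z ^ 2 - 1)) \<le>
      ennreal (2 * (real n + 3) * max 1 (cmod z) ^ (n +
        2)) * circ (\<lambda>\<theta>. cmod (poly p (cis \<theta>)) * \<bar>sin \<theta>\<bar>)" (is ?B)
proof -
  define q where "q = p * [:-1, 0, 1:]"
  have pq: "poly q z = poly p z * (z ^ 2 - 1)" for z
    by (simp add: q_def algebra_simps power2_eq_square)
  have qn: "degree q \<le> n + 2"
    unfolding q_def using degree_mult_le[of p "[:-1, 0, 1:]"] n by simp
  have cq: "cmod (poly q (cis \<theta>)) = 2 * (cmod (poly p (cis \<theta>)) * \<bar>sin \<theta>\<bar>)" for \<theta>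
    by (simp add: pq norm_mult cmod_cis_sq)
  have ci: "circ (\<lambda>\<theta>. cmod (poly q (cis \<theta>))) = ennreal 2 * circ (\<lambda>\<theta>. cmod (poly p (cis \<theta>)) * \<bar>sin \<theta>\<bar>)"
    unfolding cq by (intro circ_cmult borel_measurable_continuous_onI continuous_intros) auto
  show ?B
  proof -
    have c: "ennreal ((real (n + 2) + 1) * max 1 (cmod z) ^ (n + 2)) * ennreal 2 =
       ennreal (2 * (real n + 3) * max 1 (cmod z) ^ (n + 2))"
      by (subst ennreal_mult'[symmetric]) (auto simp: algebra_simps)
    show ?thesis
      using circ_nikolskii[OF qn, of z] unfolding ci mult.assoc[symmetric] c by (simp add: pq norm_mult)
  qed
  let ?I = "integral {-pi..pi} (\<lambda>\<theta>. cmod (poly q (cis \<theta>)))"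
  have I0: "0 \<le> ?I" using cmod_coeff_le[of q 0] by (smt (verit) mult_nonneg_nonneg norm_ge_zero pi_gt_zero)
  have b: "cmod (coeff q k) \<le> ?I" for k
  proof -
    have "cmod (coeff q k) \<le> 2 * pi * cmod (coeff q k)"
      using pi_ge_two mult_right_mono[of 1 "2 * pi" "cmod (coeff q k)"] by simp
    then show ?thesis using cmod_coeff_le[of q k] by linarith
  qed
  \<comment> \<open>Multiplication by z^2 - 1 is a two-term recursion for the coefficients.
    Unrolled, it writes a coefficient of p as a signed sum of at most k + 1 coefficients of
    q.\<close>
  have co: "coeff q k = (if k < 2 then 0 else coeff p (k - 2)) - coeff p k" for k
    by (cases k; cases "k - 1") (auto simp: q_def coeff_pCons split: nat.splits)
  have a: "cmod (coeff p k) \<le> (real k + 1) * ?I" for k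
  proof (induction k rule: less_induct)
    case (less k)
    show ?case
    proof (cases "k < 2")
      case True
      then have "cmod (coeff p k) \<le> ?I" using b[of k] by (simp add: co)
      also have "\<dots> \<le> (real k + 1) * ?I" using I0 by (simp add: algebra_simps)
      finally show ?thesis .
    next
      case False
      then have "coeff p k = coeff p (k - 2) - coeff q k" by (simp add: co)
      then have "cmod (coeff p k) \<le> cmod (coeff p (k - 2)) + cmod (coeff q k)"
        by (simp add: norm_triangle_ineq4)
      also have "\<dots> \<le> (real (k - 2) + 1) * ?I + ?I" using less[of "k - 2"] False b[of k] by (intro add_mono) auto
      also have "\<dots> \<le> (real k + 1) * ?I" using False I0 by (simp add: of_nat_diff algebra_simps)
      finally show ?thesis .
    qed
  qed
  have "cmod (coeff p k) \<le> (real n + 1) * ?I" if "k \<le> n" for k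
    using a[of k] that I0 by (smt (verit) mult_right_mono of_nat_le_iff)
  then have "cmod (poly p z) \<le> (real n + 1) * max 1 (cmod z) ^ n * ((real n + 1) * ?I)"
    by (intro cmod_poly_le n)
  then have "ennreal (cmod (poly p z)) \<le> ennreal ((real n + 1)^2 * max 1 (cmod z) ^ n) * ennreal ?I"
    using I0 by (subst ennreal_mult[symmetric]) (auto simp: power2_eq_square mult_ac)
  also have "ennreal ?I = circ (\<lambda>\<theta>. cmod (poly q (cis \<theta>)))"
    by (intro circ_eq[symmetric] continuous_intros) auto
  finally show ?A unfolding ci mult.assoc[symmetric]
    by (subst (asm) ennreal_mult'[symmetric]) (auto simp: mult_ac)
qed

text \<open>
  The fourth power of the mean of \<open>(a z)\<^sup>k\<close>, \<open>k < m\<close>, concentrates a polynomial near \<open>z = 1 / a\<close>; on the circle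
  its modulus decays like \<open>(m u)\<^bsup>-4\<^esup>\<close> with the angular distance \<open>u\<close>.
\<close>

definition peak_poly :: "nat \<Rightarrow> complex \<Rightarrow> complex poly" where
  "peak_poly m a = (\<Sum>k<m. monom (a ^ k / of_nat m) k)"

definition jker :: "nat \<Rightarrow> real \<Rightarrow> real" where
  "jker m u = (cmod (\<Sum>k<m. cis u ^ k) / real m) ^ 4"

section \<open>Peak polynomials: lower bound near the peak, integrable majorant on the
  circle\<close>

lemma poly_peak_poly: "poly (peak_poly m a) z = (\<Sum>k<m. (a * z) ^ k) / of_nat m"
  by (simp add: peak_poly_def poly_sum poly_monom sum_divide_distrib power_mult_distrib)

lemma degree_peak_poly: "degree (peak_poly m a) \<le> m"
  unfolding peak_poly_def by (rule degree_sum_le) (auto intro: order.trans[OF degree_monom_le])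

lemma cmod_peak_poly_cis: "cmod (poly (peak_poly m (cis (- \<alpha>))) (cis \<theta>)) ^ 4 = jker m (\<theta> - \<alpha>)"
  by (simp add: poly_peak_poly jker_def norm_divide cis_mult)

lemma jker_nonneg: "0 \<le> jker m u"
  by (simp add: jker_def)

lemma continuous_on_jker [continuous_intros]:
  "continuous_on S f \<Longrightarrow> continuous_on S (\<lambda>x. jker m (f x))"
  unfolding jker_def by (cases "m = 0") (auto intro!: continuous_intros)

text \<open>As a polynomial in x - 1 the left-hand side has nonnegative coefficients, so the modulus
  is dominated by the value at the modulus of x - 1.\<close>

lemma cmod_power_minus_1: "cmod (x ^ k - 1) \<le> (1 + cmod (x - 1)) ^ k - 1"
proof (induction k)
  case (Suc k)
  have "cmod (x ^ Suc k - 1) = cmod (x * (x ^ k - 1) + (x - 1))" by (simp add: algebra_simps)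
  also have "\<dots> \<le> cmod x * cmod (x ^ k - 1) + cmod (x - 1)" by (metis norm_mult norm_triangle_ineq)
  also have "\<dots> \<le> (1 + cmod (x - 1)) * ((1 + cmod (x - 1)) ^ k - 1) + cmod (x - 1)"
    using Suc norm_triangle_ineq[of 1 "x - 1"] by (intro add_mono mult_mono) auto
  finally show ?case by (simp add: algebra_simps)
qed simp

lemma power_one_plus_le_exp: "0 \<le> d \<Longrightarrow> (1 + d) ^ k \<le> exp (real k * d)"
  using power_mono[OF exp_ge_add_one_self[of d], of k] by (simp add: exp_of_nat_mult)

text \<open>On this disc every power of a z with exponent below m stays within exp (1/4) - 1 <= 1/2
  of 1, so the mean of the powers cannot drop below 1/2.\<close>

lemma peak_poly_lower:
  assumes m: "m \<ge> 1" and z: "cmod (a * z - 1) \<le> 1 / (4 * real m)"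
  shows "1 / 2 \<le> cmod (poly (peak_poly m a) z)"
proof -
  have "cmod ((a * z) ^ k - 1) \<le> 1 / 2" if k: "k < m" for k
  proof -
    have "cmod ((a * z) ^ k - 1) \<le> (1 + cmod (a * z - 1)) ^ k - 1" by (rule cmod_power_minus_1)
    also have "\<dots> \<le> exp (real k * cmod (a * z - 1)) - 1" using power_one_plus_le_exp by simp
    also have "real k * cmod (a * z - 1) \<le> real m * (1 / (4 * real m))"
      using z k by (intro mult_mono) auto
    then have "exp (real k * cmod (a * z - 1)) - 1 \<le> exp (1 / 4 :: real) - 1" using m by simp
    also have "\<dots> \<le> 1 / 2" using exp_bound[of "1/4"] by (simp add: power2_eq_square)
    finally show ?thesis .
  qed
  then have "cmod (\<Sum>k<m. ((a * z) ^ k - 1)) \<le> (\<Sum>k<m. 1 / 2)"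
    by (intro sum_norm_le) auto
  then have "cmod ((\<Sum>k<m. (a * z) ^ k) - of_nat m) \<le> real m / 2"
    by (simp add: sum_subtractf)
  then have "real m / 2 \<le> cmod (\<Sum>k<m. (a * z) ^ k)"
    using norm_triangle_ineq3[of "\<Sum>k<m. (a * z) ^ k" "of_nat m"] by simp
  then show ?thesis using m by (simp add: poly_peak_poly norm_divide field_simps)
qed

lemma sin_ge_half: assumes "0 \<le> x" "x \<le> pi / 2" shows "x / 2 \<le> sin x"
\<comment> \<open>The function sin x - x / 2 increases while cos x >= 1/2, that is up to pi / 3.
  Beyond that point sin x is at least sin (pi / 3) >= 0.85, which exceeds half of pi / 2.\<close>
proof (cases "x \<le> pi / 3")
  case True
  have "sin 0 - 0 / 2 \<le> sin x - x / 2"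
  proof (rule DERIV_nonneg_imp_nondecreasing[OF assms(1)])
    fix y assume y: "0 \<le> y" "y \<le> x"
    then have "cos (pi / 3) \<le> cos y" using True by (intro cos_monotone_0_pi_le) auto
    then show "\<exists>d. ((\<lambda>y. sin y - y / 2) has_real_derivative d) (at y) \<and> 0 \<le> d"
      by (intro exI[of _ "cos y - 1 / 2"] conjI derivative_eq_intros) (auto simp: cos_60)
  qed
  then show ?thesis by simp
next
  case False
  have "sin (pi / 3) \<le> sin x" using False assms by (intro sin_monotone_2pi_le) auto
  moreover have "1.7 \<le> sqrt 3" by (rule real_le_rsqrt) (simp add: power2_eq_square)
  moreover have "x \<le> 1.7" using assms pi_less_4 pi_approx by simp
  ultimately show ?thesis by (simp add: sin_60)
qed

lemma abs_sin_half_ge: assumes "\<bar>v\<bar> \<le> pi" shows "\<bar>v\<bar> / 4 \<le> \<bar>sin (v / 2)\<bar>"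
  using sin_ge_half[of "\<bar>v\<bar> / 2"] assms by (cases "0 \<le> v") auto

text \<open>A majorant with arctan as antiderivative: its integral over any interval is at most 4 pi
  / m. The 4 in the denominator comes from \<open>abs_sin_half_ge\<close>.\<close>

definition cauk :: "nat \<Rightarrow> real \<Rightarrow> real" where
  "cauk m v = 1 / (1 + (real m * v / 4) ^ 2)"

text \<open>The three translates are needed because angular distances up to \<open>2\<pi>\<close> occur.\<close>

definition cauk3 :: "nat \<Rightarrow> real \<Rightarrow> real" where
  "cauk3 m u = 4 * (cauk m (u - 2 * pi) + cauk m u + cauk m (u + 2 * pi))"

lemma cauk_pos: "0 < cauk m v"
  by (simp add: cauk_def) (smt (verit) zero_le_power2)

lemma cauk_even: "cauk m (- v) = cauk m v"
  by (simp add: cauk_def)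

lemma cauk3_even: "cauk3 m (- v) = cauk3 m v"
  using cauk_even[of m "v - 2 * pi"] cauk_even[of m "v + 2 * pi"] cauk_even[of m v] by (simp add: cauk3_def)

lemma cauk3_nonneg: "0 \<le> cauk3 m v"
  using cauk_pos[of m "v - 2 * pi"] cauk_pos[of m v] cauk_pos[of m "v + 2 * pi"] by (simp add: cauk3_def)

lemma cauk_bound:
  assumes "\<bar>v\<bar> \<le> pi"
  shows "1 / (1 + (real m * \<bar>sin (v / 2)\<bar>) ^ 2) \<le> cauk m v"
proof -
  have "(real m * v / 4) ^ 2 = (real m * (\<bar>v\<bar> / 4)) ^ 2" by (simp add: power_mult_distrib power_divide)
  also have "\<dots> \<le> (real m * \<bar>sin (v / 2)\<bar>) ^ 2"
    by (intro power_mono mult_left_mono abs_sin_half_ge assms) auto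
  finally show ?thesis unfolding cauk_def by (intro divide_left_mono mult_pos_pos) (auto intro: add_pos_nonneg)
qed

text \<open>Let h be the modulus of the mean of the powers and s = m |sin (u / 2)|. Summing the
  geometric series gives h s <= 1, besides h <= 1. Of the four factors h one is spent on 1 + s, two
  on 1 + s^2, and one is bounded by 1. The factor 1 + s on the left will pay for exchanging sin
  \<theta> with sin \<alpha> + 1 / n in \<open>circ_nker\<close>.\<close>

lemma jker_bound:
  assumes m: "m \<ge> 1" and u: "\<bar>u\<bar> \<le> 2 * pi"
  shows "jker m u * (1 + real m * \<bar>sin (u / 2)\<bar>) \<le> cauk3 m u"
proof -
  define h where "h = cmod (\<Sum>k<m. cis u ^ k) / real m"
  define s where "s = real m * \<bar>sin (u / 2)\<bar>"
  have h0: "0 \<le> h" and s0: "0 \<le> s" by (auto simp: h_def s_def)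
  have "cmod (\<Sum>k<m. cis u ^ k) \<le> (\<Sum>k<m. 1)" by (intro sum_norm_le) (simp add: norm_power)
  then have h1: "h \<le> 1" using m by (simp add: h_def)
  have c: "cmod (cis u - 1) = 2 * \<bar>sin (u / 2)\<bar>"
    using cmod_cis_sq[of "u / 2"] by (simp add: Complex.DeMoivre)
  have "cmod (cis u - 1) * cmod (\<Sum>k<m. cis u ^ k) = cmod (cis u ^ m - 1)"
    by (simp add: power_diff_1_eq norm_mult)
  also have "\<dots> \<le> 2" using norm_triangle_ineq4[of "cis u ^ m" 1] by (simp add: norm_power)
  finally have "cmod (\<Sum>k<m. cis u ^ k) * \<bar>sin (u / 2)\<bar> \<le> 1" unfolding c by (simp add: mult_ac)
  moreover have "h * s = cmod (\<Sum>k<m. cis u ^ k) * \<bar>sin (u / 2)\<bar>" using m by (simp add: h_def s_def)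
  ultimately have hs: "h * s \<le> 1" by simp
  have "h ^ 4 * (1 + s) * (1 + s ^ 2) = h * (h * (1 + s)) * (h ^ 2 * (1 + s ^ 2))"
    by (simp add: power2_eq_square power4_eq_xxxx algebra_simps)
  also have "\<dots> \<le> 1 * 2 * 2"
  proof (intro mult_mono)
    show "h * (1 + s) \<le> 2" using h1 hs by (simp add: algebra_simps)
    have "h ^ 2 \<le> 1" "(h * s) ^ 2 \<le> 1" using h0 h1 hs s0 by (auto simp: power_le_one)
    then show "h\<^sup>2 * (1 + s\<^sup>2) \<le> 2" by (simp add: algebra_simps power_mult_distrib)
  qed (use h0 h1 s0 in auto)
  finally have A: "h ^ 4 * (1 + s) \<le> 4 / (1 + s ^ 2)"
    by (subst pos_le_divide_eq) (auto intro: add_pos_nonneg)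
  have "1 / (1 + s ^ 2) \<le> cauk m (u - 2 * pi) + cauk m u + cauk m (u + 2 * pi)"
  proof -
    have sn: "sin ((u - 2 * pi) / 2) = - sin (u / 2)" "sin ((u + 2 * pi) / 2) = - sin (u / 2)"
      by (simp_all add: diff_divide_distrib add_divide_distrib sin_diff sin_add)
    consider "\<bar>u\<bar> \<le> pi" | "\<bar>u - 2 * pi\<bar> \<le> pi" | "\<bar>u + 2 * pi\<bar> \<le> pi" using u by linarith
    then show ?thesis
      using cauk_bound[of u m] cauk_bound[of "u - 2 * pi" m] cauk_bound[of "u + 2 * pi" m]
        cauk_pos[of m "u - 2 * pi"] cauk_pos[of m u] cauk_pos[of m "u + 2 * pi"]
      unfolding sn s_def by cases auto
  qed
  then show ?thesis using A by (simp add: jker_def h_def[symmetric] s_def[symmetric] cauk3_def)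
qed

lemma jker_le_cauk3:
  assumes "m \<ge> 1" "\<bar>u\<bar> \<le> 2 * pi" shows "jker m u \<le> cauk3 m u"
proof -
  have "jker m u * 1 \<le> jker m u * (1 + real m * \<bar>sin (u / 2)\<bar>)"
    by (intro mult_left_mono jker_nonneg) simp
  then show ?thesis using jker_bound[OF assms] by simp
qed

lemma cauk_measurable [measurable]: "cauk m \<in> borel_measurable borel"
  unfolding cauk_def [abs_def] by measurable

lemma cauk3_measurable [measurable]: "cauk3 m \<in> borel_measurable borel"
  unfolding cauk3_def [abs_def] by measurable

lemma jker_measurable [measurable]: "jker m \<in> borel_measurable borel"
  by (intro borel_measurable_continuous_onI continuous_intros)

lemma nn_integral_cauk:
  assumes m: "m \<ge> 1"
  shows "(\<integral>\<^sup>+x. ennreal (cauk m (x - \<alpha>)) * indicator {a..b} x \<partial>lborel) \<le> ennreal (4 * pi / real m)"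
proof (cases "a \<le> b")
  case True
  define F where "F x = 4 / real m * arctan (real m * (x - \<alpha>) / 4)" for x
  have "(\<integral>\<^sup>+x. ennreal (cauk m (x - \<alpha>)) * indicator {a..b} x \<partial>lborel) = F b - F a"
  proof (rule nn_integral_FTC_Icc)
    fix x
    show "DERIV F x :> cauk m (x - \<alpha>)"
    proof -
      have "DERIV F x :> 4 / real m * (real m / 4 * inverse (1 + (real m * (x - \<alpha>) / 4) ^ 2))"
        unfolding F_def by (auto intro!: derivative_eq_intros)
      moreover have "4 / real m * (real m / 4 * z) = z" for z using m by simp
      ultimately show ?thesis by (simp only: cauk_def inverse_eq_divide)
    qed
  qed (simp_all add: True less_imp_le[OF cauk_pos])
  also have "\<dots> \<le> ennreal (4 * pi / real m)"
  proof (rule ennreal_leI)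
    have "F b \<le> 4 / real m * (pi / 2)" "4 / real m * (- (pi / 2)) \<le> F a" unfolding F_def
      by (rule mult_left_mono, rule less_imp_le[OF arctan_ubound], simp,
          rule mult_left_mono, rule less_imp_le[OF arctan_lbound], simp)
    then have "F b - F a \<le> 4 / real m * (pi / 2) - 4 / real m * (- (pi / 2))" by (rule diff_mono)
    also have "\<dots> = 4 * pi / real m" by simp
    finally show "F b - F a \<le> 4 * pi / real m" .
  qed
  finally show ?thesis .
qed simp

lemma ennreal_cauk3:
  "ennreal (cauk3 m u) = 4 * (ennreal (cauk m (u - 2 * pi)) + ennreal (cauk m u) + ennreal (cauk m (u +
    2 * pi)))"
proof -
  have *: "0 \<le> cauk m v" for v using cauk_pos[of m v] by simp
  show ?thesis unfolding cauk3_def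
    by (subst ennreal_mult') (simp_all only: ennreal_plus * add_nonneg_nonneg ennreal_numeral zero_le_numeral)
qed

lemma nn_integral_cauk3:
  assumes m: "m \<ge> 1"
  shows "(\<integral>\<^sup>+x. ennreal (cauk3 m (x - \<alpha>)) * indicator {a..b} x \<partial>lborel) \<le> ennreal (12 * (4 * pi / real m))"
proof -
  have "(\<integral>\<^sup>+x. ennreal (cauk3 m (x - \<alpha>)) * indicator {a..b} x \<partial>lborel) =
    (\<integral>\<^sup>+x. 4 * (ennreal (cauk m (x - (\<alpha> + 2 * pi))) * indicator {a..b} x +
      ennreal (cauk m (x - \<alpha>)) * indicator {a..b} x
       + ennreal (cauk m (x - (\<alpha> - 2 * pi))) * indicator {a..b} x) \<partial>lborel)"
    by (intro nn_integral_cong) (simp add: ennreal_cauk3 distrib_right mult.assoc diff_diff_eq2 diff_diff_eq diff_add_eq)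
  also have "\<dots> = 4 * ((\<integral>\<^sup>+x. ennreal (cauk m (x - (\<alpha> + 2 * pi))) * indicator {a..b} x \<partial>lborel)
    + (\<integral>\<^sup>+x. ennreal (cauk m (x - \<alpha>)) * indicator {a..b} x \<partial>lborel)
    + (\<integral>\<^sup>+x. ennreal (cauk m (x - (\<alpha> - 2 * pi))) * indicator {a..b} x \<partial>lborel))"
    by (simp add: nn_integral_cmult nn_integral_add)
  also have "\<dots> \<le> 4 * (ennreal (4 * pi / real m) + ennreal (4 * pi / real m) + ennreal (4 * pi / real m))"
    by (intro mult_left_mono add_mono nn_integral_cauk m) auto
  also have "\<dots> = ennreal (12 * (4 * pi / real m))"
  proof -
    have "4 * (ennreal x + ennreal x + ennreal x) = ennreal (12 * x)" if "0 \<le> x" for x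
    proof -
      have "ennreal (12 * x) = ennreal (4 * (x + x + x))" by simp
      also have "\<dots> = ennreal 4 * ennreal (x + x + x)" by (rule ennreal_mult') simp
      also have "ennreal (x + x + x) = ennreal x + ennreal x + ennreal x"
        by (simp only: ennreal_plus that add_nonneg_nonneg)
      finally show ?thesis by (simp only: ennreal_numeral)
    qed
    then show ?thesis by auto
  qed
  finally show ?thesis .
qed

section \<open>Localised Nikolskii inequalities through Joukowski-type substitutions\<close>

lemma rational_subst:
  fixes B r :: "complex poly"
  assumes B: "degree B \<le> n" and r: "degree r \<le> 2"
  shows "\<exists>p. degree p \<le> 2 * n \<and> (\<forall>z. z \<noteq> 0 \<longrightarrow> poly p z = z ^ n * poly B (poly r z / z))"
proof (intro exI conjI allI impI)
  let ?p = "\<Sum>k\<le>n. smult (coeff B k) (r ^ k * monom 1 (n - k))"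
  show "degree ?p \<le> 2 * n"
  proof (rule degree_sum_le)
    fix k assume k: "k \<in> {..n}"
    have "degree (r ^ k * monom 1 (n - k)) \<le> degree (r ^ k) + degree (monom (1::complex) (n - k))"
      by (rule degree_mult_le)
    also have "\<dots> \<le> k * degree r + (n - k)"
      using degree_power_le[of r k] degree_monom_le[of "1::complex" "n - k"] by (simp add: mult.commute)
    also have "\<dots> \<le> 2 * n" using k mult_le_mono2[OF r, of k] by (simp only: atMost_iff)
    finally show "degree (smult (coeff B k) (r ^ k * monom 1 (n - k))) \<le> 2 * n"
      using degree_smult_le order_trans by blast
  qed simp
  fix z :: complex assume z: "z \<noteq> 0"
  have "poly ?p z = (\<Sum>k\<le>n. coeff B k * (poly r z ^ k * z ^ (n - k)))"
    by (simp add: poly_sum poly_monom)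
  also have "\<dots> = (\<Sum>k\<le>n. z ^ n * (coeff B k * (poly r z / z) ^ k))"
    by (intro sum.cong) (auto simp: z power_diff power_divide)
  also have "\<dots> = z ^ n * poly B (poly r z / z)"
    unfolding sum_distrib_left[symmetric] poly_altdef using B
    by (intro arg_cong[where f = "\<lambda>x. z ^ n * x"] sum.mono_neutral_right) (auto simp: coeff_eq_0)
  finally show "poly ?p z = z ^ n * poly B (poly r z / z)" .
qed

lemma ennreal_circ_localised:
  assumes le: "ennreal (c * b) \<le> ennreal A * I" and "0 < c" "0 \<le> b" "0 \<le> A"
  shows "ennreal b \<le> ennreal (A / c) * I"
proof -
  have "ennreal b = ennreal (1 / c) * ennreal (c * b)"
    using assms by (subst ennreal_mult[symmetric]) auto
  also have "\<dots> \<le> ennreal (1 / c) * (ennreal A * I)" by (intro mult_left_mono le) auto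
  also have "\<dots> = ennreal (A / c) * I"
    using assms unfolding mult.assoc[symmetric] by (subst ennreal_mult[symmetric]) auto
  finally show ?thesis .
qed

text \<open>The exponent 8 n leaves room for the degrees 6 n and 6 n + 2 that occur; the bound 9
  comes from exp 2 <= 3^2.\<close>

lemma max_one_power_le:
  assumes "cmod (z - z0) \<le> 1 / (4 * real n)" "cmod z0 = 1" "n \<ge> 1" "k \<le> 8 * n"
  shows "max 1 (cmod z) ^ k \<le> 9"
proof -
  have "cmod z \<le> 1 + 1 / (4 * real n)" using norm_triangle_ineq2[of z z0] assms by linarith
  then have "max 1 (cmod z) ^ k \<le> (1 + 1 / (4 * real n)) ^ k" by (intro power_mono) auto
  also have "\<dots> \<le> exp (real k * (1 / (4 * real n)))" by (rule power_one_plus_le_exp) simp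
  also have "\<dots> \<le> exp 2"
  proof -
    have "real k \<le> 8 * real n" using assms(4) by linarith
    then show ?thesis using assms(3) by (simp add: field_simps)
  qed
  also have "exp 2 = exp 1 * exp (1::real)" by (simp flip: exp_add)
  also have "\<dots> \<le> 3 * 3" by (intro mult_mono exp_le) auto
  finally show ?thesis by simp
qed

lemma power_near_unit_ge:
  assumes "cmod (z - z0) \<le> 1 / (4 * real n)" "cmod z0 = 1" "n \<ge> 1"
  shows "3 / 4 \<le> cmod z ^ n"
proof -
  have a: "1 - 1 / (4 * real n) \<le> cmod z"
    using norm_triangle_ineq2[of z0 z] norm_minus_commute[of z z0] assms by linarith
  have b: "1 / (4 * real n) \<le> 1 / 4" using assms(3) by (simp add: field_simps)
  have "1 + real n * (- (1 / (4 * real n))) \<le> (1 + (- (1 / (4 * real n)))) ^ n"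
    by (rule Bernoulli_inequality) (use b in linarith)
  also have "\<dots> \<le> cmod z ^ n" using a b by (intro power_mono) auto
  finally show ?thesis using assms(3) by simp
qed

text \<open>Clearing denominators doubles the degree and the fourth power of the peak polynomial
  adds 4 n, whence 6 n. The loss 3/64 is 3/4, from the n-th power of the modulus of z, times 1/16,
  from the value 1/2 of the peak raised to the fourth power.\<close>

lemma localised_poly:
  fixes B r :: "complex poly"
  assumes B: "degree B \<le> n" and r: "degree r \<le> 2" and n: "n \<ge> 1"
    and z: "cmod (z - cis \<alpha>) \<le> 1 / (4 * real n)"
  obtains q where "degree q \<le> 6 * n" "z \<noteq> 0"
    "3 / 64 * cmod (poly B (poly r z / z)) \<le> cmod (poly q z)"
    "\<And>\<theta>. cmod (poly q (cis \<theta>)) = jker n (\<theta> - \<alpha>) * cmod (poly B (poly r (cis \<theta>) / cis \<theta>))"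
proof -
  obtain p where p: "degree p \<le> 2 * n" "\<And>z. z \<noteq> 0 \<Longrightarrow> poly p z = z ^ n * poly B (poly r z / z)"
    using rational_subst[OF B r] by auto
  define q where "q = p * peak_poly n (cis (- \<alpha>)) ^ 4"
  have lz: "3 / 4 \<le> cmod z ^ n" using power_near_unit_ge[OF z _ n] by simp
  then have z0: "z \<noteq> 0" using n by (auto simp: power_0_left split: if_splits)
  have "degree q \<le> degree p + degree (peak_poly n (cis (- \<alpha>)) ^ 4)" unfolding q_def by (rule degree_mult_le)
  also have "\<dots> \<le> 2 * n + n * 4"
    by (intro add_mono p order_trans[OF degree_power_le] mult_right_mono degree_peak_poly) auto
  finally have 1: "degree q \<le> 6 * n" by simp
  have "cmod (cis (- \<alpha>) * z - 1) = cmod (cis (-\<alpha>) * (z - cis \<alpha>))"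
    by (simp add: algebra_simps cis_mult)
  also have "\<dots> = cmod (z - cis \<alpha>)" by (simp add: norm_mult)
  finally have "1 / 2 \<le> cmod (poly (peak_poly n (cis (- \<alpha>))) z)"
    using z by (intro peak_poly_lower n) simp
  then have "(1 / 2) ^ 4 \<le> cmod (poly (peak_poly n (cis (- \<alpha>))) z) ^ 4" by (intro power_mono) auto
  then have "3 / 4 * cmod (poly B (poly r z / z)) * (1 / 2) ^ 4 \<le>
    cmod (z ^ n) * cmod (poly B (poly r z / z)) * cmod (poly (peak_poly n (cis (- \<alpha>))) z) ^ 4"
    using lz by (intro mult_mono) (auto simp: norm_power)
  then have 2: "3 / 64 * cmod (poly B (poly r z / z)) \<le> cmod (poly q z)"
    by (simp add: q_def norm_mult norm_power p(2)[OF z0] power4_eq_xxxx)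
  have 3: "cmod (poly q (cis \<theta>)) = jker n (\<theta> - \<alpha>) * cmod (poly B (poly r (cis \<theta>) / cis \<theta>))" for \<theta>
    by (simp add: q_def norm_mult norm_power p(2) cmod_peak_poly_cis[symmetric])
  show thesis using that[OF 1 z0 2 3] .
qed

text \<open>1344 is 63 / (3/64): the factor (6 n + 1) * 9 <= 63 n of \<open>circ_nikolskii\<close>
  at degree 6 n, divided by the loss in \<open>localised_poly\<close>.\<close>

definition tker :: "nat \<Rightarrow> real \<Rightarrow> real" where
  "tker n \<theta> = 1344 * real n * jker n \<theta>"

text \<open>The quotient of sines is the gain from the weighted inequality; 1 / n caps it where sin
  \<alpha> degenerates, that is at the boundary. 40000 rounds up 1800 / (3/64).\<close>

definition nker :: "nat \<Rightarrow> real \<Rightarrow> real \<Rightarrow> real" where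
  "nker n \<alpha> \<theta> = 40000 * real n * jker n (\<theta> - \<alpha>) * \<bar>sin \<theta>\<bar> / (\<bar>sin \<alpha>\<bar> + 1 / real n)"

lemma tker_nonneg: "0 \<le> tker n \<theta>" by (simp add: tker_def jker_nonneg)
lemma nker_nonneg: "0 \<le> nker n \<alpha> \<theta>"
  by (simp add: nker_def jker_nonneg)

lemma tker_measurable [measurable]: "tker n \<in> borel_measurable borel"
  unfolding tker_def [abs_def] by measurable

lemma nker_measurable [measurable]: "(\<lambda>(a, t). nker n a t) \<in> borel_measurable (borel \<Otimes>\<^sub>M borel)"
  unfolding nker_def [abs_def] split_beta' by measurable

text \<open>Solve \<epsilon> sin \<theta> = \<sigma> with a complex \<theta>: for \<tau> = \<sigma>
  / \<epsilon> the point z = exp (i \<theta>) is i \<tau> + sqrt (1 - \<tau>^2). A small \<sigma>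
  puts z within 1 / (4 n) of 1, so the localisation is centred at angle 0.\<close>

lemma tangential_bound:
  fixes B :: "complex poly"
  assumes B: "degree B \<le> n" and n: "n \<ge> 1" and \<epsilon>: "\<epsilon> > 0" and \<sigma>: "cmod \<sigma> \<le> \<epsilon> / (8 * real n)"
  shows "ennreal (cmod (poly B \<sigma>)) \<le> circ (\<lambda>\<theta>. tker n \<theta> * cmod (poly B (of_real (\<epsilon> * sin \<theta>))))"
proof -
  define \<tau> where "\<tau> = \<sigma> / of_real \<epsilon>"
  have t: "cmod \<tau> \<le> 1 / (8 * real n)" using \<sigma> \<epsilon> by (simp add: \<tau>_def norm_divide field_simps)
  have "1 / (8 * real n) \<le> 1" using n by (simp add: divide_le_eq)
  then have t1: "cmod \<tau> \<le> 1" using t by linarith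
  define s where "s = csqrt (1 - \<tau> ^ 2)"
  have s2: "s ^ 2 = 1 - \<tau> ^ 2" by (simp add: s_def)
  have s1: "cmod (s - 1) \<le> cmod \<tau>"
  proof -
    have "0 \<le> Re s" unfolding s_def by (rule Re_csqrt)
    then have "1 \<le> cmod (s + 1)" using complex_Re_le_cmod[of "s + 1"] by simp
    then have "cmod (s - 1) * 1 \<le> cmod (s - 1) * cmod (s + 1)" by (intro mult_left_mono) auto
    also have "\<dots> = cmod (s ^ 2 - 1)" by (simp add: norm_mult[symmetric] power2_eq_square algebra_simps)
    also have "s ^ 2 - 1 = - (\<tau> ^ 2)" by (simp add: s2)
    also have "cmod (- (\<tau> ^ 2)) = cmod \<tau> * cmod \<tau>" by (simp only: norm_minus_cancel norm_mult power2_eq_square)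
    also have "\<dots> \<le> cmod \<tau> * 1" using t1 by (intro mult_left_mono) auto
    finally show ?thesis by simp
  qed
  define z where "z = \<i> * \<tau> + s"
  define r where "r = smult (- (\<i> * \<epsilon> / 2)) [:-1, 0, 1:]"
  have rz: "poly r w = - (\<i> * \<epsilon> / 2) * (w ^ 2 - 1)" for w
    by (simp add: r_def power2_eq_square algebra_simps diff_divide_distrib)
  have dr: "degree r \<le> 2" unfolding r_def by (rule order_trans[OF degree_smult_le]) simp
  have "cmod (z - cis 0) \<le> cmod (\<i> * \<tau>) + cmod (s - 1)"
    unfolding z_def using norm_triangle_ineq[of "\<i> * \<tau>" "s - 1"] by (simp add: algebra_simps)
  also have "\<dots> \<le> 2 * cmod \<tau>" using s1 by (simp add: norm_mult)
  also have "\<dots> \<le> 2 * (1 / (8 * real n))" using t by simp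
  finally have zz: "cmod (z - cis 0) \<le> 1 / (4 * real n)" by simp
  obtain q where q: "degree q \<le> 6 * n" "z \<noteq> 0"
    "3 / 64 * cmod (poly B (poly r z / z)) \<le> cmod (poly q z)"
    "\<And>\<theta>. cmod (poly q (cis \<theta>)) = jker n (\<theta> - 0) * cmod (poly B (poly r (cis \<theta>) / cis \<theta>))"
    using localised_poly[OF B dr n zz] by blast
  have "z ^ 2 = s ^ 2 + 2 * \<i> * \<tau> * s - \<tau> ^ 2"
    by (simp add: z_def power2_eq_square algebra_simps)
  then have "z ^ 2 - 1 = 2 * \<i> * \<tau> * z"
    unfolding s2 by (simp add: z_def power2_eq_square algebra_simps)
  then have "poly r z = - (\<i> * \<epsilon> / 2) * (2 * \<i> * \<tau> * z)" by (simp only: rz)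
  also have "\<dots> = \<epsilon> * \<tau> * z" by (simp add: complex_eq_iff algebra_simps)
  finally have "poly r z = \<epsilon> * \<tau> * z" .
  then have rv: "poly r z / z = \<sigma>" using q(2) \<epsilon> by (simp add: \<tau>_def)
  have cv: "poly r (cis \<theta>) / cis \<theta> = of_real (\<epsilon> * sin \<theta>)" for \<theta>
  proof -
    have "cis \<theta> * cis (-\<theta>) = 1" by (simp add: cis_mult)
    then have "cis \<theta> ^ 2 - 1 = cis \<theta> * (cis \<theta> - cis (-\<theta>))"
      by (simp add: power2_eq_square algebra_simps)
    moreover have "cis \<theta> - cis (-\<theta>) = 2 * \<i> * of_real (sin \<theta>)"
      by (simp add: complex_eq_iff)
    ultimately have "poly r (cis \<theta>) = - (\<i> * \<epsilon> / 2) * (cis \<theta> * (2 * \<i> * of_real (sin \<theta>)))" by (simp add: rz)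
    also have "\<dots> = of_real (\<epsilon> * sin \<theta>) * cis \<theta>" by (simp add: complex_eq_iff)
    finally show ?thesis by simp
  qed
  have "ennreal (3 / 64 * cmod (poly B \<sigma>)) \<le> ennreal (cmod (poly q z))"
    using q(3) rv by (intro ennreal_leI) simp
  also have "\<dots> \<le> ennreal ((real (6 * n) + 1) * max 1 (cmod z) ^ (6 * n)) * circ (\<lambda>\<theta>. cmod (poly q (cis \<theta>)))"
    by (rule circ_nikolskii[OF q(1)])
  also have "\<dots> \<le> ennreal (63 * real n) * circ (\<lambda>\<theta>. cmod (poly q (cis \<theta>)))"
  proof (intro mult_right_mono ennreal_leI)
    have "(real (6 * n) + 1) * max 1 (cmod z) ^ (6 * n) \<le> (7 * real n) * 9"
      using n by (intro mult_mono max_one_power_le[OF zz _ n]) auto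
    then show "(real (6 * n) + 1) * max 1 (cmod z) ^ (6 * n) \<le> 63 * real n" by simp
  qed simp
  finally have "ennreal (cmod (poly B \<sigma>)) \<le> ennreal (63 * real n / (3 / 64)) * circ (\<lambda>\<theta>. cmod (poly q (cis \<theta>)))"
    by (rule ennreal_circ_localised) auto
  also have "\<dots> = circ (\<lambda>\<theta>. (63 * real n / (3 / 64)) * cmod (poly q (cis \<theta>)))"
    by (intro circ_cmult[symmetric] borel_measurable_continuous_onI continuous_intros) auto
  also have "\<dots> = circ (\<lambda>\<theta>. tker n \<theta> * cmod (poly B (of_real (\<epsilon> * sin \<theta>))))"
    unfolding q(4) cv by (intro arg_cong[where f = circ] ext) (simp add: tker_def)
  finally show ?thesis .
qed

text \<open>The principal root s has nonnegative real part, so |s + v| is at least v and at least |s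
  - v|; then factor w - v^2 as (s - v) (s + v). The first bound is the better one for large v, the
  second survives when v is near 0.\<close>

lemma csqrt_diff_bounds:
  assumes v: "0 \<le> v"
  shows "cmod (csqrt w - of_real v) * v \<le> cmod (w - of_real v ^ 2)"
    and "cmod (csqrt w - of_real v) ^ 2 \<le> cmod (w - of_real v ^ 2)"
proof -
  define s where "s = csqrt w"
  have R: "0 \<le> Re s" unfolding s_def by (rule Re_csqrt)
  have s2: "s ^ 2 = w" by (simp add: s_def)
  have e: "cmod (w - of_real v ^ 2) = cmod (s - of_real v) * cmod (s + of_real v)"
    unfolding norm_mult[symmetric] s2[symmetric] by (simp add: power2_eq_square algebra_simps)
  have "v \<le> cmod (s + of_real v)" using complex_Re_le_cmod[of "s + of_real v"] R by simp
  then show "cmod (csqrt w - of_real v) * v \<le> cmod (w - of_real v ^ 2)"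
    unfolding e s_def[symmetric] by (intro mult_left_mono) auto
  have "(cmod (s - of_real v)) ^ 2 \<le> (cmod (s + of_real v)) ^ 2"
    unfolding cmod_power2 using R v by (simp add: power2_eq_square algebra_simps)
  then have "cmod (s - of_real v) \<le> cmod (s + of_real v)" by (rule power2_le_imp_le) simp
  then have "cmod (s - of_real v) * cmod (s - of_real v) \<le> cmod (w - of_real v ^ 2)"
    unfolding e by (intro mult_left_mono) auto
  then show "cmod (csqrt w - of_real v) ^ 2 \<le> cmod (w - of_real v ^ 2)"
    unfolding s_def by (simp only: power2_eq_square[of "cmod (csqrt w - of_real v)"])
qed

text \<open>With z = exp (i \<theta>) the quadratic equation says w = (1 - cos \<theta>) / 2 = sin^2
  (\<theta> / 2), so z is the square of sqrt (1 - w) + i sqrt w. The tolerance for w grows with sin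
  (\<alpha> / 2) because the derivative of the square does; at \<alpha> = 0 it is of order 1 / n^2,
  the boundary scale of Markov's inequality.\<close>

lemma normal_root:
  assumes a: "0 \<le> \<alpha>" "\<alpha> \<le> pi / 2" and n: "n \<ge> 1"
    and w: "cmod (w - of_real (sin (\<alpha> / 2)) ^ 2) \<le> (1 / real n + sin (\<alpha> / 2)) / (10000 * real n)"
  obtains z where "cmod (z - cis \<alpha>) \<le> 1 / (4 * real n)" "z \<noteq> 0" "z ^ 2 - (2 - 4 * w) * z + 1 = 0"
proof -
  define v where "v = sin (\<alpha> / 2)"
  define u where "u = cos (\<alpha> / 2)"
  have v0: "0 \<le> v" unfolding v_def using a by (intro sin_ge_zero) auto
  have v1: "v \<le> 1" by (simp add: v_def)
  have uv: "u ^ 2 + v ^ 2 = 1" by (simp add: u_def v_def)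
  \<comment> \<open>The restriction \<alpha> <= pi / 2 keeps the other root, sqrt (1 - w), away from
    its branch point.\<close>
  have "cos (pi / 3) \<le> u" unfolding u_def using a by (intro cos_monotone_0_pi_le) auto
  then have u: "1 / 2 \<le> u" by (simp add: cos_60)
  define D where "D = cmod (w - of_real v ^ 2)"
  define h where "h = 1 / real n"
  have h: "0 < h" "h \<le> 1" using n by (auto simp: h_def)
  have D: "D \<le> (h + v) * h / 10000" using w by (simp add: D_def v_def h_def mult.commute)
  have D2: "D \<le> 2 * h / 10000"
  proof -
    have "(h + v) * h \<le> 2 * h" using h v1 by (intro mult_right_mono) auto
    then show ?thesis using D by linarith
  qed
  have s1: "cmod (csqrt (1 - w) - of_real u) \<le> h / 1000"
  proof -
    have "1 - w - of_real u ^ 2 = - (w - of_real v ^ 2)"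
      using arg_cong[OF uv, of complex_of_real] by (simp add: algebra_simps)
    then have "cmod (1 - w - of_real u ^ 2) = D" unfolding D_def by (simp only: norm_minus_cancel)
    then have "cmod (csqrt (1 - w) - of_real u) * u \<le> D"
      using csqrt_diff_bounds(1)[of u "1 - w"] u by linarith
    moreover have "cmod (csqrt (1 - w) - of_real u) * (1 / 2) \<le> cmod (csqrt (1 - w) - of_real u) * u"
      using u by (intro mult_left_mono) auto
    ultimately show ?thesis using D2 h by linarith
  qed
  have s2: "cmod (csqrt w - of_real v) \<le> 2 * h / 100"
  proof (cases "v \<ge> h")
    case True
    have "cmod (csqrt w - of_real v) * v \<le> (h + v) * h / 10000"
      using csqrt_diff_bounds(1)[OF v0, of w] D by (simp add: D_def)
    also have "\<dots> \<le> (2 * v) * h / 10000" using True h by (intro divide_right_mono mult_right_mono) auto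
    finally have "cmod (csqrt w - of_real v) * v \<le> (2 * h / 10000) * v" by (simp add: mult_ac)
    then have "cmod (csqrt w - of_real v) \<le> 2 * h / 10000" using True h by simp
    then show ?thesis using h by simp
  next
    case False
    have "cmod (csqrt w - of_real v) ^ 2 \<le> (h + v) * h / 10000"
      using csqrt_diff_bounds(2)[OF v0, of w] D by (simp add: D_def)
    also have "\<dots> \<le> (4 * h) * h / 10000" using False h by (intro divide_right_mono mult_right_mono) auto
    also have "\<dots> = (2 * h / 100) ^ 2" by (simp add: power2_eq_square)
    finally show ?thesis by (rule power2_le_imp_le) (use h in simp)
  qed
  define \<psi> where "\<psi> = csqrt (1 - w) + \<i> * csqrt w"
  have p: "cmod (\<psi> - cis (\<alpha> / 2)) \<le> 3 * h / 100"
  proof -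
    have "\<psi> - cis (\<alpha> / 2) = (csqrt (1 - w) - of_real u) + \<i> * (csqrt w - of_real v)"
      by (simp add: \<psi>_def u_def v_def complex_eq_iff)
    also have "cmod \<dots> \<le> cmod (csqrt (1 - w) - of_real u) + cmod (\<i> * (csqrt w - of_real v))"
      by (rule norm_triangle_ineq)
    also have "\<dots> \<le> h / 1000 + 2 * h / 100" using s1 s2 by (simp add: norm_mult)
    also have "\<dots> \<le> 3 * h / 100" using h by simp
    finally show ?thesis .
  qed
  define \<phi> where "\<phi> = csqrt (1 - w) - \<i> * csqrt w"
  have pp: "\<psi> * \<phi> = 1"
  proof -
    have "\<psi> * \<phi> = csqrt (1 - w) ^ 2 + csqrt w ^ 2"
      by (simp add: \<psi>_def \<phi>_def power2_eq_square algebra_simps)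
    then show ?thesis by simp
  qed
  have ps: "\<psi> ^ 2 + \<phi> ^ 2 = 2 - 4 * w"
  proof -
    have "\<psi> ^ 2 + \<phi> ^ 2 = 2 * csqrt (1 - w) ^ 2 - 2 * csqrt w ^ 2"
      by (simp add: \<psi>_def \<phi>_def power2_eq_square algebra_simps)
    then show ?thesis by simp
  qed
  show thesis
  proof
    have cc: "cis \<alpha> = cis (\<alpha> / 2) ^ 2" by (simp add: Complex.DeMoivre)
    have "cmod (\<psi> ^ 2 - cis \<alpha>) = cmod (\<psi> - cis (\<alpha> / 2)) * cmod (\<psi> + cis (\<alpha> / 2))"
      unfolding cc norm_mult[symmetric] by (simp add: power2_eq_square algebra_simps)
    also have "\<dots> \<le> (3 * h / 100) * 3"
    proof (intro mult_mono p)
      have "cmod (\<psi> + cis (\<alpha> / 2)) = cmod ((\<psi> - cis (\<alpha> / 2)) + 2 * cis (\<alpha> / 2))" by (simp add: algebra_simps)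
      also have "\<dots> \<le> cmod (\<psi> - cis (\<alpha> / 2)) + 2"
        using norm_triangle_ineq[of "\<psi> - cis (\<alpha> / 2)" "2 * cis (\<alpha> / 2)"] by (simp add: norm_mult)
      finally show "cmod (\<psi> + cis (\<alpha> / 2)) \<le> 3" using p h by linarith
    qed (use h in auto)
    also have "\<dots> \<le> h / 4" using h by simp
    finally show "cmod (\<psi> ^ 2 - cis \<alpha>) \<le> 1 / (4 * real n)" by (simp add: h_def)
    show "\<psi> ^ 2 \<noteq> 0" using pp by auto
    have "(\<psi> ^ 2) ^ 2 - (2 - 4 * w) * \<psi> ^ 2 + 1 = (\<psi>^2)^2 - (\<psi> ^ 2 + \<phi> ^ 2) * \<psi> ^ 2 + (\<psi> * \<phi>) ^ 2"
      by (simp add: ps pp)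
    also have "\<dots> = 0" by (simp add: power2_eq_square algebra_simps)
    finally show "(\<psi> ^ 2) ^ 2 - (2 - 4 * w) * \<psi> ^ 2 + 1 = 0" .
  qed
qed

text \<open>Two regimes. If sin \<alpha> is at least 1 / n, then |z^2 - 1| is at least of this size
  and can be divided out. Otherwise the angle is below the resolution 1 / n, and the coefficient
  form of the weighted inequality, with its extra factor n, gives the same bound because sin
  \<alpha> + 1 / n is at most 2 / n.\<close>

lemma normal_bound:
  fixes B :: "complex poly"
  assumes B: "degree B \<le> n" and n: "n \<ge> 1" and a: "0 \<le> \<alpha>" "\<alpha> \<le> pi / 2"
    and w: "cmod (w - of_real (sin (\<alpha> / 2)) ^ 2) \<le> (1 / real n + sin (\<alpha> / 2)) / (10000 * real n)"
  shows "ennreal (cmod (poly B (of_real (\<kappa> ^ 2) * w))) \<le>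
    circ (\<lambda>\<theta>. nker n \<alpha> \<theta> * cmod (poly B (of_real (\<kappa> ^ 2 * (1 - cos \<theta>) / 2))))"
proof -
  obtain z where z: "cmod (z - cis \<alpha>) \<le> 1 / (4 * real n)" "z \<noteq> 0" "z ^ 2 - (2 - 4 * w) * z + 1 = 0"
    using normal_root[OF a n w] .
  define r :: "complex poly" where "r = smult (of_real (\<kappa> ^ 2 / 4)) [:-1, 2, -1:]"
  have rz: "poly r x = of_real (\<kappa> ^ 2 / 4) * (2 * x - x ^ 2 - 1)" for x
    by (simp add: r_def power2_eq_square algebra_simps)
  have dr: "degree r \<le> 2" unfolding r_def by (rule order_trans[OF degree_smult_le]) simp
  obtain q where q: "degree q \<le> 6 * n" "z \<noteq> 0"
    "3 / 64 * cmod (poly B (poly r z / z)) \<le> cmod (poly q z)"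
    "\<And>\<theta>. cmod (poly q (cis \<theta>)) = jker n (\<theta> - \<alpha>) * cmod (poly B (poly r (cis \<theta>) / cis \<theta>))"
    using localised_poly[OF B dr n z(1)] by blast
  have "2 * z - z ^ 2 - 1 = 4 * w * z" using z(3) by (simp add: algebra_simps)
  then have rv: "poly r z / z = of_real (\<kappa> ^ 2) * w" using z(2) by (simp add: rz)
  have cv: "poly r (cis \<theta>) / cis \<theta> = of_real (\<kappa> ^ 2 * (1 - cos \<theta>) / 2)" for \<theta>
  proof -
    have c: "cis \<theta> * cis (-\<theta>) = 1" by (simp add: cis_mult)
    have "2 * cis \<theta> - cis \<theta> ^ 2 - 1 = cis \<theta> * (2 - cis \<theta> - cis (-\<theta>))"
      unfolding right_diff_distrib c by (simp add: power2_eq_square)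
    moreover have "2 - cis \<theta> - cis (-\<theta>) = of_real (2 * (1 - cos \<theta>))"
      by (simp add: complex_eq_iff)
    ultimately have "poly r (cis \<theta>) = of_real (\<kappa> ^ 2 / 4) * (cis \<theta> * of_real (2 * (1 - cos \<theta>)))"
      by (simp only: rz)
    also have "\<dots> = of_real (\<kappa> ^ 2 / 4 * (2 * (1 - cos \<theta>))) * cis \<theta>" by (simp only: of_real_mult mult_ac)
    also have "\<kappa> ^ 2 / 4 * (2 * (1 - cos \<theta>)) = \<kappa> ^ 2 * (1 - cos \<theta>) / 2" by simp
    finally show ?thesis by simp
  qed
  define I where "I = circ (\<lambda>\<theta>. cmod (poly q (cis \<theta>)) * \<bar>sin \<theta>\<bar>)"
  define S where "S = \<bar>sin \<alpha>\<bar> + 1 / real n"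
  have S: "0 < S" using n by (simp add: S_def add_nonneg_pos)
  have main: "ennreal (cmod (poly q z)) \<le> ennreal (1800 * real n / S) * I"
  proof (cases "\<bar>sin \<alpha>\<bar> \<ge> 1 / real n")
    case False
    have "ennreal (cmod (poly q z)) \<le> ennreal (2 * (real (6 * n) + 1) ^ 2 * max 1 (cmod z) ^ (6 * n)) * I"
      unfolding I_def by (rule circ_nikolskii_sin(1)[OF q(1)])
    also have "\<dots> \<le> ennreal (1800 * real n / S) * I"
    proof (intro mult_right_mono ennreal_leI)
      have "2 * (real (6 * n) + 1) ^ 2 * max 1 (cmod z) ^ (6 * n) \<le> 2 * (7 * real n) ^ 2 * 9"
        using n by (intro mult_mono power_mono max_one_power_le[OF z(1) _ n]) auto
      also have "\<dots> = 882 * real n / (1 / real n)" using n by (simp add: power2_eq_square)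
      also have "\<dots> = 1764 * real n / (2 / real n)" by simp
      also have "\<dots> \<le> 1800 * real n / S"
        using False n S by (intro frac_le) (auto simp: S_def)
      finally show "2 * (real (6 * n) + 1) ^ 2 * max 1 (cmod z) ^ (6 * n) \<le> 1800 * real n / S" .
    qed simp
    finally show ?thesis .
  next
    case True
    have "cmod (z + cis \<alpha>) = cmod ((z - cis \<alpha>) + 2 * cis \<alpha>)" by (simp add: algebra_simps)
    also have "\<dots> \<le> cmod (z - cis \<alpha>) + 2"
      using norm_triangle_ineq[of "z - cis \<alpha>" "2 * cis \<alpha>"] by (simp add: norm_mult)
    also have "\<dots> \<le> 1 / 4 + 2" 
    proof -
      have "1 / (4 * real n) \<le> 1 / 4" using n by (simp add: divide_le_eq)
      then show ?thesis using z(1) by linarith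
    qed
    finally have zc: "cmod (z + cis \<alpha>) \<le> 4" by simp
    have "cmod (z ^ 2 - cis \<alpha> ^ 2) = cmod (z - cis \<alpha>) * cmod (z + cis \<alpha>)"
      unfolding norm_mult[symmetric] by (simp add: power2_eq_square algebra_simps)
    also have "\<dots> \<le> 1 / (4 * real n) * 4" by (intro mult_mono z(1) zc) auto
    finally have "cmod (z ^ 2 - cis \<alpha> ^ 2) \<le> 1 / real n" by simp
    moreover have "cmod (cis \<alpha> ^ 2 - 1) \<le> cmod (z ^ 2 - cis \<alpha> ^ 2) + cmod (z ^ 2 - 1)"
      using norm_triangle_ineq4[of "z ^ 2 - 1" "z ^ 2 - cis \<alpha> ^ 2"] by simp
    ultimately have zl: "S / 2 \<le> cmod (z ^ 2 - 1)"
      using True unfolding cmod_cis_sq S_def by simp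
    have "ennreal (S / 2 * cmod (poly q z)) \<le> ennreal (cmod (poly q z) * cmod (z ^ 2 - 1))"
      using zl by (intro ennreal_leI) (metis mult.commute mult_left_mono norm_ge_zero)
    also have "\<dots> \<le> ennreal (2 * (real (6 * n) + 3) * max 1 (cmod z) ^ (6 * n + 2)) * I"
      unfolding I_def by (rule circ_nikolskii_sin(2)[OF q(1)])
    also have "\<dots> \<le> ennreal (162 * real n) * I"
    proof (intro mult_right_mono ennreal_leI)
      have "2 * (real (6 * n) + 3) * max 1 (cmod z) ^ (6 * n + 2) \<le> 2 * (9 * real n) * 9"
        using n by (intro mult_mono max_one_power_le[OF z(1) _ n]) auto
      then show "2 * (real (6 * n) + 3) * max 1 (cmod z) ^ (6 * n + 2) \<le> 162 * real n" by simp
    qed simp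
    finally have "ennreal (cmod (poly q z)) \<le> ennreal (162 * real n / (S / 2)) * I"
      by (rule ennreal_circ_localised) (use S in auto)
    also have "\<dots> \<le> ennreal (1800 * real n / S) * I"
      using S by (intro mult_right_mono ennreal_leI) (auto simp: divide_right_mono)
    finally show ?thesis .
  qed
  have "ennreal (3 / 64 * cmod (poly B (of_real (\<kappa> ^ 2) * w))) \<le> ennreal (cmod (poly q z))"
    using q(3) unfolding rv by (intro ennreal_leI) simp
  also note main
  finally have "ennreal (cmod (poly B (of_real (\<kappa> ^ 2) * w))) \<le> ennreal (1800 * real n / S / (3 / 64)) * I"
    by (rule ennreal_circ_localised) (use S in auto)
  also have "\<dots> \<le> ennreal (40000 * real n / S) * I"
    using S by (intro mult_right_mono ennreal_leI) (auto simp: divide_right_mono)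
  also have "\<dots> = circ (\<lambda>\<theta>. (40000 * real n / S) * (cmod (poly q (cis \<theta>)) * \<bar>sin \<theta>\<bar>))"
    unfolding I_def using S by (intro circ_cmult[symmetric] borel_measurable_continuous_onI continuous_intros) auto
  also have "\<dots> = circ (\<lambda>\<theta>. nker n \<alpha> \<theta> * cmod (poly B (of_real (\<kappa> ^ 2 * (1 - cos \<theta>) / 2))))"
    unfolding q(4) cv by (intro arg_cong[where f = circ] ext) (simp add: nker_def S_def)
  finally show ?thesis .
qed

section \<open>A pointwise Bernstein inequality for differences\<close>

definition Kc :: real where "Kc = 80000 * (12 * (4 * pi))"

lemma Kc_pos: "0 < Kc" by (simp add: Kc_def)

lemma circ_scaled_cauk3:
  assumes n: "n \<ge> 1" and c: "0 \<le> c" "c \<le> 80000"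
    and f: "\<And>\<theta>. \<theta> \<in> {-pi..pi} \<Longrightarrow> f \<theta> \<le> c * real n * cauk3 n (\<theta> - \<alpha>)"
  shows "circ f \<le> ennreal Kc"
proof -
  have "circ f \<le> (\<integral>\<^sup>+\<theta>. ennreal (c * real n) * (ennreal (cauk3 n (\<theta> - \<alpha>)) * indicator {-pi..pi} \<theta>) \<partial>lborel)"
    unfolding circ_def
  proof (intro nn_integral_mono)
    fix \<theta>
    show "ennreal (f \<theta>) * indicator {-pi..pi} \<theta> \<le>
      ennreal (c * real n) * (ennreal (cauk3 n (\<theta> - \<alpha>)) * indicator {-pi..pi} \<theta>)"
      using f[of \<theta>] c by (cases "\<theta> \<in> {-pi..pi}")
        (auto simp: ennreal_mult[symmetric] cauk3_nonneg intro!: ennreal_leI)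
  qed
  also have "\<dots> = ennreal (c * real n) * (\<integral>\<^sup>+\<theta>. ennreal (cauk3 n (\<theta> - \<alpha>)) * indicator {-pi..pi} \<theta> \<partial>lborel)"
    by (intro nn_integral_cmult) measurable
  also have "\<dots> \<le> ennreal (c * real n) * ennreal (12 * (4 * pi / real n))"
    by (intro mult_left_mono nn_integral_cauk3 n) auto
  also have "\<dots> = ennreal (c * real n * (12 * (4 * pi / real n)))" using c
    by (intro ennreal_mult[symmetric]) auto
  also have "c * real n * (12 * (4 * pi / real n)) = c * (12 * (4 * pi))" using n by simp
  also have "ennreal \<dots> \<le> ennreal Kc" unfolding Kc_def using c by (intro ennreal_leI mult_right_mono) auto
  finally show ?thesis .
qed

lemma circ_tker:
  assumes n: "n \<ge> 1" shows "circ (tker n) \<le> ennreal Kc"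
proof (rule circ_scaled_cauk3[OF n, of 1344 _ 0])
  fix \<theta> :: real assume "\<theta> \<in> {-pi..pi}"
  then show "tker n \<theta> \<le> 1344 * real n * cauk3 n (\<theta> - 0)"
    unfolding tker_def using n by (auto intro!: mult_left_mono jker_le_cauk3)
qed auto

text \<open>The sine of \<theta> exceeds sin \<alpha> + 1 / n at most by a factor of order 1 + n
  |sin ((\<theta> - \<alpha>) / 2)|, and this is the factor that \<open>jker_bound\<close>
  absorbs.\<close>

lemma circ_nker:
  assumes n: "n \<ge> 1" and a: "0 \<le> \<alpha>" "\<alpha> \<le> pi / 2" shows "circ (nker n \<alpha>) \<le> ennreal Kc"
proof (rule circ_scaled_cauk3[OF n, of 80000 _ \<alpha>])
  fix \<theta> :: real assume t: "\<theta> \<in> {-pi..pi}"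
  have u: "\<bar>\<theta> - \<alpha>\<bar> \<le> 2 * pi" using t a by auto
  define S where "S = \<bar>sin \<alpha>\<bar> + 1 / real n"
  have S: "0 < S" using n by (simp add: S_def add_nonneg_pos)
  define d where "d = \<bar>sin ((\<theta> - \<alpha>) / 2)\<bar>"
  have "sin \<theta> - sin \<alpha> = 2 * sin ((\<theta> - \<alpha>) / 2) * cos ((\<theta> + \<alpha>) / 2)" by (rule sin_diff_sin)
  then have "\<bar>sin \<theta> - sin \<alpha>\<bar> \<le> 2 * d * 1"
    unfolding d_def by (simp only: abs_mult) (intro mult_mono, auto)
  then have "\<bar>sin \<theta>\<bar> \<le> \<bar>sin \<alpha>\<bar> + 2 * d" by linarith
  also have "\<dots> \<le> S * (2 * (1 + real n * d))"
  proof -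
    have "2 * d = (1 / real n) * (2 * (real n * d))" using n by simp
    also have "\<dots> \<le> S * (2 * (real n * d))" unfolding S_def by (intro mult_right_mono) (auto simp: d_def)
    finally have "2 * d \<le> S * (2 * (real n * d))" .
    moreover have "\<bar>sin \<alpha>\<bar> \<le> S * 2" unfolding S_def by (simp add: distrib_right)
    moreover have "S * (2 * (1 + real n * d)) = S * 2 + S * (2 * (real n * d))" by (simp add: distrib_left)
    ultimately show ?thesis by linarith
  qed
  finally have s: "\<bar>sin \<theta>\<bar> \<le> S * (2 * (1 + real n * d))" .
  have "nker n \<alpha> \<theta> = 40000 * real n * (jker n (\<theta> - \<alpha>) * \<bar>sin \<theta>\<bar>) / S"
    by (simp add: nker_def S_def)
  also have "\<dots> \<le> 40000 * real n * (jker n (\<theta> - \<alpha>) * (S * (2 * (1 + real n * d)))) / S"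
    using S s by (intro divide_right_mono mult_left_mono) (auto simp: jker_nonneg)
  also have "\<dots> = 80000 * real n * (jker n (\<theta> - \<alpha>) * (1 + real n * d))" using S by simp
  also have "\<dots> \<le> 80000 * real n * cauk3 n (\<theta> - \<alpha>)"
    unfolding d_def by (intro mult_left_mono jker_bound n u) auto
  finally show "nker n \<alpha> \<theta> \<le> 80000 * real n * cauk3 n (\<theta> - \<alpha>)" .
qed auto

text \<open>The marginal in the other variable. The weight sin \<alpha> is the Jacobian of the depth
  substitution and cancels the denominator of the kernel; the sine of \<theta> that is left is the
  Jacobian on the other side.\<close>

lemma nker_dual:
  assumes n: "n \<ge> 1" and t: "\<theta> \<in> {-pi..pi}"
  shows "(\<integral>\<^sup>+\<alpha>. ennreal (nker n \<alpha> \<theta> * sin \<alpha>) * indicator {0..pi/2} \<alpha> \<partial>lborel) \<le> ennreal (Kc * \<bar>sin \<theta>\<bar>)"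
proof -
  let ?c = "80000 * real n * \<bar>sin \<theta>\<bar>"
  have "(\<integral>\<^sup>+\<alpha>. ennreal (nker n \<alpha> \<theta> * sin \<alpha>) * indicator {0..pi/2} \<alpha> \<partial>lborel) \<le>
     (\<integral>\<^sup>+\<alpha>. ennreal ?c * (ennreal (cauk3 n (\<alpha> - \<theta>)) * indicator {0..pi/2} \<alpha>) \<partial>lborel)"
  proof (intro nn_integral_mono)
    fix \<alpha>
    show "ennreal (nker n \<alpha> \<theta> * sin \<alpha>) * indicator {0..pi/2} \<alpha> \<le>
      ennreal ?c * (ennreal (cauk3 n (\<alpha> - \<theta>)) * indicator {0..pi/2} \<alpha>)"
    proof (cases "\<alpha> \<in> {0..pi/2}")
      case True
      define S where "S = \<bar>sin \<alpha>\<bar> + 1 / real n"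
      have S: "0 < S" using n by (simp add: S_def add_nonneg_pos)
      have "sin \<alpha> \<le> S" unfolding S_def by (smt (verit) divide_nonneg_nonneg of_nat_0_le_iff)
      then have sS: "sin \<alpha> / S \<le> 1" using S by simp
      have s0: "0 \<le> sin \<alpha>" using True by (intro sin_ge_zero) auto
      have "nker n \<alpha> \<theta> * sin \<alpha> = 40000 * real n * \<bar>sin \<theta>\<bar> * jker n (\<theta> - \<alpha>) * (sin \<alpha> / S)"
        by (simp add: nker_def S_def)
      also have "\<dots> \<le> ?c * cauk3 n (\<theta> - \<alpha>) * 1"
        using True t s0 S sS by (intro mult_mono jker_le_cauk3 n) (auto simp: jker_nonneg cauk3_nonneg)
      also have "cauk3 n (\<theta> - \<alpha>) = cauk3 n (\<alpha> - \<theta>)" using cauk3_even[of n "\<theta> - \<alpha>"] by simp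
      finally show ?thesis using True by (simp add: ennreal_mult[symmetric] cauk3_nonneg ennreal_leI)
    qed simp
  qed
  also have "\<dots> = ennreal ?c * (\<integral>\<^sup>+\<alpha>. ennreal (cauk3 n (\<alpha> - \<theta>)) * indicator {0..pi/2} \<alpha> \<partial>lborel)"
    by (intro nn_integral_cmult) measurable
  also have "\<dots> \<le> ennreal ?c * ennreal (12 * (4 * pi / real n))"
    by (intro mult_left_mono nn_integral_cauk3 n) auto
  also have "\<dots> = ennreal (?c * (12 * (4 * pi / real n)))" by (intro ennreal_mult[symmetric]) auto
  also have "?c * (12 * (4 * pi / real n)) = Kc * \<bar>sin \<theta>\<bar>" using n by (simp add: Kc_def)
  finally show ?thesis .
qed

text \<open>The shift a makes the induction on r possible: Pascal's rule turns the sum into the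
  difference of the sums for a and a + 1, and expanding the k-th power of (j + a) + 1 leaves only
  exponents below k.\<close>

lemma alternating_sum_power_eq_0:
  fixes a :: "'a::comm_ring_1"
  shows "k < r \<Longrightarrow> (\<Sum>j\<le>r. (-1) ^ j * of_nat (r choose j) * (of_nat j + a) ^ k) = 0"
proof (induction r arbitrary: k a)
  case (Suc r)
  define T where "T k a = (\<Sum>j\<le>r. (-1) ^ j * of_nat (r choose j) * (of_nat j + a) ^ k)" for k and a :: 'a
  have T0: "T i a = 0" if "i < r" for i a using Suc.IH that by (simp add: T_def)
  have "(\<Sum>j\<le>Suc r. (-1) ^ j * of_nat (Suc r choose j) * (of_nat j + a) ^ k) =
      (\<Sum>j\<le>Suc r. (-1) ^ j * of_nat (r choose j) * (of_nat j + a) ^ k) - T k (a + 1)"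
  proof -
    have "(\<Sum>j\<le>Suc r. (-1) ^ j * of_nat (Suc r choose j) * (of_nat j + a) ^ k) =
      a ^ k + (\<Sum>j\<le>r. (-1) ^ Suc j * of_nat (Suc r choose Suc j) * (of_nat (Suc j) + a) ^ k)"
      by (subst sum.atMost_Suc_shift) simp
    also have "\<dots> = a ^ k + ((\<Sum>j\<le>r. (-1) ^ Suc j * of_nat (r choose Suc j) * (of_nat (Suc j) + a) ^ k)
        + (\<Sum>j\<le>r. (-1) ^ Suc j * of_nat (r choose j) * (of_nat (Suc j) + a) ^ k))"
      unfolding sum.distrib[symmetric] by (simp add: algebra_simps)
    also have "(\<Sum>j\<le>r. (-1) ^ Suc j * of_nat (r choose j) * (of_nat (Suc j) + a) ^ k) = - T k (a + 1)"
      by (simp add: T_def sum_negf algebra_simps)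
    also have "a ^ k + ((\<Sum>j\<le>r. (-1) ^ Suc j * of_nat (r choose Suc j) *
      (of_nat (Suc j) + a) ^ k) + - T k (a + 1))
       = (\<Sum>j\<le>Suc r. (-1) ^ j * of_nat (r choose j) * (of_nat j + a) ^ k) - T k (a + 1)"
      by (simp add: sum.atMost_Suc_shift del: sum.atMost_Suc)
    finally show ?thesis .
  qed
  also have "(\<Sum>j\<le>Suc r. (-1) ^ j * of_nat (r choose j) * (of_nat j + a) ^ k) = T k a"
    by (simp add: T_def binomial_eq_0)
  also have "T k (a + 1) = (\<Sum>i\<le>k. of_nat (k choose i) * T i a)"
  proof -
    have "(of_nat j + (a + 1)) ^ k = (\<Sum>i\<le>k. of_nat (k choose i) * (of_nat j + a) ^ i)" for j
      using binomial_ring[of "of_nat j + a" 1 k] by (simp add: add.assoc)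
    then have "T k (a + 1) = (\<Sum>j\<le>r. \<Sum>i\<le>k. (-1) ^ j * of_nat (r choose j) * (of_nat (k choose i) *
      (of_nat j + a) ^ i))"
      by (simp add: T_def sum_distrib_left)
    also have "\<dots> = (\<Sum>i\<le>k. \<Sum>j\<le>r. (-1) ^ j * of_nat (r choose j) * (of_nat (k choose i) * (of_nat j + a) ^ i))"
      by (rule sum.swap)
    finally show ?thesis by (simp add: T_def sum_distrib_left mult_ac)
  qed
  also have "\<dots> = (\<Sum>i<k. of_nat (k choose i) * T i a) + T k a"
    unfolding lessThan_Suc_atMost[symmetric] sum.lessThan_Suc by simp
  also have "(\<Sum>i<k. of_nat (k choose i) * T i a) = 0"
    using Suc.prems by (intro sum.neutral) (auto simp: T0)
  finally show ?case by simp
qed simp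

text \<open>Complex coordinates are passed as a function on the basis. So the tangential variable
  and the depth can be made complex separately, and the degree after a polynomial substitution can
  be read off.\<close>

lemma Polys_complexify:
  fixes P :: "'a::euclidean_space \<Rightarrow> real"
  assumes P: "P \<in> Polys N"
  obtains F :: "('a \<Rightarrow> complex) \<Rightarrow> complex" where
    "\<And>x. F (\<lambda>b. of_real (x \<bullet> b)) = of_real (P x)"
    "\<And>q k. (\<And>b. degree (q b) \<le> k) \<Longrightarrow> \<exists>p. degree p \<le> k * N \<and> (\<forall>z. poly p z = F (\<lambda>b. poly (q b) z))"
proof -
  obtain c where c: "P = (\<lambda>x. \<Sum>\<alpha>\<in>multi_indices N. c \<alpha> * (\<Prod>b\<in>Basis. (x \<bullet> b) ^ \<alpha> b))"
    using P unfolding Polys_def by auto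
  define F where "F X = (\<Sum>\<alpha>\<in>multi_indices N. of_real (c \<alpha>) * (\<Prod>b\<in>(Basis::'a set). X b ^ \<alpha> b))"
    for X :: "'a \<Rightarrow> complex"
  show thesis
  proof
    show "F (\<lambda>b. of_real (x \<bullet> b)) = of_real (P x)" for x by (simp add: F_def c)
    fix q :: "'a \<Rightarrow> complex poly" and k
    assume q: "\<And>b. degree (q b) \<le> k"
    define p where "p = (\<Sum>\<alpha>\<in>multi_indices N. smult (of_real (c \<alpha>)) (\<Prod>b\<in>(Basis::'a set). q b ^ \<alpha> b))"
    have "degree p \<le> k * N" unfolding p_def
    proof (rule degree_sum_le[OF finite_multi_indices])
      fix \<alpha> :: "'a \<Rightarrow> nat" assume a: "\<alpha> \<in> multi_indices N"
      have "degree (\<Prod>b\<in>(Basis::'a set). q b ^ \<alpha> b) \<le> (\<Sum>b\<in>(Basis::'a set). degree (q b ^ \<alpha> b))"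
        using degree_prod_sum_le[OF finite_Basis, of "\<lambda>b. q b ^ \<alpha> b"] by (simp add: o_def)
      also have "\<dots> \<le> (\<Sum>b\<in>(Basis::'a set). k * \<alpha> b)"
        by (intro sum_mono order_trans[OF degree_power_le] mult_right_mono q) auto
      also have "\<dots> = k * (\<Sum>b\<in>(Basis::'a set). \<alpha> b)" by (simp add: sum_distrib_left)
      also have "\<dots> \<le> k * N" using a by (intro mult_left_mono) (auto simp: multi_indices_def)
      finally show "degree (smult (of_real (c \<alpha>)) (\<Prod>b\<in>(Basis::'a set). q b ^ \<alpha> b)) \<le> k * N"
        using degree_smult_le order_trans by blast
    qed
    moreover have "poly p z = F (\<lambda>b. poly (q b) z)" for z
      by (simp add: p_def F_def poly_sum poly_prod)
    ultimately show "\<exists>p. degree p \<le> k * N \<and> (\<forall>z. poly p z = F (\<lambda>b. poly (q b) z))" by blast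
  qed
qed

text \<open>Cauchy's estimates on the circle of radius R bound the k-th coefficient by m / R^k. The
  difference annihilates the powers below r, the nodes j / r lie in the unit disc, and the remaining
  terms form a geometric series of ratio at most 1/2, governed by its first term m / R^r.\<close>

lemma difference_of_bounded_poly:
  fixes p :: "complex poly"
  assumes R: "R \<ge> 2" and r: "r \<ge> 1" and b: "\<And>z. cmod z \<le> R \<Longrightarrow> cmod (poly p z) \<le> m"
  shows "cmod (\<Sum>j\<le>r. (-1) ^ j * of_nat (r choose j) * poly p (of_nat j / of_nat r)) \<le>
    2 ^ r * (m * (2 * 2 ^ r / R ^ r))"
proof -
  have m0: "0 \<le> m" using order_trans[OF norm_ge_zero b[of 0]] R by simp
  have cb: "cmod (coeff p k) \<le> m / R ^ k" for k
  proof -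
    have "2 * pi * cmod (coeff (pcompose p [:0, of_real R:]) k) \<le>
        integral {-pi..pi} (\<lambda>\<theta>. cmod (poly (pcompose p [:0, of_real R:]) (cis \<theta>)))"
      by (rule cmod_coeff_le)
    also have "\<dots> \<le> integral {-pi..pi} (\<lambda>\<theta>. m)"
      using R by (intro integral_le integrable_continuous_interval continuous_intros)
         (auto simp: poly_pcompose norm_mult intro!: b)
    also have "\<dots> = 2 * pi * m" by simp
    finally have "cmod (coeff (pcompose p [:0, of_real R:]) k) \<le> m" by simp
    then have "cmod (coeff p k) * R ^ k \<le> m" using R
      by (simp add: coeff_pcompose_linear norm_mult norm_power mult.commute)
    then show ?thesis using R by (subst pos_le_divide_eq) auto
  qed
  define A where "A k = (\<Sum>j\<le>r. (-1) ^ j * of_nat (r choose j) * (of_nat j / of_nat r :: complex) ^ k)" for k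
  have A0: "A k = 0" if "k < r" for k
  proof -
    have "A k = (\<Sum>j\<le>r. (-1) ^ j * of_nat (r choose j) * (of_nat j + 0) ^ k) / of_nat r ^ k"
      by (simp add: A_def power_divide sum_divide_distrib)
    then show ?thesis using alternating_sum_power_eq_0[OF that, of "0::complex"] by simp
  qed
  have A1: "cmod (A k) \<le> 2 ^ r" for k
  proof -
    have "cmod (A k) \<le> (\<Sum>j\<le>r. real (r choose j) * 1)" unfolding A_def
    proof (intro sum_norm_le)
      fix j assume "j \<in> {..r}"
      then have "cmod (of_nat j / of_nat r) \<le> 1" by (auto simp: norm_divide divide_le_eq_1)
      then have "cmod (of_nat j / of_nat r) ^ k \<le> 1" by (intro power_le_one) auto
      then show "cmod ((-1) ^ j * of_nat (r choose j) * (of_nat j / of_nat r) ^ k) \<le> real (r choose j) * 1"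
        unfolding norm_mult norm_power by (intro mult_mono) auto
    qed
    also have "\<dots> = real (\<Sum>j\<le>r. r choose j)" by simp
    also have "\<dots> = 2 ^ r" by (simp only: choose_row_sum) simp
    finally show ?thesis .
  qed
  have "(\<Sum>j\<le>r. (-1) ^ j * of_nat (r choose j) * poly p (of_nat j / of_nat r)) = (\<Sum>k\<le>degree p. coeff p k * A k)"
    unfolding poly_altdef A_def sum_distrib_left by (subst sum.swap) (simp add: mult_ac)
  also have "cmod \<dots> \<le> (\<Sum>k\<le>degree p. 2 ^ r * (m * (2 * 2 ^ r / R ^ r)) * (1 / 2) ^ Suc k)"
  proof (intro sum_norm_le)
    fix k
    show "cmod (coeff p k * A k) \<le> 2 ^ r * (m * (2 * 2 ^ r / R ^ r)) * (1 / 2) ^ Suc k"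
    proof (cases "k < r")
      case True then show ?thesis using A0 m0 R by simp
    next
      case False
      have e: "R ^ k = R ^ r * R ^ (k - r)" "(2::real) ^ k = 2 ^ r * 2 ^ (k - r)"
        using False by (simp_all flip: power_add)
      have "2 ^ (k - r) \<le> R ^ (k - r)" using R by (intro power_mono) auto
      then have "1 / R ^ (k - r) \<le> 1 / 2 ^ (k - r)" by (intro divide_left_mono) (use R in auto)
      then have "m / R ^ r * (1 / R ^ (k - r)) \<le> m / R ^ r * (1 / 2 ^ (k - r))" using m0 R
        by (intro mult_left_mono) auto
      then have "m / R ^ k \<le> m / R ^ r * (1 / 2 ^ (k - r))" by (simp add: e)
      then have "cmod (coeff p k) \<le> m / R ^ r * (1 / 2 ^ (k - r))" using cb[of k] by linarith
      then have "cmod (coeff p k) * cmod (A k) \<le> m / R ^ r * (1 / 2 ^ (k - r)) * 2 ^ r"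
        using A1[of k] R m0 by (intro mult_mono) auto
      also have "\<dots> = 2 ^ r * (m * (2 * 2 ^ r / R ^ r)) * (1 / 2) ^ Suc k"
        by (simp add: power_divide e)
      finally show ?thesis by (simp only: norm_mult)
    qed
  qed
  also have "\<dots> = 2 ^ r * (m * (2 * 2 ^ r / R ^ r)) * (\<Sum>k\<le>degree p. (1 / 2) ^ Suc k)"
    by (simp only: sum_distrib_left)
  also have "\<dots> \<le> 2 ^ r * (m * (2 * 2 ^ r / R ^ r)) * 1"
  proof (intro mult_left_mono)
    have "(\<Sum>k\<le>n. (1 / 2 :: real) ^ Suc k) = 1 - (1 / 2) ^ Suc n" for n by (induction n) auto
    then show "(\<Sum>k\<le>degree p. (1 / 2 :: real) ^ Suc k) \<le> 1" by simp
  qed (use m0 R in auto)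
  finally show ?thesis by simp
qed

text \<open>
  The substitutions \<open>s = \<kappa> sin \<sigma>\<close> for the tangential coordinate and \<open>w = \<kappa>\<^sup>2 (1 - cos \<theta>) / 2\<close> for the depth turn
  polynomials into trigonometric ones. The depth \<open>w\<close> vanishes to second order at \<open>\<theta> = 0\<close>, which is why the square
  root of the distance to the boundary is the right scale.
\<close>

definition bern_avg :: "nat \<Rightarrow> real \<Rightarrow> real \<Rightarrow> (real \<Rightarrow> real \<Rightarrow> ennreal) \<Rightarrow> ennreal" where
  "bern_avg N \<kappa> \<alpha> H = (\<integral>\<^sup>+\<sigma>. ennreal (tker (2 * N) \<sigma>) * indicator {-pi..pi} \<sigma> *
     (\<integral>\<^sup>+\<theta>. ennreal (nker N \<alpha> \<theta>) * indicator {-pi..pi} \<theta> * H (\<kappa> * sin \<sigma>) (\<kappa>\<^sup>2 *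
       (1 - cos \<theta>) / 2) \<partial>lborel) \<partial>lborel)"

lemma half_angle_arccos:
  assumes "\<kappa> > 0" "0 \<le> w" "w \<le> \<kappa>\<^sup>2 / 2"
  defines "\<alpha> \<equiv> arccos (1 - 2 * w / \<kappa>\<^sup>2)"
  shows "0 \<le> \<alpha>" "\<alpha> \<le> pi / 2" "sin (\<alpha> / 2) = sqrt w / \<kappa>" "\<kappa>\<^sup>2 * (1 - cos \<alpha>) / 2 = w"
proof -
  have a: "0 \<le> 1 - 2 * w / \<kappa>\<^sup>2" "1 - 2 * w / \<kappa>\<^sup>2 \<le> 1" using assms by (auto simp: field_simps)
  show 0: "0 \<le> \<alpha>" unfolding \<alpha>_def by (rule arccos_lbound) (use a in auto)
  show 1: "\<alpha> \<le> pi / 2" unfolding \<alpha>_def by (rule arccos_le_pi2) (use a in auto)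
  have c: "cos \<alpha> = 1 - 2 * w / \<kappa>\<^sup>2" unfolding \<alpha>_def by (rule cos_arccos) (use a in auto)
  show "\<kappa>\<^sup>2 * (1 - cos \<alpha>) / 2 = w" using assms(1) by (simp add: c)
  have s0: "0 \<le> sin (\<alpha> / 2)" using 0 1 by (intro sin_ge_zero) auto
  have "cos \<alpha> = 1 - 2 * (sin (\<alpha> / 2))\<^sup>2" using cos_double_sin[of "\<alpha> / 2"] by simp
  then have "(sin (\<alpha> / 2))\<^sup>2 = w / \<kappa>\<^sup>2" using c by simp
  then have "sin (\<alpha> / 2) = sqrt (w / \<kappa>\<^sup>2)" using s0 real_sqrt_unique by metis
  then show "sin (\<alpha> / 2) = sqrt w / \<kappa>" using assms(1) by (simp add: real_sqrt_divide)
qed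

lemma circ_ennreal:
  "circ (\<lambda>\<theta>. k \<theta> * f \<theta>) = (\<integral>\<^sup>+\<theta>. ennreal (k \<theta>) * indicator {-pi..pi} \<theta> * ennreal (f \<theta>) \<partial>lborel)"
  if "\<And>\<theta>. 0 \<le> k \<theta>"
  unfolding circ_def ennreal_mult'[OF that] by (intro nn_integral_cong) (simp add: mult_ac)

text \<open>In the coordinates (s, w) of Y0 + s Y1 + (w + \<mu> s^2) Y3 the line through the point
  becomes the parabola s = z t, w = w0 + z \<beta> - \<mu> (z t)^2. For complex z of modulus up to c
  / (N t) it stays within the tolerances of \<open>tangential_bound\<close> and
  \<open>normal_bound\<close>; the conditions on c say just this. The two bounds are applied in
  turn: first in s, with w frozen at its complex value, then in w, for each real s produced by the
  first.\<close>

lemma bernstein_point: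
  fixes P :: "'a::euclidean_space \<Rightarrow> real" and Y0 Y1 Y3 :: 'a
  assumes P: "P \<in> Polys N" and N: "N \<ge> 1" and r: "r \<ge> 1" and \<kappa>: "\<kappa> > 0"
    and C0: "0 \<le> C0" and \<mu>: "0 \<le> \<mu>" "\<mu> \<le> M"
    and c: "0 < c" "c \<le> 1" "c \<le> \<kappa> / 16" "c * (C0 + M) \<le> \<kappa>\<^sup>2 / 10000" "c * (C0 + M) \<le> \<kappa> / 10000"
    and t: "0 < t" "t \<le> c / (2 * real N)"
    and w0: "0 \<le> w0" "w0 \<le> \<kappa>\<^sup>2 / 2" and \<beta>: "\<bar>\<beta>\<bar> \<le> C0 * t * (t + sqrt w0)"
  shows "ennreal \<bar>fdiff r ((1 / real r) *\<^sub>R (t *\<^sub>R Y1 + \<beta> *\<^sub>R Y3)) P (Y0 + w0 *\<^sub>R Y3)\<bar> \<le>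
    ennreal (2 * 4 ^ r / c ^ r * (real N * t) ^ r) *
      bern_avg N \<kappa> (arccos (1 - 2 * w0 / \<kappa>\<^sup>2)) (\<lambda>s w. ennreal \<bar>P (Y0 + s *\<^sub>R Y1 + (w + \<mu> * s\<^sup>2) *\<^sub>R Y3)\<bar>)"
    (is "_ \<le> ennreal ?K * ?M")
proof -
  obtain F :: "('a \<Rightarrow> complex) \<Rightarrow> complex" where F:
    "\<And>x. F (\<lambda>b. of_real (x \<bullet> b)) = of_real (P x)"
    "\<And>q k. (\<And>b. degree (q b) \<le> k) \<Longrightarrow> \<exists>p. degree p \<le> k * N \<and> (\<forall>z. poly p z = F (\<lambda>b. poly (q b) z))"
    using Polys_complexify[OF P] by blast
  define \<alpha> where "\<alpha> = arccos (1 - 2 * w0 / \<kappa>\<^sup>2)"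
  note \<alpha> = half_angle_arccos[OF \<kappa> w0, folded \<alpha>_def]
  define X where "X s w = (\<lambda>b. of_real (Y0 \<bullet> b) + s * of_real (Y1 \<bullet> b) + (w +
    of_real \<mu> * s\<^sup>2) * of_real (Y3 \<bullet> b))" for s w :: complex
  have Xreal: "F (X (of_real s) (of_real w)) = of_real (P (Y0 + s *\<^sub>R Y1 + (w + \<mu> * s\<^sup>2) *\<^sub>R Y3))" for s w
    unfolding F(1)[symmetric] X_def by (intro arg_cong[where f = F] ext) (simp add: inner_add_left)
  obtain p where p: "\<And>z. poly p z = F (X (z * of_real t) (of_real w0 + z * of_real \<beta> - of_real \<mu> *
    (z * of_real t)\<^sup>2))"
  proof -
    have "\<exists>p. degree p \<le> 1 * N \<and> (\<forall>z. poly p z =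
      F (\<lambda>b. poly [:of_real ((Y0 + w0 *\<^sub>R Y3) \<bullet> b), of_real ((t *\<^sub>R Y1 + \<beta> *\<^sub>R Y3) \<bullet> b):] z))"
      by (rule F(2)) simp
    moreover have "(\<lambda>b. poly [:of_real ((Y0 + w0 *\<^sub>R Y3) \<bullet> b), of_real ((t *\<^sub>R Y1 + \<beta> *\<^sub>R Y3) \<bullet> b):] z)
      = X (z * of_real t) (of_real w0 + z * of_real \<beta> - of_real \<mu> * (z * of_real t)\<^sup>2)" for z :: complex
      by (intro ext) (simp add: X_def inner_add_left algebra_simps)
    ultimately show thesis using that by auto
  qed
  have preal: "poly p (of_real z) = of_real (P ((Y0 + w0 *\<^sub>R Y3) + z *\<^sub>R (t *\<^sub>R Y1 + \<beta> *\<^sub>R Y3)))" for z :: real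
  proof -
    have "poly p (of_real z) = F (X (of_real (z * t)) (of_real (w0 + z * \<beta> - \<mu> * (z * t)\<^sup>2)))"
      unfolding p by simp
    also have "\<dots> = of_real (P ((Y0 + w0 *\<^sub>R Y3) + z *\<^sub>R (t *\<^sub>R Y1 + \<beta> *\<^sub>R Y3)))"
      unfolding Xreal by (simp add: algebra_simps)
    finally show ?thesis .
  qed
  \<comment> \<open>For this modulus of z the tangential variable z t has modulus c / N. The
    restriction on t makes R at least 2, as the geometric series in
    \<open>difference_of_bounded_poly\<close> requires.\<close>
  define R where "R = c / (real N * t)"
  have R2: "R \<ge> 2" unfolding R_def using t N by (simp add: field_simps)
  have Rt: "R * t = c / real N" using t N by (simp add: R_def)
  have tN: "t \<le> 1 / real N"
  proof -
    have "c / (2 * real N) \<le> 1 / real N" using c(1,2) N by (simp add: field_simps)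
    then show ?thesis using t(2) by linarith
  qed
  have bnd: "ennreal (cmod (poly p z)) \<le> ?M" if z: "cmod z \<le> R" for z
  proof -
    define \<sigma> where "\<sigma> = z * of_real t"
    define w where "w = of_real w0 + z * of_real \<beta> - of_real \<mu> * \<sigma>\<^sup>2"
    have zt: "cmod \<sigma> \<le> c / real N"
      unfolding \<sigma>_def norm_mult Rt[symmetric] using z t by (simp add: mult_right_mono)
    have \<sigma>: "cmod \<sigma> \<le> \<kappa> / (8 * real (2 * N))"
    proof -
      have "c / real N \<le> (\<kappa> / 16) / real N" using c by (intro divide_right_mono) auto
      then show ?thesis using zt by simp
    qed
    have w: "cmod (w / of_real (\<kappa>\<^sup>2) - of_real (sin (\<alpha> / 2)) ^ 2) \<le>
      (1 / real N + sin (\<alpha> / 2)) / (10000 * real N)"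
    proof -
      have "cmod (w - of_real w0) \<le> cmod (z * of_real \<beta>) + cmod (of_real \<mu> * \<sigma>\<^sup>2)"
        unfolding w_def using norm_triangle_ineq4[of "z * of_real \<beta>" "of_real \<mu> * \<sigma>\<^sup>2"] by simp
      also have "\<dots> = cmod z * \<bar>\<beta>\<bar> + \<mu> * (cmod \<sigma>)\<^sup>2" using \<mu> by (simp add: norm_mult norm_power)
      also have "\<dots> \<le> R * (C0 * t * (t + sqrt w0)) + M * (c / real N)\<^sup>2"
        using z \<beta> \<mu> zt R2 C0 t w0 by (intro add_mono mult_mono power_mono) auto
      also have "R * (C0 * t * (t + sqrt w0)) = (c / real N) * (C0 * (t + sqrt w0))"
        unfolding Rt[symmetric] by simp
      also have "\<dots> \<le> (c / real N) * (C0 * (1 / real N + sqrt w0))"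
        using tN C0 c by (intro mult_left_mono) auto
      also have "M * (c / real N)\<^sup>2 \<le> (c / real N) * (M * (1 / real N + sqrt w0))"
      proof -
        have "M * (c / real N)\<^sup>2 = (c / real N) * (M * (c / real N))" by (simp add: power2_eq_square)
        also have "\<dots> \<le> (c / real N) * (M * (1 / real N + sqrt w0))"
        proof (intro mult_left_mono)
          have "c / real N \<le> 1 / real N" using c by (intro divide_right_mono) auto
          moreover have "0 \<le> sqrt w0" using w0 by simp
          ultimately show "c / real N \<le> 1 / real N + sqrt w0" by linarith
        qed (use \<mu> c in auto)
        finally show ?thesis .
      qed
      also have "(c / real N) * (C0 * (1 / real N + sqrt w0)) + (c / real N) * (M * (1 / real N + sqrt w0))
          = (c * (C0 + M)) * (1 / real N) * (1 / real N) + (c * (C0 + M)) * (1 / real N) * sqrt w0"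
        by (simp add: algebra_simps)
      also have "\<dots> \<le> (\<kappa>\<^sup>2 / 10000) * (1 / real N) * (1 / real N) + (\<kappa> / 10000) * (1 / real N) * sqrt w0"
        using c w0 by (intro add_mono mult_right_mono) auto
      also have "\<dots> = \<kappa>\<^sup>2 * ((1 / real N + sin (\<alpha> / 2)) / (10000 * real N))"
        unfolding \<alpha>(3) using \<kappa> N by (simp add: field_simps power2_eq_square)
      finally have A: "cmod (w - of_real w0) \<le> \<kappa>\<^sup>2 * ((1 / real N + sin (\<alpha> / 2)) / (10000 * real N))" by simp
      have "w / of_real (\<kappa>\<^sup>2) - of_real (sin (\<alpha> / 2)) ^ 2 = (w - of_real w0) / of_real (\<kappa>\<^sup>2)"
      proof -
        have "of_real (sin (\<alpha> / 2)) ^ 2 = (of_real (w0 / \<kappa>\<^sup>2) :: complex)"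
          unfolding \<alpha>(3) of_real_power[symmetric] using w0 by (simp add: power_divide)
        then show ?thesis by (simp add: diff_divide_distrib)
      qed
      also have "cmod \<dots> = cmod (w - of_real w0) / \<kappa>\<^sup>2" by (simp add: norm_divide norm_power)
      also have "\<dots> \<le> (1 / real N + sin (\<alpha> / 2)) / (10000 * real N)"
        using A \<kappa> by (subst pos_divide_le_eq) (auto simp: mult.commute)
      finally show ?thesis .
    qed
    \<comment> \<open>The quadratic term \<mu> s^2 makes the degree in s equal to 2 N; hence the
      index 2 N of \<open>tker\<close> in \<open>bern_avg\<close>.\<close>
    obtain A where A: "degree A \<le> 2 * N" "\<And>s. poly A s = F (X s w)"
    proof -
      have "\<exists>p. degree p \<le> 2 * N \<and> (\<forall>z. poly p z =
        F (\<lambda>b. poly [:of_real (Y0 \<bullet> b) + w * of_real (Y3 \<bullet> b), of_real (Y1 \<bullet> b), of_real \<mu> *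
        of_real (Y3 \<bullet> b):] z))"
        by (rule F(2)) simp
      moreover have "(\<lambda>b. poly [:of_real (Y0 \<bullet> b) +
        w * of_real (Y3 \<bullet> b), of_real (Y1 \<bullet> b), of_real \<mu> * of_real (Y3 \<bullet> b):] z)
        = X z w" for z :: complex
        by (intro ext) (simp add: X_def power2_eq_square algebra_simps)
      ultimately show thesis using that by auto
    qed
    have "ennreal (cmod (poly p z)) = ennreal (cmod (poly A \<sigma>))"
      unfolding p A \<sigma>_def w_def by simp
    also have "\<dots> \<le> circ (\<lambda>\<theta>. tker (2 * N) \<theta> * cmod (poly A (of_real (\<kappa> * sin \<theta>))))"
      using N by (intro tangential_bound A \<kappa> \<sigma>) auto
    also have "\<dots> = (\<integral>\<^sup>+\<theta>. ennreal (tker (2 * N) \<theta>) * indicator {-pi..pi} \<theta> *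
      ennreal (cmod (poly A (of_real (\<kappa> * sin \<theta>)))) \<partial>lborel)"
      by (rule circ_ennreal[OF tker_nonneg])
    also have "\<dots> \<le> ?M" unfolding bern_avg_def \<alpha>_def[symmetric]
    proof (intro nn_integral_mono mult_left_mono)
      fix \<theta>
      define s where "s = \<kappa> * sin \<theta>"
      obtain B where B: "degree B \<le> 1 * N" "\<And>w. poly B w = F (X (of_real s) w)"
      proof -
        have "\<exists>p. degree p \<le> 1 * N \<and> (\<forall>z. poly p z =
          F (\<lambda>b. poly [:of_real (Y0 \<bullet> b) + of_real s * of_real (Y1 \<bullet> b) + of_real \<mu> *
          (of_real s)\<^sup>2 * of_real (Y3 \<bullet> b), of_real (Y3 \<bullet> b):] z))"
          by (rule F(2)) simp
        moreover have "(\<lambda>b. poly [:of_real (Y0 \<bullet> b) + of_real s * of_real (Y1 \<bullet> b) + of_real \<mu> *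
          (of_real s)\<^sup>2 * of_real (Y3 \<bullet> b), of_real (Y3 \<bullet> b):] z)
          = X (of_real s) z" for z :: complex
          by (intro ext) (simp add: X_def power2_eq_square algebra_simps)
        ultimately show thesis using that by auto
      qed
      have "poly A (of_real s) = poly B (of_real (\<kappa>\<^sup>2) * (w / of_real (\<kappa>\<^sup>2)))"
        unfolding A B using \<kappa> by simp
      then have "ennreal (cmod (poly A (of_real s))) =
        ennreal (cmod (poly B (of_real (\<kappa>\<^sup>2) * (w / of_real (\<kappa>\<^sup>2)))))" by simp
      also have "\<dots> \<le> circ (\<lambda>\<theta>. nker N \<alpha> \<theta> * cmod (poly B (of_real (\<kappa>\<^sup>2 * (1 - cos \<theta>) / 2))))"
        by (rule normal_bound[OF _ N \<alpha>(1,2) w]) (use B in simp)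
      also have "\<dots> = (\<integral>\<^sup>+\<theta>. ennreal (nker N \<alpha> \<theta>) * indicator {-pi..pi} \<theta> *
        ennreal (cmod (poly B (of_real (\<kappa>\<^sup>2 * (1 - cos \<theta>) / 2)))) \<partial>lborel)"
        by (rule circ_ennreal[OF nker_nonneg])
      also have "\<dots> = (\<integral>\<^sup>+\<theta>. ennreal (nker N \<alpha> \<theta>) * indicator {-pi..pi} \<theta> *
          ennreal \<bar>P (Y0 + s *\<^sub>R Y1 + (\<kappa>\<^sup>2 * (1 - cos \<theta>) / 2 + \<mu> * s\<^sup>2) *\<^sub>R Y3)\<bar> \<partial>lborel)"
        unfolding B Xreal by simp
      finally show "ennreal (cmod (poly A (of_real s))) \<le> (\<integral>\<^sup>+\<theta>. ennreal (nker N \<alpha> \<theta>) * indicator {-pi..pi} \<theta> *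
          ennreal \<bar>P (Y0 + s *\<^sub>R Y1 + (\<kappa>\<^sup>2 * (1 - cos \<theta>) / 2 + \<mu> * s\<^sup>2) *\<^sub>R Y3)\<bar> \<partial>lborel)" .
    qed simp
    finally show ?thesis .
  qed
  have K0: "0 < ?K" using c t N by (intro mult_pos_pos divide_pos_pos) auto
  show ?thesis
  proof (cases "?M = \<infinity>")
    case True
    define K where "K = ?K"
    have "ennreal K * ?M = \<infinity>" using True K0 unfolding K_def[symmetric] by (simp add: ennreal_mult_eq_top_iff)
    then show ?thesis unfolding K_def by simp
  next
    case False
    then obtain m where m: "0 \<le> m" "?M = ennreal m" by (cases ?M) auto
    have "cmod (poly p z) \<le> m" if "cmod z \<le> R" for z
      using bnd[OF that] m by (simp add: ennreal_le_iff)
    from difference_of_bounded_poly[OF R2 r this]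
    have D: "cmod (\<Sum>j\<le>r. (-1) ^ j * of_nat (r choose j) * poly p (of_nat j / of_nat r)) \<le>
      2 ^ r * (m * (2 * 2 ^ r / R ^ r))" .
    have "poly p (of_nat j / of_nat r) = of_real (P ((Y0 + w0 *\<^sub>R Y3) +
      real j *\<^sub>R ((1 / real r) *\<^sub>R (t *\<^sub>R Y1 + \<beta> *\<^sub>R Y3))))" for j
      using preal[of "real j / real r"] by simp
    then have "(\<Sum>j\<le>r. (-1) ^ j * of_nat (r choose j) * poly p (of_nat j / of_nat r)) =
        of_real ((-1) ^ r * fdiff r ((1 / real r) *\<^sub>R (t *\<^sub>R Y1 + \<beta> *\<^sub>R Y3)) P (Y0 + w0 *\<^sub>R Y3))"
      unfolding fdiff_def sum_distrib_left of_real_sum atLeast0AtMost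
      by (intro sum.cong) (auto simp: power_add mult.assoc[symmetric] simp flip: power_mult_distrib)
    then have "cmod (\<Sum>j\<le>r. (-1) ^ j * of_nat (r choose j) * poly p (of_nat j / of_nat r)) =
       \<bar>fdiff r ((1 / real r) *\<^sub>R (t *\<^sub>R Y1 + \<beta> *\<^sub>R Y3)) P (Y0 + w0 *\<^sub>R Y3)\<bar>"
      by (simp only: norm_of_real abs_mult power_abs) simp
    then have "\<bar>fdiff r ((1 / real r) *\<^sub>R (t *\<^sub>R Y1 + \<beta> *\<^sub>R Y3)) P (Y0 + w0 *\<^sub>R Y3)\<bar> \<le>
      2 ^ r * (m * (2 * 2 ^ r / R ^ r))"
      using D by simp
    also have "\<dots> = ?K * m"
    proof -
      have "(4::real) ^ r = 2 ^ r * 2 ^ r" by (simp flip: power_mult_distrib)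
      moreover have "1 / R ^ r = (real N * t) ^ r / c ^ r" by (simp add: R_def power_divide)
      ultimately show ?thesis by (simp add: R_def power_divide mult_ac)
    qed
    finally show ?thesis using K0 m by (simp add: ennreal_mult[symmetric] ennreal_leI del: ennreal_mult)
  qed
qed

section \<open>Averages over the moduli balls in adapted coordinates\<close>

lemma nn_integral_lborel_translate:
  fixes f :: "'a::euclidean_space \<Rightarrow> ennreal"
  assumes [measurable]: "f \<in> borel_measurable borel"
  shows "(\<integral>\<^sup>+x. f (c + x) \<partial>lborel) = (\<integral>\<^sup>+x. f x \<partial>lborel)"
proof -
  have "(\<integral>\<^sup>+x. f x \<partial>lborel) = (\<integral>\<^sup>+x. f x \<partial>distr lborel borel ((+) c))"
    by (subst lborel_distr_plus) simp
  also have "\<dots> = (\<integral>\<^sup>+x. f (c + x) \<partial>lborel)" by (subst nn_integral_distr) auto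
  finally show ?thesis by simp
qed

lemma nn_integral_lborel_reflect:
  fixes f :: "'a::euclidean_space \<Rightarrow> ennreal"
  assumes [measurable]: "f \<in> borel_measurable borel"
  shows "(\<integral>\<^sup>+x. f (c - x) \<partial>lborel) = (\<integral>\<^sup>+x. f x \<partial>lborel)"
proof -
  have "lborel = density (distr lborel borel (\<lambda>x. c + (-1) *\<^sub>R x :: 'a)) (\<lambda>_. ennreal (\<bar>-1\<bar> ^ DIM('a)))"
    by (rule lborel_affine) simp
  then have "lborel = distr lborel borel (\<lambda>x. c + (-1) *\<^sub>R x :: 'a)" by (simp add: density_1)
  then have "(\<integral>\<^sup>+x. f x \<partial>lborel) = (\<integral>\<^sup>+x. f x \<partial>distr lborel borel (\<lambda>x. c + (-1) *\<^sub>R x :: 'a))" by simp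
  also have "\<dots> = (\<integral>\<^sup>+x. f (c + (-1) *\<^sub>R x) \<partial>lborel)" by (subst nn_integral_distr) auto
  finally show ?thesis by simp
qed

lemma orthogonal_transformation_borel:
  fixes B :: "'a::euclidean_space \<Rightarrow> 'a"
  assumes "orthogonal_transformation B" shows "continuous_on UNIV B" "B \<in> borel_measurable borel"
proof -
  show "continuous_on UNIV B"
    by (intro linear_continuous_on linear_conv_bounded_linear[THEN iffD1] orthogonal_transformation_linear assms)
  then show "B \<in> borel_measurable borel" by (rule borel_measurable_continuous_onI)
qed

text \<open>A translation-invariant measure is determined up to a factor by Tonelli; the unit ball fixes the factor.\<close>

lemma emeasure_lborel_orthogonal_vimage:
  fixes B :: "'a::euclidean_space \<Rightarrow> 'a"
  assumes B: "orthogonal_transformation B" and A[measurable]: "A \<in> sets borel"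
  shows "emeasure lborel (B -` A) = emeasure lborel A"
proof -
  note [measurable] = orthogonal_transformation_borel(2)[OF B]
  have lin: "linear B" using B by (rule orthogonal_transformation_linear)
  define E :: "'a set" where "E = ball 0 1"
  have [measurable]: "E \<in> sets borel" by (simp add: E_def)
  define iA iE :: "'a \<Rightarrow> ennreal" where "iA = indicator A" and "iE = indicator E"
  have [measurable]: "iA \<in> borel_measurable borel" "iE \<in> borel_measurable borel"
    by (auto simp: iA_def iE_def)
  have A1: "(\<integral>\<^sup>+x. iA (B x) \<partial>lborel) = emeasure lborel (B -` A)"
  proof -
    have "B -` A \<in> sets borel" using measurable_sets[OF orthogonal_transformation_borel(2)[OF B] A] by simp
    then have "emeasure lborel (B -` A) = (\<integral>\<^sup>+x. indicator (B -` A) x \<partial>lborel)" by simp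
    then show ?thesis by (simp add: iA_def indicator_vimage[symmetric] o_def)
  qed
  have E1: "(\<integral>\<^sup>+x. iE (B x) \<partial>lborel) = emeasure lborel E"
  proof -
    have "iE (B x) = indicator E x" for x
      using B by (simp add: iE_def E_def indicator_def orthogonal_transformation_norm)
    then show ?thesis by simp
  qed
  have "emeasure lborel E * (\<integral>\<^sup>+x. iA (B x) \<partial>lborel) = (\<integral>\<^sup>+x. emeasure lborel E * iA (B x) \<partial>lborel)"
    by (rule nn_integral_cmult[symmetric]) measurable
  also have "\<dots> = (\<integral>\<^sup>+x. (\<integral>\<^sup>+y. iA (B x) * iE (B x + y) \<partial>lborel) \<partial>lborel)"
  proof (rule nn_integral_cong)
    fix x
    have "(\<integral>\<^sup>+y. iA (B x) * iE (B x + y) \<partial>lborel) = iA (B x) * (\<integral>\<^sup>+y. iE (B x + y) \<partial>lborel)"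
      by (rule nn_integral_cmult) measurable
    also have "(\<integral>\<^sup>+y. iE (B x + y) \<partial>lborel) = emeasure lborel E"
      by (subst nn_integral_lborel_translate) (auto simp: iE_def)
    finally show "emeasure lborel E * iA (B x) = (\<integral>\<^sup>+y. iA (B x) * iE (B x + y) \<partial>lborel)"
      by (simp add: mult.commute)
  qed
  also have "\<dots> = (\<integral>\<^sup>+y. (\<integral>\<^sup>+x. iA (B x) * iE (B x + y) \<partial>lborel) \<partial>lborel)"
    by (rule lborel_pair.Fubini'[symmetric]) measurable
  also have "\<dots> = (\<integral>\<^sup>+y. (\<integral>\<^sup>+x. iA (B x - y) * iE (B x) \<partial>lborel) \<partial>lborel)"
  proof (rule nn_integral_cong)
    fix y
    obtain v where v: "y = B v" using orthogonal_transformation_surj[OF B] by (metis surjD)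
    have "(\<integral>\<^sup>+x. iA (B x - y) * iE (B x) \<partial>lborel) = (\<integral>\<^sup>+x. iA (B (v + x) - y) * iE (B (v + x)) \<partial>lborel)"
      by (rule nn_integral_lborel_translate[symmetric]) measurable
    then show "(\<integral>\<^sup>+x. iA (B x) * iE (B x + y) \<partial>lborel) = (\<integral>\<^sup>+x. iA (B x - y) * iE (B x) \<partial>lborel)"
      by (simp add: v linear_add[OF lin] add.commute)
  qed
  also have "\<dots> = (\<integral>\<^sup>+x. (\<integral>\<^sup>+y. iA (B x - y) * iE (B x) \<partial>lborel) \<partial>lborel)"
    by (rule lborel_pair.Fubini') measurable
  also have "\<dots> = (\<integral>\<^sup>+x. emeasure lborel A * iE (B x) \<partial>lborel)"
  proof (rule nn_integral_cong)
    fix x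
    have "(\<integral>\<^sup>+y. iA (B x - y) * iE (B x) \<partial>lborel) = (\<integral>\<^sup>+y. iA (B x - y) \<partial>lborel) * iE (B x)"
      by (rule nn_integral_multc) measurable
    also have "(\<integral>\<^sup>+y. iA (B x - y) \<partial>lborel) = emeasure lborel A"
      by (subst nn_integral_lborel_reflect) (auto simp: iA_def)
    finally show "(\<integral>\<^sup>+y. iA (B x - y) * iE (B x) \<partial>lborel) = emeasure lborel A * iE (B x)" .
  qed
  also have "\<dots> = emeasure lborel A * (\<integral>\<^sup>+x. iE (B x) \<partial>lborel)"
    by (rule nn_integral_cmult) measurable
  finally have "emeasure lborel E * emeasure lborel (B -` A) = emeasure lborel E * emeasure lborel A"
    unfolding A1 E1 by (simp add: mult.commute)
  moreover have "emeasure lborel E = ennreal (unit_ball_vol (DIM('a)))"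
    by (simp add: E_def emeasure_ball)
  moreover have "0 < unit_ball_vol (real DIM('a))" by (rule unit_ball_vol_pos) simp
  ultimately show ?thesis by (simp add: ennreal_mult_cancel_left)
qed

lemma nn_integral_lborel_isometry:
  fixes B :: "'a::euclidean_space \<Rightarrow> 'a" and h :: "'a \<Rightarrow> ennreal"
  assumes B: "orthogonal_transformation B" and [measurable]: "h \<in> borel_measurable borel"
  shows "(\<integral>\<^sup>+x. h (a + B x) \<partial>lborel) = (\<integral>\<^sup>+x. h x \<partial>lborel)"
proof -
  note [measurable] = orthogonal_transformation_borel(2)[OF B]
  have "distr lborel borel B = lborel"
  proof (rule measure_eqI)
    fix A assume "A \<in> sets (distr lborel borel B)"
    then have A: "A \<in> sets borel" by simp
    then show "emeasure (distr lborel borel B) A = emeasure lborel A"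
      by (subst emeasure_distr) (auto simp: emeasure_lborel_orthogonal_vimage[OF B A])
  qed simp
  then have "(\<integral>\<^sup>+x. h (a + x) \<partial>lborel) = (\<integral>\<^sup>+x. h (a + x) \<partial>distr lborel borel B)" by simp
  also have "\<dots> = (\<integral>\<^sup>+x. h (a + B x) \<partial>lborel)" by (subst nn_integral_distr) auto
  finally show ?thesis by (simp add: nn_integral_lborel_translate)
qed

lemma ennreal_divide_le:
  assumes "0 < v" "ennreal v \<le> E" shows "I / E \<le> ennreal (1 / v) * I"
proof (cases E)
  case (real e)
  then have e: "v \<le> e" "0 < e" using assms by auto
  have "I / E = I * inverse (ennreal e)" using real by (simp add: divide_ennreal_def)
  also have "\<dots> = ennreal (1 / e) * I" using e by (simp add: inverse_ennreal inverse_eq_divide mult.commute)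
  also have "\<dots> \<le> ennreal (1 / v) * I" using e assms by (intro mult_right_mono ennreal_leI divide_left_mono) auto
  finally show ?thesis .
qed (simp add: divide_ennreal_def)

text \<open>Testing against all positive real bounds of Y allows powers of the bound to be formed,
  and keeps away from 0, where a negative power has no useful value.\<close>

lemma ennreal_le_by_reals:
  assumes D: "0 < D" and le: "\<And>y. 0 < y \<Longrightarrow> Y \<le> ennreal y \<Longrightarrow> A \<le> D * y"
  shows "ennreal A \<le> ennreal D * Y"
proof (cases Y)
  case (real y)
  have "A \<le> D * y + e" if "0 < e" for e
  proof -
    have "A \<le> D * (y + e / D)" using real that D by (intro le) (auto intro!: ennreal_leI add_nonneg_pos)
    then show ?thesis using D by (simp add: distrib_left)
  qed
  then have "A \<le> D * y" by (rule field_le_epsilon)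
  then show ?thesis using real D by (simp add: ennreal_mult[symmetric] ennreal_leI)
qed (use D in \<open>simp add: ennreal_mult_eq_top_iff\<close>)

lemma nn_integral_lborel_pair:
  fixes F :: "'a::euclidean_space \<times> 'b::euclidean_space \<Rightarrow> ennreal"
  assumes "F \<in> borel_measurable (borel \<Otimes>\<^sub>M borel)"
  shows "(\<integral>\<^sup>+z. F z \<partial>lborel) = (\<integral>\<^sup>+x. \<integral>\<^sup>+y. F (x, y) \<partial>lborel \<partial>lborel)"
  unfolding lborel_prod[symmetric]
  by (rule lborel.nn_integral_fst[symmetric]) (use assms in \<open>simp add: measurable_def sets_pair_measure space_pair_measure\<close>)

section \<open>Averages over moduli balls, written in the coordinates of a patch\<close>

definition avg_int :: "'a::euclidean_space set \<Rightarrow> 'a set \<Rightarrow> real \<Rightarrow> ('a \<Rightarrow> 'a \<Rightarrow> ennreal) \<Rightarrow> ennreal" where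
  "avg_int \<Omega> S t X = (\<integral>\<^sup>+\<xi>. indicator S \<xi> * ((\<integral>\<^sup>+\<eta>. X \<xi> \<eta> *
    indicator (rho_ball \<Omega> \<xi> t) \<eta> \<partial>lborel) / emeasure lborel (rho_ball \<Omega> \<xi> t)) \<partial>lborel)"

text \<open>
  A patch \<open>S\<close> carries coordinates \<open>a + B (x, y)\<close> in which \<open>f x - y\<close> plays the role of the distance to the
  boundary. By \<open>inside\<close>, a parabolic cap below the graph belongs to \<open>\<Omega>\<close>; by \<open>ball_sub\<close> and \<open>ball_vol\<close>, the moduli
  balls are comparable to sheared boxes of width \<open>t\<close> and height \<open>t (t + sqrt (f x - y))\<close>. Interior patches
  are obtained with constant \<open>f\<close>.
\<close>

locale patch =
  fixes \<Omega> S :: "((real ^ 'd) \<times> real) set" and a :: "(real ^ 'd) \<times> real"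
    and B :: "(real ^ 'd) \<times> real \<Rightarrow> (real ^ 'd) \<times> real"
    and f :: "real ^ 'd \<Rightarrow> real" and g :: "real ^ 'd \<Rightarrow> real ^ 'd" and \<kappa> M c C :: real
  assumes orth: "orthogonal_transformation B"
    and cont: "continuous_on UNIV f" "continuous_on UNIV g"
    and pos: "0 < \<kappa>" "0 \<le> M" "0 < c" "0 \<le> C"
    and S_sub: "S \<subseteq> \<Omega>"
    and depth: "a + B (x, y) \<in> S \<Longrightarrow> 0 \<le> f x - y \<and> f x - y \<le> \<kappa>\<^sup>2 / 2"
    and inside: "\<lbrakk>a + B (x, y) \<in> S; norm u \<le> \<kappa>; 0 \<le> w; w \<le> \<kappa>\<^sup>2\<rbrakk> \<Longrightarrow>
      a + B (x + u, f x + g x \<bullet> u - M * (norm u)\<^sup>2 - w) \<in> \<Omega>"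
    and ball_sub: "\<lbrakk>a + B (x, y) \<in> S; 0 < t; t \<le> 1; a + B (x + u, y + b) \<in> rho_ball \<Omega> (a + B (x, y)) t\<rbrakk>
      \<Longrightarrow> norm u \<le> t \<and> \<bar>b - g x \<bullet> u\<bar> \<le> C * t * (t + sqrt (f x - y))"
    and ball_vol: "\<lbrakk>a + B (x, y) \<in> S; 0 < t; t \<le> 1\<rbrakk>
      \<Longrightarrow> ennreal (c * t ^ CARD('d) * (t * (t + sqrt (f x - y)))) \<le> emeasure lborel (rho_ball \<Omega> (a + B (x, y)) t)"
begin

lemma f_g_measurable [measurable]: "f \<in> borel_measurable borel" "g \<in> borel_measurable borel"
  using cont by (auto intro: borel_measurable_continuous_onI)

lemma coords: obtains x y where "\<xi> = a + B (x, y)"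
  using orthogonal_transformation_surj[OF orth] by (metis surjD surj_pair diff_add_cancel add.commute)

definition chi_ball :: "real \<Rightarrow> real ^ 'd \<Rightarrow> ennreal" where
  "chi_ball t u = (if norm u \<le> t then 1 else 0)"

definition chi_slab :: "real \<Rightarrow> real ^ 'd \<Rightarrow> real \<Rightarrow> real ^ 'd \<Rightarrow> real \<Rightarrow> ennreal" where
  "chi_slab t x y u b = (if \<bar>b - g x \<bullet> u\<bar> \<le> C * t * (t + sqrt (f x - y)) then 1 else 0)"

definition chi_depth :: "real ^ 'd \<Rightarrow> real \<Rightarrow> ennreal" where
  "chi_depth x y = (if 0 \<le> f x - y \<and> f x - y \<le> \<kappa>\<^sup>2 / 2 then 1 else 0)"

lemma chi_measurable [measurable (raw)]:
  assumes [measurable]: "X \<in> measurable N borel" "Y \<in> measurable N borel" "U \<in> measurable N borel" "V \<in> measurable N borel"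
  shows "(\<lambda>z. chi_ball t (U z)) \<in> borel_measurable N"
    "(\<lambda>z. chi_slab t (X z) (Y z) (U z) (V z)) \<in> borel_measurable N"
    "(\<lambda>z. chi_depth (X z) (Y z)) \<in> borel_measurable N"
  unfolding chi_ball_def chi_slab_def chi_depth_def by measurable

text \<open>The ball is enlarged to a sheared box in the numerator by \<open>ball_sub\<close>, and
  its volume is bounded below in the denominator by \<open>ball_vol\<close>; the two are of the same
  order.\<close>

lemma avg_le:
  assumes \<xi>: "a + B (x, y) \<in> S" and t: "0 < t" "t \<le> 1"
    and Y [measurable]: "Y \<in> borel_measurable (borel \<Otimes>\<^sub>M borel)"
    and le: "\<And>u b. a + B (x + u, y + b) \<in> rho_ball \<Omega> (a + B (x, y)) t \<Longrightarrow> X (a + B (x + u, y + b)) \<le> Y (u, b)"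
  shows "(\<integral>\<^sup>+\<eta>. X \<eta> * indicator (rho_ball \<Omega> (a + B (x, y)) t) \<eta> \<partial>lborel) / emeasure lborel (rho_ball \<Omega> (a +
    B (x, y)) t)
    \<le> ennreal (1 / (c * t ^ CARD('d) * (t * (t + sqrt (f x - y))))) *
       (\<integral>\<^sup>+u. \<integral>\<^sup>+b. chi_ball t u * (chi_slab t x y u b * Y (u, b)) \<partial>lborel \<partial>lborel)"
proof -
  define h where "h = (\<lambda>(u, b). chi_ball t u * (chi_slab t x y u b * Y (u, b)))"
  have hm: "h \<in> borel_measurable (borel \<Otimes>\<^sub>M borel)" unfolding h_def by measurable
  then have [measurable]: "h \<in> borel_measurable borel" by (simp add: borel_prod)
  define B' where "B' = inv B"
  have B': "orthogonal_transformation B'" unfolding B'_def by (rule orthogonal_transformation_inv[OF orth])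
  have BB: "B (B' z) = z" for z unfolding B'_def using orthogonal_transformation_surj[OF orth]
    by (simp add: surj_f_inv_f)
  have BB': "B' (B z) = z" for z unfolding B'_def using orthogonal_transformation_inj[OF orth]
    by (simp add: inv_f_f)
  have lin: "linear B'" "linear B" using B' orth by (auto simp: orthogonal_transformation_linear)
  have "(\<integral>\<^sup>+\<eta>. X \<eta> * indicator (rho_ball \<Omega> (a + B (x, y)) t) \<eta> \<partial>lborel)
     \<le> (\<integral>\<^sup>+\<eta>. h ((- (B' a) - (x, y)) + B' \<eta>) \<partial>lborel)"
  proof (rule nn_integral_mono)
    fix \<eta>
    obtain u b where ub: "(- (B' a) - (x, y)) + B' \<eta> = (u, b)" by (metis surj_pair)
    then have "B' \<eta> = B' a + (x + u, y + b)" by (simp add: algebra_simps)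
    then have \<eta>: "\<eta> = a + B (x + u, y + b)" by (metis BB linear_add[OF lin(2)])
    show "X \<eta> * indicator (rho_ball \<Omega> (a + B (x, y)) t) \<eta> \<le> h ((- (B' a) - (x, y)) + B' \<eta>)"
    proof (cases "\<eta> \<in> rho_ball \<Omega> (a + B (x, y)) t")
      case True
      have "chi_ball t u = 1" "chi_slab t x y u b = 1"
        using ball_sub[OF \<xi> t True[unfolded \<eta>]] by (auto simp: chi_ball_def chi_slab_def)
      then have "h (- B' a - (x, y) + B' \<eta>) = Y (u, b)" unfolding ub h_def by simp
      then show ?thesis using True le[of u b] \<eta> by simp
    qed simp
  qed
  also have "\<dots> = (\<integral>\<^sup>+z. h z \<partial>lborel)" by (rule nn_integral_lborel_isometry[OF B']) measurable
  also have "\<dots> = (\<integral>\<^sup>+u. \<integral>\<^sup>+b. h (u, b) \<partial>lborel \<partial>lborel)" by (rule nn_integral_lborel_pair[OF hm])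
  finally have A: "(\<integral>\<^sup>+\<eta>. X \<eta> * indicator (rho_ball \<Omega> (a + B (x, y)) t) \<eta> \<partial>lborel)
     \<le> (\<integral>\<^sup>+u. \<integral>\<^sup>+b. chi_ball t u * (chi_slab t x y u b * Y (u, b)) \<partial>lborel \<partial>lborel)"
    by (simp add: h_def)
  have "0 \<le> f x - y" using depth[OF \<xi>] by simp
  then have v: "0 < c * t ^ CARD('d) * (t * (t + sqrt (f x - y)))"
    using pos t by (intro mult_pos_pos add_pos_nonneg zero_less_power) auto
  show ?thesis
    using ennreal_divide_le[OF v ball_vol[OF \<xi> t]] A by (meson mult_left_mono order_trans zero_le)
qed

text \<open>Tonelli brings the horizontal displacement u outside. It ranges over a ball whose volume
  is a multiple of t^d, which cancels the normalising power of t, so that only the vertical average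
  for one fixed u remains to be estimated.\<close>

lemma avg_int_le:
  assumes t: "0 < t" "t \<le> 1"
    and Y [measurable]: "Y \<in> borel_measurable (borel \<Otimes>\<^sub>M borel \<Otimes>\<^sub>M borel \<Otimes>\<^sub>M borel)"
    and le: "\<And>x y u b. a + B (x, y) \<in> S \<Longrightarrow> a + B (x + u, y + b) \<in> rho_ball \<Omega> (a + B (x, y)) t \<Longrightarrow>
        X (a + B (x, y)) (a + B (x + u, y + b)) \<le> Y (x, y, u, b)"
    and A: "\<And>u. norm u \<le> t \<Longrightarrow> (\<integral>\<^sup>+x. \<integral>\<^sup>+y. chi_depth x y * ennreal (1 / (t * (t + sqrt (f x - y)))) *
        (\<integral>\<^sup>+b. chi_slab t x y u b * Y (x, y, u, b) \<partial>lborel) \<partial>lborel \<partial>lborel) \<le> A"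
  shows "avg_int \<Omega> S t X \<le> ennreal (unit_ball_vol CARD('d) / c) * A"
proof -
  define W where "W = (\<lambda>(x, y). chi_depth x y * (ennreal (1 / (c * t ^ CARD('d))) *
       (\<integral>\<^sup>+u. chi_ball t u * (ennreal (1 / (t * (t + sqrt (f x - y)))) *
         (\<integral>\<^sup>+b. chi_slab t x y u b * Y (x, y, u, b) \<partial>lborel)) \<partial>lborel)))"
  have Wm: "W \<in> borel_measurable (borel \<Otimes>\<^sub>M borel)" unfolding W_def by measurable
  then have [measurable]: "W \<in> borel_measurable borel" by (simp add: borel_prod)
  define B' where "B' = inv B"
  have B': "orthogonal_transformation B'" unfolding B'_def by (rule orthogonal_transformation_inv[OF orth])
  have BB': "B' (B z) = z" for z unfolding B'_def using orthogonal_transformation_inj[OF orth]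
    by (simp add: inv_f_f)
  have lin: "linear B'" using B' by (auto simp: orthogonal_transformation_linear)
  have "avg_int \<Omega> S t X \<le> (\<integral>\<^sup>+\<xi>. W (- B' a + B' \<xi>) \<partial>lborel)"
    unfolding avg_int_def
  proof (rule nn_integral_mono)
    fix \<xi>
    obtain x y where xy: "\<xi> = a + B (x, y)" by (rule coords)
    have T: "- B' a + B' \<xi> = (x, y)" by (simp add: xy linear_add[OF lin] BB')
    show "indicator S \<xi> * ((\<integral>\<^sup>+\<eta>. X \<xi> \<eta> * indicator (rho_ball \<Omega> \<xi> t) \<eta> \<partial>lborel) / emeasure lborel (rho_ball \<Omega> \<xi> t))
        \<le> W (- B' a + B' \<xi>)"
    proof (cases "\<xi> \<in> S")
      case True
      then have S: "a + B (x, y) \<in> S" by (simp add: xy)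
      have d: "chi_depth x y = 1" using depth[OF S] by (simp add: chi_depth_def)
      let ?s = "t * (t + sqrt (f x - y))"
      have s: "0 < ?s" using depth[OF S] t by (intro mult_pos_pos add_pos_nonneg) auto
      have "(\<integral>\<^sup>+\<eta>. X \<xi> \<eta> * indicator (rho_ball \<Omega> \<xi> t) \<eta> \<partial>lborel) / emeasure lborel (rho_ball \<Omega> \<xi> t)
        \<le> ennreal (1 / (c * t ^ CARD('d) * ?s)) *
         (\<integral>\<^sup>+u. \<integral>\<^sup>+b. chi_ball t u * (chi_slab t x y u b * Y (x, y, u, b)) \<partial>lborel \<partial>lborel)"
        unfolding xy by (rule avg_le[OF S t, of "\<lambda>(u, b). Y (x, y, u, b)", simplified]) (use le[OF S] in auto)
      also have "(\<integral>\<^sup>+u. \<integral>\<^sup>+b. chi_ball t u * (chi_slab t x y u b * Y (x, y, u, b)) \<partial>lborel \<partial>lborel)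
         = (\<integral>\<^sup>+u. chi_ball t u * (\<integral>\<^sup>+b. chi_slab t x y u b * Y (x, y, u, b) \<partial>lborel) \<partial>lborel)"
        by (intro nn_integral_cong nn_integral_cmult) measurable
      also have "ennreal (1 / (c * t ^ CARD('d) * ?s)) * \<dots> =
        ennreal (1 / (c * t ^ CARD('d))) * (ennreal (1 / ?s) * \<dots>)"
      proof -
        have "ennreal (1 / (c * t ^ CARD('d) * ?s)) = ennreal (1 / (c * t ^ CARD('d))) * ennreal (1 / ?s)"
          using s pos t by (subst ennreal_mult[symmetric]) (auto simp: less_imp_le)
        then show ?thesis by (simp only: mult.assoc)
      qed
      also have "ennreal (1 / ?s) * (\<integral>\<^sup>+u. chi_ball t u *
        (\<integral>\<^sup>+b. chi_slab t x y u b * Y (x, y, u, b) \<partial>lborel) \<partial>lborel)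
        = (\<integral>\<^sup>+u. ennreal (1 / ?s) * (chi_ball t u *
          (\<integral>\<^sup>+b. chi_slab t x y u b * Y (x, y, u, b) \<partial>lborel)) \<partial>lborel)"
        by (rule nn_integral_cmult[symmetric]) measurable
      also have "\<dots> = (\<integral>\<^sup>+u. chi_ball t u * (ennreal (1 / ?s) *
        (\<integral>\<^sup>+b. chi_slab t x y u b * Y (x, y, u, b) \<partial>lborel)) \<partial>lborel)"
        by (simp only: mult.left_commute)
      finally show ?thesis using True d unfolding T W_def by simp
    qed simp
  qed
  also have "\<dots> = (\<integral>\<^sup>+z. W z \<partial>lborel)" by (rule nn_integral_lborel_isometry[OF B']) measurable
  also have "\<dots> = (\<integral>\<^sup>+x. \<integral>\<^sup>+y. W (x, y) \<partial>lborel \<partial>lborel)" by (rule nn_integral_lborel_pair[OF Wm])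
  also have "\<dots> = (\<integral>\<^sup>+x. \<integral>\<^sup>+y. \<integral>\<^sup>+u. ennreal (1 / (c * t ^ CARD('d))) * chi_ball t u * (chi_depth x y *
       ennreal (1 / (t * (t + sqrt (f x - y)))) *
         (\<integral>\<^sup>+b. chi_slab t x y u b * Y (x, y, u, b) \<partial>lborel)) \<partial>lborel \<partial>lborel \<partial>lborel)"
    unfolding W_def prod.case by (subst nn_integral_cmult[symmetric], measurable, subst nn_integral_cmult[symmetric], measurable) (simp only: mult_ac)
  also have "\<dots> = (\<integral>\<^sup>+x. \<integral>\<^sup>+u. \<integral>\<^sup>+y. ennreal (1 / (c * t ^ CARD('d))) * chi_ball t u * (chi_depth x y *
       ennreal (1 / (t * (t + sqrt (f x - y)))) *
         (\<integral>\<^sup>+b. chi_slab t x y u b * Y (x, y, u, b) \<partial>lborel)) \<partial>lborel \<partial>lborel \<partial>lborel)"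
    by (intro nn_integral_cong lborel_pair.Fubini') measurable
  also have "\<dots> = (\<integral>\<^sup>+u. \<integral>\<^sup>+x. \<integral>\<^sup>+y. ennreal (1 / (c * t ^ CARD('d))) * chi_ball t u * (chi_depth x y *
       ennreal (1 / (t * (t + sqrt (f x - y)))) *
         (\<integral>\<^sup>+b. chi_slab t x y u b * Y (x, y, u, b) \<partial>lborel)) \<partial>lborel \<partial>lborel \<partial>lborel)"
    by (rule lborel_pair.Fubini') measurable
  also have "\<dots> = (\<integral>\<^sup>+u. ennreal (1 / (c * t ^ CARD('d))) * chi_ball t u * (\<integral>\<^sup>+x. \<integral>\<^sup>+y. (chi_depth x y *
       ennreal (1 / (t * (t + sqrt (f x - y)))) *
         (\<integral>\<^sup>+b. chi_slab t x y u b * Y (x, y, u, b) \<partial>lborel)) \<partial>lborel \<partial>lborel) \<partial>lborel)"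
    by (simp add: nn_integral_cmult)
  also have "\<dots> \<le> (\<integral>\<^sup>+u. ennreal (1 / (c * t ^ CARD('d))) * A * chi_ball t u \<partial>lborel)"
  proof (intro nn_integral_mono)
    fix u :: "real ^ 'd"
    show "ennreal (1 / (c * t ^ CARD('d))) * chi_ball t u * (\<integral>\<^sup>+x. \<integral>\<^sup>+y. (chi_depth x y *
       ennreal (1 / (t * (t + sqrt (f x - y)))) *
         (\<integral>\<^sup>+b. chi_slab t x y u b * Y (x, y, u, b) \<partial>lborel)) \<partial>lborel \<partial>lborel)
       \<le> ennreal (1 / (c * t ^ CARD('d))) * A * chi_ball t u"
      using A[of u] by (cases "norm u \<le> t") (auto simp: chi_ball_def intro!: mult_left_mono)
  qed
  also have "\<dots> = ennreal (1 / (c * t ^ CARD('d))) * A * emeasure lborel (cball (0 :: real ^ 'd) t)"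
  proof -
    have "chi_ball t = indicator (cball 0 t)" by (auto simp: fun_eq_iff chi_ball_def indicator_def)
    then show ?thesis by (simp add: nn_integral_cmult_indicator)
  qed
  also have "emeasure lborel (cball (0 :: real ^ 'd) t) = ennreal (unit_ball_vol CARD('d) * t ^ CARD('d))"
    using t by (subst emeasure_cball) auto
  also have "ennreal (1 / (c * t ^ CARD('d))) * A * \<dots> = (ennreal (1 / (c * t ^ CARD('d))) * \<dots>) * A"
    by (simp only: mult_ac)
  also have "ennreal (1 / (c * t ^ CARD('d))) * ennreal (unit_ball_vol CARD('d) * t ^ CARD('d)) =
    ennreal (unit_ball_vol CARD('d) / c)"
    using t pos by (subst ennreal_mult[symmetric]) auto
  finally show ?thesis .
qed

end

text \<open>The cut-off makes the angle measurable in all of \<open>w\<close>, as \<open>arccos\<close> is unspecified outside \<open>[-1, 1]\<close>.\<close>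

definition depth_angle :: "real \<Rightarrow> real \<Rightarrow> real" where
  "depth_angle \<kappa> w = arccos (max 0 (min 1 (1 - 2 * w / \<kappa>\<^sup>2)))"

lemma depth_angle_measurable [measurable]: "depth_angle \<kappa> \<in> borel_measurable borel"
proof -
  have "continuous_on UNIV (\<lambda>v::real. arccos (max 0 (min 1 v)))" by (intro continuous_intros) auto
  then have [measurable]: "(\<lambda>v::real. arccos (max 0 (min 1 v))) \<in> borel_measurable borel"
    by (rule borel_measurable_continuous_onI)
  have "(\<lambda>w. 1 - 2 * w / \<kappa>\<^sup>2) \<in> borel_measurable borel" by measurable
  then show ?thesis unfolding depth_angle_def [abs_def]
    by (rule measurable_compose) measurable
qed

lemma depth_angle_bounds: "0 \<le> depth_angle \<kappa> w" "depth_angle \<kappa> w \<le> pi / 2"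
  unfolding depth_angle_def by (rule arccos_lbound; simp) (rule arccos_le_pi2; simp)

lemma depth_angle_eq: "\<kappa> > 0 \<Longrightarrow> 0 \<le> w \<Longrightarrow> w \<le> \<kappa>\<^sup>2 / 2 \<Longrightarrow> depth_angle \<kappa> w = arccos (1 - 2 * w / \<kappa>\<^sup>2)"
  by (simp add: depth_angle_def max_def min_def field_simps)

lemma depth_angle_cos:
  assumes "\<kappa> > 0" "0 \<le> \<alpha>" "\<alpha> \<le> pi / 2" shows "depth_angle \<kappa> (\<kappa>\<^sup>2 * (1 - cos \<alpha>) / 2) = \<alpha>"
proof -
  have c: "0 \<le> cos \<alpha>" using assms by (intro cos_ge_zero) auto
  have "1 - 2 * (\<kappa>\<^sup>2 * (1 - cos \<alpha>) / 2) / \<kappa>\<^sup>2 = cos \<alpha>" using assms(1) by simp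
  then have "depth_angle \<kappa> (\<kappa>\<^sup>2 * (1 - cos \<alpha>) / 2) = arccos (cos \<alpha>)" using c unfolding depth_angle_def
    by (simp only:) simp
  also have "\<dots> = \<alpha>" using assms by (intro arccos_cos) auto
  finally show ?thesis .
qed

section \<open>From depth to angle; a Jensen inequality for kernels of bounded mass\<close>

lemma nn_integral_cos_substitution:
  fixes H :: "real \<Rightarrow> ennreal"
  assumes [measurable]: "H \<in> borel_measurable borel" and b: "0 < b" "b \<le> pi"
  shows "(\<integral>\<^sup>+w. H w * indicator {0..\<kappa>\<^sup>2 * (1 - cos b) / 2} w \<partial>lborel) =
    (\<integral>\<^sup>+\<alpha>. H (\<kappa>\<^sup>2 * (1 - cos \<alpha>) / 2) * ennreal (\<kappa>\<^sup>2 / 2 * sin \<alpha>) * indicator {0..b} \<alpha> \<partial>lborel)"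
proof -
  have "(\<integral>\<^sup>+w. H w * indicator {\<kappa>\<^sup>2 * (1 - cos 0) / 2..\<kappa>\<^sup>2 * (1 - cos b) / 2} w \<partial>lborel) =
    (\<integral>\<^sup>+\<alpha>. H (\<kappa>\<^sup>2 * (1 - cos \<alpha>) / 2) * ennreal (\<kappa>\<^sup>2 / 2 * sin \<alpha>) * indicator {0..b} \<alpha> \<partial>lborel)"
  proof (rule nn_integral_substitution_aux)
    fix x assume "x \<in> {0..b}"
    then show "0 \<le> \<kappa>\<^sup>2 / 2 * sin x" using b by (intro mult_nonneg_nonneg sin_ge_zero) auto
    show "((\<lambda>\<alpha>. \<kappa>\<^sup>2 * (1 - cos \<alpha>) / 2) has_real_derivative \<kappa>\<^sup>2 / 2 * sin x) (at x)"
      by (auto intro!: derivative_eq_intros)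
  qed (use b in \<open>auto intro!: continuous_intros\<close>)
  then show ?thesis by simp
qed

text \<open>This is \<open>nker_dual\<close> read in the depth variable, whose Jacobian supplies the
  weight sin \<alpha>. Depths up to \<kappa>^2 / 2 correspond to angles up to pi / 2.\<close>

lemma nker_depth:
  assumes n: "N \<ge> 1" and \<kappa>: "\<kappa> > 0" and \<theta>: "\<theta> \<in> {-pi..pi}"
  shows "(\<integral>\<^sup>+w. ennreal (nker N (depth_angle \<kappa> w) \<theta>) * indicator {0..\<kappa>\<^sup>2 / 2} w \<partial>lborel) \<le>
    ennreal (\<kappa>\<^sup>2 / 2 * (Kc * \<bar>sin \<theta>\<bar>))"
proof -
  have [measurable]: "(\<lambda>w. nker N (depth_angle \<kappa> w) \<theta>) \<in> borel_measurable borel" unfolding nker_def by measurable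
  have [measurable]: "(\<lambda>\<alpha>. nker N \<alpha> \<theta>) \<in> borel_measurable borel" unfolding nker_def by measurable
  have "(\<integral>\<^sup>+w. ennreal (nker N (depth_angle \<kappa> w) \<theta>) * indicator {0..\<kappa>\<^sup>2 / 2} w \<partial>lborel) =
     (\<integral>\<^sup>+w. ennreal (nker N (depth_angle \<kappa> w) \<theta>) * indicator {0..\<kappa>\<^sup>2 *
       (1 - cos (pi / 2)) / 2} w \<partial>lborel)" by simp
  also have "\<dots> = (\<integral>\<^sup>+\<alpha>. ennreal (nker N (depth_angle \<kappa> (\<kappa>\<^sup>2 *
    (1 - cos \<alpha>) / 2)) \<theta>) * ennreal (\<kappa>\<^sup>2 / 2 * sin \<alpha>) * indicator {0..pi / 2} \<alpha> \<partial>lborel)"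
    by (rule nn_integral_cos_substitution) auto
  also have "\<dots> = (\<integral>\<^sup>+\<alpha>. ennreal (\<kappa>\<^sup>2 / 2) * (ennreal (nker N \<alpha> \<theta> * sin \<alpha>) * indicator {0..pi / 2} \<alpha>) \<partial>lborel)"
  proof (rule nn_integral_cong)
    fix \<alpha>
    show "ennreal (nker N (depth_angle \<kappa> (\<kappa>\<^sup>2 *
      (1 - cos \<alpha>) / 2)) \<theta>) * ennreal (\<kappa>\<^sup>2 / 2 * sin \<alpha>) * indicator {0..pi / 2} \<alpha>
      = ennreal (\<kappa>\<^sup>2 / 2) * (ennreal (nker N \<alpha> \<theta> * sin \<alpha>) * indicator {0..pi / 2} \<alpha>)"
    proof (cases "\<alpha> \<in> {0..pi/2}")
      case True
      have "0 \<le> sin \<alpha>" using True by (intro sin_ge_zero) auto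
      moreover have "depth_angle \<kappa> (\<kappa>\<^sup>2 * (1 - cos \<alpha>) / 2) = \<alpha>" using True \<kappa> by (intro depth_angle_cos) auto
      ultimately show ?thesis using True by (simp only:) (simp add: ennreal_mult[symmetric] nker_nonneg mult_ac)
    qed simp
  qed
  also have "\<dots> = ennreal (\<kappa>\<^sup>2 / 2) * (\<integral>\<^sup>+\<alpha>. (ennreal (nker N \<alpha> \<theta> * sin \<alpha>) * indicator {0..pi / 2} \<alpha>) \<partial>lborel)"
    by (rule nn_integral_cmult) measurable
  also have "\<dots> \<le> ennreal (\<kappa>\<^sup>2 / 2) * ennreal (Kc * \<bar>sin \<theta>\<bar>)"
    by (intro mult_left_mono nker_dual n \<theta>) auto
  also have "\<dots> = ennreal (\<kappa>\<^sup>2 / 2 * (Kc * \<bar>sin \<theta>\<bar>))" using Kc_pos by (intro ennreal_mult[symmetric]) auto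
  finally show ?thesis .
qed

text \<open>The depth is an even function of \<theta>, so the circle covers the interval from 0 to
  \<kappa>^2 twice; this is the factor 2.\<close>

lemma sin_weight_integral:
  fixes H :: "real \<Rightarrow> ennreal"
  assumes [measurable]: "H \<in> borel_measurable borel" and \<kappa>: "\<kappa> > 0"
  shows "(\<integral>\<^sup>+\<theta>. indicator {-pi..pi} \<theta> * ennreal (\<kappa>\<^sup>2 / 2 * \<bar>sin \<theta>\<bar>) * H (\<kappa>\<^sup>2 * (1 - cos \<theta>) / 2) \<partial>lborel) \<le>
    2 * (\<integral>\<^sup>+w. H w \<partial>lborel)"
proof -
  define h where "h \<theta> = H (\<kappa>\<^sup>2 * (1 - cos \<theta>) / 2) * ennreal (\<kappa>\<^sup>2 / 2 * sin \<theta>) * indicator {0..pi} \<theta>" for \<theta>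
  have [measurable]: "h \<in> borel_measurable borel" unfolding h_def by measurable
  have "(\<integral>\<^sup>+\<theta>. indicator {-pi..pi} \<theta> * ennreal (\<kappa>\<^sup>2 / 2 * \<bar>sin \<theta>\<bar>) * H (\<kappa>\<^sup>2 * (1 - cos \<theta>) / 2) \<partial>lborel) \<le>
    (\<integral>\<^sup>+\<theta>. h \<theta> + h (0 - \<theta>) \<partial>lborel)"
  proof (rule nn_integral_mono)
    fix \<theta> :: real
    show "indicator {-pi..pi} \<theta> * ennreal (\<kappa>\<^sup>2 / 2 * \<bar>sin \<theta>\<bar>) * H (\<kappa>\<^sup>2 * (1 - cos \<theta>) / 2) \<le> h \<theta> + h (0 - \<theta>)"
    proof (cases "\<theta> \<in> {-pi..pi}")
      case True
      show ?thesis
      proof (cases "0 \<le> \<theta>")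
        case t: True
        have "0 \<le> sin \<theta>" using True t by (intro sin_ge_zero) auto
        then have "indicator {-pi..pi} \<theta> * ennreal (\<kappa>\<^sup>2 / 2 * \<bar>sin \<theta>\<bar>) * H (\<kappa>\<^sup>2 * (1 - cos \<theta>) / 2) = h \<theta>"
          using True t by (simp add: h_def mult_ac)
        then show ?thesis by simp
      next
        case t: False
        have "0 \<le> sin (-\<theta>)" using True t by (intro sin_ge_zero) auto
        then have "indicator {-pi..pi} \<theta> * ennreal (\<kappa>\<^sup>2 / 2 * \<bar>sin \<theta>\<bar>) * H (\<kappa>\<^sup>2 * (1 - cos \<theta>) / 2) = h (0 - \<theta>)"
          using True t by (simp add: h_def mult_ac)
        then show ?thesis by simp
      qed
    qed simp
  qed
  also have "\<dots> = (\<integral>\<^sup>+\<theta>. h \<theta> \<partial>lborel) + (\<integral>\<^sup>+\<theta>. h (0 - \<theta>) \<partial>lborel)"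
    by (rule nn_integral_add) measurable
  also have "(\<integral>\<^sup>+\<theta>. h (0 - \<theta>) \<partial>lborel) = (\<integral>\<^sup>+\<theta>. h \<theta> \<partial>lborel)" by (rule nn_integral_lborel_reflect) measurable
  also have "(\<integral>\<^sup>+\<theta>. h \<theta> \<partial>lborel) = (\<integral>\<^sup>+w. H w * indicator {0..\<kappa>\<^sup>2 * (1 - cos pi) / 2} w \<partial>lborel)"
    unfolding h_def by (rule nn_integral_cos_substitution[symmetric]) auto
  also have "\<dots> + \<dots> \<le> (\<integral>\<^sup>+w. H w \<partial>lborel) + (\<integral>\<^sup>+w. H w \<partial>lborel)"
    by (intro add_mono nn_integral_mono) (auto split: split_indicator)
  finally show ?thesis by (simp add: mult_2)
qed

lemma bern_avg_const:
  assumes "N \<ge> 1" "0 \<le> \<alpha>" "\<alpha> \<le> pi / 2"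
  shows "bern_avg N \<kappa> \<alpha> (\<lambda>_ _. A) \<le> ennreal (Kc\<^sup>2) * A"
proof -
  have "bern_avg N \<kappa> \<alpha> (\<lambda>_ _. A) = circ (tker (2 * N)) * (circ (nker N \<alpha>) * A)"
    unfolding bern_avg_def circ_def by (simp add: nn_integral_multc nker_def)
  also have "\<dots> \<le> ennreal Kc * (ennreal Kc * A)"
    using assms by (intro mult_mono circ_tker circ_nker) auto
  also have "\<dots> = ennreal (Kc\<^sup>2) * A"
    using Kc_pos by (simp add: power2_eq_square ennreal_mult mult.assoc)
  finally show ?thesis .
qed

lemma bern_avg_mono:
  assumes "\<And>\<sigma> \<theta>. H (\<kappa> * sin \<sigma>) (\<kappa>\<^sup>2 * (1 - cos \<theta>) / 2) \<le> H' (\<kappa> * sin \<sigma>) (\<kappa>\<^sup>2 * (1 - cos \<theta>) / 2)"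
  shows "bern_avg N \<kappa> \<alpha> H \<le> bern_avg N \<kappa> \<alpha> H'"
  unfolding bern_avg_def by (intro nn_integral_mono mult_left_mono assms) auto

lemma bern_avg_add_cmult:
  assumes [measurable]: "case_prod H \<in> borel_measurable (borel \<Otimes>\<^sub>M borel)"
  shows "bern_avg N \<kappa> \<alpha> (\<lambda>s w. A + b * H s w) = bern_avg N \<kappa> \<alpha> (\<lambda>_ _. A) + b * bern_avg N \<kappa> \<alpha> H"
proof -
  have [measurable]: "nker N \<alpha> \<in> borel_measurable borel" unfolding nker_def [abs_def] by measurable
  show ?thesis
    unfolding bern_avg_def
    by (simp add: nn_integral_add[symmetric] nn_integral_cmult[symmetric] distrib_left mult.left_commute)
qed

text \<open>Above l the (p - 1)-th power of x / l is at least 1. The right-hand side is affine in x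
  powr p, so integrating it takes the place of Hoelder's inequality.\<close>

lemma le_add_powr:
  fixes x l p :: real
  assumes "0 \<le> x" "0 < l" "1 \<le> p" shows "x \<le> l + l powr (1 - p) * x powr p"
proof (cases "x \<le> l")
  case True
  have "0 \<le> l powr (1 - p) * x powr p" by simp
  then show ?thesis using True by linarith
next
  case False
  have "x = x powr (1 - p) * x powr p" using False assms by (simp add: powr_add[symmetric])
  also have "\<dots> \<le> l powr (1 - p) * x powr p"
    using False assms by (intro mult_right_mono powr_mono2') auto
  finally show ?thesis using assms by linarith
qed

text \<open>Jensen's inequality for a kernel whose mass is bounded but not 1. The parameter l is
  chosen so that the two terms of \<open>le_add_powr\<close> balance, which yields a constant
  uniform in p.\<close>

lemma bern_avg_powr:
  assumes Hm: "case_prod H \<in> borel_measurable (borel \<Otimes>\<^sub>M borel)" and H: "\<And>s w. 0 \<le> H s w"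
    and p: "1 \<le> p" and N: "N \<ge> 1" "0 \<le> \<alpha>" "\<alpha> \<le> pi / 2" and y: "0 < y"
    and le: "bern_avg N \<kappa> \<alpha> (\<lambda>s w. ennreal (H s w powr p)) \<le> ennreal y"
  shows "bern_avg N \<kappa> \<alpha> (\<lambda>s w. ennreal (H s w)) \<le> ennreal ((Kc\<^sup>2 + 1) * y powr (1 / p))"
proof -
  define l where "l = y powr (1 / p)"
  have l: "0 < l" using y by (simp add: l_def)
  have ly: "l powr (1 - p) * y = l"
  proof -
    have "y = l powr p" using y p by (simp add: l_def powr_powr)
    then show ?thesis using l by (simp add: powr_add[symmetric])
  qed
  have [measurable]: "case_prod (\<lambda>s w. ennreal (H s w powr p)) \<in> borel_measurable (borel \<Otimes>\<^sub>M borel)"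
  proof -
    have "case_prod (\<lambda>s w. ennreal (H s w powr p)) = (\<lambda>z. ennreal (case_prod H z powr p))"
      by (auto simp: fun_eq_iff)
    then show ?thesis using Hm by simp
  qed
  have "bern_avg N \<kappa> \<alpha> (\<lambda>s w. ennreal (H s w)) \<le>
    bern_avg N \<kappa> \<alpha> (\<lambda>s w. ennreal l + ennreal (l powr (1 - p)) * ennreal (H s w powr p))"
  proof (rule bern_avg_mono)
    fix \<sigma> \<theta>
    define h where "h = H (\<kappa> * sin \<sigma>) (\<kappa>\<^sup>2 * (1 - cos \<theta>) / 2)"
    have "h \<le> l + l powr (1 - p) * h powr p" using H l p by (intro le_add_powr) (auto simp: h_def)
    then have "ennreal h \<le> ennreal (l + l powr (1 - p) * h powr p)" by (rule ennreal_leI)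
    also have "\<dots> = ennreal l + ennreal (l powr (1 - p)) * ennreal (h powr p)"
      using l by (simp add: ennreal_plus ennreal_mult)
    finally show "ennreal (H (\<kappa> * sin \<sigma>) (\<kappa>\<^sup>2 * (1 - cos \<theta>) / 2)) \<le>
      ennreal l + ennreal (l powr (1 - p)) * ennreal (H (\<kappa> * sin \<sigma>) (\<kappa>\<^sup>2 * (1 - cos \<theta>) / 2) powr p)"
      unfolding h_def .
  qed
  also have "\<dots> = bern_avg N \<kappa> \<alpha> (\<lambda>_ _. ennreal l) +
    ennreal (l powr (1 - p)) * bern_avg N \<kappa> \<alpha> (\<lambda>s w. ennreal (H s w powr p))"
    by (rule bern_avg_add_cmult) measurable
  also have "\<dots> \<le> ennreal (Kc\<^sup>2) * ennreal l + ennreal (l powr (1 - p)) * ennreal y"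
    by (intro add_mono mult_left_mono bern_avg_const N le) auto
  also have "\<dots> = ennreal (Kc\<^sup>2 * l + l)"
    using l y ly by (simp add: ennreal_mult[symmetric] ennreal_plus[symmetric] del: ennreal_plus)
  also have "Kc\<^sup>2 * l + l = (Kc\<^sup>2 + 1) * y powr (1 / p)" by (simp add: l_def algebra_simps)
  finally show ?thesis .
qed

context patch begin

section \<open>Density of the points that divide the segment from \<xi> to \<eta>\<close>

definition pull :: "((real ^ 'd) \<times> real \<Rightarrow> ennreal) \<Rightarrow> real ^ 'd \<Rightarrow> real \<Rightarrow> ennreal" where
  "pull G x y = G (a + B (x, y))"

lemma pull_measurable:
  assumes "G \<in> borel_measurable borel"
  shows "case_prod (pull G) \<in> borel_measurable (borel \<Otimes>\<^sub>M borel)"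
proof -
  note [measurable] = assms orthogonal_transformation_borel(2)[OF orth]
  have "(\<lambda>z. G (a + B z)) \<in> borel_measurable borel" by measurable
  moreover have "case_prod (pull G) = (\<lambda>z. G (a + B z))" by (auto simp: pull_def)
  ultimately show ?thesis by (simp add: borel_prod)
qed

lemma nn_integral_pull:
  assumes G: "G \<in> borel_measurable borel"
  shows "(\<integral>\<^sup>+x. \<integral>\<^sup>+y. pull G (x + v) y \<partial>lborel \<partial>lborel) = (\<integral>\<^sup>+z. G z \<partial>lborel)"
proof -
  note [measurable] = pull_measurable[OF G]
  have "(\<integral>\<^sup>+x. \<integral>\<^sup>+y. pull G (x + v) y \<partial>lborel \<partial>lborel) = (\<integral>\<^sup>+x. \<integral>\<^sup>+y. pull G x y \<partial>lborel \<partial>lborel)"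
    using nn_integral_lborel_translate[of "\<lambda>x. \<integral>\<^sup>+y. pull G x y \<partial>lborel" v] by (simp add: add.commute)
  also have "\<dots> = (\<integral>\<^sup>+z. case_prod (pull G) z \<partial>lborel)"
    by (subst nn_integral_lborel_pair) (auto intro: pull_measurable[OF G])
  also have "\<dots> = (\<integral>\<^sup>+z. G (a + B z) \<partial>lborel)" by (intro nn_integral_cong) (auto simp: pull_def)
  also have "\<dots> = (\<integral>\<^sup>+z. G z \<partial>lborel)" by (rule nn_integral_lborel_isometry[OF orth G])
  finally show ?thesis .
qed

definition K1 :: real where "K1 = (2 + C) * (2 * (C * (2 + 2 * C)))"

text \<open>Fix x, u and the height y' of the image point. The slab then confines the squared root
  of depth, s^2 = f x - y, to within C t (t + s) of a fixed number w'. Therefore t + s is comparable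
  to q = t + sqrt |w'|; the possible y fill an interval of length of order t q, on which the
  integrand is of order 1 / (t q).\<close>

lemma shift_kernel:
  assumes t: "0 < t" and k: "0 < k" "k \<le> 1"
  shows "(\<integral>\<^sup>+y. chi_depth x y * ennreal (1 / (t *
    (t + sqrt (f x - y)))) * chi_slab t x y u ((y' - y) / k) \<partial>lborel) \<le> ennreal K1"
proof -
  \<comment> \<open>The depth at which (y' - y) / k equals \<open>g x \<bullet> u\<close>, that is,
    at which the image point comes from the centre of the slab.\<close>
  define w' where "w' = f x + k * (g x \<bullet> u) - y'"
  define q where "q = t + sqrt \<bar>w'\<bar>"
  have q: "t \<le> q" "0 < q" using t by (auto simp: q_def add_pos_nonneg)
  define L where "L = C * t * ((2 + 2 * C) * q)"
  have L: "0 \<le> L" using pos t q by (simp add: L_def)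
  have "(\<integral>\<^sup>+y. chi_depth x y * ennreal (1 / (t *
    (t + sqrt (f x - y)))) * chi_slab t x y u ((y' - y) / k) \<partial>lborel)
    \<le> (\<integral>\<^sup>+y. ennreal ((2 + C) / (t * q)) * indicator {(f x - w') - L..(f x - w') + L} y \<partial>lborel)"
  proof (rule nn_integral_mono)
    fix y
    show "chi_depth x y * ennreal (1 / (t * (t + sqrt (f x - y)))) * chi_slab t x y u ((y' - y) / k)
      \<le> ennreal ((2 + C) / (t * q)) * indicator {(f x - w') - L..(f x - w') + L} y"
    proof (cases "0 \<le> f x - y \<and> \<bar>(y' - y) / k - g x \<bullet> u\<bar> \<le> C * t * (t + sqrt (f x - y))")
      case False
      then show ?thesis by (auto simp: chi_depth_def chi_slab_def)
    next
      case True
      define s where "s = sqrt (f x - y)"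
      have s: "0 \<le> s" "s\<^sup>2 = f x - y" using True by (auto simp: s_def)
      define D where "D = C * t * (t + s)"
      have D0: "0 \<le> D" using pos t s by (simp add: D_def)
      have "\<bar>s\<^sup>2 - w'\<bar> = k * \<bar>(y' - y) / k - g x \<bullet> u\<bar>"
      proof -
        have "k * ((y' - y) / k) = y' - y" using k by simp
        then have "s\<^sup>2 - w' = k * ((y' - y) / k - g x \<bullet> u)"
          unfolding w'_def s(2) right_diff_distrib by linarith
        then have "\<bar>s\<^sup>2 - w'\<bar> = \<bar>k\<bar> * \<bar>(y' - y) / k - g x \<bullet> u\<bar>" by (simp only: abs_mult)
        then show ?thesis using k by simp
      qed
      also have "\<dots> \<le> 1 * D" using k True by (intro mult_mono) (auto simp: D_def s_def)
      finally have d: "\<bar>s\<^sup>2 - w'\<bar> \<le> D" by simp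
      have "sqrt \<bar>w'\<bar> \<le> (1 + C) * (t + s)"
      proof (rule real_le_lsqrt)
        have "\<bar>w'\<bar> \<le> s\<^sup>2 + C * t * (t + s)" using d D_def by (smt (verit) zero_le_power2)
        also have "\<dots> \<le> (t + s)\<^sup>2 + C * (t + s) * (t + s)"
          using t s pos by (intro add_mono power_mono mult_mono) auto
        also have "\<dots> = (1 + C) * 1 * (t + s)\<^sup>2" by (simp add: power2_eq_square algebra_simps)
        also have "\<dots> \<le> (1 + C) * (1 + C) * (t + s)\<^sup>2" using pos by (intro mult_right_mono mult_left_mono) auto
        finally show "\<bar>w'\<bar> \<le> ((1 + C) * (t + s))\<^sup>2" by (simp add: power2_eq_square mult_ac)
      qed (use pos t s in auto)
      then have q1: "q \<le> (2 + C) * (t + s)" using s by (simp add: q_def algebra_simps)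
      \<comment> \<open>The reverse comparison. If s were larger, then s^2 <= |w'| + C t (t + s) <=
        (1 + 2 C) q s < s^2.\<close>
      have sq: "s \<le> (1 + 2 * C) * q"
      proof (rule ccontr)
        assume "\<not> s \<le> (1 + 2 * C) * q"
        then have h: "(1 + 2 * C) * q < s" by simp
        have "q \<le> (1 + 2 * C) * q" using pos q mult_right_mono[of 1 "1 + 2 * C" q] by simp
        then have qs: "q \<le> s" using h by linarith
        have "\<bar>w'\<bar> + t * t \<le> q * q"
        proof -
          have "\<bar>w'\<bar> = sqrt \<bar>w'\<bar> * sqrt \<bar>w'\<bar>" by simp
          then show ?thesis using t unfolding q_def by (simp add: algebra_simps)
        qed
        then have w1: "\<bar>w'\<bar> \<le> q * q" using t mult_pos_pos[of t t] by linarith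
        have "s * s \<le> \<bar>w'\<bar> + C * t * (t + s)" using d by (simp add: D_def power2_eq_square)
        also have "\<dots> \<le> q * s + C * q * (s + s)"
          using w1 qs q pos s t by (intro add_mono mult_mono order_trans[OF w1]) auto
        also have "\<dots> = ((1 + 2 * C) * q) * s" by (simp add: algebra_simps)
        also have "\<dots> < s * s" using h qs q by (intro mult_strict_right_mono) auto
        finally show False by simp
      qed
      have "D \<le> L" unfolding D_def L_def using q sq pos t
        by (intro mult_left_mono) (auto simp: algebra_simps)
      then have yin: "y \<in> {(f x - w') - L..(f x - w') + L}" using d s by auto
      have "1 / (t * (t + s)) \<le> (2 + C) / (t * q)"
      proof -
        have "1 / (t * (t + s)) = (2 + C) / (t * ((2 + C) * (t + s)))" using pos by simp
        also have "\<dots> \<le> (2 + C) / (t * q)"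
          using q q1 t pos s by (intro divide_left_mono mult_left_mono mult_pos_pos add_pos_nonneg) auto
        finally show ?thesis .
      qed
      then show ?thesis using yin by (simp add: chi_depth_def chi_slab_def s_def ennreal_leI)
    qed
  qed
  also have "\<dots> = ennreal ((2 + C) / (t * q)) * emeasure lborel {(f x - w') - L..(f x - w') + L}"
    by (rule nn_integral_cmult_indicator) simp
  also have "\<dots> = ennreal ((2 + C) / (t * q)) * ennreal (2 * L)" using L by simp
  also have "\<dots> = ennreal ((2 + C) / (t * q) * (2 * L))" using L q t pos by (intro ennreal_mult[symmetric]) auto
  also have "(2 + C) / (t * q) * (2 * L) = K1" using t q by (simp add: L_def K1_def)
  finally show ?thesis by simp
qed

text \<open>For fixed u the horizontal part of the dividing point is a translation of x, which
  preserves the integral, and \<open>shift_kernel\<close> bounds the vertical density. The factor 1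
  / k is the Jacobian of the map from b to y + k b.\<close>

lemma segment_average:
  assumes t: "0 < t" "t \<le> 1" and k: "0 < k" "k \<le> 1" and G: "G \<in> borel_measurable borel"
  shows "avg_int \<Omega> S t (\<lambda>\<xi> \<eta>. G (\<xi> + k *\<^sub>R (\<eta> - \<xi>))) \<le>
    ennreal (unit_ball_vol CARD('d) / c) * (ennreal (K1 / k) * (\<integral>\<^sup>+z. G z \<partial>lborel))"
proof (rule avg_int_le[OF t, of "\<lambda>(x, y, u, b). pull G (x + k *\<^sub>R u) (y + k * b)", unfolded prod.case])
  note [measurable] = pull_measurable[OF G]
  show "(\<lambda>(x, y, u, b). pull G (x + k *\<^sub>R u) (y +
    k * b)) \<in> borel_measurable (borel \<Otimes>\<^sub>M borel \<Otimes>\<^sub>M borel \<Otimes>\<^sub>M borel)"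
    by measurable
  have lin: "linear B" using orth by (rule orthogonal_transformation_linear)
  fix x y u b
  have "a + B (x, y) + k *\<^sub>R (a + B (x + u, y + b) - (a + B (x, y))) = a + B (x + k *\<^sub>R u, y + k * b)"
    by (simp add: linear_diff[OF lin, symmetric] linear_scale[OF lin, symmetric] add.assoc linear_add[OF lin, symmetric])
  then show "G (a + B (x, y) + k *\<^sub>R (a + B (x + u, y + b) - (a + B (x, y)))) \<le>
    pull G (x + k *\<^sub>R u) (y + k * b)"
    unfolding pull_def by (simp only: order_refl)
next
  note [measurable] = pull_measurable[OF G]
  fix u :: "real ^ 'd" assume "norm u \<le> t"
  have "(\<integral>\<^sup>+x. \<integral>\<^sup>+y. chi_depth x y * ennreal (1 / (t * (t + sqrt (f x - y)))) *
        (\<integral>\<^sup>+b. chi_slab t x y u b * pull G (x + k *\<^sub>R u) (y + k * b) \<partial>lborel) \<partial>lborel \<partial>lborel)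
     = (\<integral>\<^sup>+x. \<integral>\<^sup>+y. \<integral>\<^sup>+y'. ennreal (1 / k) * pull G (x + k *\<^sub>R u) y' * (chi_depth x y * ennreal (1 / (t *
       (t + sqrt (f x - y)))) *
         chi_slab t x y u ((y' - y) / k)) \<partial>lborel \<partial>lborel \<partial>lborel)"
  proof (intro nn_integral_cong)
    fix x :: "real ^ 'd" and y :: real
    let ?c = "chi_depth x y * ennreal (1 / (t * (t + sqrt (f x - y))))"
    have "(\<integral>\<^sup>+y'. chi_slab t x y u ((y' - y) / k) * pull G (x + k *\<^sub>R u) y' \<partial>lborel)
      = ennreal \<bar>k\<bar> * (\<integral>\<^sup>+b. chi_slab t x y u ((y + k * b - y) / k) * pull G (x + k *\<^sub>R u) (y + k * b) \<partial>lborel)"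
      by (rule nn_integral_real_affine) (use k in auto)
    also have "\<dots> = ennreal k * (\<integral>\<^sup>+b. chi_slab t x y u b * pull G (x + k *\<^sub>R u) (y + k * b) \<partial>lborel)"
      using k by simp
    finally have e: "(\<integral>\<^sup>+b. chi_slab t x y u b * pull G (x + k *\<^sub>R u) (y + k * b) \<partial>lborel) =
       ennreal (1 / k) * (\<integral>\<^sup>+y'. chi_slab t x y u ((y' - y) / k) * pull G (x + k *\<^sub>R u) y' \<partial>lborel)"
      using k by (simp add: mult.assoc[symmetric] ennreal_mult[symmetric])
    show "?c * (\<integral>\<^sup>+b. chi_slab t x y u b * pull G (x + k *\<^sub>R u) (y + k * b) \<partial>lborel) =
      (\<integral>\<^sup>+y'. ennreal (1 / k) * pull G (x + k *\<^sub>R u) y' * (?c * chi_slab t x y u ((y' - y) / k)) \<partial>lborel)"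
      unfolding e mult.assoc[symmetric] by (subst nn_integral_cmult[symmetric])
        (auto intro!: nn_integral_cong simp: mult_ac)
  qed
  also have "\<dots> = (\<integral>\<^sup>+x. \<integral>\<^sup>+y'. \<integral>\<^sup>+y. ennreal (1 / k) * pull G (x + k *\<^sub>R u) y' *
    (chi_depth x y * ennreal (1 / (t * (t + sqrt (f x - y)))) *
         chi_slab t x y u ((y' - y) / k)) \<partial>lborel \<partial>lborel \<partial>lborel)"
    by (intro nn_integral_cong lborel_pair.Fubini') measurable
  also have "\<dots> = (\<integral>\<^sup>+x. \<integral>\<^sup>+y'. ennreal (1 / k) * pull G (x + k *\<^sub>R u) y' *
    (\<integral>\<^sup>+y. chi_depth x y * ennreal (1 / (t * (t + sqrt (f x - y)))) *
         chi_slab t x y u ((y' - y) / k) \<partial>lborel) \<partial>lborel \<partial>lborel)"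
    by (intro nn_integral_cong nn_integral_cmult) measurable
  also have "\<dots> \<le> (\<integral>\<^sup>+x. \<integral>\<^sup>+y'. ennreal (1 / k) * pull G (x + k *\<^sub>R u) y' * ennreal K1 \<partial>lborel \<partial>lborel)"
    by (intro nn_integral_mono mult_left_mono shift_kernel t k) auto
  also have "\<dots> = ennreal (K1 / k) * (\<integral>\<^sup>+x. \<integral>\<^sup>+y'. pull G (x + k *\<^sub>R u) y' \<partial>lborel \<partial>lborel)"
  proof -
    have "0 \<le> K1" using pos by (simp add: K1_def)
    then have "ennreal (1 / k) * z * ennreal K1 = ennreal (K1 / k) * z" for z
      using k by (simp add: mult.assoc mult.commute[of z] mult.assoc[symmetric] ennreal_mult[symmetric])
    then show ?thesis by (simp add: nn_integral_cmult)
  qed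
  finally show "(\<integral>\<^sup>+x. \<integral>\<^sup>+y. chi_depth x y * ennreal (1 / (t * (t + sqrt (f x - y)))) *
        (\<integral>\<^sup>+b. chi_slab t x y u b * pull G (x + k *\<^sub>R u) (y + k * b) \<partial>lborel) \<partial>lborel \<partial>lborel) \<le>
       ennreal (K1 / k) * (\<integral>\<^sup>+z. G z \<partial>lborel)"
    unfolding nn_integral_pull[OF G] .
qed

text \<open>The cap in the direction u. The variable s is scaled so that s = t is the displacement u
  itself; subtracting M times the squared displacement keeps the point below the graph even at depth
  w = 0.\<close>

definition curve :: "real \<Rightarrow> real ^ 'd \<Rightarrow> real ^ 'd \<Rightarrow> real \<Rightarrow> real \<Rightarrow> ((real ^ 'd) \<times> real)" where
  "curve t x u s w = (x + (s / t) *\<^sub>R u, f x + g x \<bullet> ((s / t) *\<^sub>R u) - M * (norm ((s / t) *\<^sub>R u))\<^sup>2 - w)"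

definition admissible :: "real \<Rightarrow> bool" where
  "admissible e \<longleftrightarrow> 0 < e \<and> e \<le> 1 \<and> e \<le> \<kappa> / 16 \<and> e * (C + M) \<le> \<kappa>\<^sup>2 / 10000 \<and> e * (C + M) \<le> \<kappa> / 10000"

lemma ex_admissible: "\<exists>e. admissible e"
proof -
  define q where "q = C + M + 1"
  define A where "A = \<kappa>\<^sup>2 / 10000"
  define D where "D = \<kappa> / 10000"
  define e where "e = min (min 1 (\<kappa> / 16)) (min (A / q) (D / q))"
  have q: "0 < q" "C + M \<le> q" using pos by (auto simp: q_def)
  have AD: "0 < A" "0 < D" using pos by (auto simp: A_def D_def)
  have e: "0 < e" "e \<le> 1" "e \<le> \<kappa> / 16" "e \<le> A / q" "e \<le> D / q"
  proof -
    show "0 < e" using pos q AD by (simp add: e_def)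
  qed (unfold e_def, linarith+)
  have "e * (C + M) \<le> e * q" using e q by (intro mult_left_mono) auto
  moreover have "e * q \<le> A" "e * q \<le> D" using e(4,5) q(1) by (simp_all add: pos_le_divide_eq)
  ultimately show ?thesis using e(1-3) unfolding admissible_def A_def D_def by (intro exI[of _ e]) linarith
qed

lemma curve_inside:
  assumes "a + B (x, y) \<in> S" "norm u \<le> t" "0 < t"
  shows "a + B (curve t x u (\<kappa> * sin \<sigma>) (\<kappa>\<^sup>2 * (1 - cos \<theta>) / 2)) \<in> \<Omega>"
  unfolding curve_def
proof (rule inside[OF assms(1)])
  have "norm ((\<kappa> * sin \<sigma> / t) *\<^sub>R u) = \<kappa> * \<bar>sin \<sigma>\<bar> * (norm u / t)" using pos assms by (simp add: abs_mult)
  also have "\<dots> \<le> \<kappa> * 1 * 1" using pos assms by (intro mult_mono) auto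
  finally show "norm ((\<kappa> * sin \<sigma> / t) *\<^sub>R u) \<le> \<kappa>" by simp
  have "\<kappa>\<^sup>2 * (1 - cos \<theta>) \<le> \<kappa>\<^sup>2 * 2" by (intro mult_left_mono) (use cos_ge_minus_one[of \<theta>] in auto)
  then show "\<kappa>\<^sup>2 * (1 - cos \<theta>) / 2 \<le> \<kappa>\<^sup>2" by simp
qed (simp add: mult_nonneg_nonneg)

text \<open>The frame for \<open>bernstein_point\<close>: Y0 lies on the graph above the point, Y1
  is the tangent vector over u / t, and Y3 points downwards. Then \<beta> is the deviation of the
  chord from the tangent plane, and \<open>ball_sub\<close> bounds it by exactly what the depth
  variable tolerates.\<close>

lemma bernstein_curve:
  assumes P: "P \<in> Polys N" and N: "N \<ge> 1" and r: "r \<ge> 1" and e: "admissible e"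
    and t: "0 < t" "t \<le> e / (2 * real N)" and S: "a + B (x, y) \<in> S"
    and \<eta>: "a + B (x + u, y + b) \<in> rho_ball \<Omega> (a + B (x, y)) t"
  shows "ennreal \<bar>fdiff r ((1 / real r) *\<^sub>R (a + B (x + u, y + b) - (a + B (x, y)))) P (a + B (x, y))\<bar> \<le>
    ennreal (2 * 4 ^ r / e ^ r * (real N * t) ^ r) *
      bern_avg N \<kappa> (depth_angle \<kappa> (f x - y)) (\<lambda>s w. ennreal \<bar>P (a + B (curve t x u s w))\<bar>)"
proof -
  have lin: "linear B" using orth by (rule orthogonal_transformation_linear)
  note e' = e[unfolded admissible_def]
  have "e / (2 * real N) \<le> 1" using e' N by (simp add: divide_le_eq)
  then have t1: "t \<le> 1" using t by linarith
  define w0 where "w0 = f x - y"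
  have w0: "0 \<le> w0" "w0 \<le> \<kappa>\<^sup>2 / 2" using depth[OF S] by (auto simp: w0_def)
  have ub: "norm u \<le> t" "\<bar>b - g x \<bullet> u\<bar> \<le> C * t * (t + sqrt w0)" using ball_sub[OF S t(1) t1 \<eta>]
    by (auto simp: w0_def)
  define Y0 Y1 Y3 where "Y0 = a + B (x, f x)" and "Y1 = B ((1 / t) *\<^sub>R u, (1 / t) * (g x \<bullet> u))"
    and "Y3 = B (0, -1)"
  define \<mu> where "\<mu> = M * (norm u / t)\<^sup>2"
  define \<beta> where "\<beta> = g x \<bullet> u - b"
  have \<mu>: "0 \<le> \<mu>" "\<mu> \<le> M"
  proof -
    show "0 \<le> \<mu>" using pos by (simp add: \<mu>_def)
    have "(norm u / t)\<^sup>2 \<le> 1" using ub t by (intro power_le_one) auto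
    then show "\<mu> \<le> M" unfolding \<mu>_def using pos mult_left_mono[of "(norm u / t)\<^sup>2" 1 M] by simp
  qed
  have base: "Y0 + w0 *\<^sub>R Y3 = a + B (x, y)"
    by (simp add: Y0_def Y3_def w0_def linear_scale[OF lin, symmetric] linear_add[OF lin, symmetric] add.assoc)
  have dir: "t *\<^sub>R Y1 + \<beta> *\<^sub>R Y3 = a + B (x + u, y + b) - (a + B (x, y))"
    using t by (simp add: Y1_def Y3_def \<beta>_def linear_scale[OF lin, symmetric] linear_add[OF lin, symmetric] linear_diff[OF lin, symmetric])
  have crv: "Y0 + s *\<^sub>R Y1 + (w + \<mu> * s\<^sup>2) *\<^sub>R Y3 = a + B (curve t x u s w)" for s w
  proof -
    have "(norm ((s / t) *\<^sub>R u))\<^sup>2 = (norm u / t)\<^sup>2 * s\<^sup>2" by (simp add: power_mult_distrib power_divide)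
    then have "M * (norm ((s / t) *\<^sub>R u))\<^sup>2 = \<mu> * s\<^sup>2" by (simp add: \<mu>_def)
    then have "curve t x u s w = (x + (s / t) *\<^sub>R u, f x + (s / t) * (g x \<bullet> u) - \<mu> * s\<^sup>2 - w)"
      by (simp add: curve_def)
    then show ?thesis
      by (simp add: Y0_def Y1_def Y3_def linear_scale[OF lin, symmetric] linear_add[OF lin, symmetric] linear_diff[OF lin, symmetric] add.assoc algebra_simps)
  qed
  have "\<bar>\<beta>\<bar> \<le> C * t * (t + sqrt w0)" using ub(2) by (simp add: \<beta>_def abs_minus_commute)
  from bernstein_point[OF P N r pos(1) pos(4) \<mu> _ _ _ _ _ t w0 this, of Y1 Y3 Y0] e'
  show ?thesis unfolding base dir crv depth_angle_eq[OF pos(1) w0, folded w0_def] w0_def[symmetric] by blast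
qed

text \<open>The pointwise form, for the uniform norm: the kernels have joint mass at most the square
  of \<open>Kc\<close>, so a supremum over the domain passes through the average.\<close>

lemma bernstein_sup:
  assumes P: "P \<in> Polys N" and N: "N \<ge> 1" and r: "r \<ge> 1" and e: "admissible e"
    and t: "0 < t" "t \<le> e / (2 * real N)" and \<xi>: "\<xi> \<in> S" and \<eta>: "\<eta> \<in> rho_ball \<Omega> \<xi> t"
    and bd: "\<And>z. z \<in> \<Omega> \<Longrightarrow> ennreal \<bar>P z\<bar> \<le> A"
  shows "ennreal \<bar>fdiff r ((1 / real r) *\<^sub>R (\<eta> - \<xi>)) P \<xi>\<bar> \<le>
    ennreal (2 * 4 ^ r / e ^ r * (real N * t) ^ r) * (ennreal (Kc\<^sup>2) * A)"
proof -
  obtain x y where xy: "\<xi> = a + B (x, y)" by (rule coords)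
  obtain x' y' where "\<eta> = a + B (x', y')" by (rule coords)
  then obtain u b where ub: "\<eta> = a + B (x + u, y + b)" by (metis add.commute diff_add_cancel)
  have "e / (2 * real N) \<le> 1" using e[unfolded admissible_def] N by (simp add: divide_le_eq)
  then have t1: "t \<le> 1" using t by linarith
  have S: "a + B (x, y) \<in> S" using \<xi> xy by simp
  have u: "norm u \<le> t" using ball_sub[OF S t(1) t1 \<eta>[unfolded xy ub]] by simp
  have "bern_avg N \<kappa> (depth_angle \<kappa> (f x - y)) (\<lambda>s w. ennreal \<bar>P (a + B (curve t x u s w))\<bar>) \<le>
    bern_avg N \<kappa> (depth_angle \<kappa> (f x - y)) (\<lambda>_ _. A)"
    by (intro bern_avg_mono bd curve_inside[OF S u t(1)])
  also have "\<dots> \<le> ennreal (Kc\<^sup>2) * A" by (intro bern_avg_const N depth_angle_bounds)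
  finally show ?thesis
    using bernstein_curve[OF P N r e t S \<eta>[unfolded xy ub]] unfolding xy ub
    by (meson mult_left_mono order_trans zero_le)
qed

lemma curve_measurable [measurable (raw)]:
  assumes [measurable]: "X \<in> measurable N borel" "U \<in> measurable N borel" "s \<in> borel_measurable N" "w \<in> borel_measurable N"
  shows "(\<lambda>z. curve t (X z) (U z) (s z) (w z)) \<in> measurable N (borel \<Otimes>\<^sub>M borel)"
  unfolding curve_def by measurable

text \<open>The majorant G is compared with P on the domain only, so it may be zero outside. This
  suffices because, by \<open>curve_inside\<close>, the average never leaves the domain.\<close>

lemma bernstein_powr:
  fixes p :: real
  assumes P: "P \<in> Polys N" and N: "N \<ge> 1" and r: "r \<ge> 1" and e: "admissible e"
    and t: "0 < t" "t \<le> e / (2 * real N)" and S: "a + B (x, y) \<in> S"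
    and \<eta>: "a + B (x + u, y + b) \<in> rho_ball \<Omega> (a + B (x, y)) t"
    and Pm: "P \<in> borel_measurable borel" and p: "1 \<le> p"
    and G: "\<And>z. z \<in> \<Omega> \<Longrightarrow> ennreal (\<bar>P z\<bar> powr p) \<le> G z"
  shows "ennreal (\<bar>fdiff r ((1 / real r) *\<^sub>R (a + B (x + u, y + b) - (a + B (x, y)))) P (a +
    B (x, y))\<bar> powr p) \<le>
    ennreal ((2 * 4 ^ r / e ^ r * (real N * t) ^ r * (Kc\<^sup>2 + 1)) powr p) *
      bern_avg N \<kappa> (depth_angle \<kappa> (f x - y)) (\<lambda>s w. G (a + B (curve t x u s w)))"
proof -
  let ?D = "\<bar>fdiff r ((1 / real r) *\<^sub>R (a + B (x + u, y + b) - (a + B (x, y)))) P (a + B (x, y))\<bar>"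
  define K where "K = 2 * 4 ^ r / e ^ r * (real N * t) ^ r"
  have e0: "0 < e" using e by (simp add: admissible_def)
  have K: "0 < K" unfolding K_def using e0 t N by (intro mult_pos_pos divide_pos_pos) auto
  have "e / (2 * real N) \<le> 1" using e[unfolded admissible_def] N by (simp add: divide_le_eq)
  then have t1: "t \<le> 1" using t by linarith
  have u: "norm u \<le> t" using ball_sub[OF S t(1) t1 \<eta>] by simp
  have KK: "0 < Kc\<^sup>2 + 1" by (intro add_nonneg_pos) auto
  note [measurable] = orthogonal_transformation_borel(2)[OF orth] Pm
  have Hm: "case_prod (\<lambda>s w. \<bar>P (a + B (curve t x u s w))\<bar>) \<in> borel_measurable (borel \<Otimes>\<^sub>M borel)"
  proof -
    have "(\<lambda>z. \<bar>P (a + B z)\<bar>) \<in> borel_measurable borel" by measurable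
    then have [measurable]: "(\<lambda>z. \<bar>P (a + B z)\<bar>) \<in> borel_measurable (borel \<Otimes>\<^sub>M borel)"
      by (simp only: borel_prod)
    have "(\<lambda>z. \<bar>P (a + B (curve t x u (fst z) (snd z)))\<bar>) \<in> borel_measurable (borel \<Otimes>\<^sub>M borel)" by measurable
    then show ?thesis by (simp only: split_beta')
  qed
  show ?thesis unfolding K_def[symmetric]
  proof (rule ennreal_le_by_reals)
    show "0 < (K * (Kc\<^sup>2 + 1)) powr p" using K KK by simp
    fix z :: real
    assume z: "0 < z" "bern_avg N \<kappa> (depth_angle \<kappa> (f x - y)) (\<lambda>s w. G (a + B (curve t x u s w))) \<le> ennreal z"
    have "bern_avg N \<kappa> (depth_angle \<kappa> (f x - y)) (\<lambda>s w. ennreal (\<bar>P (a + B (curve t x u s w))\<bar> powr p)) \<le>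
      ennreal z"
      by (rule order_trans[OF bern_avg_mono z(2)]) (intro G curve_inside[OF S u t(1)])
    from bern_avg_powr[OF Hm _ p N depth_angle_bounds z(1) this]
    have "bern_avg N \<kappa> (depth_angle \<kappa> (f x - y)) (\<lambda>s w. ennreal \<bar>P (a + B (curve t x u s w))\<bar>) \<le>
      ennreal ((Kc\<^sup>2 + 1) * z powr (1 / p))" by simp
    then have "ennreal ?D \<le> ennreal K * ennreal ((Kc\<^sup>2 + 1) * z powr (1 / p))"
      using bernstein_curve[OF P N r e t S \<eta>, folded K_def] by (meson mult_left_mono order_trans zero_le)
    also have "\<dots> = ennreal (K * (Kc\<^sup>2 + 1) * z powr (1 / p))" using K KK z
      by (simp add: ennreal_mult[symmetric] mult.assoc)
    finally have "?D \<le> K * (Kc\<^sup>2 + 1) * z powr (1 / p)" using K KK by (subst (asm) ennreal_le_iff) auto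
    then have "?D powr p \<le> (K * (Kc\<^sup>2 + 1) * z powr (1 / p)) powr p" using p by (intro powr_mono2) auto
    also have "\<dots> = (K * (Kc\<^sup>2 + 1)) powr p * z" using K KK z p by (simp add: powr_mult powr_powr)
    finally show "?D powr p \<le> (K * (Kc\<^sup>2 + 1)) powr p * z" .
  qed
qed

lemma nn_integral_chi_slab:
  assumes "0 \<le> f x - y" "0 < t"
  shows "ennreal (1 / (t * (t + sqrt (f x - y)))) * (\<integral>\<^sup>+b. chi_slab t x y u b \<partial>lborel) \<le> ennreal (2 * C)"
proof -
  define L where "L = C * t * (t + sqrt (f x - y))"
  have L: "0 \<le> L" using pos assms by (simp add: L_def)
  have "chi_slab t x y u = indicator {g x \<bullet> u - L..g x \<bullet> u + L}"
    by (auto simp: fun_eq_iff chi_slab_def L_def indicator_def)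
  then have "(\<integral>\<^sup>+b. chi_slab t x y u b \<partial>lborel) = ennreal (2 * L)" using L by simp
  then have "ennreal (1 / (t * (t + sqrt (f x - y)))) * (\<integral>\<^sup>+b. chi_slab t x y u b \<partial>lborel) =
    ennreal (1 / (t * (t + sqrt (f x - y))) * (2 * L))"
    using L assms by (simp add: ennreal_mult[symmetric])
  also have "1 / (t * (t + sqrt (f x - y))) * (2 * L) = 2 * C"
  proof -
    have "t + sqrt (f x - y) \<noteq> 0" using assms by (smt (verit) real_sqrt_ge_zero)
    then show ?thesis using assms by (simp add: L_def)
  qed
  finally show ?thesis by simp
qed

lemma nker_depth_chi:
  assumes "N \<ge> 1" "\<theta> \<in> {-pi..pi}"
  shows "(\<integral>\<^sup>+y. chi_depth x y * ennreal (nker N (depth_angle \<kappa> (f x - y)) \<theta>) \<partial>lborel) \<le>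
    ennreal (\<kappa>\<^sup>2 / 2 * \<bar>sin \<theta>\<bar>) * ennreal Kc"
proof -
  have [measurable]: "(\<lambda>w. nker N (depth_angle \<kappa> w) \<theta>) \<in> borel_measurable borel" unfolding nker_def by measurable
  define h where "h w = ennreal (nker N (depth_angle \<kappa> w) \<theta>) * indicator {0..\<kappa>\<^sup>2 / 2} w" for w
  have [measurable]: "h \<in> borel_measurable borel" unfolding h_def by measurable
  have "(\<integral>\<^sup>+y. chi_depth x y * ennreal (nker N (depth_angle \<kappa> (f x - y)) \<theta>) \<partial>lborel) =
    (\<integral>\<^sup>+y. h (f x - y) \<partial>lborel)"
    by (intro nn_integral_cong) (auto simp: chi_depth_def h_def indicator_def)
  also have "\<dots> = (\<integral>\<^sup>+y. h y \<partial>lborel)" by (rule nn_integral_lborel_reflect) measurable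
  also have "\<dots> \<le> ennreal (\<kappa>\<^sup>2 / 2 * (Kc * \<bar>sin \<theta>\<bar>))" unfolding h_def by (intro nker_depth assms pos)
  also have "\<dots> = ennreal (\<kappa>\<^sup>2 / 2 * \<bar>sin \<theta>\<bar>) * ennreal Kc"
    using Kc_pos by (subst ennreal_mult[symmetric]) (auto simp: mult_ac)
  finally show ?thesis .
qed

text \<open>The points of the curve do not depend on y; only the depth angle does. So y is
  integrated first, and \<open>nker_depth_chi\<close> leaves the Jacobian of the depth substitution,
  which converts the integral over \<theta> into one over heights. After that x is translated by the
  tangential shift, and only the mass of \<open>tker\<close> remains.\<close>

lemma bern_avg_depth_integral:
  assumes N: "N \<ge> 1" and G: "G \<in> borel_measurable borel"
  shows "(\<integral>\<^sup>+x. \<integral>\<^sup>+y. chi_depth x y * bern_avg N \<kappa> (depth_angle \<kappa> (f x - y)) (\<lambda>s w. G (a +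
    B (curve t x u s w))) \<partial>lborel \<partial>lborel)
    \<le> ennreal (2 * Kc\<^sup>2) * (\<integral>\<^sup>+z. G z \<partial>lborel)"
proof -
  define T where "T \<sigma> = ennreal (tker (2 * N) \<sigma>) * indicator {-pi..pi} \<sigma>" for \<sigma>
  define I where "I \<theta> = (indicator {-pi..pi} \<theta> :: ennreal)" for \<theta> :: real
  define v where "v \<sigma> = (\<kappa> * sin \<sigma> / t) *\<^sub>R u" for \<sigma>
  define h where "h x \<sigma> = f x + g x \<bullet> v \<sigma> - M * (norm (v \<sigma>))\<^sup>2" for x \<sigma>
  define W where "W \<theta> = \<kappa>\<^sup>2 * (1 - cos \<theta>) / 2" for \<theta>
  note [measurable] = pull_measurable[OF G]
  have [measurable]: "T \<in> borel_measurable borel" "I \<in> borel_measurable borel" "v \<in> borel_measurable borel"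
     "W \<in> borel_measurable borel" "case_prod h \<in> borel_measurable (borel \<Otimes>\<^sub>M borel)"
    unfolding T_def [abs_def] I_def [abs_def] v_def [abs_def] W_def [abs_def] h_def [abs_def] by measurable
  have "(\<integral>\<^sup>+x. \<integral>\<^sup>+y. chi_depth x y * bern_avg N \<kappa> (depth_angle \<kappa> (f x - y)) (\<lambda>s w. G (a +
    B (curve t x u s w))) \<partial>lborel \<partial>lborel) =
    (\<integral>\<^sup>+x. \<integral>\<^sup>+y. chi_depth x y * (\<integral>\<^sup>+\<sigma>. T \<sigma> * (\<integral>\<^sup>+\<theta>. ennreal (nker N (depth_angle \<kappa> (f x - y)) \<theta>) * I \<theta> *
      pull G (x + v \<sigma>) (h x \<sigma> - W \<theta>) \<partial>lborel) \<partial>lborel) \<partial>lborel \<partial>lborel)"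
    unfolding bern_avg_def T_def I_def v_def h_def W_def pull_def curve_def ..
  also have "\<dots> = (\<integral>\<^sup>+x. \<integral>\<^sup>+y. (\<integral>\<^sup>+\<sigma>. \<integral>\<^sup>+\<theta>. T \<sigma> * (I \<theta> * pull G (x + v \<sigma>) (h x \<sigma> - W \<theta>)) *
    (chi_depth x y * ennreal (nker N (depth_angle \<kappa> (f x - y)) \<theta>)) \<partial>lborel \<partial>lborel) \<partial>lborel \<partial>lborel)"
    by (simp add: nn_integral_cmult[symmetric] mult_ac)
  also have "\<dots> = (\<integral>\<^sup>+x. \<integral>\<^sup>+\<sigma>. (\<integral>\<^sup>+y. \<integral>\<^sup>+\<theta>. T \<sigma> * (I \<theta> * pull G (x + v \<sigma>) (h x \<sigma> - W \<theta>)) *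
    (chi_depth x y * ennreal (nker N (depth_angle \<kappa> (f x - y)) \<theta>)) \<partial>lborel \<partial>lborel) \<partial>lborel \<partial>lborel)"
    by (intro nn_integral_cong lborel_pair.Fubini') measurable
  also have "\<dots> = (\<integral>\<^sup>+x. \<integral>\<^sup>+\<sigma>. (\<integral>\<^sup>+\<theta>. \<integral>\<^sup>+y. T \<sigma> * (I \<theta> * pull G (x + v \<sigma>) (h x \<sigma> - W \<theta>)) *
    (chi_depth x y * ennreal (nker N (depth_angle \<kappa> (f x - y)) \<theta>)) \<partial>lborel \<partial>lborel) \<partial>lborel \<partial>lborel)"
    by (intro nn_integral_cong lborel_pair.Fubini') measurable
  also have "\<dots> = (\<integral>\<^sup>+x. \<integral>\<^sup>+\<sigma>. (\<integral>\<^sup>+\<theta>. T \<sigma> * (I \<theta> * pull G (x + v \<sigma>) (h x \<sigma> - W \<theta>)) *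
    (\<integral>\<^sup>+y. chi_depth x y * ennreal (nker N (depth_angle \<kappa> (f x - y)) \<theta>) \<partial>lborel) \<partial>lborel) \<partial>lborel \<partial>lborel)"
    by (intro nn_integral_cong nn_integral_cmult) measurable
  also have "\<dots> \<le> (\<integral>\<^sup>+x. \<integral>\<^sup>+\<sigma>. (\<integral>\<^sup>+\<theta>. T \<sigma> * (I \<theta> * pull G (x + v \<sigma>) (h x \<sigma> - W \<theta>)) *
    (ennreal (\<kappa>\<^sup>2 / 2 * \<bar>sin \<theta>\<bar>) * ennreal Kc) \<partial>lborel) \<partial>lborel \<partial>lborel)"
  proof (intro nn_integral_mono)
    fix x \<sigma> \<theta>
    show "T \<sigma> * (I \<theta> * pull G (x + v \<sigma>) (h x \<sigma> - W \<theta>)) *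
      (\<integral>\<^sup>+y. chi_depth x y * ennreal (nker N (depth_angle \<kappa> (f x - y)) \<theta>) \<partial>lborel)
      \<le> T \<sigma> * (I \<theta> * pull G (x + v \<sigma>) (h x \<sigma> - W \<theta>)) * (ennreal (\<kappa>\<^sup>2 / 2 * \<bar>sin \<theta>\<bar>) * ennreal Kc)"
    proof (cases "\<theta> \<in> {-pi..pi}")
      case True
      show ?thesis by (intro mult_left_mono nker_depth_chi N True) simp
    qed (simp add: I_def)
  qed
  also have "\<dots> = (\<integral>\<^sup>+x. \<integral>\<^sup>+\<sigma>. T \<sigma> * (ennreal Kc *
    (\<integral>\<^sup>+\<theta>. I \<theta> * ennreal (\<kappa>\<^sup>2 / 2 * \<bar>sin \<theta>\<bar>) * pull G (x + v \<sigma>) (h x \<sigma> - W \<theta>) \<partial>lborel)) \<partial>lborel \<partial>lborel)"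
    by (simp add: nn_integral_cmult[symmetric] mult_ac)
  also have "\<dots> \<le> (\<integral>\<^sup>+x. \<integral>\<^sup>+\<sigma>. T \<sigma> * (ennreal Kc * (2 * (\<integral>\<^sup>+y. pull G (x + v \<sigma>) y \<partial>lborel))) \<partial>lborel \<partial>lborel)"
  proof (intro nn_integral_mono mult_left_mono)
    fix x \<sigma>
    have "(\<integral>\<^sup>+\<theta>. I \<theta> * ennreal (\<kappa>\<^sup>2 / 2 * \<bar>sin \<theta>\<bar>) * pull G (x + v \<sigma>) (h x \<sigma> - W \<theta>) \<partial>lborel) \<le>
      2 * (\<integral>\<^sup>+w. pull G (x + v \<sigma>) (h x \<sigma> - w) \<partial>lborel)"
      unfolding I_def W_def by (rule sin_weight_integral) (use pos in measurable)
    also have "(\<integral>\<^sup>+w. pull G (x + v \<sigma>) (h x \<sigma> - w) \<partial>lborel) = (\<integral>\<^sup>+y. pull G (x + v \<sigma>) y \<partial>lborel)"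
      by (rule nn_integral_lborel_reflect) measurable
    finally show "(\<integral>\<^sup>+\<theta>. I \<theta> * ennreal (\<kappa>\<^sup>2 / 2 * \<bar>sin \<theta>\<bar>) * pull G (x + v \<sigma>) (h x \<sigma> - W \<theta>) \<partial>lborel) \<le>
      2 * (\<integral>\<^sup>+y. pull G (x + v \<sigma>) y \<partial>lborel)" .
  qed auto
  also have "\<dots> = (\<integral>\<^sup>+\<sigma>. \<integral>\<^sup>+x. T \<sigma> * (ennreal Kc * (2 * (\<integral>\<^sup>+y. pull G (x + v \<sigma>) y \<partial>lborel))) \<partial>lborel \<partial>lborel)"
    by (rule lborel_pair.Fubini') measurable
  also have "\<dots> = (\<integral>\<^sup>+\<sigma>. T \<sigma> * (ennreal Kc * (2 * (\<integral>\<^sup>+x. \<integral>\<^sup>+y. pull G (x + v \<sigma>) y \<partial>lborel \<partial>lborel))) \<partial>lborel)"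
    by (simp add: nn_integral_cmult)
  also have "\<dots> = circ (tker (2 * N)) * (ennreal Kc * (2 * (\<integral>\<^sup>+z. G z \<partial>lborel)))"
    unfolding nn_integral_pull[OF G] T_def circ_def by (rule nn_integral_multc) measurable
  also have "\<dots> \<le> ennreal Kc * (ennreal Kc * (2 * (\<integral>\<^sup>+z. G z \<partial>lborel)))"
    using N by (intro mult_right_mono circ_tker) auto
  also have "\<dots> = ennreal (2 * Kc\<^sup>2) * (\<integral>\<^sup>+z. G z \<partial>lborel)"
  proof -
    have "ennreal (2 * Kc\<^sup>2) = ennreal Kc * (ennreal Kc * ennreal 2)"
      using Kc_pos by (simp only: ennreal_mult[symmetric] power2_eq_square less_imp_le mult_nonneg_nonneg zero_le_numeral mult_ac)
    then show ?thesis by (simp add: mult.assoc)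
  qed
  finally show ?thesis .
qed

lemma bernstein_average:
  fixes p :: real
  assumes P: "P \<in> Polys N" and N: "N \<ge> 1" and r: "r \<ge> 1" and e: "admissible e"
    and t: "0 < t" "t \<le> e / (2 * real N)"
    and Pm: "P \<in> borel_measurable borel" and p: "1 \<le> p"
    and Gm: "G \<in> borel_measurable borel" and G: "\<And>z. z \<in> \<Omega> \<Longrightarrow> ennreal (\<bar>P z\<bar> powr p) \<le> G z"
  shows "avg_int \<Omega> S t (\<lambda>\<xi> \<eta>. ennreal (\<bar>fdiff r ((1 / real r) *\<^sub>R (\<eta> - \<xi>)) P \<xi>\<bar> powr p)) \<le>
    ennreal (unit_ball_vol CARD('d) / c) * (ennreal (2 * C) * (ennreal ((2 * 4 ^ r / e ^ r *
      (real N * t) ^ r * (Kc\<^sup>2 + 1)) powr p) *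
      (ennreal (2 * Kc\<^sup>2) * (\<integral>\<^sup>+z. G z \<partial>lborel))))"
proof -
  define K where "K = ennreal ((2 * 4 ^ r / e ^ r * (real N * t) ^ r * (Kc\<^sup>2 + 1)) powr p)"
  define BA where "BA x y u = bern_avg N \<kappa> (depth_angle \<kappa> (f x - y)) (\<lambda>s w. G (a + B (curve t x u s w)))"
    for x y u
  have "e / (2 * real N) \<le> 1" using e[unfolded admissible_def] N by (simp add: divide_le_eq)
  then have t1: "t \<le> 1" using t by linarith
  have [measurable]: "(\<lambda>z. G (a + B z)) \<in> borel_measurable (borel \<Otimes>\<^sub>M borel)"
    using pull_measurable[OF Gm] by (simp add: pull_def split_beta')
  have BAm [measurable (raw)]: "(\<lambda>z. BA (X z) (Y z) (U z)) \<in> borel_measurable Q"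
    if [measurable]: "X \<in> measurable Q borel" "Y \<in> borel_measurable Q" "U \<in> measurable Q borel" for X Y U
      and Q :: "'q measure"
    unfolding BA_def bern_avg_def by measurable
  show ?thesis unfolding K_def[symmetric]
  proof (rule avg_int_le[OF t(1) t1, of "\<lambda>(x, y, u, b). K * BA x y u", unfolded prod.case])
    show "(\<lambda>(x, y, u, b). K * BA x y u) \<in> borel_measurable (borel \<Otimes>\<^sub>M borel \<Otimes>\<^sub>M borel \<Otimes>\<^sub>M borel)"
      by measurable
    fix x y u b
    assume "a + B (x, y) \<in> S" "a + B (x + u, y + b) \<in> rho_ball \<Omega> (a + B (x, y)) t"
    from bernstein_powr[OF P N r e t this Pm p G]
    show "ennreal (\<bar>fdiff r ((1 / real r) *\<^sub>R (a + B (x + u, y + b) - (a + B (x, y)))) P (a +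
      B (x, y))\<bar> powr p) \<le> K * BA x y u"
      by (simp add: K_def BA_def)
  next
    fix u :: "real ^ 'd"
    have "(\<integral>\<^sup>+x. \<integral>\<^sup>+y. chi_depth x y * ennreal (1 / (t * (t + sqrt (f x - y)))) * (\<integral>\<^sup>+b. chi_slab t x y u b *
      (K * BA x y u) \<partial>lborel) \<partial>lborel \<partial>lborel)
      \<le> (\<integral>\<^sup>+x. \<integral>\<^sup>+y. ennreal (2 * C) * (K * (chi_depth x y * BA x y u)) \<partial>lborel \<partial>lborel)"
    proof (intro nn_integral_mono)
      fix x :: "real ^ 'd" and y :: real
      show "chi_depth x y * ennreal (1 / (t * (t + sqrt (f x - y)))) * (\<integral>\<^sup>+b. chi_slab t x y u b *
        (K * BA x y u) \<partial>lborel) \<le> ennreal (2 * C) * (K * (chi_depth x y * BA x y u))"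
      proof (cases "0 \<le> f x - y")
        case True
        have "(\<integral>\<^sup>+b. chi_slab t x y u b * (K * BA x y u) \<partial>lborel) =
          (\<integral>\<^sup>+b. chi_slab t x y u b \<partial>lborel) * (K * BA x y u)"
          by (rule nn_integral_multc) measurable
        then have "chi_depth x y * ennreal (1 / (t * (t + sqrt (f x - y)))) * (\<integral>\<^sup>+b. chi_slab t x y u b *
          (K * BA x y u) \<partial>lborel)
          = (ennreal (1 / (t * (t + sqrt (f x - y)))) * (\<integral>\<^sup>+b. chi_slab t x y u b \<partial>lborel)) * (K *
            (chi_depth x y * BA x y u))"
          by (simp add: mult_ac)
        also have "\<dots> \<le> ennreal (2 * C) * (K * (chi_depth x y * BA x y u))"
          by (intro mult_right_mono nn_integral_chi_slab True t) simp
        finally show ?thesis .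
      qed (simp add: chi_depth_def)
    qed
    also have "\<dots> = ennreal (2 * C) * (K * (\<integral>\<^sup>+x. \<integral>\<^sup>+y. chi_depth x y * BA x y u \<partial>lborel \<partial>lborel))"
      by (simp add: nn_integral_cmult)
    also have "\<dots> \<le> ennreal (2 * C) * (K * (ennreal (2 * Kc\<^sup>2) * (\<integral>\<^sup>+z. G z \<partial>lborel)))"
      unfolding BA_def by (intro mult_left_mono bern_avg_depth_integral N Gm) auto
    finally show "(\<integral>\<^sup>+x. \<integral>\<^sup>+y. chi_depth x y * ennreal (1 / (t * (t + sqrt (f x - y)))) *
      (\<integral>\<^sup>+b. chi_slab t x y u b * (K * BA x y u) \<partial>lborel) \<partial>lborel \<partial>lborel)
      \<le> ennreal (2 * C) * (K * (ennreal (2 * Kc\<^sup>2) * (\<integral>\<^sup>+z. G z \<partial>lborel)))" .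
  qed
qed

end

section \<open>Boundary charts\<close>

lemma partial_line_derivative:
  assumes "\<And>x. (\<lambda>t. h (x + t *\<^sub>R axis i 1)) differentiable (at 0)"
  shows "((\<lambda>t. h (x + t *\<^sub>R axis i 1)) has_real_derivative partial i h (x + t *\<^sub>R axis i 1)) (at t)"
proof -
  have "((\<lambda>s. h ((x + t *\<^sub>R axis i 1) + s *\<^sub>R axis i 1)) has_real_derivative partial i h (x +
    t *\<^sub>R axis i 1)) (at 0)"
    unfolding partial_def using assms[of "x + t *\<^sub>R axis i 1"]
    by (simp add: DERIV_deriv_iff_real_differentiable)
  then have "((\<lambda>s. h (x + (s + t) *\<^sub>R axis i 1)) has_real_derivative partial i h (x + t *\<^sub>R axis i 1)) (at 0)"
    by (simp add: scaleR_add_left add_ac)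
  then show ?thesis
    using DERIV_shift[of "\<lambda>s. h (x + s *\<^sub>R axis i 1)" "partial i h (x + t *\<^sub>R axis i 1)" 0 t] by simp
qed

text \<open>Moving from \<open>x\<close> to \<open>y\<close> one coordinate at a time avoids differentiability in the sense of Frechet.\<close>

lemma partial_bounded_imp_lipschitz_aux:
  fixes h :: "real ^ 'd \<Rightarrow> real"
  assumes diff: "\<And>i x. (\<lambda>t. h (x + t *\<^sub>R axis i 1)) differentiable (at 0)"
    and bd: "\<And>i z. z \<in> cbox lo hi \<Longrightarrow> \<bar>partial i h z\<bar> \<le> M" and I: "finite I"
  shows "x \<in> cbox lo hi \<Longrightarrow> y \<in> cbox lo hi \<Longrightarrow> (\<And>i. i \<notin> I \<Longrightarrow> x $ i = y $ i) \<Longrightarrow>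
    \<bar>h x - h y\<bar> \<le> real (card I) * (M * norm (x - y))"
  using I
proof (induction I arbitrary: x)
  case empty
  then have "x = y" by (simp add: vec_eq_iff)
  then show ?case by simp
next
  case (insert i I)
  define z where "z = x + (y $ i - x $ i) *\<^sub>R axis i 1"
  have zi: "z $ j = (if j = i then y $ i else x $ j)" for j by (simp add: z_def axis_def)
  have M0: "0 \<le> M" using bd[OF insert.prems(1)] abs_ge_zero order_trans by blast
  have zb: "z \<in> cbox lo hi" using insert.prems(1,2) by (auto simp: mem_box_cart zi)
  have "norm (z - y) \<le> norm (x - y)"
    by (rule norm_le_componentwise_cart) (simp add: zi)
  then have IH: "\<bar>h z - h y\<bar> \<le> real (card I) * (M * norm (x - y))"
    using insert.IH[OF zb insert.prems(2)] insert.prems(3) zi M0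
    by (smt (verit) insert_iff mult_left_mono of_nat_0_le_iff)
  have "\<bar>h x - h z\<bar> \<le> M * norm (x - y)"
  proof -
    define \<phi> where "\<phi> t = h (x + t *\<^sub>R axis i 1)" for t
    define \<Delta> where "\<Delta> = y $ i - x $ i"
    have "norm (\<phi> \<Delta> - \<phi> 0) \<le> M * norm (\<Delta> - 0)"
    proof (rule field_differentiable_bound[where S = "closed_segment 0 \<Delta>"
      and f' = "\<lambda>t. partial i h (x + t *\<^sub>R axis i 1)"])
      fix t assume t: "t \<in> closed_segment 0 \<Delta>"
      show "(\<phi> has_field_derivative partial i h (x + t *\<^sub>R axis i 1)) (at t within closed_segment 0 \<Delta>)"
        unfolding \<phi>_def by (rule has_field_derivative_at_within[OF partial_line_derivative[OF diff]])
      have "x + t *\<^sub>R axis i 1 \<in> cbox lo hi"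
        unfolding mem_box_cart
      proof
        fix j
        have ti: "min (x $ i) (y $ i) \<le> x $ i + t \<and> x $ i + t \<le> max (x $ i) (y $ i)"
          using t by (auto simp: \<Delta>_def closed_segment_eq_real_ivl split: if_splits)
        have "lo $ j \<le> x $ j \<and> x $ j \<le> hi $ j" "lo $ j \<le> y $ j \<and> y $ j \<le> hi $ j"
          using insert.prems(1,2) by (auto simp: mem_box_cart)
        then show "lo $ j \<le> (x + t *\<^sub>R axis i 1) $ j \<and> (x + t *\<^sub>R axis i 1) $ j \<le> hi $ j"
          using ti by (cases "j = i") (auto simp: axis_def)
      qed
      then show "norm (partial i h (x + t *\<^sub>R axis i 1)) \<le> M" using bd by simp
    qed auto
    moreover have "\<phi> \<Delta> = h z" "\<phi> 0 = h x" by (auto simp: \<phi>_def z_def \<Delta>_def)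
    moreover have "\<bar>\<Delta>\<bar> \<le> norm (x - y)" using component_le_norm_cart[of "x - y" i]
      by (simp add: \<Delta>_def abs_minus_commute)
    ultimately show ?thesis using M0 mult_left_mono[of "\<bar>\<Delta>\<bar>" "norm (x - y)" M] by (simp add: abs_minus_commute)
  qed
  then have "\<bar>h x - h y\<bar> \<le> M * norm (x - y) + real (card I) * (M * norm (x - y))" using IH by linarith
  also have "\<dots> = real (card (insert i I)) * (M * norm (x - y))" using insert.hyps by (simp add: algebra_simps)
  finally show ?case .
qed

lemma partial_bounded_imp_lipschitz:
  fixes h :: "real ^ 'd \<Rightarrow> real"
  assumes diff: "\<And>i x. (\<lambda>t. h (x + t *\<^sub>R axis i 1)) differentiable (at 0)"
    and bd: "\<And>i z. norm (z - p) \<le> norm u \<Longrightarrow> \<bar>partial i h z\<bar> \<le> M"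
  shows "\<bar>h (p + u) - h p\<bar> \<le> real CARD('d) * (M * norm u)"
proof -
  \<comment> \<open>The coordinatewise path stays in the box between p - v and p + v, and no point
    of this box is farther from p than p + u is.\<close>
  define v :: "real ^ 'd" where "v = (\<chi> i. \<bar>u $ i\<bar>)"
  have in_box: "norm (z - p) \<le> norm u" if "z \<in> cbox (p - v) (p + v)" for z
  proof (rule norm_le_componentwise_cart)
    fix i
    have "p $ i - \<bar>u $ i\<bar> \<le> z $ i \<and> z $ i \<le> p $ i + \<bar>u $ i\<bar>" using that by (auto simp: mem_box_cart v_def)
    then show "norm ((z - p) $ i) \<le> norm (u $ i)" by auto
  qed
  have "\<bar>h (p + u) - h p\<bar> \<le> real (card (UNIV :: 'd set)) * (M * norm (p + u - p))"
  proof (rule partial_bounded_imp_lipschitz_aux[OF diff])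
    show "\<bar>partial i h z\<bar> \<le> M" if "z \<in> cbox (p - v) (p + v)" for i z using bd in_box that by blast
    show "p + u \<in> cbox (p - v) (p + v)" unfolding mem_box_cart v_def
      by (auto intro: abs_ge_self abs_ge_minus_self)
    show "p \<in> cbox (p - v) (p + v)" by (auto simp: mem_box_cart v_def)
  qed auto
  then show ?thesis by simp
qed

text \<open>All that is retained of the class C^2: a Lipschitz gradient field and a quadratic
  remainder, with one constant for both. The field g is carried as data, so that a Frechet
  derivative of f is never formed.\<close>

definition taylor_bound :: "(real ^ 'd \<Rightarrow> real) \<Rightarrow> (real ^ 'd \<Rightarrow> real ^ 'd) \<Rightarrow> real \<Rightarrow> bool" where
  "taylor_bound f g M \<longleftrightarrow> 0 \<le> M \<and> (\<forall>x u. \<bar>f (x + u) - f x - g x \<bullet> u\<bar> \<le> M * (norm u)\<^sup>2) \<and>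
     (\<forall>x y. norm (g x - g y) \<le> M * norm (x - y))"

lemma class_C2_taylor_bound:
  fixes f :: "real ^ 'd \<Rightarrow> real"
  assumes f: "class_C 2 f" and bd: "\<And>i k x. \<bar>partial i (partial k f) x\<bar> \<le> M"
  shows "\<exists>g M'. taylor_bound f g M'"
proof -
  have d1: "(\<lambda>t. f (x + t *\<^sub>R axis i 1)) differentiable (at 0)" for i x
    using f by (simp add: numeral_2_eq_2)
  have d2: "(\<lambda>t. partial k f (x + t *\<^sub>R axis i 1)) differentiable (at 0)" for i k x
    using f by (simp add: numeral_2_eq_2)
  have M0: "0 \<le> M" using bd abs_ge_zero order_trans by blast
  define n where "n = real CARD('d)"
  have n1: "1 \<le> n" by (simp add: n_def Suc_leI)
  define g where "g x = (\<chi> i. partial i f x)" for x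
  have lip: "\<bar>partial k f x - partial k f y\<bar> \<le> n * (M * norm (x - y))" for k x y
    using partial_bounded_imp_lipschitz[OF d2 bd, of k y "x - y"] by (simp add: n_def)
  have glip: "norm (g x - g y) \<le> n * (n * M) * norm (x - y)" for x y
  proof -
    have "norm (g x - g y) \<le> (\<Sum>i\<in>UNIV. \<bar>(g x - g y) $ i\<bar>)" by (rule norm_le_l1_cart)
    also have "\<dots> \<le> (\<Sum>i\<in>(UNIV::'d set). n * (M * norm (x - y)))"
      using lip by (intro sum_mono) (simp add: g_def)
    also have "\<dots> = n * (n * M) * norm (x - y)" by (simp add: n_def)
    finally show ?thesis .
  qed
  have tay: "\<bar>f (p + u) - f p - g p \<bullet> u\<bar> \<le> n * (n * M) * (norm u)\<^sup>2" for p u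
  proof -
    \<comment> \<open>Remove the linear part at p. On the ball of radius |u| the partial derivatives
      of h are at most n M |u|, so a Lipschitz estimate for h is a quadratic remainder for
      f.\<close>
    define h where "h z = f z - g p \<bullet> z" for z
    have dh: "((\<lambda>t. h (x + t *\<^sub>R axis i 1)) has_real_derivative partial i f x - g p $ i) (at 0)" for x i
    proof -
      have "((\<lambda>t. f (x + t *\<^sub>R axis i 1)) has_real_derivative partial i f x) (at 0)"
        using partial_line_derivative[OF d1, of x i 0] by simp
      moreover have "((\<lambda>t. g p \<bullet> (x + t *\<^sub>R axis i 1)) has_real_derivative g p $ i) (at 0)"
        by (auto intro!: derivative_eq_intros simp: inner_add_right inner_axis)
      ultimately show ?thesis unfolding h_def by (rule DERIV_diff)
    qed
    have ph: "partial i h x = partial i f x - g p $ i" for i x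
      unfolding partial_def[of i h] by (rule DERIV_imp_deriv[OF dh])
    have "\<bar>h (p + u) - h p\<bar> \<le> real CARD('d) * (n * (M * norm u) * norm u)"
    proof (rule partial_bounded_imp_lipschitz)
      show "(\<lambda>t. h (x + t *\<^sub>R axis i 1)) differentiable (at 0)" for i x
        using dh real_differentiable_def by blast
      fix i z assume z: "norm (z - p) \<le> norm u"
      have "\<bar>partial i h z\<bar> \<le> n * (M * norm (z - p))" using lip[of i z p] by (simp add: ph g_def)
      also have "\<dots> \<le> n * (M * norm u)" using z M0 n1 by (intro mult_left_mono) auto
      finally show "\<bar>partial i h z\<bar> \<le> n * (M * norm u)" .
    qed
    then show ?thesis by (simp add: h_def n_def inner_add_right power2_eq_square algebra_simps)
  qed
  have "taylor_bound f g (n * (n * M))"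
    unfolding taylor_bound_def using M0 n1 tay glip by auto
  then show ?thesis by blast
qed

lemma taylor_bound_derivative:
  assumes "taylor_bound f g M"
  shows "((\<lambda>s. f (x + s *\<^sub>R u)) has_real_derivative g (x + s *\<^sub>R u) \<bullet> u) (at s)"
proof -
  have M: "0 \<le> M" and T: "\<And>x u. \<bar>f (x + u) - f x - g x \<bullet> u\<bar> \<le> M * (norm u)\<^sup>2"
    using assms by (auto simp: taylor_bound_def)
  have *: "\<bar>(f (x + (s + h) *\<^sub>R u) - f (x + s *\<^sub>R u)) / h - g (x + s *\<^sub>R u) \<bullet> u\<bar> \<le>
    M * (norm u)\<^sup>2 * \<bar>h\<bar>" if "h \<noteq> 0" for h
  proof -
    have "\<bar>f (x + (s + h) *\<^sub>R u) - f (x + s *\<^sub>R u) - h * (g (x + s *\<^sub>R u) \<bullet> u)\<bar> \<le> M * (norm u)\<^sup>2 * h\<^sup>2"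
      using T[of "x + s *\<^sub>R u" "h *\<^sub>R u"] by (simp add: scaleR_add_left add.assoc power_mult_distrib mult_ac)
    moreover have "(f (x + (s + h) *\<^sub>R u) - f (x + s *\<^sub>R u)) / h - g (x + s *\<^sub>R u) \<bullet> u =
        (f (x + (s + h) *\<^sub>R u) - f (x + s *\<^sub>R u) - h * (g (x + s *\<^sub>R u) \<bullet> u)) / h"
      using that by (simp add: diff_divide_distrib)
    ultimately have "\<bar>(f (x + (s + h) *\<^sub>R u) - f (x + s *\<^sub>R u)) / h - g (x + s *\<^sub>R u) \<bullet> u\<bar> \<le>
      M * (norm u)\<^sup>2 * h\<^sup>2 / \<bar>h\<bar>"
      by (simp add: divide_right_mono)
    also have "\<dots> = M * (norm u)\<^sup>2 * \<bar>h\<bar>" using that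
      by (simp add: power2_eq_square) (metis abs_mult_self_eq nonzero_mult_div_cancel_right abs_eq_0 mult.assoc)
    finally show ?thesis .
  qed
  have "((\<lambda>h. (f (x + (s + h) *\<^sub>R u) - f (x + s *\<^sub>R u)) / h - g (x + s *\<^sub>R u) \<bullet> u) \<longlongrightarrow> 0) (at 0)"
  proof (rule Lim_null_comparison)
    show "\<forall>\<^sub>F h in at 0. norm ((f (x + (s + h) *\<^sub>R u) - f (x + s *\<^sub>R u)) / h - g (x + s *\<^sub>R u) \<bullet> u) \<le>
      M * (norm u)\<^sup>2 * \<bar>h\<bar>"
      using * by (auto simp: eventually_at_filter)
    show "((\<lambda>h. M * (norm u)\<^sup>2 * \<bar>h\<bar>) \<longlongrightarrow> 0) (at (0::real))"
      by (auto intro!: tendsto_eq_intros)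
  qed
  then show ?thesis unfolding DERIV_def by (simp add: LIM_zero_iff)
qed

text \<open>The mean value theorem along u for the difference of two translates; the Lipschitz
  gradient supplies the factor |x - y|. This mixed second difference is what makes the error in
  \<open>dd_shift\<close> proportional to the distance.\<close>

lemma taylor_bound_shift:
  assumes T: "taylor_bound f g M"
  shows "\<bar>(f (x + u) - f x) - (f (y + u) - f y)\<bar> \<le> M * norm (x - y) * norm u"
proof -
  define \<phi> where "\<phi> s = f (x + s *\<^sub>R u) - f (y + s *\<^sub>R u)" for s
  have "norm (\<phi> 1 - \<phi> 0) \<le> (M * norm (x - y) * norm u) * norm (1 - 0 :: real)"
  proof (rule field_differentiable_bound[where S = "{0..1}"
    and f' = "\<lambda>s. g (x + s *\<^sub>R u) \<bullet> u - g (y + s *\<^sub>R u) \<bullet> u"])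
    fix s :: real
    show "(\<phi> has_field_derivative g (x + s *\<^sub>R u) \<bullet> u - g (y + s *\<^sub>R u) \<bullet> u) (at s within {0..1})"
      unfolding \<phi>_def
      by (intro DERIV_diff has_field_derivative_at_within[OF taylor_bound_derivative[OF T]])
    have "\<bar>(g (x + s *\<^sub>R u) - g (y + s *\<^sub>R u)) \<bullet> u\<bar> \<le> norm (g (x + s *\<^sub>R u) - g (y + s *\<^sub>R u)) * norm u"
      by (rule Cauchy_Schwarz_ineq2)
    also have "\<dots> \<le> (M * norm (x - y)) * norm u"
      using T unfolding taylor_bound_def by (intro mult_right_mono) (auto, metis add_diff_cancel_right)
    finally show "norm (g (x + s *\<^sub>R u) \<bullet> u - g (y + s *\<^sub>R u) \<bullet> u) \<le> M * norm (x - y) * norm u"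
      by (simp add: inner_diff_left)
  qed auto
  then show ?thesis by (simp add: \<phi>_def algebra_simps)
qed

lemma taylor_bound_continuous:
  assumes T: "taylor_bound f g M" shows "continuous_on UNIV f" "continuous_on UNIV g"
proof -
  have M: "0 \<le> M" and T1: "\<And>x u. \<bar>f (x + u) - f x - g x \<bullet> u\<bar> \<le>
    M * (norm u)\<^sup>2" and T2: "\<And>x y. norm (g x - g y) \<le> M * norm (x - y)"
    using T by (auto simp: taylor_bound_def)
  have "M-lipschitz_on UNIV g" using M T2 by (auto simp: lipschitz_on_def dist_norm)
  then show "continuous_on UNIV g" by (rule lipschitz_on_continuous_on)
  show "continuous_on UNIV f"
  proof (rule continuous_at_imp_continuous_on, rule ballI)
    fix x
    have "((\<lambda>y. f y - f x) \<longlongrightarrow> 0) (at x)"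
    proof (rule Lim_null_comparison)
      show "\<forall>\<^sub>F y in at x. norm (f y - f x) \<le> norm (g x) * norm (y - x) + M * (norm (y - x))\<^sup>2"
      proof (rule always_eventually, rule allI)
        fix y
        have "\<bar>f y - f x - g x \<bullet> (y - x)\<bar> \<le> M * (norm (y - x))\<^sup>2" using T1[of x "y - x"] by simp
        moreover have "\<bar>g x \<bullet> (y - x)\<bar> \<le> norm (g x) * norm (y - x)" by (rule Cauchy_Schwarz_ineq2)
        ultimately show "norm (f y - f x) \<le> norm (g x) * norm (y - x) + M * (norm (y - x))\<^sup>2" by simp
      qed
      show "((\<lambda>y. norm (g x) * norm (y - x) + M * (norm (y - x))\<^sup>2) \<longlongrightarrow> 0) (at x)"
        by (auto intro!: tendsto_eq_intros)
    qed
    then show "isCont f x" by (simp add: isCont_def LIM_zero_iff)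
  qed
qed

text \<open>A quadratic remainder permits quadratic growth, so the constant L depends on the radius
  of the ball; for a bounded domain one ball is enough.\<close>

lemma taylor_bound_lipschitz:
  assumes T: "taylor_bound f g M" and r: "0 \<le> r"
  obtains L where "1 \<le> L" "\<And>x. norm x \<le> r \<Longrightarrow> norm (g x) \<le> L"
    "\<And>x y. norm x \<le> r \<Longrightarrow> norm y \<le> r \<Longrightarrow> \<bar>f x - f y\<bar> \<le> L * norm (x - y)"
proof
  have M: "0 \<le> M" and T1: "\<And>x u. \<bar>f (x + u) - f x - g x \<bullet> u\<bar> \<le>
    M * (norm u)\<^sup>2" and T2: "\<And>x y. norm (g x - g y) \<le> M * norm (x - y)"
    using T by (auto simp: taylor_bound_def)
  define L where "L = 1 + norm (g 0) + M * r + M * (2 * r)"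
  have gb: "norm (g x) \<le> norm (g 0) + M * r" if "norm x \<le> r" for x
  proof -
    have "norm (g x) \<le> norm (g 0) + norm (g x - g 0)" by (rule norm_triangle_sub)
    also have "norm (g x - g 0) \<le> M * norm x" using T2[of x 0] by simp
    also have "\<dots> \<le> M * r" using M that by (rule mult_left_mono[rotated])
    finally show ?thesis by simp
  qed
  have nn: "0 \<le> norm (g 0) + M * r" "0 \<le> M * (2 * r)" using M r by auto
  show "1 \<le> L" using nn by (simp add: L_def)
  show "norm (g x) \<le> L" if "norm x \<le> r" for x using gb[OF that] nn by (simp add: L_def)
  show "\<bar>f x - f y\<bar> \<le> L * norm (x - y)" if "norm x \<le> r" "norm y \<le> r" for x y
  proof -
    have "\<bar>f x - f y - g y \<bullet> (x - y)\<bar> \<le> M * (norm (x - y))\<^sup>2" using T1[of y "x - y"] by simp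
    moreover have "\<bar>g y \<bullet> (x - y)\<bar> \<le> (norm (g 0) + M * r) * norm (x - y)"
      by (rule order_trans[OF Cauchy_Schwarz_ineq2]) (intro mult_right_mono gb that, simp)
    moreover have "M * (norm (x - y))\<^sup>2 \<le> M * (2 * r) * norm (x - y)"
    proof -
      have "norm (x - y) \<le> 2 * r" using norm_triangle_ineq4[of x y] that by simp
      then have "M * norm (x - y) * norm (x - y) \<le> M * (2 * r) * norm (x - y)" using M
        by (intro mult_right_mono mult_left_mono) auto
      then show ?thesis by (simp add: power2_eq_square mult.assoc)
    qed
    ultimately have "\<bar>f x - f y\<bar> \<le> (norm (g 0) + M * r) * norm (x - y) + M * (2 * r) * norm (x - y)" by linarith
    also have "\<dots> \<le> L * norm (x - y)" by (simp add: L_def distrib_right)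
    finally show ?thesis .
  qed
qed

text \<open>The slack 3 in \<open>r\<close> keeps points displaced by at most 1 in the ball on which
  L is valid. The frontier equation identifies the distance occurring in the moduli balls of the
  closure with the distance to the boundary of G.\<close>

locale chart =
  fixes G U :: "((real ^ 'd) \<times> real) set" and a :: "(real ^ 'd) \<times> real"
    and B :: "(real ^ 'd) \<times> real \<Rightarrow> (real ^ 'd) \<times> real"
    and f :: "real ^ 'd \<Rightarrow> real" and g :: "real ^ 'd \<Rightarrow> real ^ 'd" and M r L :: real
  assumes G: "open G" "bounded G" "G \<noteq> {}" and U: "open U"
    and orth: "orthogonal_transformation B" and T: "taylor_bound f g M"
    and sub: "a + B (x, y) \<in> U \<Longrightarrow> a + B (x, y) \<in> G \<longleftrightarrow> y < f x"
    and clos: "a + B (x, y) \<in> U \<Longrightarrow> a + B (x, y) \<in> closure G \<longleftrightarrow> y \<le> f x"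
    and fr: "frontier (closure G) = frontier G"
    and r: "a + B (x, y) \<in> closure G \<Longrightarrow> norm x + 3 \<le> r"
    and L1: "1 \<le> L" and gL: "norm x \<le> r \<Longrightarrow> norm (g x) \<le> L"
    and Lip: "norm x \<le> r \<Longrightarrow> norm x' \<le> r \<Longrightarrow> \<bar>f x - f x'\<bar> \<le> L * norm (x - x')"
begin

abbreviation R :: "real ^ 'd \<Rightarrow> real \<Rightarrow> (real ^ 'd) \<times> real" where "R x y \<equiv> a + B (x, y)"

abbreviation dd :: "(real ^ 'd) \<times> real \<Rightarrow> real" where "dd \<xi> \<equiv> infdist \<xi> (frontier G)"

lemma lin: "linear B" using orth by (rule orthogonal_transformation_linear)

lemma coords: obtains x y where "\<xi> = R x y"
  using orthogonal_transformation_surj[OF orth] by (metis surjD surj_pair diff_add_cancel add.commute)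

lemma dist_R: "dist (R x y) (R x' y') = norm ((x, y) - (x', y'))"
proof -
  have "dist (R x y) (R x' y') = norm (B ((x, y) - (x', y')))"
    by (simp add: dist_norm linear_diff[OF lin, symmetric])
  then show ?thesis using orth by (simp add: orthogonal_transformation_norm)
qed

lemma dist_R_le: "dist (R x y) (R x' y') \<le> norm (x - x') + \<bar>y - y'\<bar>"
  unfolding dist_R using norm_Pair_le[of "x - x'" "y - y'"] by simp

lemma le_dist_R: "norm (x - x') \<le> dist (R x y) (R x' y')" "\<bar>y - y'\<bar> \<le> dist (R x y) (R x' y')"
  unfolding dist_R using norm_fst_le[of "x - x'" "y - y'"] norm_snd_le[of "y - y'" "x - x'"] by simp_all

lemma frontier_G: "frontier G = closure G - G"
  using G(1) by (simp add: frontier_def interior_open)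

lemma frontier_nonempty: "frontier G \<noteq> {}"
  using G frontier_eq_empty[of G] not_bounded_UNIV by auto

lemma M0: "0 \<le> M" using T by (simp add: taylor_bound_def)

lemma graph_in_frontier: "R x (f x) \<in> U \<Longrightarrow> R x (f x) \<in> frontier G"
  using sub[of x "f x"] clos[of x "f x"] by (simp add: frontier_G)

lemma dd_lipschitz: "\<bar>dd \<xi> - dd \<eta>\<bar> \<le> dist \<xi> \<eta>"
  using infdist_triangle_abs[of \<xi> "frontier G" \<eta>] .

text \<open>The nearest boundary point lies in the ball, hence in U, where the boundary is the
  graph.\<close>

lemma nearest:
  assumes e: "ball (R x y) e \<subseteq> U" and d: "dd (R x y) < e"
  obtains x1 where "dd (R x y) = dist (R x y) (R x1 (f x1))" "R x1 (f x1) \<in> frontier G"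
proof -
  obtain q where q: "q \<in> frontier G" "dd (R x y) = dist (R x y) q"
    using infdist_attains_inf[OF frontier_closed frontier_nonempty] by blast
  obtain x1 y1 where xy: "q = R x1 y1" by (rule coords)
  have "R x1 y1 \<in> U" using q d e xy by auto
  then have "y1 = f x1" using sub[of x1 y1] clos[of x1 y1] q(1) xy by (auto simp: frontier_G)
  then show thesis using that q xy by simp
qed

lemma dd_le_depth:
  assumes e: "ball (R x y) e \<subseteq> U" and w: "0 \<le> f x - y" "f x - y < e"
  shows "dd (R x y) \<le> f x - y"
proof -
  have d: "dist (R x y) (R x (f x)) \<le> f x - y" using dist_R_le[of x y x "f x"] w by simp
  then have "R x (f x) \<in> U" using e w by auto
  then have "dd (R x y) \<le> dist (R x y) (R x (f x))" by (intro infdist_le graph_in_frontier)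
  then show ?thesis using d by simp
qed

lemma depth_le_dd:
  assumes e: "ball (R x y) e \<subseteq> U" and d: "dd (R x y) < e" and x: "norm x \<le> r"
  shows "f x - y \<le> (1 + L) * dd (R x y)"
proof -
  obtain x1 where x1: "dd (R x y) = dist (R x y) (R x1 (f x1))" "R x1 (f x1) \<in> frontier G"
    using nearest[OF e d] .
  have "norm x1 \<le> r" using r[of x1 "f x1"] x1(2) by (auto simp: frontier_G)
  then have "\<bar>f x - f x1\<bar> \<le> L * norm (x - x1)" using Lip x by blast
  also have "\<dots> \<le> L * dd (R x y)" using le_dist_R(1)[of x x1 y "f x1"] x1(1) L1 by (intro mult_left_mono) auto
  finally have "\<bar>f x - f x1\<bar> \<le> L * dd (R x y)" .
  moreover have "\<bar>y - f x1\<bar> \<le> dd (R x y)" using le_dist_R(2)[of y "f x1" x x1] x1(1) by simp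
  ultimately show ?thesis by (simp add: algebra_simps)
qed

text \<open>Displace the nearest boundary point along the graph by the same p. The vertical
  displacements differ by a mixed second difference, at most M |x - x1| |p|, and |x - x1| is at most
  the distance. The proportional error is essential: an additive error of order |p| would, after
  taking square roots, not be O(|p|) uniformly near the boundary.\<close>

lemma dd_shift:
  assumes e: "ball (R x y) e \<subseteq> U" and d: "dd (R x y) + (1 + L) * norm p < e" and p: "norm p \<le> 1"
  shows "dd (R (x + p) (y + f (x + p) - f x)) \<le> (1 + M * norm p) * dd (R x y)"
proof -
  have "0 \<le> (1 + L) * norm p" using L1 by simp
  then have d': "dd (R x y) < e" using d by linarith
  obtain x1 where x1: "dd (R x y) = dist (R x y) (R x1 (f x1))" "R x1 (f x1) \<in> frontier G"
    using nearest[OF e d'] .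
  have nx: "norm x1 + 3 \<le> r" using r[of x1 "f x1"] x1(2) by (auto simp: frontier_G)
  have "norm (x1 + p) \<le> r" using nx p norm_triangle_ineq[of x1 p] by linarith
  then have lp: "\<bar>f (x1 + p) - f x1\<bar> \<le> L * norm p" using Lip[of "x1 + p" x1] nx by simp
  have "dist (R x y) (R (x1 + p) (f (x1 + p))) \<le>
    dist (R x y) (R x1 (f x1)) + dist (R x1 (f x1)) (R (x1 + p) (f (x1 + p)))"
    by (rule dist_triangle)
  also have "\<dots> \<le> dd (R x y) + (norm p + L * norm p)"
    using dist_R_le[of x1 "f x1" "x1 + p" "f (x1 + p)"] lp x1(1) by (simp add: abs_minus_commute)
  also have "\<dots> < e" using d by (simp add: algebra_simps)
  finally have "R (x1 + p) (f (x1 + p)) \<in> U" using e by auto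
  then have fr': "R (x1 + p) (f (x1 + p)) \<in> frontier G" by (rule graph_in_frontier)
  define s where "s = (f (x + p) - f x) - (f (x1 + p) - f x1)"
  have s: "\<bar>s\<bar> \<le> M * norm (x - x1) * norm p" unfolding s_def by (rule taylor_bound_shift[OF T])
  have "dd (R (x + p) (y + f (x + p) - f x)) \<le> dist (R (x + p) (y + f (x + p) - f x)) (R (x1 + p) (f (x1 + p)))"
    by (rule infdist_le[OF fr'])
  also have "\<dots> = norm (((x, y) - (x1, f x1)) + (0, s))" unfolding dist_R by (simp add: s_def algebra_simps)
  also have "\<dots> \<le> norm ((x, y) - (x1, f x1)) + norm ((0, s) :: (real ^ 'd) \<times> real)" by (rule norm_triangle_ineq)
  also have "\<dots> \<le> dd (R x y) + M * norm (x - x1) * norm p"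
  proof -
    have "norm ((0, s) :: (real ^ 'd) \<times> real) = \<bar>s\<bar>" by (simp add: norm_Pair)
    then show ?thesis using s unfolding x1(1) dist_R by linarith
  qed
  also have "M * norm (x - x1) * norm p \<le> M * dd (R x y) * norm p"
    using le_dist_R(1)[of x x1 y "f x1"] x1(1) M0 by (intro mult_right_mono mult_left_mono) auto
  finally show ?thesis by (simp add: algebra_simps)
qed

lemma dd_le_dist_outside:
  assumes "\<xi> \<in> closure G" "z \<notin> G" shows "dd \<xi> \<le> dist \<xi> z"
proof (cases "\<xi> \<in> G")
  case True
  have "closed_segment \<xi> z \<inter> frontier G \<noteq> {}"
    using True assms(2) by (intro connected_Int_frontier convex_connected) auto
  then obtain m where m: "m \<in> closed_segment \<xi> z" "m \<in> frontier G" by auto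
  have "dd \<xi> \<le> dist \<xi> m" by (rule infdist_le[OF m(2)])
  also have "\<dots> \<le> dist \<xi> z" using segment_bound(1)[OF m(1)] by (simp add: dist_norm norm_minus_commute)
  finally show ?thesis .
next
  case False
  then have "\<xi> \<in> frontier G" using assms(1) by (simp add: frontier_G)
  then show ?thesis by simp
qed

text \<open>Below a Lipschitz graph the complement is invariant under an upward cone, so moving down by \<open>\<beta>\<close>
  increases the distance by a fixed fraction of \<open>\<beta>\<close>.\<close>

lemma dd_vertical:
  assumes e: "ball (R x y) e \<subseteq> U" "ball (R x (y - \<beta>)) e \<subseteq> U" and d: "dd (R x (y - \<beta>)) < e"
    and \<beta>: "0 \<le> \<beta>" and cl: "R x y \<in> closure G" and w: "0 \<le> f x - y"
  shows "dd (R x y) + \<beta> / (1 + L) \<le> dd (R x (y - \<beta>))"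
proof -
  define c where "c = 1 / (1 + L)"
  have c: "0 < c" "c * (1 + L) = 1" using L1 by (auto simp: c_def)
  obtain x1 where x1: "dd (R x (y - \<beta>)) = dist (R x (y - \<beta>)) (R x1 (f x1))" "R x1 (f x1) \<in> frontier G"
    using nearest[OF e(2) d] .
  define D where "D = dd (R x (y - \<beta>))"
  have D0: "0 \<le> D" by (simp add: D_def infdist_nonneg)
  have nx: "norm x + 3 \<le> r" using r[OF cl] .
  have nx1: "norm x1 + 3 \<le> r" using r[of x1 "f x1"] x1(2) by (auto simp: frontier_G)
  have "\<beta> \<le> (1 + L) * D" using depth_le_dd[OF e(2) d] nx w by (simp add: D_def)
  then have "c * \<beta> \<le> c * ((1 + L) * D)" using c by (intro mult_left_mono) auto
  then have cb: "c * \<beta> \<le> D" unfolding mult.assoc[symmetric] c by simp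
  show ?thesis
  proof (cases "\<beta> = 0")
    case False
    then have b0: "0 < c * \<beta>" using \<beta> c by simp
    then have D: "0 < D" using cb by linarith
    \<comment> \<open>The point z is reached from \<open>R x y\<close> by the fraction 1 - k of the
      vector that leads from the lower point to its nearest boundary point. Seen from that boundary
      point, z is moved horizontally by at most c \<beta> and upwards by at least L c \<beta>; by
      the cone condition it is outside G.\<close>
    define k where "k = c * \<beta> / D"
    have k: "0 < k" "k \<le> 1" "k * D = c * \<beta>" using b0 D cb by (auto simp: k_def)
    define v1 v2 where "v1 = x1 - x" and "v2 = f x1 - (y - \<beta>)"
    have Dv: "D = norm ((v1, v2))" unfolding D_def x1(1) dist_R v1_def v2_def by (subst norm_minus_commute) simp
    have v1: "norm v1 \<le> D" and v2: "\<bar>v2\<bar> \<le> D" unfolding Dv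
      using norm_fst_le[of v1 v2] norm_snd_le[of v2 v1] by auto
    define zx zy where "zx = x + (1 - k) *\<^sub>R v1" and "zy = y + (1 - k) * v2"
    have dz: "dist (R x y) (R zx zy) = (1 - k) * D"
    proof -
      have "(x, y) - (zx, zy) = (- (1 - k)) *\<^sub>R (v1, v2)" by (simp add: zx_def zy_def algebra_simps)
      then have "norm ((x, y) - (zx, zy)) = \<bar>- (1 - k)\<bar> * norm (v1, v2)" by (simp only: norm_scaleR)
      then show ?thesis using k unfolding dist_R Dv by simp
    qed
    have "(1 - k) * D < e"
    proof -
      have "(1 - k) * D \<le> 1 * D" using k D by (intro mult_right_mono) auto
      then show ?thesis using d by (simp add: D_def)
    qed
    then have zU: "R zx zy \<in> U" using e(1) dz by auto
    have zx1: "zx = x1 - k *\<^sub>R v1" by (simp add: zx_def v1_def algebra_simps)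
    have "norm v1 \<le> norm x1 + norm x" unfolding v1_def by (rule norm_triangle_ineq4)
    have kv: "norm (k *\<^sub>R v1) \<le> c * \<beta>" using k v1 mult_left_mono[OF v1, of k] by simp
    have "norm zx \<le> r"
    proof -
      have "zx = (1 - k) *\<^sub>R x1 + k *\<^sub>R x" by (simp add: zx1 v1_def algebra_simps)
      then have "norm zx \<le> (1 - k) * norm x1 + k * norm x"
        using k norm_triangle_ineq[of "(1 - k) *\<^sub>R x1" "k *\<^sub>R x"] by simp
      also have "\<dots> \<le> (1 - k) * r + k * r" using k nx nx1 by (intro add_mono mult_left_mono) auto
      finally show ?thesis by (simp add: algebra_simps)
    qed
    then have "\<bar>f zx - f x1\<bar> \<le> L * norm (zx - x1)" using Lip nx1 by auto
    also have "\<dots> \<le> L * (c * \<beta>)" using kv L1 by (intro mult_left_mono) (auto simp: zx1)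
    finally have f1: "f zx \<le> f x1 + L * (c * \<beta>)" by linarith
    have "k * v2 \<le> c * \<beta>" using mult_left_mono[OF v2, of k] k by (smt (verit) mult_left_mono)
    moreover have "zy = f x1 + \<beta> - k * v2" by (simp add: zy_def v2_def algebra_simps)
    moreover have "\<beta> = c * \<beta> + L * (c * \<beta>)" using c(2)
      by (simp add: algebra_simps) (metis distrib_left mult.assoc mult.commute mult_1)
    ultimately have "f zx \<le> zy" using f1 by linarith
    then have "R zx zy \<notin> G" using sub[OF zU] by simp
    then have "dd (R x y) \<le> (1 - k) * D" using dd_le_dist_outside[OF cl] dz by metis
    also have "\<dots> = D - c * \<beta>" using k(3) by (simp add: algebra_simps)
    finally show ?thesis by (simp add: D_def c_def)
  qed simp
qed

end

section \<open>Moduli balls and sheared boxes in a boundary chart\<close>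

lemma continuous_on_rho: "continuous_on UNIV (\<lambda>z. rho \<Omega> (fst z) (snd z))"
  unfolding rho_def by (intro continuous_intros)

lemma closed_rho_ball:
  assumes "closed \<Omega>" shows "closed {z. snd z \<in> rho_ball \<Omega> (fst z) t}"
proof -
  have "{z. snd z \<in> rho_ball \<Omega> (fst z) t} = snd -` \<Omega> \<inter> {z. rho \<Omega> (fst z) (snd z) \<le> t}"
    by (auto simp: rho_ball_def)
  also have "closed \<dots>"
    by (intro closed_Int closed_Collect_le continuous_on_rho continuous_on_const continuous_closed_vimage assms)
       (auto intro!: continuous_intros)
  finally show ?thesis .
qed

lemma rho_ball_borel:
  assumes "closed \<Omega>" shows "rho_ball \<Omega> \<xi> t \<in> sets borel"
proof -
  have "rho_ball \<Omega> \<xi> t = (\<lambda>\<eta>. (\<xi>, \<eta>)) -` {z. snd z \<in> rho_ball \<Omega> (fst z) t}" by auto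
  also have "closed \<dots>" by (intro closed_vimage closed_rho_ball assms continuous_intros)
  finally show ?thesis by simp
qed

lemma rho_ball_mono: "t \<le> t' \<Longrightarrow> rho_ball \<Omega> \<xi> t \<subseteq> rho_ball \<Omega> \<xi> t'"
  by (auto simp: rho_ball_def)

context chart begin

lemma rho_eq: "rho (closure G) \<xi> \<eta> = dist \<xi> \<eta> + \<bar>sqrt (dd \<xi>) - sqrt (dd \<eta>)\<bar>"
  by (simp add: rho_def fr dist_norm)

lemma near_ball: "ball \<xi> e \<subseteq> U \<Longrightarrow> dist \<xi> \<eta> \<le> e / 2 \<Longrightarrow> ball \<eta> (e / 2) \<subseteq> U"
proof
  fix z assume a: "ball \<xi> e \<subseteq> U" "dist \<xi> \<eta> \<le> e / 2" "z \<in> ball \<eta> (e / 2)"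
  then have "dist \<xi> z < e" using dist_triangle[of \<xi> z \<eta>] by (simp add: dist_commute)
  then show "z \<in> U" using a by auto
qed

text \<open>A step u parallel to the graph. The estimate \<open>dd_shift\<close> is used there and
  back, as only both directions together show that the distance changes by a factor close to
  1.\<close>

lemma dd_parallel:
  assumes e: "0 < e" "e \<le> 1" "ball (R x y) e \<subseteq> U" and \<xi>: "R x y \<in> closure G" "dd (R x y) \<le> e / 8"
    and u: "norm u \<le> s" "(1 + L) * s \<le> e / 8"
  defines "\<xi>' \<equiv> R (x + u) (y + f (x + u) - f x)"
  shows "dist (R x y) \<xi>' \<le> (1 + L) * s" "ball \<xi>' (e / 2) \<subseteq> U" "\<xi>' \<in> closure G" "norm (x + u) \<le> r"
    "dd \<xi>' \<le> (1 + M * s) * dd (R x y)" "dd (R x y) \<le> (1 + M * s) * dd \<xi>'" "\<bar>f (x + u) - f x\<bar> \<le> L * s"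
proof -
  have s0: "0 \<le> s" using u(1) norm_ge_zero order_trans by blast
  have s1: "s \<le> e / 8" using u(2) L1 s0 mult_right_mono[of 1 "1 + L" s] by simp
  have nx: "norm x + 3 \<le> r" using r[OF \<xi>(1)] .
  show nxu: "norm (x + u) \<le> r" using norm_triangle_ineq[of x u] nx u s1 e by linarith
  have "\<bar>f (x + u) - f x\<bar> \<le> L * norm u" using Lip[OF nxu, of x] nx by simp
  also have "\<dots> \<le> L * s" using u L1 by (intro mult_left_mono) auto
  finally show fu: "\<bar>f (x + u) - f x\<bar> \<le> L * s" .
  have "dist (R x y) \<xi>' \<le> norm (x - (x + u)) + \<bar>y - (y + f (x + u) - f x)\<bar>" unfolding \<xi>'_def by (rule dist_R_le)
  also have "\<dots> \<le> s + L * s" using u fu by simp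
  finally show d: "dist (R x y) \<xi>' \<le> (1 + L) * s" by (simp add: algebra_simps)
  show b: "ball \<xi>' (e / 2) \<subseteq> U" by (rule near_ball[OF e(3)]) (use d u e in linarith)
  have "\<xi>' \<in> U" using b e by (meson centre_in_ball half_gt_zero subsetD)
  moreover have "y \<le> f x" using clos[of x y] e \<xi> by (meson centre_in_ball subsetD)
  ultimately show c: "\<xi>' \<in> closure G" using clos[of "x + u" "y + f (x + u) - f x"] unfolding \<xi>'_def by simp
  have lu: "(1 + L) * norm u \<le> e / 8" using u L1 mult_left_mono[of "norm u" s "1 + L"] by linarith
  have "dd \<xi>' \<le> (1 + M * norm u) * dd (R x y)"
    unfolding \<xi>'_def by (rule dd_shift[OF e(3)]) (use lu \<xi> e u s1 in linarith)+
  also have "\<dots> \<le> (1 + M * s) * dd (R x y)" using u M0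
    by (intro mult_right_mono add_left_mono mult_left_mono) (auto simp: infdist_nonneg)
  finally show "dd \<xi>' \<le> (1 + M * s) * dd (R x y)" .
  have "dd \<xi>' \<le> dd (R x y) + dist (R x y) \<xi>'" using dd_lipschitz[of "R x y" \<xi>'] by linarith
  then have d2: "dd \<xi>' \<le> e / 4" using d u \<xi> by linarith
  have "dd (R ((x + u) + (- u)) ((y + f (x + u) - f x) + f ((x + u) + (- u)) - f (x + u))) \<le>
    (1 + M * norm (- u)) * dd (R (x + u) (y + f (x + u) - f x))"
    by (rule dd_shift[OF b[unfolded \<xi>'_def]]) (use d2[unfolded \<xi>'_def] lu e u s1 in \<open>simp_all\<close>)
  then have "dd (R x y) \<le> (1 + M * norm u) * dd \<xi>'" by (simp add: \<xi>'_def)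
  also have "\<dots> \<le> (1 + M * s) * dd \<xi>'" using u M0
    by (intro mult_right_mono add_left_mono mult_left_mono) (auto simp: infdist_nonneg)
  finally show "dd (R x y) \<le> (1 + M * s) * dd \<xi>'" .
qed

definition C2 :: real where "C2 = (1 + L) * (2 + M * (1 + M)) + M"

text \<open>Go from \<xi> to \<eta> in two steps, parallel to the graph by u and then vertically by
  \<beta>. The first changes the distance d by O(t d). The condition on square roots allows a total
  change of O(t (t + sqrt d)). By \<open>dd_vertical\<close> the second step changes the distance by
  at least |\<beta>| / (1 + L), which bounds \<beta>. The Taylor remainder, of order t^2, then
  exchanges f (x + u) - f x for \<open>g x \<bullet> u\<close>.\<close>

lemma ball_coords_small:
  assumes e: "0 < e" "e \<le> 1" "ball (R x y) e \<subseteq> U" and \<xi>: "R x y \<in> closure G" "(1 + L) * dd (R x y) \<le> e / 8"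
    and t: "0 < t" "(1 + L) * t \<le> e / 8" and \<eta>: "R (x + u) (y + b) \<in> rho_ball (closure G) (R x y) t"
  shows "\<bar>b - g x \<bullet> u\<bar> \<le> C2 * t * (t + sqrt (f x - y))"
proof -
  define d d' where "d = dd (R x y)" and "d' = dd (R (x + u) (y + b))"
  have d0: "0 \<le> d" "0 \<le> d'" by (auto simp: d_def d'_def infdist_nonneg)
  have d8: "d \<le> e / 8" using \<xi>(2) L1 d0 mult_right_mono[of 1 "1 + L" d] by (simp add: d_def)
  have "1 * t \<le> (1 + L) * t" using L1 t by (intro mult_right_mono) auto
  then have t8: "t \<le> e / 8" using t(2) by linarith
  have t1: "t \<le> 1" using t8 e by linarith
  have nx: "norm x \<le> r" using r[OF \<xi>(1)] by simp
  have "R (x + u) (y + b) \<in> closure G \<and> dist (R x y) (R (x + u) (y + b)) + \<bar>sqrt d - sqrt d'\<bar> \<le> t"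
    using \<eta> unfolding rho_ball_def rho_eq d_def d'_def by simp
  then have \<rho>: "R (x + u) (y + b) \<in> closure G" "dist (R x y) (R (x + u) (y + b)) \<le> t" "\<bar>sqrt d - sqrt d'\<bar> \<le> t"
    using zero_le_dist[of "R x y" "R (x + u) (y + b)"] abs_ge_zero[of "sqrt d - sqrt d'"] by linarith+
  have u: "norm u \<le> t" using le_dist_R(1)[of x "x + u" y "y + b"] \<rho>(2) by simp
  define y' where "y' = y + f (x + u) - f x"
  define \<beta> where "\<beta> = f (x + u) - f x - b"
  note par = dd_parallel[OF e \<xi>(1) d8[unfolded d_def] u t(2), folded y'_def]
  define ds where "ds = dd (R (x + u) y')"
  have "R x y \<in> U" using e by (meson centre_in_ball subsetD)
  then have w0: "0 \<le> f x - y" using clos[of x y] \<xi> by simp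
  have dw: "f x - y \<le> e / 8"
    using depth_le_dd[OF e(3) _ nx] d8 e \<xi>(2) by (simp add: d_def)
  have dle: "d \<le> f x - y" unfolding d_def by (rule dd_le_depth[OF e(3) w0]) (use dw e in linarith)
  have b\<eta>: "ball (R (x + u) (y + b)) (e / 2) \<subseteq> U" by (rule near_ball[OF e(3)]) (use \<rho>(2) t8 e in linarith)
  have "R (x + u) (y + b) \<in> U" using b\<eta> e by (meson centre_in_ball half_gt_zero subsetD)
  then have w\<eta>: "0 \<le> f (x + u) - (y + b)" using clos[of "x + u" "y + b"] \<rho>(1) by simp
  have "d' \<le> d + t" using dd_lipschitz[of "R x y" "R (x + u) (y + b)"] \<rho>(2) by (simp add: d_def d'_def)
  then have d'2: "d' < e / 2" using d8 t8 e by linarith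
  have "(1 + M * t) * d \<le> (1 + M) * d"
    using t1 M0 d0 by (intro mult_right_mono add_left_mono) (auto intro: mult_left_le)
  have ds1: "ds \<le> d + M * t * d" using par(5) by (simp add: ds_def d_def algebra_simps)
  have "d \<le> ds + M * t * ds" using par(6) by (simp add: ds_def d_def algebra_simps)
  moreover have "M * t * ds \<le> M * t * ((1 + M) * d)"
    using ds1 t t1 M0 d0 \<open>(1 + M * t) * d \<le> (1 + M) * d\<close> by (intro mult_left_mono) (auto simp: algebra_simps)
  ultimately have ds2: "d \<le> ds + M * (1 + M) * (t * d)" by (simp add: mult_ac)
  have dsh: "ds < e / 2"
  proof -
    have "ds \<le> d + dist (R x y) (R (x + u) y')" using dd_lipschitz[of "R x y" "R (x + u) y'"]
      by (simp add: ds_def d_def)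
    then show ?thesis using par(1) t d8 e by linarith
  qed
  have ddiff: "\<bar>d - d'\<bar> \<le> t * (2 * sqrt d + t)"
  proof -
    have "d - d' = (sqrt d - sqrt d') * (sqrt d + sqrt d')" using d0 by (simp add: algebra_simps)
    then have "\<bar>d - d'\<bar> = \<bar>sqrt d - sqrt d'\<bar> * (sqrt d + sqrt d')" using d0 by (simp add: abs_mult)
    also have "\<dots> \<le> t * (2 * sqrt d + t)"
    proof (intro mult_mono \<rho>(3))
      show "sqrt d + sqrt d' \<le> 2 * sqrt d + t" using \<rho>(3) by linarith
    qed (use t d0 in auto)
    finally show ?thesis .
  qed
  have "M * 1 \<le> M * (1 + M)" using M0 by (intro mult_left_mono) auto
  then have MM: "M * (t * d) \<le> M * (1 + M) * (t * d)"
    using mult_right_mono[of "M * 1" "M * (1 + M)" "t * d"] t d0 by simp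
  have main: "\<bar>\<beta>\<bar> / (1 + L) \<le> t * (2 * sqrt d + t) + M * (1 + M) * (t * d)"
  proof (cases "0 \<le> \<beta>")
    case True
    have e1: "y' - \<beta> = y + b" by (simp add: y'_def \<beta>_def)
    have "dd (R (x + u) y') + \<beta> / (1 + L) \<le> dd (R (x + u) (y' - \<beta>))"
    proof (rule dd_vertical[OF par(2) _ _ True par(3)])
      show "ball (R (x + u) (y' - \<beta>)) (e / 2) \<subseteq> U" unfolding e1 by (rule b\<eta>)
      show "dd (R (x + u) (y' - \<beta>)) < e / 2" using d'2 unfolding e1 d'_def .
      show "0 \<le> f (x + u) - y'" using w0 by (simp add: y'_def)
    qed
    then have "\<beta> / (1 + L) \<le> d' - ds" by (simp add: e1 ds_def d'_def)
    then show ?thesis using True ddiff ds2 by simp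
  next
    case False
    have e1: "y + b - (- \<beta>) = y'" by (simp add: y'_def \<beta>_def)
    have "dd (R (x + u) (y + b)) + (- \<beta>) / (1 + L) \<le> dd (R (x + u) (y + b - (- \<beta>)))"
      unfolding e1 by (rule dd_vertical[OF b\<eta> _ _ _ \<rho>(1), of "- \<beta>", unfolded e1]) (use par(2) dsh False w\<eta> in \<open>simp_all add: ds_def\<close>)
    then have "(- \<beta>) / (1 + L) \<le> ds - d'" by (simp only: e1 ds_def d'_def)
    moreover have "\<bar>\<beta>\<bar> / (1 + L) = (- \<beta>) / (1 + L)" using False by simp
    ultimately show ?thesis using ddiff ds1 MM by (simp add: mult_ac)
  qed
  define q where "q = sqrt (f x - y)"
  have q: "0 \<le> q" "sqrt d \<le> q" using w0 dle by (auto simp: q_def)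
  \<comment> \<open>Since d <= 1, the error t d of the parallel step is at most t sqrt d, which has
    the required form.\<close>
  have dq: "d \<le> q"
  proof -
    have "sqrt d \<le> 1" using d8 e by simp
    then have "sqrt d * sqrt d \<le> sqrt d * 1" using d0 by (intro mult_left_mono) auto
    then show ?thesis using q d0 by simp
  qed
  have "\<bar>\<beta>\<bar> \<le> (1 + L) * (t * (2 * sqrt d + t) + M * (1 + M) * (t * d))"
    using main L1 by (simp add: pos_divide_le_eq mult.commute)
  also have "\<dots> \<le> (1 + L) * (t * (2 * (t + q)) + M * (1 + M) * (t * (t + q)))"
    using q dq t M0 L1 by (intro mult_left_mono add_mono) auto
  also have "\<dots> = (1 + L) * (2 + M * (1 + M)) * t * (t + q)" by (simp add: algebra_simps)
  finally have B1: "\<bar>\<beta>\<bar> \<le> (1 + L) * (2 + M * (1 + M)) * t * (t + q)" .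
  have "\<bar>f (x + u) - f x - g x \<bullet> u\<bar> \<le> M * (norm u)\<^sup>2" using T by (simp add: taylor_bound_def)
  also have "\<dots> \<le> M * (t * (t + q))"
  proof (intro mult_left_mono M0)
    have "(norm u)\<^sup>2 \<le> t * t" using u t by (simp add: power2_eq_square mult_mono)
    also have "\<dots> \<le> t * (t + q)" using t q by (intro mult_left_mono) auto
    finally show "(norm u)\<^sup>2 \<le> t * (t + q)" .
  qed
  finally have "\<bar>b - g x \<bullet> u\<bar> \<le> \<bar>\<beta>\<bar> + M * (t * (t + q))" unfolding \<beta>_def by linarith
  also have "\<dots> \<le> C2 * t * (t + q)" using B1 by (simp add: C2_def algebra_simps)
  finally show ?thesis by (simp add: q_def)
qed

end

context chart begin

text \<open>The proportion of a sheared box that fits into a moduli ball. With it the point moves by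
  at most t / 16, and the root of its distance changes by at most t / 4.\<close>

definition c1 :: real where "c1 = 1 / (16 * (1 + M) * (3 + L))"

lemma c1: "0 < c1" "c1 \<le> 1" "c1 * (1 + M) * (3 + L) = 1 / 16" "(3 + L) * c1 \<le> 1 / 16" "c1 * (1 + M) \<le> 1 / 64"
proof -
  have p: "1 \<le> 1 + M" "4 \<le> 3 + L" using M0 L1 by auto
  show 0: "0 < c1" using p by (simp add: c1_def)
  show 1: "c1 * (1 + M) * (3 + L) = 1 / 16" using p by (simp add: c1_def)
  have k: "0 < c1 * (1 + M)" using 0 p by simp
  have "c1 * (1 + M) * 4 \<le> c1 * (1 + M) * (3 + L)" using k p by (intro mult_left_mono) auto
  then show 2: "c1 * (1 + M) \<le> 1 / 64" using 1 by linarith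
  have "c1 * 1 \<le> c1 * (1 + M)" using 0 p by (intro mult_left_mono) auto
  then show "c1 \<le> 1" using 2 by linarith
  have "(3 + L) * c1 * 1 \<le> (3 + L) * c1 * (1 + M)" using 0 p by (intro mult_left_mono) auto
  moreover have "(3 + L) * c1 * (1 + M) = c1 * (1 + M) * (3 + L)" by (simp only: mult_ac)
  ultimately show "(3 + L) * c1 \<le> 1 / 16" using 1 by linarith
qed

text \<open>The converse of \<open>ball_coords_small\<close>, on a smaller scale. If t is at most
  the root of the depth, the change of the distance is divided by the sum of the two roots, which is
  at least comparable to the root of the depth. Otherwise it suffices that the square of a
  difference of roots is at most the difference of the distances.\<close>

lemma in_ball_small:
  assumes e: "0 < e" "e \<le> 1" "ball (R x y) e \<subseteq> U" and \<xi>: "R x y \<in> closure G" "(1 + L) * dd (R x y) \<le> e / 8"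
    and t: "0 < t" "(1 + L) * t \<le> e / 8" and u: "norm u \<le> c1 * t"
    and \<beta>: "0 \<le> \<beta>" "\<beta> \<le> c1 * t * (t + sqrt (f x - y))"
  shows "R (x + u) (y + f (x + u) - f x - \<beta>) \<in> rho_ball (closure G) (R x y) t"
proof -
  define \<eta> where "\<eta> = R (x + u) (y + f (x + u) - f x - \<beta>)"
  define d d' where "d = dd (R x y)" and "d' = dd \<eta>"
  have d0: "0 \<le> d" "0 \<le> d'" by (auto simp: d_def d'_def infdist_nonneg)
  have d8: "d \<le> e / 8" using \<xi>(2) L1 d0 mult_right_mono[of 1 "1 + L" d] by (simp add: d_def)
  have "1 * t \<le> (1 + L) * t" using L1 t by (intro mult_right_mono) auto
  then have t8: "t \<le> e / 8" using t(2) by linarith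
  have nx: "norm x \<le> r" using r[OF \<xi>(1)] by simp
  define s where "s = c1 * t"
  have s: "0 < s" "s \<le> t" using c1 t by (auto simp: s_def mult_left_le_one_le)
  have "(1 + L) * s \<le> (1 + L) * t" using s L1 by (intro mult_left_mono) auto
  then have sL: "(1 + L) * s \<le> e / 8" using t by linarith
  define y' where "y' = y + f (x + u) - f x"
  note par = dd_parallel[OF e \<xi>(1) d8[unfolded d_def] u[folded s_def] sL, folded y'_def]
  define ds where "ds = dd (R (x + u) y')"
  have "R x y \<in> U" using e by (meson centre_in_ball subsetD)
  then have w0: "0 \<le> f x - y" using clos[of x y] \<xi> by simp
  have wd: "f x - y \<le> (1 + L) * d"
    using depth_le_dd[OF e(3) _ nx] d8 e by (simp add: d_def)
  then have dw: "f x - y \<le> e / 8" using \<xi>(2) by (simp add: d_def)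
  have dle: "d \<le> f x - y" unfolding d_def by (rule dd_le_depth[OF e(3) w0]) (use dw e in linarith)
  define q where "q = sqrt (f x - y)"
  have q: "0 \<le> q" "q * q = f x - y" using w0 by (auto simp: q_def)
  have q1: "q \<le> 1" unfolding q_def using dw e by simp
  then have "q * q \<le> q * 1" using q by (intro mult_left_mono) auto
  then have wq: "f x - y \<le> q" using q by simp
  have "t + q \<le> 2" using t8 e q1 by linarith
  then have "s * (t + q) \<le> s * 2" using s by (intro mult_left_mono) auto
  then have \<beta>2: "\<beta> \<le> 2 * s" using \<beta>(2) by (simp add: s_def q_def)
  have d\<xi>'\<eta>: "dist (R (x + u) y') \<eta> \<le> \<beta>"
    using dist_R_le[of "x + u" y' "x + u" "y' - \<beta>"] \<beta> by (simp add: \<eta>_def y'_def)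
  have "dist (R x y) \<eta> \<le> (1 + L) * s + \<beta>"
    using dist_triangle[of "R x y" \<eta> "R (x + u) y'"] par(1) d\<xi>'\<eta> by linarith
  also have "\<dots> \<le> (3 + L) * c1 * t" using \<beta>2 by (simp add: s_def algebra_simps)
  also have "\<dots> \<le> 1 / 16 * t" using c1 t by (intro mult_right_mono) auto
  finally have dist: "dist (R x y) \<eta> \<le> t / 16" by simp
  have "ball \<eta> (e / 2) \<subseteq> U" by (rule near_ball[OF e(3)]) (use dist t8 e t in linarith)
  then have "\<eta> \<in> U" using e by (meson centre_in_ball half_gt_zero subsetD)
  then have \<eta>in: "\<eta> \<in> closure G" using clos[of "x + u" "y + f (x + u) - f x - \<beta>"] \<beta>(1) w0 by (simp add: \<eta>_def)
  have dsw: "ds \<le> f x - y"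
    using dd_le_depth[OF par(2)] w0 dw e by (simp add: ds_def y'_def)
  have Ms: "0 \<le> M * s" using M0 s by simp
  have "ds \<le> d + M * s * d" "d \<le> ds + M * s * ds" using par(5,6) by (simp_all add: ds_def d_def algebra_simps)
  moreover have "M * s * d \<le> M * s * q" "M * s * ds \<le> M * s * q" using Ms dle dsw wq
    by (intro mult_left_mono; linarith)+
  ultimately have "\<bar>ds - d\<bar> \<le> M * s * q" by linarith
  moreover have "\<bar>d' - ds\<bar> \<le> \<beta>" using dd_lipschitz[of \<eta> "R (x + u) y'"] d\<xi>'\<eta>
    by (simp add: d'_def ds_def dist_commute)
  moreover have "\<beta> \<le> s * (t + q)" using \<beta>(2) by (simp add: s_def q_def)
  moreover have "M * s * q \<le> M * s * (t + q)" using Ms t by (intro mult_left_mono) auto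
  ultimately have "\<bar>d' - d\<bar> \<le> s * (t + q) + M * s * (t + q)" by linarith
  also have "\<dots> = c1 * (1 + M) * (t * (t + q))" by (simp add: s_def algebra_simps)
  finally have E: "\<bar>d' - d\<bar> \<le> c1 * (1 + M) * (t * (t + q))" .
  define \<Delta> where "\<Delta> = \<bar>sqrt d - sqrt d'\<bar>"
  have D0: "0 \<le> \<Delta>" by (simp add: \<Delta>_def)
  have sq: "\<Delta> * (sqrt d + sqrt d') = \<bar>d' - d\<bar>"
  proof -
    have "d' - d = (sqrt d' - sqrt d) * (sqrt d' + sqrt d)" using d0 by (simp add: algebra_simps)
    then show ?thesis using d0 by (simp add: \<Delta>_def abs_mult abs_minus_commute add.commute)
  qed
  have kp: "0 < c1 * (1 + M)" using c1 M0 by simp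
  have "\<Delta> \<le> t / 4"
  proof (cases "t \<le> q")
    case True
    have "q \<le> (1 + L) * sqrt d"
    proof (unfold q_def, rule real_le_lsqrt)
      have "(1 + L) * d * 1 \<le> (1 + L) * d * (1 + L)" using L1 d0 by (intro mult_left_mono) auto
      moreover have "((1 + L) * sqrt d)\<^sup>2 = (1 + L) * d * (1 + L)"
        using d0 by (simp only: power_mult_distrib real_sqrt_pow2) (simp add: power2_eq_square)
      ultimately show "f x - y \<le> ((1 + L) * sqrt d)\<^sup>2" using wd by linarith
    qed (use L1 d0 w0 in auto)
    then have "\<Delta> * q \<le> \<Delta> * ((1 + L) * sqrt d)" using D0 by (intro mult_left_mono) auto
    also have "\<dots> \<le> (1 + L) * (\<Delta> * (sqrt d + sqrt d'))"
      using L1 D0 d0 by (simp add: mult_left_mono distrib_left mult.left_commute)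
    also have "\<dots> \<le> (1 + L) * (c1 * (1 + M) * (t * (t + q)))" unfolding sq using E L1
      by (intro mult_left_mono) auto
    also have "\<dots> \<le> (3 + L) * (c1 * (1 + M) * (t * (2 * q)))"
      using L1 kp c1(1) M0 t True by (intro mult_mono) auto
    also have "\<dots> = (c1 * (1 + M) * (3 + L)) * 2 * t * q" by (simp add: mult_ac)
    also have "\<dots> = t / 8 * q" unfolding c1(3) by simp
    finally have "\<Delta> * q \<le> t / 8 * q" .
    then have "\<Delta> \<le> t / 8" using True t by (simp add: mult_le_cancel_right)
    then show ?thesis using t by linarith
  next
    case False
    have "\<Delta> \<le> sqrt d + sqrt d'" unfolding \<Delta>_def using d0 by (smt (verit) real_sqrt_ge_zero)
    then have "\<Delta> * \<Delta> \<le> \<Delta> * (sqrt d + sqrt d')" using D0 by (intro mult_left_mono) auto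
    also have "\<dots> \<le> c1 * (1 + M) * (t * (t + q))" unfolding sq by (rule E)
    also have "\<dots> \<le> 1 / 64 * (t * (2 * t))" using c1(5) kp t q False by (intro mult_mono) auto
    also have "\<dots> \<le> (t / 4) * (t / 4)" using t by simp
    finally have "\<Delta>\<^sup>2 \<le> (t / 4)\<^sup>2" by (simp only: power2_eq_square)
    then show ?thesis by (rule power2_le_imp_le) (use t in simp)
  qed
  then have "rho (closure G) (R x y) \<eta> \<le> t" unfolding rho_eq using dist t by (simp add: \<Delta>_def d_def d'_def)
  then show ?thesis using \<eta>in by (simp add: rho_ball_def \<eta>_def)
qed

text \<open>The box of \<open>in_ball_small\<close> is measured by Tonelli: for each u a vertical
  interval of length \<open>b0\<close> hangs below the point moved parallel to the graph.\<close>

lemma ball_vol_small: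
  assumes e: "0 < e" "e \<le> 1" "ball (R x y) e \<subseteq> U" and \<xi>: "R x y \<in> closure G" "(1 + L) * dd (R x y) \<le> e / 8"
    and t: "0 < t" "(1 + L) * t \<le> e / 8"
  shows "ennreal (unit_ball_vol CARD('d) * c1 ^ CARD('d) * c1 * t ^ CARD('d) * (t * (t + sqrt (f x - y)))) \<le>
    emeasure lborel (rho_ball (closure G) (R x y) t)"
proof -
  define K where "K = rho_ball (closure G) (R x y) t"
  have Kb: "K \<in> sets borel" unfolding K_def by (intro rho_ball_borel) simp
  note [measurable] = orthogonal_transformation_borel(2)[OF orth] Kb
  define b0 where "b0 = c1 * t * (t + sqrt (f x - y))"
  have "R x y \<in> U" using e by (meson centre_in_ball subsetD)
  then have w0: "0 \<le> f x - y" using clos[of x y] \<xi> by simp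
  have b0: "0 \<le> b0" using c1 t w0 by (simp add: b0_def)
  have hm: "(\<lambda>z. indicator K (a + B z) :: ennreal) \<in> borel_measurable (borel \<Otimes>\<^sub>M borel)"
    unfolding borel_prod by measurable
  have hm2 [measurable]: "(\<lambda>x. \<integral>\<^sup>+y. indicator K (a + B (x, y)) \<partial>lborel) \<in> borel_measurable borel"
    using hm by (intro lborel.borel_measurable_nn_integral) (simp add: split_beta')
  have "ennreal b0 * emeasure lborel (cball (0 :: real ^ 'd) (c1 * t)) =
    (\<integral>\<^sup>+u. ennreal b0 * indicator (cball (0 :: real ^ 'd) (c1 * t)) u \<partial>lborel)"
    by (rule nn_integral_cmult_indicator[symmetric]) simp
  also have "\<dots> \<le> (\<integral>\<^sup>+u. \<integral>\<^sup>+y'. indicator K (R (x + u) y') \<partial>lborel \<partial>lborel)"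
  proof (rule nn_integral_mono)
    fix u :: "real ^ 'd"
    show "ennreal b0 * indicator (cball 0 (c1 * t)) u \<le> (\<integral>\<^sup>+y'. indicator K (R (x + u) y') \<partial>lborel)"
    proof (cases "norm u \<le> c1 * t")
      case True
      let ?h = "y + f (x + u) - f x"
      have "ennreal b0 = (\<integral>\<^sup>+y'. indicator {?h - b0..?h} y' \<partial>lborel)" using b0 by simp
      also have "\<dots> \<le> (\<integral>\<^sup>+y'. indicator K (R (x + u) y') \<partial>lborel)"
      proof (intro nn_integral_mono)
        fix y' :: real
        show "indicator {?h - b0..?h} y' \<le> (indicator K (R (x + u) y') :: ennreal)"
        proof (cases "y' \<in> {?h - b0..?h}")
          case y: True
          have "R (x + u) (?h - (?h - y')) \<in> K" unfolding K_def
            by (rule in_ball_small[OF e \<xi> t True]) (use y in \<open>auto simp: b0_def\<close>)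
          then show ?thesis using y by simp
        qed simp
      qed
      finally show ?thesis using True by simp
    qed simp
  qed
  also have "\<dots> = (\<integral>\<^sup>+x. \<integral>\<^sup>+y'. indicator K (R x y') \<partial>lborel \<partial>lborel)"
    by (rule nn_integral_lborel_translate) measurable
  also have "\<dots> = (\<integral>\<^sup>+z. indicator K (a + B z) \<partial>lborel)"
    by (rule nn_integral_lborel_pair[OF hm, symmetric])
  also have "\<dots> = (\<integral>\<^sup>+z. indicator K z \<partial>lborel)" by (rule nn_integral_lborel_isometry[OF orth]) simp
  also have "\<dots> = emeasure lborel K" using Kb by simp
  finally have A: "ennreal b0 * emeasure lborel (cball (0 :: real ^ 'd) (c1 * t)) \<le> emeasure lborel K" .
  have "emeasure lborel (cball (0 :: real ^ 'd) (c1 * t)) =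
    ennreal (unit_ball_vol CARD('d) * (c1 * t) ^ CARD('d))"
    using c1 t by (subst emeasure_cball) auto
  then have "ennreal b0 * emeasure lborel (cball (0 :: real ^ 'd) (c1 * t)) =
    ennreal (b0 * (unit_ball_vol CARD('d) * (c1 * t) ^ CARD('d)))"
    using b0 by (simp add: ennreal_mult')
  also have "b0 * (unit_ball_vol CARD('d) * (c1 * t) ^ CARD('d)) =
    unit_ball_vol CARD('d) * c1 ^ CARD('d) * c1 * t ^ CARD('d) * (t * (t + sqrt (f x - y)))"
    by (simp add: b0_def power_mult_distrib mult_ac)
  finally show ?thesis using A by (simp add: K_def)
qed

text \<open>The chart estimates hold for t below a threshold t0. Radii between t0 and 1 are absorbed
  into the constants: the ball of radius t0 bounds the volume from below by monotonicity, and the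
  trivial bound (1 + L) t on the shear is compared with t t0.\<close>

lemma boundary_patch:
  assumes e: "0 < e" "e \<le> 1"
  shows "\<exists>\<delta>>0. \<exists>\<kappa> c C. patch (closure G) {\<xi> \<in> closure G. ball \<xi> e \<subseteq> U \<and> dd \<xi> \<le> \<delta>} a B f g \<kappa> M c C"
proof -
  have cancel: "q * (z / (k * q)) = z / k" if "0 < q" for q z k :: real using that by simp
  define t0 where "t0 = e / (8 * (1 + L))"
  have t0: "0 < t0" "(1 + L) * t0 = e / 8" unfolding t0_def using e L1 by (simp, intro cancel, simp)
  have "1 * t0 \<le> (1 + L) * t0" using L1 t0(1) by (intro mult_right_mono) auto
  then have t01: "t0 \<le> 1" using t0(2) e by linarith
  \<comment> \<open>All points of the cap are within (3 + L + M) \<kappa> < e of the given point, so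
    the cap stays in U.\<close>
  define \<kappa> where "\<kappa> = e / (8 * (2 + L + M))"
  have k: "0 < \<kappa>" "(2 + L + M) * \<kappa> = e / 8" unfolding \<kappa>_def using e L1 M0 by (simp, intro cancel, simp)
  have "1 * \<kappa> \<le> (2 + L + M) * \<kappa>" using L1 M0 k by (intro mult_right_mono) auto
  then have k1: "\<kappa> \<le> e / 8" using k by linarith
  then have kk: "\<kappa>\<^sup>2 \<le> \<kappa>" using k e by (simp add: power2_eq_square mult_left_le)
  \<comment> \<open>By \<open>depth_le_dd\<close>, distance at most \<delta> forces depth at most
    \<kappa>^2 / 2, the range of depths that a patch allows.\<close>
  define \<delta> where "\<delta> = \<kappa>\<^sup>2 / (2 * (1 + L))"
  have \<delta>: "0 < \<delta>" "(1 + L) * \<delta> = \<kappa>\<^sup>2 / 2" unfolding \<delta>_def using k L1 by (simp, intro cancel, simp)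
  define c where "c = unit_ball_vol CARD('d) * c1 ^ CARD('d) * c1 * t0 ^ CARD('d) * t0\<^sup>2 / 2"
  define v where "v = unit_ball_vol CARD('d) * c1 ^ CARD('d) * c1"
  have v: "0 < v" unfolding v_def using c1 by (intro mult_pos_pos unit_ball_vol_pos) auto
  have c: "0 < c" "c = v * t0 ^ CARD('d) * t0\<^sup>2 / 2" using v t0 by (auto simp: c_def v_def)
  define C where "C = C2 + (1 + L) / t0"
  have C2: "0 \<le> C2" using L1 M0 by (simp add: C2_def)
  have C: "0 \<le> C" "C2 \<le> C" "(1 + L) / t0 \<le> C" using L1 t0 C2 by (auto simp: C_def)
  let ?S = "{\<xi> \<in> closure G. ball \<xi> e \<subseteq> U \<and> dd \<xi> \<le> \<delta>}"
  have "patch (closure G) ?S a B f g \<kappa> M c C"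
  proof
    fix x y
    assume S: "R x y \<in> ?S"
    then have \<xi>: "R x y \<in> closure G" "ball (R x y) e \<subseteq> U" "dd (R x y) \<le> \<delta>" by auto
    have dL: "(1 + L) * dd (R x y) \<le> \<kappa>\<^sup>2 / 2"
      using \<xi>(3) L1 mult_left_mono[of "dd (R x y)" \<delta> "1 + L"] \<delta>(2) by simp
    have dL8: "(1 + L) * dd (R x y) \<le> e / 8" using dL kk k1 k by linarith
    have d0: "0 \<le> dd (R x y)" by (rule infdist_nonneg)
    have "1 * dd (R x y) \<le> (1 + L) * dd (R x y)" using L1 d0 by (intro mult_right_mono) auto
    then have de: "dd (R x y) < e" using dL8 e by linarith
    have nx: "norm x \<le> r" using r[OF \<xi>(1)] by simp
    have "R x y \<in> U" using e \<xi> by (meson centre_in_ball subsetD)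
    then have w0: "0 \<le> f x - y" using clos[of x y] \<xi> by simp
    have w1: "f x - y \<le> \<kappa>\<^sup>2 / 2" using depth_le_dd[OF \<xi>(2) de nx] dL by linarith
    show "0 \<le> f x - y \<and> f x - y \<le> \<kappa>\<^sup>2 / 2" using w0 w1 by simp
    have q1: "sqrt (f x - y) \<le> 1" using w1 kk k1 e k by simp
    have q0: "0 \<le> sqrt (f x - y)" using w0 by simp
    {
      fix u :: "real ^ 'd" and w :: real assume u: "norm u \<le> \<kappa>" and w: "0 \<le> w" "w \<le> \<kappa>\<^sup>2"
      define y' where "y' = f x + g x \<bullet> u - M * (norm u)\<^sup>2 - w"
      have gu: "\<bar>g x \<bullet> u\<bar> \<le> L * \<kappa>"
        by (rule order_trans[OF Cauchy_Schwarz_ineq2]) (use gL[OF nx] u L1 in \<open>auto intro: mult_mono\<close>)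
      have mu: "0 \<le> M * (norm u)\<^sup>2" "M * (norm u)\<^sup>2 \<le> M * \<kappa>"
      proof -
        have "(norm u)\<^sup>2 \<le> \<kappa>\<^sup>2" using u by (intro power_mono) auto
        then show "M * (norm u)\<^sup>2 \<le> M * \<kappa>" using kk M0 by (intro mult_left_mono) auto
      qed (use M0 in simp)
      have "dist (R x y) (R (x + u) y') \<le> norm u + \<bar>y - y'\<bar>" using dist_R_le[of x y "x + u" y'] by simp
      also have "\<dots> \<le> \<kappa> + (\<kappa> + L * \<kappa> + M * \<kappa> + \<kappa>)"
        using u gu mu w w0 w1 kk k unfolding y'_def by linarith
      also have "\<dots> = (2 + L + M) * \<kappa> + \<kappa>" by (simp add: algebra_simps)
      also have "\<dots> < e" using k k1 e by linarith
      finally have "R (x + u) y' \<in> U" using \<xi>(2) by auto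
      moreover have "y' \<le> f (x + u)"
      proof -
        have "\<bar>f (x + u) - f x - g x \<bullet> u\<bar> \<le> M * (norm u)\<^sup>2" using T by (simp add: taylor_bound_def)
        then show ?thesis using w unfolding y'_def by linarith
      qed
      ultimately show "R (x + u) (f x + g x \<bullet> u - M * (norm u)\<^sup>2 - w) \<in> closure G"
        using clos[of "x + u" y'] by (simp add: y'_def)
    }
    {
      fix t :: real and u :: "real ^ 'd" and b :: real assume t: "0 < t" "t \<le>
        1" and \<eta>: "R (x + u) (y + b) \<in> rho_ball (closure G) (R x y) t"
      have "rho (closure G) (R x y) (R (x + u) (y + b)) \<le> t" using \<eta> by (simp add: rho_ball_def)
      then have d: "dist (R x y) (R (x + u) (y + b)) \<le> t" unfolding rho_eq by linarith
      have u: "norm u \<le> t" using le_dist_R(1)[of x "x + u" y "y + b"] d by simp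
      have b: "\<bar>b\<bar> \<le> t" using le_dist_R(2)[of y "y + b" x "x + u"] d by simp
      have tq: "0 \<le> t * (t + sqrt (f x - y))" using t q0 by simp
      have "\<bar>b - g x \<bullet> u\<bar> \<le> C * t * (t + sqrt (f x - y))"
      proof (cases "t \<le> t0")
        case True
        have "(1 + L) * t \<le> (1 + L) * t0" using True L1 by (intro mult_left_mono) auto
        then have "\<bar>b - g x \<bullet> u\<bar> \<le> C2 * t * (t + sqrt (f x - y))"
          using t0 by (intro ball_coords_small[OF e \<xi>(2,1) dL8 t(1) _ \<eta>]) simp
        also have "\<dots> \<le> C * t * (t + sqrt (f x - y))" using mult_right_mono[OF C(2) tq] by (simp add: mult.assoc)
        finally show ?thesis .
      next
        case False
        have "\<bar>g x \<bullet> u\<bar> \<le> L * t"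
          by (rule order_trans[OF Cauchy_Schwarz_ineq2]) (use gL[OF nx] u L1 in \<open>auto intro: mult_mono\<close>)
        then have "\<bar>b - g x \<bullet> u\<bar> \<le> (1 + L) * t" using b by (simp add: algebra_simps)
        also have "\<dots> = ((1 + L) / t0) * (t * t0)" using t0(1) by simp
        also have "\<dots> \<le> C * (t * (t + sqrt (f x - y)))"
        proof -
          have "t0 \<le> t + sqrt (f x - y)" using False q0 by linarith
          then have "t * t0 \<le> t * (t + sqrt (f x - y))" using t by (intro mult_left_mono) auto
          then show ?thesis using C(1,3) t t0(1) by (intro mult_mono) auto
        qed
        finally show ?thesis by (simp add: mult.assoc)
      qed
      then show "norm u \<le> t \<and> \<bar>b - g x \<bullet> u\<bar> \<le> C * t * (t + sqrt (f x - y))" using u by simp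
    }
    {
      fix t :: real assume t: "0 < t" "t \<le> 1"
      define s where "s = min t t0"
      have s: "0 < s" "s \<le> t" "s \<le> t0" using t t0 by (auto simp: s_def)
      have "(1 + L) * s \<le> (1 + L) * t0" using s L1 by (intro mult_left_mono) auto
      then have "ennreal (v * s ^ CARD('d) * (s * (s + sqrt (f x - y)))) \<le>
        emeasure lborel (rho_ball (closure G) (R x y) s)"
        using ball_vol_small[OF e \<xi>(2,1) dL8 s(1)] t0 by (simp add: v_def)
      also have "\<dots> \<le> emeasure lborel (rho_ball (closure G) (R x y) t)"
        using s by (intro emeasure_mono rho_ball_mono) (auto intro: rho_ball_borel)
      finally have A: "ennreal (v * s ^ CARD('d) * (s * (s + sqrt (f x - y)))) \<le>
        emeasure lborel (rho_ball (closure G) (R x y) t)" .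
      have "c * t ^ CARD('d) * (t * (t + sqrt (f x - y))) \<le> v * s ^ CARD('d) * (s * (s + sqrt (f x - y)))"
      proof (cases "t \<le> t0")
        case True
        then have st: "s = t" by (simp add: s_def)
        have "t0 ^ CARD('d) * t0\<^sup>2 \<le> 1 * 1" using t0 t01 by (intro mult_mono power_le_one) auto
        then have "v * (t0 ^ CARD('d) * t0\<^sup>2) \<le> v * 1" using v by (intro mult_left_mono) auto
        moreover have "c * 2 = v * (t0 ^ CARD('d) * t0\<^sup>2)" by (simp add: c(2) mult.assoc)
        ultimately have "c \<le> v" using v by linarith
        then show ?thesis unfolding st using t q0 by (intro mult_right_mono) auto
      next
        case False
        then have st: "s = t0" by (simp add: s_def)
        have "t + sqrt (f x - y) \<le> 2" using t q1 by linarith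
        then have "c * t ^ CARD('d) * (t * (t + sqrt (f x - y))) \<le> c * 1 * (1 * 2)"
          using t q0 c(1) by (intro mult_mono power_le_one) auto
        also have "\<dots> = v * t0 ^ CARD('d) * (t0 * t0)" by (simp add: c(2) power2_eq_square)
        also have "\<dots> \<le> v * t0 ^ CARD('d) * (t0 * (t0 + sqrt (f x - y)))"
          using v t0 q0 by (intro mult_left_mono) auto
        finally show ?thesis unfolding st .
      qed
      then show "ennreal (c * t ^ CARD('d) * (t * (t + sqrt (f x - y)))) \<le>
        emeasure lborel (rho_ball (closure G) (R x y) t)"
        using A order_trans ennreal_leI by blast
    }
  qed (use orth taylor_bound_continuous[OF T] k c C M0 in auto)
  then show ?thesis using \<delta> by blast
qed

end

section \<open>Covering the domain by patches\<close>

lemma infdist_frontier_le: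
  fixes \<xi> z :: "'a::euclidean_space"
  assumes "\<xi> \<in> \<Omega>" "z \<notin> \<Omega>" shows "infdist \<xi> (frontier \<Omega>) \<le> dist \<xi> z"
proof -
  have "closed_segment \<xi> z \<inter> frontier \<Omega> \<noteq> {}"
    using assms by (intro connected_Int_frontier convex_connected) auto
  then obtain m where m: "m \<in> closed_segment \<xi> z" "m \<in> frontier \<Omega>" by auto
  have "infdist \<xi> (frontier \<Omega>) \<le> dist \<xi> m" by (rule infdist_le[OF m(2)])
  also have "\<dots> \<le> dist \<xi> z" using segment_bound(1)[OF m(1)] by (simp add: dist_norm norm_minus_commute)
  finally show ?thesis .
qed

lemma patch_subset:
  assumes "patch \<Omega> S a B f g \<kappa> M c C" "S' \<subseteq> S" shows "patch \<Omega> S' a B f g \<kappa> M c C"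
proof -
  interpret patch \<Omega> S a B f g \<kappa> M c C by fact
  show ?thesis
    by unfold_locales
      (rule orth cont pos subset_trans[OF assms(2) S_sub]
        | (rule depth, erule subsetD[OF assms(2)])
        | (rule inside ball_sub ball_vol, erule subsetD[OF assms(2)], assumption+))+
qed

text \<open>Away from the boundary a fictitious horizontal plane at height h above the centre serves
  as the graph, with zero slope and curvature. Depths stay between h / 2 and 3 h / 2, so their roots
  are bounded above and below, and sheared boxes are comparable to Euclidean balls of radius
  t.\<close>

lemma interior_patch:
  fixes \<Omega> :: "((real ^ 'd) \<times> real) set"
  assumes \<Omega>: "closed \<Omega>" and \<xi>0: "\<xi>0 \<in> \<Omega>" and \<delta>: "0 < \<delta>" "\<delta> \<le> infdist \<xi>0 (frontier \<Omega>)"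
  shows "\<exists>\<rho>>0. \<exists>a B f g \<kappa> M c C. patch \<Omega> (ball \<xi>0 \<rho>) a B f g \<kappa> M c C"
proof -
  obtain x0 y0 where xy0: "\<xi>0 = (x0, y0)" by fastforce
  \<comment> \<open>With \<kappa>^2 = 3 h the limit \<kappa>^2 / 2 is the largest depth 3 h / 2. The
    bound \<delta>^2 / 48 makes \<kappa> at most \<delta> / 4, so the fictitious cap stays in the
    domain.\<close>
  define h where "h = min (\<delta> / 20) (\<delta>\<^sup>2 / 48)"
  have h: "0 < h" "h \<le> \<delta> / 20" "h \<le> \<delta>\<^sup>2 / 48" using \<delta> by (auto simp: h_def)
  define \<kappa> where "\<kappa> = sqrt (3 * h)"
  have k: "0 < \<kappa>" "\<kappa>\<^sup>2 = 3 * h" using h by (auto simp: \<kappa>_def)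
  have k4: "\<kappa> \<le> \<delta> / 4" unfolding \<kappa>_def
    by (rule real_le_lsqrt) (use h \<delta> in \<open>auto simp: power_divide\<close>)
  have sub: "ball \<xi>0 \<delta> \<subseteq> \<Omega>"
    using infdist_frontier_le[OF \<xi>0] \<delta> by (auto simp: dist_commute) (smt (verit) dist_commute mem_ball)
  \<comment> \<open>The distance changes by at most k1 t; divided by the lower bound sqrt (\<delta>
    / 2) for the roots this leaves t / 2. The other half of t is for the Euclidean part of
    \<open>rho\<close>.\<close>
  define k1 where "k1 = min (1 / 2) (sqrt (\<delta> / 2) / 2)"
  have k1: "0 < k1" "k1 \<le> 1 / 2" "k1 \<le> sqrt (\<delta> / 2) / 2" using \<delta> by (auto simp: k1_def)
  define Q where "Q = 1 + sqrt (2 * h)"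
  have Q: "0 < Q" using h by (simp add: Q_def add_pos_nonneg)
  define k2 where "k2 = min k1 (\<delta> / 4)"
  have k2: "0 < k2" "k2 \<le> k1" "k2 \<le> \<delta> / 4" using k1 \<delta> by (auto simp: k2_def)
  define v where "v = unit_ball_vol (real (CARD('d) + 1)) * k2 ^ (CARD('d) + 1)"
  have v: "0 < v" unfolding v_def using k2 by (intro mult_pos_pos unit_ball_vol_pos) auto
  have "patch \<Omega> (ball \<xi>0 (h / 2)) 0 id (\<lambda>_. y0 + h) (\<lambda>_. 0) \<kappa> 0 (v / Q) (1 / sqrt (h / 2))"
  proof
    show "ball \<xi>0 (h / 2) \<subseteq> \<Omega>" using sub h \<delta> by force
    show "orthogonal_transformation id" by (simp add: id_def orthogonal_transformation_id)
    fix x y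
    assume "0 + id (x, y) \<in> ball \<xi>0 (h / 2)"
    then have d: "dist (x0, y0) (x, y) < h / 2" by (simp add: xy0)
    have dx: "dist x0 x < h / 2" and dy: "\<bar>y0 - y\<bar> < h / 2"
      using d dist_fst_le[of "(x0, y0)" "(x, y)"] dist_snd_le[of "(x0, y0)" "(x, y)"]
        by (auto simp: dist_real_def)
    show "0 \<le> y0 + h - y \<and> y0 + h - y \<le> \<kappa>\<^sup>2 / 2" using dy h unfolding k by (auto simp: abs_if split: if_splits)
    have w: "h / 2 \<le> y0 + h - y" "y0 + h - y \<le> 2 * h" using dy h by (auto simp: abs_if split: if_splits)
    {
      fix u :: "real ^ 'd" and w assume u: "norm u \<le> \<kappa>" "0 \<le> w" "w \<le> \<kappa>\<^sup>2"
      have "dist \<xi>0 (x + u, y0 + h - w) \<le> dist x0 (x + u) + dist y0 (y0 + h - w)"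
        unfolding xy0 dist_prod_def fst_conv snd_conv by (rule sqrt_sum_squares_le_sum) auto
      also have "dist x0 (x + u) \<le> h / 2 + \<kappa>"
        using dist_triangle[of x0 "x + u" x] dx u by (simp add: dist_norm)
      also have "dist y0 (y0 + h - w) \<le> 2 * h" using u k by (simp add: dist_real_def)
      finally have "dist \<xi>0 (x + u, y0 + h - w) < \<delta>" using h k4 \<delta> by linarith
      then show "0 + id (x + u, y0 + h + 0 \<bullet> u - 0 * (norm u)\<^sup>2 - w) \<in> \<Omega>" using sub by auto
    }
    {
      fix t :: real and u :: "real ^ 'd" and b assume t: "0 < t"
        and \<eta>: "0 + id (x + u, y + b) \<in> rho_ball \<Omega> (0 + id (x, y)) t"
      have "rho \<Omega> (x, y) (x + u, y + b) \<le> t" using \<eta> by (simp add: rho_ball_def)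
      then have "norm ((x, y) - (x + u, y + b)) \<le> t" unfolding rho_def by linarith
      then have n: "norm (- u, - b) \<le> t" by simp
      have u: "norm u \<le> t" using norm_fst_le[of "- u" "- b"] n by simp
      have b: "\<bar>b\<bar> \<le> t" using norm_snd_le[of "- b" "- u"] n by simp
      have "sqrt (h / 2) \<le> t + sqrt (y0 + h - y)" using t w by (intro add_increasing) auto
      then have "1 \<le> 1 / sqrt (h / 2) * (t + sqrt (y0 + h - y))" using h by (simp add: field_simps)
      then have "t * 1 \<le> t * (1 / sqrt (h / 2) * (t + sqrt (y0 + h - y)))" using t
        by (intro mult_left_mono) auto
      then show "norm u \<le> t \<and> \<bar>b - 0 \<bullet> u\<bar> \<le> 1 / sqrt (h / 2) * t * (t + sqrt (y0 + h - y))"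
        using u b by (simp add: mult_ac)
    }
    {
      fix t :: real assume t: "0 < t" "t \<le> 1"
      have "cball (x, y) (k2 * t) \<subseteq> rho_ball \<Omega> (x, y) t"
      proof
        fix z assume "z \<in> cball (x, y) (k2 * t)"
        then have z: "dist (x, y) z \<le> k2 * t" by simp
        have k2t: "k2 * t \<le> k2" "k2 * t \<le> 1 / 2 * t" "k2 * t \<le> k1 * t"
          using k2 k1 t by (auto intro: mult_left_le mult_right_mono)
        have "dist \<xi>0 z \<le> dist \<xi>0 (x, y) + dist (x, y) z" by (rule dist_triangle)
        then have "dist \<xi>0 z < \<delta>" using d z h k2 k2t \<delta> unfolding xy0 by linarith
        then have z\<Omega>: "z \<in> \<Omega>" using sub by auto
        define d1 d2 where "d1 = infdist (x, y) (frontier \<Omega>)" and "d2 = infdist z (frontier \<Omega>)"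
        have dn: "0 \<le> d1" "0 \<le> d2" by (auto simp: d1_def d2_def infdist_nonneg)
        have "infdist \<xi>0 (frontier \<Omega>) \<le> d1 + dist \<xi>0 (x, y)" unfolding d1_def by (rule infdist_triangle)
        then have d1: "\<delta> / 2 \<le> d1" using \<delta> d h unfolding xy0 by linarith
        have dd: "\<bar>d1 - d2\<bar> \<le> k1 * t" unfolding d1_def d2_def
          using infdist_triangle_abs[of "(x, y)" "frontier \<Omega>" z] z k2t by linarith
        have "\<bar>sqrt d1 - sqrt d2\<bar> * sqrt (\<delta> / 2) \<le> \<bar>sqrt d1 - sqrt d2\<bar> * (sqrt d1 + sqrt d2)"
          using d1 dn by (intro mult_left_mono add_increasing2) auto
        also have "\<dots> = \<bar>d1 - d2\<bar>"
        proof -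
          have "d1 - d2 = (sqrt d1 - sqrt d2) * (sqrt d1 + sqrt d2)" using dn by (simp add: algebra_simps)
          then show ?thesis using dn by (simp add: abs_mult)
        qed
        also note dd
        also have "k1 * t \<le> sqrt (\<delta> / 2) / 2 * t" using k1(3) t by (intro mult_right_mono) auto
        also have "\<dots> = (t / 2) * sqrt (\<delta> / 2)" by simp
        finally have "\<bar>sqrt d1 - sqrt d2\<bar> \<le> t / 2" using \<delta> by (simp add: mult_le_cancel_right)
        then show "z \<in> rho_ball \<Omega> (x, y) t"
          using z\<Omega> z k2t by (simp add: rho_ball_def rho_def d1_def d2_def dist_norm)
      qed
      then have "emeasure lborel (cball (x, y) (k2 * t)) \<le> emeasure lborel (rho_ball \<Omega> (x, y) t)"
        by (rule emeasure_mono) (simp add: rho_ball_borel[OF \<Omega>])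
      moreover have "emeasure lborel (cball (x, y) (k2 * t)) = ennreal (v * t ^ (CARD('d) + 1))"
        using k2 t by (subst emeasure_cball) (auto simp: v_def power_mult_distrib mult_ac)
      moreover have "v / Q * t ^ CARD('d) * (t * (t + sqrt (y0 + h - y))) \<le> v * t ^ (CARD('d) + 1)"
      proof -
        have "sqrt (y0 + h - y) \<le> sqrt (2 * h)" using w by simp
        then have "t + sqrt (y0 + h - y) \<le> Q" unfolding Q_def using t by linarith
        then have "v / Q * t ^ CARD('d) * (t * (t + sqrt (y0 + h - y))) \<le> v / Q * t ^ CARD('d) * (t * Q)"
          using v Q t by (intro mult_left_mono) auto
        also have "\<dots> = v * t ^ (CARD('d) + 1)" using Q by (simp add: mult_ac)
        finally show ?thesis .
      qed
      ultimately show "ennreal (v / Q * t ^ CARD('d) * (t * (t + sqrt (y0 + h - y)))) \<le>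
        emeasure lborel (rho_ball \<Omega> (0 + id (x, y)) t)"
        using ennreal_leI order_trans by fastforce
    }
  qed (use k v Q h in auto)
  then have "\<exists>a B f g \<kappa> M c C. patch \<Omega> (ball \<xi>0 (h / 2)) a B f g \<kappa> M c C" by blast
  then show ?thesis using h by (intro exI[of _ "h / 2"] conjI) simp_all
qed

text \<open>The collar condition is given at points of the open domain; closedness of this set
  carries it over to points of the closure.\<close>

lemma closed_ball_subset: "closed {\<xi>::'a::metric_space. ball \<xi> e \<subseteq> U}"
proof -
  have *: "{\<xi>. ball \<xi> e \<subseteq> U} = - (\<Union>z\<in>-U. ball z e)" by (auto simp: dist_commute)
  show ?thesis unfolding * by (intro closed_Compl open_UN) auto
qed

text \<open>The descriptions of G and its closure are stated apart from the chart, because they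
  serve to prove the frontier equation that the chart presupposes.\<close>

lemma subgraph_chart:
  fixes G U :: "((real ^ 'd) \<times> real) set"
  assumes G: "open G" "bounded G" "G \<noteq> {}" and U: "open U" and f: "class_C 2 f"
    and bd: "\<And>i k x. \<bar>partial i (partial k f) x\<bar> \<le> M0" and sub: "subgraph_on G U f"
  obtains a B g M where "orthogonal_transformation B" "taylor_bound f g M"
    "\<And>x y. a + B (x, y) \<in> U \<Longrightarrow> a + B (x, y) \<in> G \<longleftrightarrow> y < f x"
    "\<And>x y. a + B (x, y) \<in> U \<Longrightarrow> a + B (x, y) \<in> closure G \<longleftrightarrow> y \<le> f x"
    "frontier (closure G) = frontier G \<Longrightarrow> \<exists>r L. chart G U a B f g M r L"
proof -
  obtain A a where A: "orthogonal_transformation A" "G \<inter> U = {x \<in> U. snd (A (x - a)) < f (fst (A (x - a)))}"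
    using sub by (auto simp: subgraph_on_def)
  obtain g M where T: "taylor_bound f g M" using class_C2_taylor_bound[OF f bd] by blast
  have cl: "closure G \<inter> U = {x \<in> U. snd (A (x - a)) \<le> f (fst (A (x - a)))}"
    by (rule closure_subgraph[OF A(1) U taylor_bound_continuous(1)[OF T] A(2)])
  define B where "B = inv A"
  have B: "orthogonal_transformation B" unfolding B_def by (rule orthogonal_transformation_inv[OF A(1)])
  have AB: "A (B z) = z" for z unfolding B_def using orthogonal_transformation_surj[OF A(1)]
    by (simp add: surj_f_inv_f)
  have s1: "a + B (x, y) \<in> G \<longleftrightarrow> y < f x" if "a + B (x, y) \<in> U" for x y
  proof -
    have "a + B (x, y) \<in> G \<longleftrightarrow> a + B (x, y) \<in> G \<inter> U" using that by simp
    also have "\<dots> \<longleftrightarrow> y < f x" unfolding A(2) using that by (simp add: AB)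
    finally show ?thesis .
  qed
  have s2: "a + B (x, y) \<in> closure G \<longleftrightarrow> y \<le> f x" if "a + B (x, y) \<in> U" for x y
  proof -
    have "a + B (x, y) \<in> closure G \<longleftrightarrow> a + B (x, y) \<in> closure G \<inter> U" using that by simp
    also have "\<dots> \<longleftrightarrow> y \<le> f x" unfolding cl using that by (simp add: AB)
    finally show ?thesis .
  qed
  obtain \<rho> where \<rho>: "\<And>z. z \<in> closure G \<Longrightarrow> norm z \<le> \<rho>" using bounded_closure[OF G(2)] by (auto simp: bounded_iff)
  have \<rho>0: "0 \<le> \<rho>" using G(3) \<rho> closure_subset norm_ge_zero by (metis all_not_in_conv order_trans subsetD)
  define r where "r = \<rho> + norm a + 3"
  have r0: "0 \<le> r" using \<rho>0 by (simp add: r_def)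
  have rr: "norm x + 3 \<le> r" if "a + B (x, y) \<in> closure G" for x y
  proof -
    have "norm x \<le> norm (x, y)" by (rule norm_fst_le)
    also have "\<dots> = norm (B (x, y))" using B by (simp add: orthogonal_transformation_norm)
    also have "B (x, y) = (a + B (x, y)) - a" by simp
    also have "norm \<dots> \<le> norm (a + B (x, y)) + norm a" by (rule norm_triangle_ineq4)
    also have "\<dots> \<le> \<rho> + norm a" using \<rho>[OF that] by simp
    finally show ?thesis by (simp add: r_def)
  qed
  obtain L where L: "1 \<le> L" "\<And>x. norm x \<le> r \<Longrightarrow> norm (g x) \<le> L"
    "\<And>x y. norm x \<le> r \<Longrightarrow> norm y \<le> r \<Longrightarrow> \<bar>f x - f y\<bar> \<le> L * norm (x - y)"
    using taylor_bound_lipschitz[OF T r0] by blast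
  show thesis
  proof
    show "orthogonal_transformation B" "taylor_bound f g M" by fact+
    show "\<exists>r L. chart G U a B f g M r L" if "frontier (closure G) = frontier G"
    proof (intro exI)
      show "chart G U a B f g M r L"
        by unfold_locales (rule G U B T that L(1) | (rule s1 s2 rr L(2,3); assumption))+
    qed
  qed (use s1 s2 in blast)+
qed

lemma C2_domain_patches:
  fixes G :: "((real ^ 'd) \<times> real) set"
  assumes "C2_domain G"
  obtains \<S> where "finite \<S>" "closure G \<subseteq> \<Union>\<S>"
    "\<And>S. S \<in> \<S> \<Longrightarrow> S \<in> sets borel" "\<And>S. S \<in> \<S> \<Longrightarrow> \<exists>a B f g \<kappa> M c C. patch (closure G) S a B f g \<kappa> M c C"
proof -
  have G: "open G" "bounded G" "G \<noteq> {}" using assms by (auto simp: C2_domain_def)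
  obtain \<delta> M0 and J :: nat and U f where \<delta>: "0 < \<delta>" and cov: "frontier G \<subseteq> (\<Union>j\<in>{1..J}. U j)"
    and ch: "\<forall>j\<in>{1..J}. open (U j) \<and> connected (U j) \<and> class_C 2 (f j) \<and>
           (\<forall>i k x. \<bar>partial i (partial k (f j)) x\<bar> \<le> M0) \<and> subgraph_on G (U j) (f j)"
    and col: "\<forall>x\<in>G. infdist x (frontier G) < \<delta> \<longrightarrow>
           (\<exists>j\<in>{1..J}. x \<in> U j \<and> infdist x (frontier (U j)) > \<delta>)"
    using assms unfolding C2_domain_def by (elim conjE exE) (rule that; assumption)
  have chart: "open (U j)" "class_C 2 (f j)" "\<And>i k x. \<bar>partial i (partial k (f j)) x\<bar> \<le>
    M0" "subgraph_on G (U j) (f j)"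
    if "j \<in> {1..J}" for j using bspec[OF ch that] by auto
  \<comment> \<open>Points just above the graph are outside the closure, so no boundary point is
    interior to the closure.\<close>
  have fr: "frontier (closure G) = frontier G"
  proof -
    have "x \<notin> interior (closure G)" if x: "x \<in> frontier G" for x
    proof
      assume xi: "x \<in> interior (closure G)"
      obtain j where j: "j \<in> {1..J}" "x \<in> U j" using cov x by auto
      obtain B g M a where B: "orthogonal_transformation B" "taylor_bound (f j) g M"
        "\<And>x y. a + B (x, y) \<in> U j \<Longrightarrow> a + B (x, y) \<in> G \<longleftrightarrow> y < f j x"
        "\<And>x y. a + B (x, y) \<in> U j \<Longrightarrow> a + B (x, y) \<in> closure G \<longleftrightarrow> y \<le> f j x"
        "frontier (closure G) = frontier G \<Longrightarrow> \<exists>r L. chart G (U j) a B (f j) g M r L"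
        by (rule subgraph_chart[OF G chart[OF j(1)]]) (rule that; blast)
      obtain x1 y1 where xy: "x = a + B (x1, y1)"
        using orthogonal_transformation_surj[OF B(1)] by (metis surjD surj_pair diff_add_cancel add.commute)
      have "x \<notin> G" using x G(1) by (simp add: frontier_def interior_open)
      then have y1: "f j x1 \<le> y1" using B(3)[of x1 y1] j xy by simp
      have lim: "((\<lambda>s. a + B (x1, y1 + s)) \<longlongrightarrow> x) (at_right 0)"
      proof -
        have "continuous_on UNIV (\<lambda>s. a + B (x1, y1 + s))"
          by (intro continuous_intros continuous_on_compose2[OF orthogonal_transformation_borel(1)[OF B(1)]]) auto
        then have "isCont (\<lambda>s. a + B (x1, y1 + s)) 0" by (simp add: continuous_on_eq_continuous_at)
        then have "((\<lambda>s. a + B (x1, y1 + s)) \<longlongrightarrow> a + B (x1, y1 + 0)) (at 0)" by (simp add: isCont_def)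
        then show ?thesis by (simp add: xy filterlim_at_split)
      qed
      have "open (interior (closure G) \<inter> U j)" using chart(1)[OF j(1)] by auto
      then have "\<forall>\<^sub>F s in at_right 0. a + B (x1, y1 + s) \<in> interior (closure G) \<inter> U j"
        using topological_tendstoD[OF lim] xi j by blast
      moreover have "\<forall>\<^sub>F s::real in at_right 0. 0 < s" by (simp add: eventually_at_right_less)
      ultimately have "\<forall>\<^sub>F s::real in at_right 0. False"
      proof eventually_elim
        case (elim s)
        then have "a + B (x1, y1 + s) \<in> closure G" "a + B (x1, y1 + s) \<in> U j" using interior_subset by auto
        then show False using B(4)[of x1 "y1 + s"] y1 elim by simp
      qed
      then show False by simp
    qed
    moreover have "interior (closure G) \<supseteq> G" using G(1) by (simp add: closure_subset interior_maximal)
    ultimately show ?thesis using G(1) by (auto simp: frontier_def interior_open)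
  qed
  define e where "e = min \<delta> 1"
  have e: "0 < e" "e \<le> 1" "e \<le> \<delta>" using \<delta> by (auto simp: e_def)
  define Z where "Z d j = {\<xi> \<in> closure G. ball \<xi> e \<subseteq> U j \<and> infdist \<xi> (frontier G) \<le> d}" for d j
  have "\<forall>j\<in>{1..J}. \<exists>d>0. \<exists>a B f g \<kappa> M c C. patch (closure G) (Z d j) a B f g \<kappa> M c C"
  proof
    fix j assume j: "j \<in> {1..J}"
    obtain a B g M r L where "chart G (U j) a B (f j) g M r L"
      using subgraph_chart[OF G chart[OF j]] fr by metis
    from chart.boundary_patch[OF this e(1,2)]
    show "\<exists>d>0. \<exists>a B f g \<kappa> M c C. patch (closure G) (Z d j) a B f g \<kappa> M c C" unfolding Z_def by blast
  qed
  then obtain d where d: "\<And>j. j \<in> {1..J} \<Longrightarrow> 0 < d j"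
    "\<And>j. j \<in> {1..J} \<Longrightarrow> \<exists>a B f g \<kappa> M c C. patch (closure G) (Z (d j) j) a B f g \<kappa> M c C" by metis
  \<comment> \<open>The half makes it strictly smaller than \<delta>, so that points left over by
    the interior balls satisfy the strict inequality in the collar condition.\<close>
  define \<delta>1 where "\<delta>1 = Min (insert (\<delta> / 2) (d ` {1..J}))"
  have \<delta>1: "0 < \<delta>1" "\<delta>1 < \<delta>" "\<And>j. j \<in> {1..J} \<Longrightarrow> \<delta>1 \<le> d j"
  proof -
    show "0 < \<delta>1" unfolding \<delta>1_def using d \<delta> by (subst Min_gr_iff) auto
    have "\<delta>1 \<le> \<delta> / 2" unfolding \<delta>1_def by (intro Min_le) auto
    then show "\<delta>1 < \<delta>" using \<delta> by simp
    show "\<delta>1 \<le> d j" if "j \<in> {1..J}" for j unfolding \<delta>1_def using that by (intro Min_le) auto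
  qed
  define K where "K = {\<xi> \<in> closure G. \<delta>1 \<le> infdist \<xi> (frontier G)}"
  have "closed K" unfolding K_def Collect_conj_eq
    by (intro closed_Int closed_Collect_le continuous_intros) (simp add: closed_closure)
  moreover have "bounded K" using bounded_closure[OF G(2)] by (rule bounded_subset) (auto simp: K_def)
  ultimately have cK: "compact K" by (simp add: compact_eq_bounded_closed)
  have "\<forall>\<xi>\<in>K. \<exists>\<rho>>0. \<exists>a B f g \<kappa> M c C. patch (closure G) (ball \<xi> \<rho>) a B f g \<kappa> M c C"
  proof
    fix \<xi> assume "\<xi> \<in> K"
    then show "\<exists>\<rho>>0. \<exists>a B f g \<kappa> M c C. patch (closure G) (ball \<xi> \<rho>) a B f g \<kappa> M c C"
      by (intro interior_patch[OF closed_closure _ \<delta>1(1)]) (auto simp: K_def fr)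
  qed
  then obtain \<rho> where \<rho>: "\<And>\<xi>. \<xi> \<in> K \<Longrightarrow> 0 < \<rho> \<xi>"
    "\<And>\<xi>. \<xi> \<in> K \<Longrightarrow> \<exists>a B f g \<kappa> M c C. patch (closure G) (ball \<xi> (\<rho> \<xi>)) a B f g \<kappa> M c C" by metis
  have "K \<subseteq> (\<Union>\<xi>\<in>K. ball \<xi> (\<rho> \<xi>))" using \<rho>(1) by force
  then obtain F where F: "F \<subseteq> K" "finite F" "K \<subseteq> (\<Union>\<xi>\<in>F. ball \<xi> (\<rho> \<xi>))"
    using compactE_image[OF cK, of K "\<lambda>\<xi>. ball \<xi> (\<rho> \<xi>)"] by auto
  define \<S> where "\<S> = Z \<delta>1 ` {1..J} \<union> (\<lambda>\<xi>. ball \<xi> (\<rho> \<xi>)) ` F"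
  show thesis
  proof
    show "finite \<S>" using F by (simp add: \<S>_def)
    show "closure G \<subseteq> \<Union>\<S>"
    proof
      fix \<xi> assume \<xi>: "\<xi> \<in> closure G"
      show "\<xi> \<in> \<Union>\<S>"
      proof (cases "\<delta>1 \<le> infdist \<xi> (frontier G)")
        case True
        then have "\<xi> \<in> K" using \<xi> by (simp add: K_def)
        then show ?thesis using F(3) by (auto simp: \<S>_def)
      next
        case False
        \<comment> \<open>Points of G near \<xi> have charts with room e around them. The centres
          with this property form, for each of the finitely many charts, a closed set, so one of
          these sets also contains \<xi>.\<close>
        define N where "N = {\<xi>. infdist \<xi> (frontier G) < \<delta>}"
        have N: "open N" unfolding N_def by (intro open_Collect_less continuous_intros)
        have GN: "G \<inter> N \<subseteq> (\<Union>j\<in>{1..J}. {\<xi>. ball \<xi> e \<subseteq> U j})"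
        proof
          fix x assume x: "x \<in> G \<inter> N"
          then obtain j where j: "j \<in> {1..J}" "x \<in> U j" "infdist x (frontier (U j)) > \<delta>"
            using bspec[OF col, of x] by (auto simp: N_def)
          have "ball x e \<subseteq> U j"
          proof
            fix z assume "z \<in> ball x e"
            then show "z \<in> U j" using infdist_frontier_le[OF j(2), of z] j(3) e by force
          qed
          then show "x \<in> (\<Union>j\<in>{1..J}. {\<xi>. ball \<xi> e \<subseteq> U j})" using j by blast
        qed
        have "\<xi> \<in> N \<inter> closure G" using False \<delta>1 \<xi> by (simp add: N_def)
        then have "\<xi> \<in> closure (N \<inter> G)" using open_Int_closure_subset[OF N] by blast
        moreover have "closure (N \<inter> G) \<subseteq> (\<Union>j\<in>{1..J}. {\<xi>. ball \<xi> e \<subseteq> U j})"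
        proof (rule closure_minimal)
          show "N \<inter> G \<subseteq> (\<Union>j\<in>{1..J}. {\<xi>. ball \<xi> e \<subseteq> U j})" using GN by blast
          show "closed (\<Union>j\<in>{1..J}. {\<xi>. ball \<xi> e \<subseteq> U j})" by (intro closed_UN ballI closed_ball_subset) simp
        qed
        ultimately obtain j where j: "j \<in> {1..J}" "ball \<xi> e \<subseteq> U j" by blast
        then have "\<xi> \<in> Z \<delta>1 j" using \<xi> False by (simp add: Z_def)
        then show ?thesis using j by (auto simp: \<S>_def)
      qed
    qed
    fix S assume "S \<in> \<S>"
    then consider j where "j \<in> {1..J}" "S = Z \<delta>1 j" | \<xi> where "\<xi> \<in> F" "S = ball \<xi> (\<rho> \<xi>)" by (auto simp: \<S>_def)
    then show "S \<in> sets borel"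
    proof cases
      case (1 j)
      have "closed (Z \<delta>1 j)" unfolding Z_def Collect_conj_eq
        by (intro closed_Int closed_Collect_le closed_ball_subset continuous_intros) (simp add: closed_closure)
      then show ?thesis using 1 by simp
    qed simp
    show "\<exists>a B f g \<kappa> M c C. patch (closure G) S a B f g \<kappa> M c C"
      using \<open>S \<in> \<S>\<close>
    proof -
      consider j where "j \<in> {1..J}" "S = Z \<delta>1 j" | \<xi> where "\<xi> \<in> F" "S = ball \<xi> (\<rho> \<xi>)" using \<open>S \<in> \<S>\<close>
        by (auto simp: \<S>_def)
      then show ?thesis
      proof cases
        case (1 j)
        have "Z \<delta>1 j \<subseteq> Z (d j) j" using \<delta>1(3)[OF 1(1)] by (auto simp: Z_def)
        then show ?thesis using d(2)[OF 1(1)] patch_subset 1(2) by metis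
      next
        case (2 \<xi>)
        then show ?thesis using \<rho>(2) F(1) by blast
      qed
    qed
  qed
qed

section \<open>Averaged differences on the whole domain\<close>

lemma indicator_rho_ball_measurable:
  fixes \<Omega> :: "'a::euclidean_space set"
  assumes "closed \<Omega>"
  shows "(\<lambda>z. indicator (rho_ball \<Omega> (fst z) t) (snd z) :: ennreal) \<in> borel_measurable (borel \<Otimes>\<^sub>M borel)"
proof -
  have "{z :: 'a \<times> 'a. snd z \<in> rho_ball \<Omega> (fst z) t} \<in> sets borel"
    using closed_rho_ball[OF assms] by auto
  moreover have "(\<lambda>z. indicator (rho_ball \<Omega> (fst z) t) (snd z) :: ennreal) =
    indicator {z. snd z \<in> rho_ball \<Omega> (fst z) t}"
    by (auto simp: fun_eq_iff indicator_def)
  ultimately show ?thesis unfolding borel_prod by simp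
qed

lemma avg_measurable:
  fixes \<Omega> :: "'a::euclidean_space set"
  assumes \<Omega>: "closed \<Omega>" and X[measurable]: "case_prod X \<in> borel_measurable (borel \<Otimes>\<^sub>M borel)"
  shows "(\<lambda>\<xi>. (\<integral>\<^sup>+\<eta>. X \<xi> \<eta> * indicator (rho_ball \<Omega> \<xi> t) \<eta> \<partial>lborel) / emeasure lborel (rho_ball \<Omega> \<xi> t)) \<in> borel_measurable borel"
proof -
  note [measurable] = indicator_rho_ball_measurable[OF \<Omega>, of t]
  have "(\<lambda>z. X (fst z) (snd z) * indicator (rho_ball \<Omega> (fst z) t) (snd z)) \<in> borel_measurable (borel \<Otimes>\<^sub>M borel)"
    by measurable
  then have 1: "(\<lambda>\<xi>. \<integral>\<^sup>+\<eta>. X \<xi> \<eta> * indicator (rho_ball \<Omega> \<xi> t) \<eta> \<partial>lborel) \<in> borel_measurable borel"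
    by (intro lborel.borel_measurable_nn_integral) (simp add: split_beta')
  have "(\<lambda>\<xi>. \<integral>\<^sup>+\<eta>. indicator (rho_ball \<Omega> \<xi> t) \<eta> \<partial>lborel) \<in> borel_measurable borel"
    by (intro lborel.borel_measurable_nn_integral) (simp add: split_beta')
  then have 2: "(\<lambda>\<xi>. emeasure lborel (rho_ball \<Omega> \<xi> t)) \<in> borel_measurable borel"
    using rho_ball_borel[OF \<Omega>] by simp
  show ?thesis using 1 2 by measurable
qed

lemma avg_int_mono:
  assumes "\<And>\<xi> \<eta>. \<xi> \<in> S \<Longrightarrow> \<eta> \<in> rho_ball \<Omega> \<xi> t \<Longrightarrow> X \<xi> \<eta> \<le> Y \<xi> \<eta>"
  shows "avg_int \<Omega> S t X \<le> avg_int \<Omega> S t Y"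
  unfolding avg_int_def
proof (intro nn_integral_mono)
  fix \<xi>
  show "indicator S \<xi> * ((\<integral>\<^sup>+\<eta>. X \<xi> \<eta> * indicator (rho_ball \<Omega> \<xi> t) \<eta> \<partial>lborel) / emeasure lborel (rho_ball \<Omega> \<xi> t))
    \<le> indicator S \<xi> * ((\<integral>\<^sup>+\<eta>. Y \<xi> \<eta> * indicator (rho_ball \<Omega> \<xi> t) \<eta> \<partial>lborel) / emeasure lborel (rho_ball \<Omega> \<xi> t))"
    using assms[of \<xi>] by (cases "\<xi> \<in> S") (auto intro!: divide_right_mono_ennreal nn_integral_mono split: split_indicator)
qed

lemma avg_int_add:
  fixes \<Omega> :: "'a::euclidean_space set"
  assumes \<Omega>: "closed \<Omega>" and S[measurable]: "S \<in> sets borel"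
    and X[measurable]: "case_prod X \<in> borel_measurable (borel \<Otimes>\<^sub>M borel)"
      and Y[measurable]: "case_prod Y \<in> borel_measurable (borel \<Otimes>\<^sub>M borel)"
  shows "avg_int \<Omega> S t (\<lambda>\<xi> \<eta>. X \<xi> \<eta> + Y \<xi> \<eta>) = avg_int \<Omega> S t X + avg_int \<Omega> S t Y"
proof -
  have [measurable]: "rho_ball \<Omega> \<xi> t \<in> sets borel" for \<xi> by (rule rho_ball_borel[OF \<Omega>])
  note [measurable] = avg_measurable[OF \<Omega> X, of t] avg_measurable[OF \<Omega> Y, of t]
  define FX FY where "FX \<xi> = (\<integral>\<^sup>+\<eta>. X \<xi> \<eta> * indicator (rho_ball \<Omega> \<xi> t) \<eta> \<partial>lborel) / emeasure lborel (rho_ball \<Omega> \<xi> t)"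
    and "FY \<xi> = (\<integral>\<^sup>+\<eta>. Y \<xi> \<eta> * indicator (rho_ball \<Omega> \<xi> t) \<eta> \<partial>lborel) / emeasure lborel (rho_ball \<Omega> \<xi> t)" for \<xi>
  have [measurable]: "FX \<in> borel_measurable borel" "FY \<in> borel_measurable borel"
    unfolding FX_def [abs_def] FY_def [abs_def] by measurable
  have 1: "(\<integral>\<^sup>+\<eta>. (X \<xi> \<eta> + Y \<xi> \<eta>) * indicator (rho_ball \<Omega> \<xi> t) \<eta> \<partial>lborel) / emeasure lborel (rho_ball \<Omega> \<xi> t) =
    FX \<xi> + FY \<xi>" for \<xi>
  proof -
    have "(\<integral>\<^sup>+\<eta>. (X \<xi> \<eta> + Y \<xi> \<eta>) * indicator (rho_ball \<Omega> \<xi> t) \<eta> \<partial>lborel) =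
      (\<integral>\<^sup>+\<eta>. X \<xi> \<eta> * indicator (rho_ball \<Omega> \<xi> t) \<eta> \<partial>lborel) +
        (\<integral>\<^sup>+\<eta>. Y \<xi> \<eta> * indicator (rho_ball \<Omega> \<xi> t) \<eta> \<partial>lborel)"
      unfolding distrib_right by (rule nn_integral_add) measurable
    then show ?thesis by (simp only: FX_def FY_def divide_ennreal_def distrib_right)
  qed
  have "avg_int \<Omega> S t (\<lambda>\<xi> \<eta>. X \<xi> \<eta> + Y \<xi> \<eta>) = (\<integral>\<^sup>+\<xi>. indicator S \<xi> * FX \<xi> + indicator S \<xi> * FY \<xi> \<partial>lborel)"
    unfolding avg_int_def 1 distrib_left ..
  also have "\<dots> = avg_int \<Omega> S t X + avg_int \<Omega> S t Y"
    unfolding avg_int_def FX_def[symmetric] FY_def[symmetric] by (rule nn_integral_add) measurable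
  finally show ?thesis .
qed

lemma avg_int_cmult:
  fixes \<Omega> :: "'a::euclidean_space set"
  assumes \<Omega>: "closed \<Omega>" and S[measurable]: "S \<in> sets borel"
    and X[measurable]: "case_prod X \<in> borel_measurable (borel \<Otimes>\<^sub>M borel)"
  shows "avg_int \<Omega> S t (\<lambda>\<xi> \<eta>. b * X \<xi> \<eta>) = b * avg_int \<Omega> S t X"
proof -
  have [measurable]: "rho_ball \<Omega> \<xi> t \<in> sets borel" for \<xi> by (rule rho_ball_borel[OF \<Omega>])
  note [measurable] = avg_measurable[OF \<Omega> X, of t]
  have 1: "(\<integral>\<^sup>+\<eta>. b * X \<xi> \<eta> * indicator (rho_ball \<Omega> \<xi> t) \<eta> \<partial>lborel) =
    b * (\<integral>\<^sup>+\<eta>. X \<xi> \<eta> * indicator (rho_ball \<Omega> \<xi> t) \<eta> \<partial>lborel)" for \<xi>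
    by (simp add: mult.assoc nn_integral_cmult)
  have "avg_int \<Omega> S t (\<lambda>\<xi> \<eta>. b * X \<xi> \<eta>) = (\<integral>\<^sup>+\<xi>. b * (indicator S \<xi> *
    ((\<integral>\<^sup>+\<eta>. X \<xi> \<eta> * indicator (rho_ball \<Omega> \<xi> t) \<eta> \<partial>lborel) / emeasure lborel (rho_ball \<Omega> \<xi> t))) \<partial>lborel)"
    unfolding avg_int_def 1 divide_ennreal_def by (simp only: mult_ac)
  also have "\<dots> = b * avg_int \<Omega> S t X" unfolding avg_int_def by (rule nn_integral_cmult) measurable
  finally show ?thesis .
qed

lemma avg_int_sum:
  fixes \<Omega> :: "'a::euclidean_space set"
  assumes \<Omega>: "closed \<Omega>" and S: "S \<in> sets borel" and I: "finite I"
    and X: "\<And>i. i \<in> I \<Longrightarrow> case_prod (X i) \<in> borel_measurable (borel \<Otimes>\<^sub>M borel)"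
  shows "avg_int \<Omega> S t (\<lambda>\<xi> \<eta>. \<Sum>i\<in>I. X i \<xi> \<eta>) = (\<Sum>i\<in>I. avg_int \<Omega> S t (X i))"
  using I X
proof (induction I)
  case empty
  then show ?case by (simp add: avg_int_def)
next
  case (insert i I)
  have m: "case_prod (\<lambda>\<xi> \<eta>. \<Sum>i\<in>I. X i \<xi> \<eta>) \<in> borel_measurable (borel \<Otimes>\<^sub>M borel)"
    using insert.prems by (auto simp: split_beta' intro!: borel_measurable_sum)
  have "avg_int \<Omega> S t (\<lambda>\<xi> \<eta>. \<Sum>i\<in>insert i I. X i \<xi> \<eta>) = avg_int \<Omega> S t (\<lambda>\<xi> \<eta>. X i \<xi> \<eta> + (\<Sum>i\<in>I. X i \<xi> \<eta>))"
    using insert.hyps by simp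
  also have "\<dots> = avg_int \<Omega> S t (X i) + avg_int \<Omega> S t (\<lambda>\<xi> \<eta>. \<Sum>i\<in>I. X i \<xi> \<eta>)"
    by (rule avg_int_add[OF \<Omega> S _ m]) (use insert.prems in simp)
  finally show ?case using insert by simp
qed

lemma avg_int_cover:
  fixes \<Omega> :: "'a::euclidean_space set"
  assumes \<Omega>: "closed \<Omega>" and fin: "finite \<S>" and cov: "\<Omega> \<subseteq> \<Union>\<S>" and bor: "\<And>S. S \<in> \<S> \<Longrightarrow> S \<in> sets borel"
    and X: "case_prod X \<in> borel_measurable (borel \<Otimes>\<^sub>M borel)"
  shows "avg_int \<Omega> \<Omega> t X \<le> (\<Sum>S\<in>\<S>. avg_int \<Omega> S t X)"
proof -
  note [measurable] = avg_measurable[OF \<Omega> X, of t] bor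
  define F where "F \<xi> = (\<integral>\<^sup>+\<eta>. X \<xi> \<eta> * indicator (rho_ball \<Omega> \<xi> t) \<eta> \<partial>lborel) / emeasure lborel (rho_ball \<Omega> \<xi> t)" for \<xi>
  have Fm: "F \<in> borel_measurable borel" unfolding F_def [abs_def] by measurable
  have "avg_int \<Omega> \<Omega> t X \<le> (\<integral>\<^sup>+\<xi>. (\<Sum>S\<in>\<S>. indicator S \<xi> * F \<xi>) \<partial>lborel)"
    unfolding avg_int_def F_def[symmetric]
  proof (intro nn_integral_mono)
    fix \<xi>
    show "indicator \<Omega> \<xi> * F \<xi> \<le> (\<Sum>S\<in>\<S>. indicator S \<xi> * F \<xi>)"
    proof (cases "\<xi> \<in> \<Omega>")
      case True
      then obtain S where S: "S \<in> \<S>" "\<xi> \<in> S" using cov by auto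
      have "indicator \<Omega> \<xi> * F \<xi> = indicator S \<xi> * F \<xi>" using True S by simp
      also have "\<dots> \<le> (\<Sum>S\<in>\<S>. indicator S \<xi> * F \<xi>)" using S fin by (intro member_le_sum) auto
      finally show ?thesis .
    qed simp
  qed
  also have "\<dots> = (\<Sum>S\<in>\<S>. \<integral>\<^sup>+\<xi>. indicator S \<xi> * F \<xi> \<partial>lborel)"
    using Fm bor by (intro nn_integral_sum) auto
  finally show ?thesis by (simp add: avg_int_def F_def)
qed

text \<open>Jensen's inequality with weights w i at the points z i / w i. Zero terms are set aside
  and the other weights renormalised by their sum W; the resulting factor W powr (p - 1) is at most
  1 and is dropped.\<close>

lemma powr_convex_sum:
  fixes p :: real
  assumes I: "finite I" and p: "1 \<le> p" and w: "\<And>i. i \<in> I \<Longrightarrow> 0 < w i" "(\<Sum>i\<in>I. w i) = 1" and z: "\<And>i. i \<in> I \<Longrightarrow>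
    0 \<le> z i"
  shows "(\<Sum>i\<in>I. z i) powr p \<le> (\<Sum>i\<in>I. w i powr (1 - p) * z i powr p)"
proof -
  define J where "J = {i \<in> I. 0 < z i}"
  have J: "finite J" "J \<subseteq> I" using I by (auto simp: J_def)
  have zJ: "(\<Sum>i\<in>I. z i) = (\<Sum>i\<in>J. z i)"
    by (rule sum.mono_neutral_right) (use I z in \<open>auto simp: J_def order.order_iff_strict\<close>)
  show ?thesis
  proof (cases "J = {}")
    case True
    then show ?thesis unfolding zJ by (auto intro!: sum_nonneg)
  next
    case False
    define W where "W = (\<Sum>i\<in>J. w i)"
    have W0: "0 < W" unfolding W_def using J False w by (intro sum_pos) auto
    have W1: "W \<le> 1" unfolding W_def w(2)[symmetric] using I J w by (intro sum_mono2) (auto intro: less_imp_le)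
    have "(\<Sum>i\<in>J. z i) = (\<Sum>i\<in>J. (w i / W) *\<^sub>R (W * z i / w i))"
    proof (intro sum.cong refl)
      fix i assume "i \<in> J"
      then have "0 < w i" using w J by auto
      then show "z i = (w i / W) *\<^sub>R (W * z i / w i)" using W0 by simp
    qed
    also have "\<dots> powr p \<le> (\<Sum>i\<in>J. (w i / W) * (W * z i / w i) powr p)"
    proof (rule convex_on_sum[OF J(1) False powr_convex[OF p]])
      show "(\<Sum>i\<in>J. w i / W) = 1" using W0 by (simp add: sum_divide_distrib[symmetric] W_def)
      fix i assume i: "i \<in> J"
      then have wi: "0 < w i" "0 < z i" using w J by (auto simp: J_def)
      then show "0 \<le> w i / W" "W * z i / w i \<in> {0<..}" using W0 by auto
    qed
    also have "\<dots> \<le> (\<Sum>i\<in>J. w i powr (1 - p) * z i powr p)"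
    proof (rule sum_mono)
      fix i assume i: "i \<in> J"
      then have wi: "0 < w i" "0 < z i" using w J by (auto simp: J_def)
      have "(w i / W) * (W * z i / w i) powr p = (W powr p / W) * ((w i / w i powr p) * z i powr p)"
        using wi W0 by (simp add: powr_mult powr_divide)
      also have "W powr p / W = W powr (p - 1)" using W0 by (simp add: powr_diff)
      also have "w i / w i powr p = w i powr (1 - p)" using wi by (simp add: powr_diff)
      also have "W powr (p - 1) * (w i powr (1 - p) * z i powr p) \<le> 1 * (w i powr (1 - p) * z i powr p)"
        using W0 W1 p by (intro mult_right_mono powr_le1) auto
      finally show "(w i / W) * (W * z i / w i) powr p \<le> w i powr (1 - p) * z i powr p" by simp
    qed
    also have "\<dots> \<le> (\<Sum>i\<in>I. w i powr (1 - p) * z i powr p)" using I J by (intro sum_mono2) auto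
    finally show ?thesis unfolding zJ .
  qed
qed

text \<open>With weights proportional to the bounds A i, the convexity estimate integrates to
  exactly the p-th power of their sum. A constant depending on the number of summands would be
  fatal, as there will be one summand per dyadic level. The weights have to be positive, hence 0 < A
  i.\<close>

lemma avg_int_minkowski:
  fixes \<Omega> :: "'a::euclidean_space set" and p :: real
  assumes \<Omega>: "closed \<Omega>" and I: "finite I" "I \<noteq> {}" and p: "1 \<le> p"
    and Z: "\<And>i. i \<in> I \<Longrightarrow> case_prod (Z i) \<in> borel_measurable (borel \<Otimes>\<^sub>M borel)" "\<And>i \<xi> \<eta>. i \<in> I \<Longrightarrow> 0 \<le> Z i \<xi> \<eta>"
    and A: "\<And>i. i \<in> I \<Longrightarrow> 0 < A i" "\<And>i. i \<in> I \<Longrightarrow> avg_int \<Omega> \<Omega> t (\<lambda>\<xi> \<eta>. ennreal (Z i \<xi> \<eta> powr p)) \<le>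
      ennreal (A i powr p)"
  shows "avg_int \<Omega> \<Omega> t (\<lambda>\<xi> \<eta>. ennreal ((\<Sum>i\<in>I. Z i \<xi> \<eta>) powr p)) \<le> ennreal ((\<Sum>i\<in>I. A i) powr p)"
proof -
  define T where "T = (\<Sum>i\<in>I. A i)"
  have T: "0 < T" unfolding T_def using I A by (intro sum_pos) auto
  define w where "w i = A i / T" for i
  have w: "0 < w i" if "i \<in> I" for i using A T that by (simp add: w_def)
  have w1: "(\<Sum>i\<in>I. w i) = 1" using T by (simp add: w_def sum_divide_distrib[symmetric] T_def)
  have [measurable]: "\<Omega> \<in> sets borel" using \<Omega> by simp
  have Zm: "case_prod (\<lambda>\<xi> \<eta>. ennreal (Z i \<xi> \<eta> powr p)) \<in> borel_measurable (borel \<Otimes>\<^sub>M borel)" if "i \<in> I" for i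
  proof -
    note [measurable] = Z(1)[OF that]
    have "(\<lambda>z. ennreal (case_prod (Z i) z powr p)) \<in> borel_measurable (borel \<Otimes>\<^sub>M borel)" by measurable
    then show ?thesis by (simp add: split_beta')
  qed
  have "avg_int \<Omega> \<Omega> t (\<lambda>\<xi> \<eta>. ennreal ((\<Sum>i\<in>I. Z i \<xi> \<eta>) powr p)) \<le>
    avg_int \<Omega> \<Omega> t (\<lambda>\<xi> \<eta>. \<Sum>i\<in>I. ennreal (w i powr (1 - p)) * ennreal (Z i \<xi> \<eta> powr p))"
  proof (rule avg_int_mono)
    fix \<xi> \<eta>
    have "ennreal ((\<Sum>i\<in>I. Z i \<xi> \<eta>) powr p) \<le> ennreal (\<Sum>i\<in>I. w i powr (1 - p) * Z i \<xi> \<eta> powr p)"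
      using w w1 Z(2) by (intro ennreal_leI powr_convex_sum I p) auto
    also have "\<dots> = (\<Sum>i\<in>I. ennreal (w i powr (1 - p)) * ennreal (Z i \<xi> \<eta> powr p))"
      by (subst sum_ennreal[symmetric]) (auto simp: ennreal_mult)
    finally show "ennreal ((\<Sum>i\<in>I. Z i \<xi> \<eta>) powr p) \<le>
      (\<Sum>i\<in>I. ennreal (w i powr (1 - p)) * ennreal (Z i \<xi> \<eta> powr p))" .
  qed
  also have "\<dots> = (\<Sum>i\<in>I. avg_int \<Omega> \<Omega> t (\<lambda>\<xi> \<eta>. ennreal (w i powr (1 - p)) * ennreal (Z i \<xi> \<eta> powr p)))"
  proof (rule avg_int_sum[OF \<Omega> _ I(1)])
    fix i assume "i \<in> I"
    note [measurable] = Zm[OF this]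
    have "(\<lambda>z. ennreal (w i powr (1 - p)) * case_prod (\<lambda>\<xi> \<eta>. ennreal (Z i \<xi> \<eta> powr p)) z) \<in> borel_measurable (borel \<Otimes>\<^sub>M borel)" by measurable
    then show "case_prod (\<lambda>\<xi> \<eta>. ennreal (w i powr (1 - p)) *
      ennreal (Z i \<xi> \<eta> powr p)) \<in> borel_measurable (borel \<Otimes>\<^sub>M borel)"
      by (simp add: split_beta')
  qed simp
  also have "\<dots> = (\<Sum>i\<in>I. ennreal (w i powr (1 - p)) * avg_int \<Omega> \<Omega> t (\<lambda>\<xi> \<eta>. ennreal (Z i \<xi> \<eta> powr p)))"
    by (intro sum.cong refl avg_int_cmult \<Omega> Zm) simp_all
  also have "\<dots> \<le> (\<Sum>i\<in>I. ennreal (w i powr (1 - p)) * ennreal (A i powr p))"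
    by (intro sum_mono mult_left_mono A) auto
  also have "\<dots> = ennreal (\<Sum>i\<in>I. w i powr (1 - p) * A i powr p)"
    by (subst sum_ennreal[symmetric]) (auto simp: ennreal_mult)
  also have "(\<Sum>i\<in>I. w i powr (1 - p) * A i powr p) = (\<Sum>i\<in>I. w i * T powr p)"
  proof (rule sum.cong)
    fix i assume i: "i \<in> I"
    have "A i = w i * T" using T by (simp add: w_def)
    then have "A i powr p = w i powr p * T powr p" using w[OF i] T by (simp add: powr_mult)
    then have "w i powr (1 - p) * A i powr p = (w i powr (1 - p) * w i powr p) * T powr p" by simp
    also have "w i powr (1 - p) * w i powr p = w i" using w[OF i] by (simp add: powr_add[symmetric])
    finally show "w i powr (1 - p) * A i powr p = w i * T powr p" .
  qed simp
  also have "\<dots> = T powr p" by (simp add: sum_distrib_right[symmetric] w1)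
  finally show ?thesis by (simp add: T_def)
qed

section \<open>Differences in terms of nodes, and the estimates on a single patch\<close>

lemma Polys_continuous: "P \<in> Polys N \<Longrightarrow> continuous_on UNIV P"
  by (auto simp: Polys_def intro!: continuous_intros)

lemma Polys_measurable: "P \<in> Polys N \<Longrightarrow> P \<in> borel_measurable borel"
  by (intro borel_measurable_continuous_onI Polys_continuous)

lemma Polys_mono: assumes "M \<le> N" shows "Polys M \<subseteq> (Polys N :: ('a::euclidean_space \<Rightarrow> real) set)"
proof
  fix P :: "'a \<Rightarrow> real" assume "P \<in> Polys M"
  then obtain c where c: "P = (\<lambda>x. \<Sum>\<alpha>\<in>multi_indices M. c \<alpha> * (\<Prod>b\<in>Basis. (x \<bullet> b) ^ \<alpha> b))"
    by (auto simp: Polys_def)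
  define c' where "c' \<alpha> = (if \<alpha> \<in> multi_indices M then c \<alpha> else 0)" for \<alpha> :: "'a \<Rightarrow> nat"
  have sub: "multi_indices M \<subseteq> (multi_indices N :: ('a \<Rightarrow> nat) set)" using assms
    by (auto simp: multi_indices_def)
  have "P = (\<lambda>x. \<Sum>\<alpha>\<in>multi_indices N. c' \<alpha> * (\<Prod>b\<in>Basis. (x \<bullet> b) ^ \<alpha> b))"
  proof
    fix x
    show "P x = (\<Sum>\<alpha>\<in>multi_indices N. c' \<alpha> * (\<Prod>b\<in>Basis. (x \<bullet> b) ^ \<alpha> b))"
      unfolding c by (rule sum.mono_neutral_cong_left[OF finite_multi_indices sub]) (auto simp: c'_def)
  qed
  then show "P \<in> Polys N" by (auto simp: Polys_def)
qed

lemma Polys_diff: assumes "P \<in> Polys N" "Q \<in> Polys N" shows "(\<lambda>x. P x - Q x) \<in> Polys N"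
proof -
  obtain c where c: "P = (\<lambda>x. \<Sum>\<alpha>\<in>multi_indices N. c \<alpha> * (\<Prod>b\<in>Basis. (x \<bullet> b) ^ \<alpha> b))" using assms
    by (auto simp: Polys_def)
  obtain c' where c': "Q = (\<lambda>x. \<Sum>\<alpha>\<in>multi_indices N. c' \<alpha> * (\<Prod>b\<in>Basis. (x \<bullet> b) ^ \<alpha> b))" using assms
    by (auto simp: Polys_def)
  have "(\<lambda>x. P x - Q x) = (\<lambda>x. \<Sum>\<alpha>\<in>multi_indices N. (c \<alpha> - c' \<alpha>) * (\<Prod>b\<in>Basis. (x \<bullet> b) ^ \<alpha> b))"
    by (simp add: c c' sum_subtractf[symmetric] left_diff_distrib)
  then show ?thesis by (auto simp: Polys_def intro!: exI[of _ "\<lambda>\<alpha>. c \<alpha> - c' \<alpha>"])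
qed

lemma fdiff_diff: "fdiff r \<xi> (\<lambda>x. P x - Q x) \<eta> = fdiff r \<xi> P \<eta> - fdiff r \<xi> Q \<eta>"
  by (simp add: fdiff_def right_diff_distrib sum_subtractf)

lemma fdiff_Polys_0:
  assumes "P \<in> Polys 0" "r \<ge> 1" shows "fdiff r \<xi> P \<eta> = 0"
proof -
  obtain c where c: "P = (\<lambda>x. \<Sum>\<alpha>\<in>multi_indices 0. c \<alpha> * (\<Prod>b\<in>Basis. (x \<bullet> b) ^ \<alpha> b))" using assms
    by (auto simp: Polys_def)
  have "(\<Prod>b\<in>Basis. (x \<bullet> b) ^ \<alpha> b) = 1" if "\<alpha> \<in> multi_indices 0" for \<alpha> and x :: 'a
    using that by (intro prod.neutral) (auto simp: multi_indices_def)
  then have "P = (\<lambda>x. \<Sum>\<alpha>\<in>multi_indices 0. c \<alpha>)" unfolding c by simp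
  then obtain k where k: "P = (\<lambda>x. k)" by blast
  have "fdiff r \<xi> P \<eta> = (-1) ^ r * k * (\<Sum>j\<le>r. (-1) ^ j * real (r choose j) * (real j + 0) ^ 0)"
    by (simp add: fdiff_def k sum_distrib_left power_add mult_ac atLeast0AtMost)
  then show ?thesis using alternating_sum_power_eq_0[of 0 r "0::real"] assms by simp
qed

definition node :: "nat \<Rightarrow> 'a::euclidean_space \<Rightarrow> 'a \<Rightarrow> nat \<Rightarrow> 'a" where
  "node r \<xi> \<eta> j = \<xi> + (real j / real r) *\<^sub>R (\<eta> - \<xi>)"

text \<open>The indicator makes the sum depend on h inside the domain only, which is where its norm
  is controlled.\<close>

definition node_sum :: "'a::euclidean_space set \<Rightarrow> nat \<Rightarrow> ('a \<Rightarrow> real) \<Rightarrow> 'a \<Rightarrow> 'a \<Rightarrow> nat \<Rightarrow> real" where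
  "node_sum \<Omega> r h \<xi> \<eta> j = real (r choose j) * (indicator \<Omega> (node r \<xi> \<eta> j) * \<bar>h (node r \<xi> \<eta> j)\<bar>)"

lemma fdiff_node:
  "fdiff r ((1 / real r) *\<^sub>R (\<eta> - \<xi>)) h \<xi> = (\<Sum>j\<le>r. (-1) ^ (r + j) * real (r choose j) * h (node r \<xi> \<eta> j))"
  by (simp add: fdiff_def node_def atLeast0AtMost)

lemma abs_fdiff_le_node_sum:
  assumes "\<And>j. j \<le> r \<Longrightarrow> node r \<xi> \<eta> j \<in> \<Omega>"
  shows "\<bar>fdiff r ((1 / real r) *\<^sub>R (\<eta> - \<xi>)) h \<xi>\<bar> \<le> (\<Sum>j\<le>r. node_sum \<Omega> r h \<xi> \<eta> j)"
  unfolding fdiff_node using assms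
  by (intro order_trans[OF sum_abs] sum_mono) (auto simp: node_sum_def abs_mult power_abs)

lemma segment_nodes:
  assumes "closed_segment \<xi> (\<xi> + real r *\<^sub>R ((1 / real r) *\<^sub>R (\<eta> - \<xi>))) \<subseteq> \<Omega>" "r \<ge> 1" "j \<le> r"
  shows "node r \<xi> \<eta> j \<in> \<Omega>"
proof -
  have e: "\<xi> + real r *\<^sub>R ((1 / real r) *\<^sub>R (\<eta> - \<xi>)) = \<eta>" using assms(2) by simp
  have "node r \<xi> \<eta> j = (1 - real j / real r) *\<^sub>R \<xi> + (real j / real r) *\<^sub>R \<eta>"
    by (simp add: node_def algebra_simps)
  moreover have "0 \<le> real j / real r" "real j / real r \<le> 1" using assms by auto
  ultimately have "node r \<xi> \<eta> j \<in> closed_segment \<xi> \<eta>" unfolding in_segment by blast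
  then show ?thesis using assms(1) e by auto
qed

text \<open>Both forms of the Bernstein estimate under one threshold e, so that the constants of
  finitely many patches can be merged. The geometric constant D stays outside the p-th power, F is
  inside.\<close>

definition bernstein_on :: "'a::euclidean_space set \<Rightarrow> nat \<Rightarrow> 'a set \<Rightarrow> real \<Rightarrow> real \<Rightarrow> real \<Rightarrow> bool" where
  "bernstein_on \<Omega> r S e D F \<longleftrightarrow> (\<forall>N t P. N \<ge> 1 \<longrightarrow> 0 < t \<longrightarrow> t \<le> e / (2 * real N) \<longrightarrow> P \<in> Polys N \<longrightarrow>
      (\<forall>p Gf. 1 \<le> p \<longrightarrow> Gf \<in> borel_measurable borel \<longrightarrow> (\<forall>z\<in>\<Omega>. ennreal (\<bar>P z\<bar> powr p) \<le> Gf z) \<longrightarrow>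
        avg_int \<Omega> S t (\<lambda>\<xi> \<eta>. ennreal (\<bar>fdiff r ((1 / real r) *\<^sub>R (\<eta> - \<xi>)) P \<xi>\<bar> powr p)) \<le>
          ennreal D * (ennreal ((F * (real N * t) ^ r) powr p) * (\<integral>\<^sup>+z. Gf z \<partial>lborel))) \<and>
      (\<forall>\<xi> \<eta> A. \<xi> \<in> S \<longrightarrow> \<eta> \<in> rho_ball \<Omega> \<xi> t \<longrightarrow> (\<forall>z\<in>\<Omega>. ennreal \<bar>P z\<bar> \<le> A) \<longrightarrow>
        ennreal \<bar>fdiff r ((1 / real r) *\<^sub>R (\<eta> - \<xi>)) P \<xi>\<bar> \<le> ennreal (F * (real N * t) ^ r) * A))"

lemma (in patch) patch_bernstein:
  assumes r: "r \<ge> 1"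
  shows "\<exists>e D F. 0 < e \<and> e \<le> 1 \<and> 0 \<le> D \<and> 0 \<le> F \<and> bernstein_on \<Omega> r S e D F"
proof -
  obtain e where e: "admissible e" using ex_admissible by blast
  then have e0: "0 < e" "e \<le> 1" by (auto simp: admissible_def)
  define V where "V = unit_ball_vol CARD('d) / c"
  have V: "0 \<le> V" using pos by (simp add: V_def)
  define D where "D = V * (2 * C * (2 * Kc\<^sup>2))"
  define F where "F = 2 * 4 ^ r / e ^ r * (Kc\<^sup>2 + 1)"
  have DF: "0 \<le> D" "0 \<le> F" using V pos e0 by (auto simp: D_def F_def)
  have main: "avg_int \<Omega> S t (\<lambda>\<xi> \<eta>. ennreal (\<bar>fdiff r ((1 / real r) *\<^sub>R (\<eta> - \<xi>)) P \<xi>\<bar> powr p)) \<le>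
          ennreal D * (ennreal ((F * (real N * t) ^ r) powr p) * (\<integral>\<^sup>+z. Gf z \<partial>lborel))"
    if "N \<ge> 1" "0 < t" "t \<le> e / (2 * real N)" "P \<in> Polys N" "1 \<le>
      p" "Gf \<in> borel_measurable borel" "\<forall>z\<in>\<Omega>. ennreal (\<bar>P z\<bar> powr p) \<le> Gf z"
    for N t P p Gf
  proof -
    have "avg_int \<Omega> S t (\<lambda>\<xi> \<eta>. ennreal (\<bar>fdiff r ((1 / real r) *\<^sub>R (\<eta> - \<xi>)) P \<xi>\<bar> powr p)) \<le>
      ennreal V * (ennreal (2 * C) * (ennreal ((2 * 4 ^ r / e ^ r * (real N * t) ^ r * (Kc\<^sup>2 + 1)) powr p) *
      (ennreal (2 * Kc\<^sup>2) * (\<integral>\<^sup>+z. Gf z \<partial>lborel))))"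
      unfolding V_def using that by (intro bernstein_average r e Polys_measurable) auto
    also have "2 * 4 ^ r / e ^ r * (real N * t) ^ r * (Kc\<^sup>2 + 1) = F * (real N * t) ^ r" by (simp add: F_def)
    also have "ennreal V * (ennreal (2 * C) * (ennreal ((F * (real N * t) ^ r) powr p) *
      (ennreal (2 * Kc\<^sup>2) * (\<integral>\<^sup>+z. Gf z \<partial>lborel))))
       = (ennreal V * (ennreal (2 * C) * ennreal (2 * Kc\<^sup>2))) * (ennreal ((F * (real N * t) ^ r) powr p) *
         (\<integral>\<^sup>+z. Gf z \<partial>lborel))"
      by (simp only: mult_ac)
    also have "ennreal V * (ennreal (2 * C) * ennreal (2 * Kc\<^sup>2)) = ennreal D"
      unfolding D_def using V pos by (simp only: ennreal_mult mult_nonneg_nonneg zero_le_numeral zero_le_power2)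
    finally show ?thesis .
  qed
  have sup: "ennreal \<bar>fdiff r ((1 / real r) *\<^sub>R (\<eta> - \<xi>)) P \<xi>\<bar> \<le> ennreal (F * (real N * t) ^ r) * A"
    if "N \<ge> 1" "0 < t" "t \<le> e / (2 * real N)" "P \<in> Polys N" "\<xi> \<in> S" "\<eta> \<in> rho_ball \<Omega> \<xi> t" "\<forall>z\<in>\<Omega>. ennreal \<bar>P z\<bar> \<le> A"
    for N t P \<xi> \<eta> A
  proof -
    have "ennreal \<bar>fdiff r ((1 / real r) *\<^sub>R (\<eta> - \<xi>)) P \<xi>\<bar> \<le>
      ennreal (2 * 4 ^ r / e ^ r * (real N * t) ^ r) * (ennreal (Kc\<^sup>2) * A)"
      using that by (intro bernstein_sup[OF _ _ r e]) auto
    also have "\<dots> = ennreal (2 * 4 ^ r / e ^ r * (real N * t) ^ r * Kc\<^sup>2) * A"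
      using e0 that by (simp add: ennreal_mult[symmetric] mult.assoc[symmetric])
    also have "\<dots> \<le> ennreal (F * (real N * t) ^ r) * A"
    proof (intro mult_right_mono ennreal_leI)
      have "2 * 4 ^ r / e ^ r * (real N * t) ^ r * Kc\<^sup>2 \<le> 2 * 4 ^ r / e ^ r * (real N * t) ^ r * (Kc\<^sup>2 + 1)"
        using e0 that by (intro mult_left_mono) auto
      moreover have "F * (real N * t) ^ r = 2 * 4 ^ r / e ^ r * (real N * t) ^ r * (Kc\<^sup>2 + 1)"
        by (simp add: F_def mult_ac)
      ultimately show "2 * 4 ^ r / e ^ r * (real N * t) ^ r * Kc\<^sup>2 \<le> F * (real N * t) ^ r" by linarith
    qed simp
    finally show ?thesis .
  qed
  show ?thesis unfolding bernstein_on_def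
    by (intro exI[of _ e] exI[of _ D] exI[of _ F] conjI allI impI e0 DF main sup)
qed

lemma (in patch) patch_node:
  shows "\<exists>K\<ge>0. \<forall>t j Gf. 0 < t \<longrightarrow> t \<le> 1 \<longrightarrow> 1 \<le> j \<longrightarrow> j \<le> r \<longrightarrow> Gf \<in> borel_measurable borel \<longrightarrow>
     avg_int \<Omega> S t (\<lambda>\<xi> \<eta>. Gf (node r \<xi> \<eta> j)) \<le> ennreal K * (\<integral>\<^sup>+z. Gf z \<partial>lborel)"
proof -
  define V where "V = unit_ball_vol CARD('d) / c"
  have V: "0 \<le> V" using pos by (simp add: V_def)
  have K1: "0 \<le> K1" using pos by (simp add: K1_def)
  show ?thesis
  proof (intro exI[of _ "V * (K1 * real r)"] conjI allI impI)
    fix t :: real and j and Gf :: "(real ^ 'd) \<times> real \<Rightarrow> ennreal"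
    assume t: "0 < t" "t \<le> 1" and j: "1 \<le> j" "j \<le> r" and G: "Gf \<in> borel_measurable borel"
    have k: "0 < real j / real r" "real j / real r \<le> 1" using j by auto
    \<comment> \<open>For j >= 1 the ratio j / r is at least 1 / r, so the density is bounded
      uniformly over these nodes.\<close>
    have "K1 / (real j / real r) \<le> K1 * real r"
    proof -
      have "K1 * real r / real j \<le> K1 * real r / 1" using j K1 by (intro divide_left_mono) auto
      then show ?thesis by simp
    qed
    then have "ennreal V * (ennreal (K1 / (real j / real r)) * (\<integral>\<^sup>+z. Gf z \<partial>lborel)) \<le>
      ennreal V * (ennreal (K1 * real r) * (\<integral>\<^sup>+z. Gf z \<partial>lborel))"
      by (intro mult_left_mono mult_right_mono ennreal_leI) auto
    also have "\<dots> = ennreal (V * (K1 * real r)) * (\<integral>\<^sup>+z. Gf z \<partial>lborel)"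
      using V K1 by (simp add: ennreal_mult mult.assoc)
    finally show "avg_int \<Omega> S t (\<lambda>\<xi> \<eta>. Gf (node r \<xi> \<eta> j)) \<le> ennreal (V * (K1 * real r)) * (\<integral>\<^sup>+z. Gf z \<partial>lborel)"
      using segment_average[OF t k G] unfolding node_def V_def by (rule order_trans[rotated])
  qed (use V K1 in simp)
qed

lemma node_measurable [measurable (raw)]:
  assumes [measurable]: "X \<in> measurable N borel" "Y \<in> measurable N borel"
  shows "(\<lambda>z. node r (X z) (Y z) j) \<in> measurable N borel"
  unfolding node_def by measurable

text \<open>An inequality rather than an equation, because E may be 0 or infinite.\<close>

lemma ennreal_mult_divide_le: "(a :: ennreal) * E / E \<le> a"
proof (cases E)
  case (real e)
  show ?thesis
  proof (cases "e = 0")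
    case False
    then have "ennreal e * inverse (ennreal e) = 1"
      using real by (simp add: inverse_ennreal ennreal_mult[symmetric])
    then show ?thesis unfolding divide_ennreal_def real(2) mult.assoc by simp
  qed (use real in simp)
qed simp

locale covered =
  fixes \<Omega> :: "((real ^ 'd) \<times> real) set" and \<S> and r :: nat
  assumes comp: "compact \<Omega>" and r: "r \<ge> 1" and fin: "finite \<S>" and cov: "\<Omega> \<subseteq> \<Union>\<S>" and bor: "\<And>S. S \<in> \<S> \<Longrightarrow>
    S \<in> sets borel"
    and pat: "\<And>S. S \<in> \<S> \<Longrightarrow> \<exists>a B f g \<kappa> M c C. patch \<Omega> S a B f g \<kappa> M c C"
begin

lemma clo: "closed \<Omega>" using comp by (rule compact_imp_closed)

text \<open>The node with j = 0 is \<xi> itself, whose average over \<eta> is trivial; for j >= 1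
  the density bounds of the patches are added up.\<close>

lemma node_average:
  obtains K where "1 \<le> K" "\<And>t j Gf. 0 < t \<Longrightarrow> t \<le> 1 \<Longrightarrow> j \<le> r \<Longrightarrow> Gf \<in> borel_measurable borel \<Longrightarrow>
     avg_int \<Omega> \<Omega> t (\<lambda>\<xi> \<eta>. Gf (node r \<xi> \<eta> j)) \<le> ennreal K * (\<integral>\<^sup>+z. Gf z \<partial>lborel)"
proof -
  have "\<forall>S\<in>\<S>. \<exists>K\<ge>0. \<forall>t j Gf. 0 < t \<longrightarrow> t \<le> 1 \<longrightarrow> 1 \<le> j \<longrightarrow> j \<le> r \<longrightarrow> Gf \<in> borel_measurable borel \<longrightarrow>
     avg_int \<Omega> S t (\<lambda>\<xi> \<eta>. Gf (node r \<xi> \<eta> j)) \<le> ennreal K * (\<integral>\<^sup>+z. Gf z \<partial>lborel)"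
  proof
    fix S assume "S \<in> \<S>"
    then obtain a B f g \<kappa> M c C where "patch \<Omega> S a B f g \<kappa> M c C" using pat by blast
    then show "\<exists>K\<ge>0. \<forall>t j Gf. 0 < t \<longrightarrow> t \<le> 1 \<longrightarrow> 1 \<le> j \<longrightarrow> j \<le> r \<longrightarrow> Gf \<in> borel_measurable borel \<longrightarrow>
       avg_int \<Omega> S t (\<lambda>\<xi> \<eta>. Gf (node r \<xi> \<eta> j)) \<le> ennreal K * (\<integral>\<^sup>+z. Gf z \<partial>lborel)"
      by (rule patch.patch_node)
  qed
  from bchoice[OF this] obtain K where K: "\<And>S. S \<in> \<S> \<Longrightarrow> 0 \<le> K S" "\<And>S t j Gf. S \<in> \<S> \<Longrightarrow> 0 < t \<Longrightarrow> t \<le> 1 \<Longrightarrow> 1 \<le> j \<Longrightarrow>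
    j \<le> r \<Longrightarrow> Gf \<in> borel_measurable borel \<Longrightarrow>
     avg_int \<Omega> S t (\<lambda>\<xi> \<eta>. Gf (node r \<xi> \<eta> j)) \<le> ennreal (K S) * (\<integral>\<^sup>+z. Gf z \<partial>lborel)"
    by metis
  define T where "T = 1 + (\<Sum>S\<in>\<S>. K S)"
  have T: "1 \<le> T" using K by (simp add: T_def sum_nonneg)
  show thesis
  proof
    show "1 \<le> T" by (rule T)
    fix t :: real and j and Gf :: "(real ^ 'd) \<times> real \<Rightarrow> ennreal"
    assume t: "0 < t" "t \<le> 1" and j: "j \<le> r" and G[measurable]: "Gf \<in> borel_measurable borel"
    show "avg_int \<Omega> \<Omega> t (\<lambda>\<xi> \<eta>. Gf (node r \<xi> \<eta> j)) \<le> ennreal T * (\<integral>\<^sup>+z. Gf z \<partial>lborel)"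
    proof (cases "j = 0")
      case True
      have [measurable]: "rho_ball \<Omega> \<xi> t \<in> sets borel" for \<xi> by (rule rho_ball_borel[OF clo])
      have "avg_int \<Omega> \<Omega> t (\<lambda>\<xi> \<eta>. Gf (node r \<xi> \<eta> j)) \<le> (\<integral>\<^sup>+z. Gf z \<partial>lborel)"
        unfolding avg_int_def
      proof (rule nn_integral_mono)
        fix \<xi>
        have "(\<integral>\<^sup>+\<eta>. Gf (node r \<xi> \<eta> j) * indicator (rho_ball \<Omega> \<xi> t) \<eta> \<partial>lborel) =
          Gf \<xi> * emeasure lborel (rho_ball \<Omega> \<xi> t)"
          using True by (simp add: node_def nn_integral_cmult_indicator)
        then show "indicator \<Omega> \<xi> * ((\<integral>\<^sup>+\<eta>. Gf (node r \<xi> \<eta> j) *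
          indicator (rho_ball \<Omega> \<xi> t) \<eta> \<partial>lborel) / emeasure lborel (rho_ball \<Omega> \<xi> t)) \<le> Gf \<xi>"
          using ennreal_mult_divide_le[of "Gf \<xi>" "emeasure lborel (rho_ball \<Omega> \<xi> t)"] by (cases "\<xi> \<in> \<Omega>") auto
      qed
      also have "\<dots> = ennreal 1 * (\<integral>\<^sup>+z. Gf z \<partial>lborel)" by simp
      also have "\<dots> \<le> ennreal T * (\<integral>\<^sup>+z. Gf z \<partial>lborel)" using T by (intro mult_right_mono ennreal_leI) auto
      finally show ?thesis .
    next
      case False
      then have j1: "1 \<le> j" by simp
      have "avg_int \<Omega> \<Omega> t (\<lambda>\<xi> \<eta>. Gf (node r \<xi> \<eta> j)) \<le> (\<Sum>S\<in>\<S>. avg_int \<Omega> S t (\<lambda>\<xi> \<eta>. Gf (node r \<xi> \<eta> j)))"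
        by (rule avg_int_cover[OF clo fin cov bor]) (simp_all add: split_beta')
      also have "\<dots> \<le> (\<Sum>S\<in>\<S>. ennreal (K S) * (\<integral>\<^sup>+z. Gf z \<partial>lborel))" using t j j1 by (intro sum_mono K) auto
      also have "\<dots> = ennreal (\<Sum>S\<in>\<S>. K S) * (\<integral>\<^sup>+z. Gf z \<partial>lborel)"
        using K by (simp add: sum_ennreal sum_distrib_right[symmetric])
      also have "\<dots> \<le> ennreal T * (\<integral>\<^sup>+z. Gf z \<partial>lborel)" by (intro mult_right_mono ennreal_leI) (auto simp: T_def)
      finally show ?thesis .
    qed
  qed
qed

definition node_sum_bound :: "real \<Rightarrow> bool" where
  "node_sum_bound K \<longleftrightarrow> (\<forall>t p h D. 0 < t \<longrightarrow> t \<le> 1 \<longrightarrow> 1 \<le> p \<longrightarrow> h \<in> borel_measurable borel \<longrightarrow> 0 < D \<longrightarrow>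
     (\<integral>\<^sup>+z. indicator \<Omega> z * ennreal (\<bar>h z\<bar> powr p) \<partial>lborel) \<le> ennreal (D powr p) \<longrightarrow>
     avg_int \<Omega> \<Omega> t (\<lambda>\<xi> \<eta>. ennreal ((\<Sum>j\<le>r. node_sum \<Omega> r h \<xi> \<eta> j) powr p)) \<le> ennreal ((K * D) powr p))"

lemma node_sum_average:
  obtains K where "1 \<le> K" "node_sum_bound K"
proof -
  obtain K where K: "1 \<le> K" "\<And>t j Gf. 0 < t \<Longrightarrow> t \<le> 1 \<Longrightarrow> j \<le> r \<Longrightarrow> Gf \<in> borel_measurable borel \<Longrightarrow>
     avg_int \<Omega> \<Omega> t (\<lambda>\<xi> \<eta>. Gf (node r \<xi> \<eta> j)) \<le> ennreal K * (\<integral>\<^sup>+z. Gf z \<partial>lborel)"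
    using node_average by blast
  have [measurable]: "\<Omega> \<in> sets borel" using clo by simp
  show thesis
  proof
    have "1 * 1 \<le> 2 ^ r * K" using K(1) by (intro mult_mono) auto
    then show "1 \<le> 2 ^ r * K" by simp
    show "node_sum_bound (2 ^ r * K)" unfolding node_sum_bound_def
    proof (intro allI impI)
      fix t p D :: real and h :: "(real ^ 'd) \<times> real \<Rightarrow> real"
      assume t: "0 < t" "t \<le> 1" and p: "1 \<le> p" and h[measurable]: "h \<in> borel_measurable borel" and D: "0 < D"
        and le: "(\<integral>\<^sup>+z. indicator \<Omega> z * ennreal (\<bar>h z\<bar> powr p) \<partial>lborel) \<le> ennreal (D powr p)"
      define Gf where "Gf z = indicator \<Omega> z * ennreal (\<bar>h z\<bar> powr p)" for z
      have [measurable]: "Gf \<in> borel_measurable borel" unfolding Gf_def by measurable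
      define A where "A j = real (r choose j) * (K * D)" for j
      have "avg_int \<Omega> \<Omega> t (\<lambda>\<xi> \<eta>. ennreal ((\<Sum>j\<in>{..r}. node_sum \<Omega> r h \<xi> \<eta> j) powr p)) \<le>
        ennreal ((\<Sum>j\<in>{..r}. A j) powr p)"
      proof (rule avg_int_minkowski[OF clo _ _ p, where Z = "\<lambda>j \<xi> \<eta>. node_sum \<Omega> r h \<xi> \<eta> j"])
        fix j assume j: "j \<in> {..r}"
        show "(\<lambda>(\<xi>, \<eta>). node_sum \<Omega> r h \<xi> \<eta> j) \<in> borel_measurable (borel \<Otimes>\<^sub>M borel)"
          unfolding node_sum_def split_beta' by measurable
        show "0 < A j" using j K D by (auto simp: A_def)
        have "ennreal (node_sum \<Omega> r h \<xi> \<eta> j powr p) = ennreal (real (r choose j) powr p) * Gf (node r \<xi> \<eta> j)"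
          for \<xi> \<eta>
          using p by (auto simp: node_sum_def Gf_def powr_mult ennreal_mult indicator_def)
        then have "avg_int \<Omega> \<Omega> t (\<lambda>\<xi> \<eta>. ennreal (node_sum \<Omega> r h \<xi> \<eta> j powr p)) =
           ennreal (real (r choose j) powr p) * avg_int \<Omega> \<Omega> t (\<lambda>\<xi> \<eta>. Gf (node r \<xi> \<eta> j))"
          by (simp only:) (rule avg_int_cmult[OF clo], simp_all add: split_beta')
        also have "\<dots> \<le> ennreal (real (r choose j) powr p) * (ennreal K * (\<integral>\<^sup>+z. Gf z \<partial>lborel))"
          using t j by (intro mult_left_mono K(2)) auto
        also have "\<dots> \<le> ennreal (real (r choose j) powr p) * (ennreal (K powr p) * ennreal (D powr p))"
        proof -
          \<comment> \<open>Because K >= 1, the density constant may be raised to the power p; it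
            then multiplies D inside the p-th power, uniformly in p.\<close>
          have "K powr 1 \<le> K powr p" using K(1) p by (intro powr_mono) auto
          then show ?thesis using le K(1) unfolding Gf_def by (intro mult_left_mono mult_mono ennreal_leI) auto
        qed
        also have "\<dots> = ennreal (A j powr p)"
          using K D by (simp add: A_def powr_mult ennreal_mult[symmetric])
        finally show "avg_int \<Omega> \<Omega> t (\<lambda>\<xi> \<eta>. ennreal (node_sum \<Omega> r h \<xi> \<eta> j powr p)) \<le> ennreal (A j powr p)" .
      qed (auto simp: node_sum_def)
      also have "(\<Sum>j\<in>{..r}. A j) = 2 ^ r * K * D"
      proof -
        have "(\<Sum>j\<in>{..r}. A j) = real (\<Sum>j\<le>r. r choose j) * (K * D)" by (simp add: A_def sum_distrib_right)
        also have "\<dots> = 2 ^ r * K * D" by (simp only: choose_row_sum) simp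
        finally show ?thesis .
      qed
      finally show "avg_int \<Omega> \<Omega> t (\<lambda>\<xi> \<eta>. ennreal ((\<Sum>j\<le>r. node_sum \<Omega> r h \<xi> \<eta> j) powr p)) \<le>
        ennreal ((2 ^ r * K * D) powr p)" .
    qed
  qed
qed

lemma bernstein_constants:
  obtains e K where "0 < e" "e \<le> 1" "1 \<le> K"
    "\<And>N t P p Gf. N \<ge> 1 \<Longrightarrow> 0 < t \<Longrightarrow> t \<le> e / (2 * real N) \<Longrightarrow> P \<in> Polys N \<Longrightarrow> 1 \<le> p \<Longrightarrow> Gf \<in> borel_measurable borel \<Longrightarrow>
        (\<And>z. z \<in> \<Omega> \<Longrightarrow> ennreal (\<bar>P z\<bar> powr p) \<le> Gf z) \<Longrightarrow>
        avg_int \<Omega> \<Omega> t (\<lambda>\<xi> \<eta>. ennreal (\<bar>fdiff r ((1 / real r) *\<^sub>R (\<eta> - \<xi>)) P \<xi>\<bar> powr p)) \<le>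
          ennreal ((K * (real N * t) ^ r) powr p) * (\<integral>\<^sup>+z. Gf z \<partial>lborel)"
    "\<And>N t P \<xi> \<eta> A. N \<ge> 1 \<Longrightarrow> 0 < t \<Longrightarrow> t \<le> e / (2 * real N) \<Longrightarrow> P \<in> Polys N \<Longrightarrow> \<xi> \<in> \<Omega> \<Longrightarrow> \<eta> \<in> rho_ball \<Omega> \<xi> t \<Longrightarrow>
        (\<And>z. z \<in> \<Omega> \<Longrightarrow> ennreal \<bar>P z\<bar> \<le> A) \<Longrightarrow>
        ennreal \<bar>fdiff r ((1 / real r) *\<^sub>R (\<eta> - \<xi>)) P \<xi>\<bar> \<le> ennreal (K * (real N * t) ^ r) * A"
proof -
  have "\<forall>S\<in>\<S>. \<exists>e D F. 0 < e \<and> e \<le> 1 \<and> 0 \<le> D \<and> 0 \<le> F \<and> bernstein_on \<Omega> r S e D F"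
  proof
    fix S assume "S \<in> \<S>"
    then obtain a B f g \<kappa> M c C where "patch \<Omega> S a B f g \<kappa> M c C" using pat by blast
    then show "\<exists>e D F. 0 < e \<and> e \<le> 1 \<and> 0 \<le> D \<and> 0 \<le> F \<and> bernstein_on \<Omega> r S e D F"
      using r by (rule patch.patch_bernstein)
  qed
  then obtain e D F where c: "\<And>S. S \<in> \<S> \<Longrightarrow> 0 < e S" "\<And>S. S \<in> \<S> \<Longrightarrow> e S \<le> 1" "\<And>S. S \<in> \<S> \<Longrightarrow> 0 \<le> D S"
    "\<And>S. S \<in> \<S> \<Longrightarrow> 0 \<le> F S" "\<And>S. S \<in> \<S> \<Longrightarrow> bernstein_on \<Omega> r S (e S) (D S) (F S)" by metis
  define e0 where "e0 = Min (insert 1 (e ` \<S>))"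
  \<comment> \<open>The summand 1 makes D0 at least 1, so that D0 <= D0 powr p moves it inside the
    p-th power.\<close>
  define D0 where "D0 = 1 + (\<Sum>S\<in>\<S>. D S)"
  define F0 where "F0 = 1 + (\<Sum>S\<in>\<S>. F S)"
  have e0: "0 < e0" "e0 \<le> 1" "\<And>S. S \<in> \<S> \<Longrightarrow> e0 \<le> e S"
    unfolding e0_def using fin c by (auto simp: Min_gr_iff intro!: Min_le)
  have D0: "1 \<le> D0" using c by (simp add: D0_def sum_nonneg)
  have F0: "1 \<le> F0" using c by (simp add: F0_def sum_nonneg)
  have FS: "F S \<le> F0" if "S \<in> \<S>" for S
    using member_le_sum[OF that, of F] fin c by (simp add: F0_def)
  show thesis
  proof
    show "0 < e0" "e0 \<le> 1" by fact+
    have "1 * 1 \<le> D0 * F0" using D0 F0 by (intro mult_mono) auto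
    then show "1 \<le> D0 * F0" by simp
    {
      fix N :: nat and t p :: real and P and Gf :: "(real ^ 'd) \<times> real \<Rightarrow> ennreal"
      assume N: "N \<ge> 1" and t: "0 < t" "t \<le> e0 / (2 * real N)" and P: "P \<in> Polys N" and p: "1 \<le>
        p" and G: "Gf \<in> borel_measurable borel"
        and le: "\<And>z. z \<in> \<Omega> \<Longrightarrow> ennreal (\<bar>P z\<bar> powr p) \<le> Gf z"
      define I where "I = (\<integral>\<^sup>+z. Gf z \<partial>lborel)"
      define R where "R = (real N * t) ^ r"
      have R: "0 \<le> R" using t by (simp add: R_def)
      note [measurable] = Polys_measurable[OF P]
      have "avg_int \<Omega> \<Omega> t (\<lambda>\<xi> \<eta>. ennreal (\<bar>fdiff r ((1 / real r) *\<^sub>R (\<eta> - \<xi>)) P \<xi>\<bar> powr p)) \<le>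
        (\<Sum>S\<in>\<S>. avg_int \<Omega> S t (\<lambda>\<xi> \<eta>. ennreal (\<bar>fdiff r ((1 / real r) *\<^sub>R (\<eta> - \<xi>)) P \<xi>\<bar> powr p)))"
        by (rule avg_int_cover[OF clo fin cov bor]) (simp_all add: split_beta' fdiff_def)
      also have "\<dots> \<le> (\<Sum>S\<in>\<S>. ennreal (D S) * (ennreal ((F0 * R) powr p) * I))"
      proof (rule sum_mono)
        fix S assume S: "S \<in> \<S>"
        have "e0 / (2 * real N) \<le> e S / (2 * real N)" using e0(3)[OF S] by (intro divide_right_mono) auto
        then have "t \<le> e S / (2 * real N)" using t by linarith
        then have "avg_int \<Omega> S t (\<lambda>\<xi> \<eta>. ennreal (\<bar>fdiff r ((1 / real r) *\<^sub>R (\<eta> - \<xi>)) P \<xi>\<bar> powr p)) \<le>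
          ennreal (D S) * (ennreal ((F S * R) powr p) * I)"
          using c(5)[OF S] N t P p G le unfolding bernstein_on_def R_def I_def by blast
        also have "\<dots> \<le> ennreal (D S) * (ennreal ((F0 * R) powr p) * I)"
          using FS[OF S] c(4)[OF S] R p by (intro mult_left_mono mult_right_mono ennreal_leI powr_mono2) auto
        finally show "avg_int \<Omega> S t (\<lambda>\<xi> \<eta>. ennreal (\<bar>fdiff r ((1 / real r) *\<^sub>R (\<eta> - \<xi>)) P \<xi>\<bar> powr p)) \<le>
          ennreal (D S) * (ennreal ((F0 * R) powr p) * I)" .
      qed
      also have "\<dots> = ennreal (\<Sum>S\<in>\<S>. D S) * (ennreal ((F0 * R) powr p) * I)"
        using c by (simp add: sum_ennreal sum_distrib_right[symmetric])
      also have "\<dots> \<le> ennreal (D0 powr p) * (ennreal ((F0 * R) powr p) * I)"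
      proof (intro mult_right_mono ennreal_leI)
        have "D0 powr 1 \<le> D0 powr p" using D0 p by (intro powr_mono) auto
        then show "(\<Sum>S\<in>\<S>. D S) \<le> D0 powr p" using D0 by (simp add: D0_def)
      qed simp
      also have "\<dots> = ennreal ((D0 * F0 * R) powr p) * I"
        using D0 F0 R by (simp add: powr_mult ennreal_mult mult.assoc)
      finally show "avg_int \<Omega> \<Omega> t (\<lambda>\<xi> \<eta>. ennreal (\<bar>fdiff r ((1 / real r) *\<^sub>R (\<eta> - \<xi>)) P \<xi>\<bar> powr p)) \<le>
          ennreal ((D0 * F0 * (real N * t) ^ r) powr p) * (\<integral>\<^sup>+z. Gf z \<partial>lborel)"
        by (simp add: R_def I_def)
    }
    fix N :: nat and t :: real and P \<xi> \<eta> A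
    assume N: "N \<ge> 1" and t: "0 < t" "t \<le> e0 / (2 * real N)" and P: "P \<in> Polys N"
      and \<xi>: "\<xi> \<in> \<Omega>" "\<eta> \<in> rho_ball \<Omega> \<xi> t"
      and le: "\<And>z. z \<in> \<Omega> \<Longrightarrow> ennreal \<bar>P z\<bar> \<le> A"
    obtain S where S: "S \<in> \<S>" "\<xi> \<in> S" using cov \<xi> by auto
    have "e0 / (2 * real N) \<le> e S / (2 * real N)" using e0(3)[OF S(1)] by (intro divide_right_mono) auto
    then have "t \<le> e S / (2 * real N)" using t by linarith
    then have "ennreal \<bar>fdiff r ((1 / real r) *\<^sub>R (\<eta> - \<xi>)) P \<xi>\<bar> \<le> ennreal (F S * (real N * t) ^ r) * A"
      using c(5)[OF S(1)] N t P \<xi> S le unfolding bernstein_on_def by blast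
    also have "\<dots> \<le> ennreal (D0 * F0 * (real N * t) ^ r) * A"
    proof (intro mult_right_mono ennreal_leI)
      have "1 * F S \<le> D0 * F0" using D0 F0 FS[OF S(1)] c(4)[OF S(1)] by (intro mult_mono) auto
      then show "F S \<le> D0 * F0" by simp
    qed (use t in auto)
    finally show "ennreal \<bar>fdiff r ((1 / real r) *\<^sub>R (\<eta> - \<xi>)) P \<xi>\<bar> \<le> ennreal (D0 * F0 * (real N * t) ^ r) * A" .
  qed
qed

definition seg :: "(real ^ 'd) \<times> real \<Rightarrow> (real ^ 'd) \<times> real \<Rightarrow> bool" where
  "seg \<xi> \<eta> \<longleftrightarrow> (\<forall>j\<le>r. node r \<xi> \<eta> j \<in> \<Omega>)"

text \<open>A measurable majorant Z takes the place of the difference itself, since beyond the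
  Bernstein threshold the estimate is for a sum over nodes. The existential quantifier lets both
  cases be used alike.\<close>

definition majorant_bound :: "real \<Rightarrow> bool" where
  "majorant_bound K \<longleftrightarrow> (\<forall>N t P p D. N \<ge> 1 \<longrightarrow> 0 < t \<longrightarrow> real N * t \<le> 1 \<longrightarrow> P \<in> Polys N \<longrightarrow> 1 \<le> p \<longrightarrow> 0 < D \<longrightarrow>
       (\<integral>\<^sup>+z. indicator \<Omega> z * ennreal (\<bar>P z\<bar> powr p) \<partial>lborel) \<le> ennreal (D powr p) \<longrightarrow>
       (\<exists>Z. case_prod Z \<in> borel_measurable (borel \<Otimes>\<^sub>M borel) \<and> (\<forall>\<xi> \<eta>. 0 \<le> Z \<xi> \<eta>) \<and>
         (\<forall>\<xi> \<eta>. seg \<xi> \<eta> \<longrightarrow> \<bar>fdiff r ((1 / real r) *\<^sub>R (\<eta> - \<xi>)) P \<xi>\<bar> \<le> Z \<xi> \<eta>) \<and>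
         avg_int \<Omega> \<Omega> t (\<lambda>\<xi> \<eta>. ennreal (Z \<xi> \<eta> powr p)) \<le> ennreal ((K * (real N * t) ^ r * D) powr p)))"

definition sup_bound :: "real \<Rightarrow> bool" where
  "sup_bound K \<longleftrightarrow> (\<forall>N t P \<xi> \<eta> D. N \<ge> 1 \<longrightarrow> 0 < t \<longrightarrow> real N * t \<le> 1 \<longrightarrow> P \<in> Polys N \<longrightarrow> \<xi> \<in> \<Omega> \<longrightarrow> \<eta> \<in> rho_ball \<Omega> \<xi> t \<longrightarrow>
    seg \<xi> \<eta> \<longrightarrow>
        (\<forall>z\<in>\<Omega>. \<bar>P z\<bar> \<le> D) \<longrightarrow> \<bar>fdiff r ((1 / real r) *\<^sub>R (\<eta> - \<xi>)) P \<xi>\<bar> \<le> K * (real N * t) ^ r * D)"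

text \<open>For t above e / (2 N) the product N t exceeds e / 2, so (2 / e)^r (N t)^r is at least 1,
  and the trivial bound by the values at the nodes already has the required form.\<close>

lemma polynomial_majorant:
  obtains K where "1 \<le> K" "majorant_bound K" "sup_bound K"
proof -
  obtain e K1 where e: "0 < e" "e \<le> 1" "1 \<le> K1"
    and b1: "\<And>N t P p Gf. N \<ge> 1 \<Longrightarrow> 0 < t \<Longrightarrow> t \<le> e / (2 * real N) \<Longrightarrow> P \<in> Polys N \<Longrightarrow> 1 \<le> p \<Longrightarrow>
      Gf \<in> borel_measurable borel \<Longrightarrow>
        (\<And>z. z \<in> \<Omega> \<Longrightarrow> ennreal (\<bar>P z\<bar> powr p) \<le> Gf z) \<Longrightarrow>
        avg_int \<Omega> \<Omega> t (\<lambda>\<xi> \<eta>. ennreal (\<bar>fdiff r ((1 / real r) *\<^sub>R (\<eta> - \<xi>)) P \<xi>\<bar> powr p)) \<le>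
          ennreal ((K1 * (real N * t) ^ r) powr p) * (\<integral>\<^sup>+z. Gf z \<partial>lborel)"
    and b2: "\<And>N t P \<xi> \<eta> A. N \<ge> 1 \<Longrightarrow> 0 < t \<Longrightarrow> t \<le> e / (2 * real N) \<Longrightarrow> P \<in> Polys N \<Longrightarrow> \<xi> \<in> \<Omega> \<Longrightarrow> \<eta> \<in> rho_ball \<Omega> \<xi> t \<Longrightarrow>
        (\<And>z. z \<in> \<Omega> \<Longrightarrow> ennreal \<bar>P z\<bar> \<le> A) \<Longrightarrow>
        ennreal \<bar>fdiff r ((1 / real r) *\<^sub>R (\<eta> - \<xi>)) P \<xi>\<bar> \<le> ennreal (K1 * (real N * t) ^ r) * A"
    by (rule bernstein_constants) (rule that; blast)
  obtain K2 where K2: "1 \<le> K2" "node_sum_bound K2" by (rule node_sum_average)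
  have \<Omega>b[measurable]: "\<Omega> \<in> sets borel" using clo by simp
  define K3 where "K3 = (2 / e) ^ r * (K2 + 2 ^ r)"
  have e2: "1 \<le> (2 / e) ^ r" using e by (intro one_le_power) simp
  have K3: "0 \<le> K3" "(2 / e) ^ r * K2 \<le> K3" "(2 / e) ^ r * 2 ^ r \<le> K3"
    using e2 K2(1) e by (auto simp: K3_def algebra_simps)
  define K where "K = K1 + K3"
  have trivial: "1 \<le> (2 / e) ^ r * (real N * t) ^ r" if "\<not> t \<le> e / (2 * real N)" "N \<ge> 1" for N t
  proof -
    have "e \<le> 2 * (real N * t)" using that by (simp add: field_simps)
    then have "1 \<le> 2 / e * (real N * t)" using e by (simp add: field_simps)
    then show ?thesis unfolding power_mult_distrib[symmetric] by (rule one_le_power)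
  qed
  show thesis
  proof
    show "1 \<le> K" using e K3 by (simp add: K_def)
    show "majorant_bound K" unfolding majorant_bound_def
    proof (intro allI impI)
      fix N :: nat and t p D :: real and P
      assume N: "N \<ge> 1" and t: "0 < t" "real N * t \<le> 1" and P: "P \<in> Polys N" and p: "1 \<le> p" and D: "0 < D"
        and le: "(\<integral>\<^sup>+z. indicator \<Omega> z * ennreal (\<bar>P z\<bar> powr p) \<partial>lborel) \<le> ennreal (D powr p)"
      note [measurable] = Polys_measurable[OF P]
      define R where "R = (real N * t) ^ r"
      have R: "0 \<le> R" using t by (simp add: R_def)
      have "1 * t \<le> real N * t" using N t by (intro mult_right_mono) auto
      then have t1: "t \<le> 1" using t by linarith
      show "\<exists>Z. case_prod Z \<in> borel_measurable (borel \<Otimes>\<^sub>M borel) \<and> (\<forall>\<xi> \<eta>. 0 \<le> Z \<xi> \<eta>) \<and>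
         (\<forall>\<xi> \<eta>. seg \<xi> \<eta> \<longrightarrow> \<bar>fdiff r ((1 / real r) *\<^sub>R (\<eta> - \<xi>)) P \<xi>\<bar> \<le> Z \<xi> \<eta>) \<and>
         avg_int \<Omega> \<Omega> t (\<lambda>\<xi> \<eta>. ennreal (Z \<xi> \<eta> powr p)) \<le> ennreal ((K * (real N * t) ^ r * D) powr p)"
      proof (cases "t \<le> e / (2 * real N)")
        case True
        define Z where "Z \<xi> \<eta> = \<bar>fdiff r ((1 / real r) *\<^sub>R (\<eta> - \<xi>)) P \<xi>\<bar>" for \<xi> \<eta>
        have Zm: "case_prod Z \<in> borel_measurable (borel \<Otimes>\<^sub>M borel)" unfolding Z_def [abs_def] split_beta' fdiff_def by measurable
        define Gf where "Gf z = indicator \<Omega> z * ennreal (\<bar>P z\<bar> powr p)" for z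
        have Gm: "Gf \<in> borel_measurable borel" unfolding Gf_def [abs_def] by measurable
        have "avg_int \<Omega> \<Omega> t (\<lambda>\<xi> \<eta>. ennreal (Z \<xi> \<eta> powr p)) \<le> ennreal ((K1 * R) powr p) * (\<integral>\<^sup>+z. Gf z \<partial>lborel)"
          unfolding Z_def R_def by (rule b1[OF N t(1) True P p Gm]) (simp add: Gf_def)
        also have "\<dots> \<le> ennreal ((K1 * R) powr p) * ennreal (D powr p)" using le unfolding Gf_def
          by (intro mult_left_mono) auto
        also have "\<dots> = ennreal ((K1 * R * D) powr p)" using e R D by (simp add: powr_mult ennreal_mult)
        also have "\<dots> \<le> ennreal ((K * R * D) powr p)"
          using e R D p K3 by (intro ennreal_leI powr_mono2 mult_right_mono) (auto simp: K_def)
        finally show ?thesis using Zm unfolding R_def by (intro exI[of _ Z]) (auto simp: Z_def)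
      next
        case False
        define Z where "Z \<xi> \<eta> = (\<Sum>j\<le>r. node_sum \<Omega> r P \<xi> \<eta> j)" for \<xi> \<eta>
        have Zm: "case_prod Z \<in> borel_measurable (borel \<Otimes>\<^sub>M borel)" unfolding Z_def [abs_def] split_beta' node_sum_def by measurable
        have "avg_int \<Omega> \<Omega> t (\<lambda>\<xi> \<eta>. ennreal (Z \<xi> \<eta> powr p)) \<le> ennreal ((K2 * D) powr p)"
          unfolding Z_def by (rule K2(2)[unfolded node_sum_bound_def, rule_format, OF t(1) t1 p _ D le]) measurable
        also have "\<dots> \<le> ennreal ((K * R * D) powr p)"
        proof (intro ennreal_leI powr_mono2 mult_right_mono)
          have "K2 * 1 \<le> K2 * ((2 / e) ^ r * R)" unfolding R_def using K2(1) trivial[OF False N]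
            by (intro mult_left_mono) auto
          also have "\<dots> = ((2 / e) ^ r * K2) * R" by (simp only: mult_ac)
          also have "\<dots> \<le> K * R" using K3 R e by (intro mult_right_mono) (auto simp: K_def)
          finally show "K2 \<le> K * R" by simp
        qed (use D K2 p in auto)
        finally have avg: "avg_int \<Omega> \<Omega> t (\<lambda>\<xi> \<eta>. ennreal (Z \<xi> \<eta> powr p)) \<le> ennreal ((K * R * D) powr p)" .
        moreover have "\<forall>\<xi> \<eta>. seg \<xi> \<eta> \<longrightarrow> \<bar>fdiff r ((1 / real r) *\<^sub>R (\<eta> - \<xi>)) P \<xi>\<bar> \<le> Z \<xi> \<eta>"
          unfolding seg_def Z_def by (intro allI impI abs_fdiff_le_node_sum) auto
        moreover have "\<forall>\<xi> \<eta>. 0 \<le> Z \<xi> \<eta>" by (auto simp: Z_def node_sum_def intro!: sum_nonneg)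
        ultimately show ?thesis using Zm unfolding R_def by (intro exI[of _ Z] conjI) assumption+
      qed
    qed
    show "sup_bound K" unfolding sup_bound_def
    proof (intro allI impI)
      fix N :: nat and t D :: real and P \<xi> \<eta>
      assume N: "N \<ge> 1" and t: "0 < t" "real N * t \<le>
        1" and P: "P \<in> Polys N" and \<xi>: "\<xi> \<in> \<Omega>" "\<eta> \<in> rho_ball \<Omega> \<xi> t" "seg \<xi> \<eta>"
        and le: "\<forall>z\<in>\<Omega>. \<bar>P z\<bar> \<le> D"
      have D: "0 \<le> D" using bspec[OF le \<xi>(1)] by linarith
      have R: "0 \<le> (real N * t) ^ r" using t by simp
      show "\<bar>fdiff r ((1 / real r) *\<^sub>R (\<eta> - \<xi>)) P \<xi>\<bar> \<le> K * (real N * t) ^ r * D"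
      proof (cases "t \<le> e / (2 * real N)")
        case True
        have "ennreal \<bar>fdiff r ((1 / real r) *\<^sub>R (\<eta> - \<xi>)) P \<xi>\<bar> \<le> ennreal (K1 * (real N * t) ^ r) * ennreal D"
          by (rule b2[OF N t(1) True P \<xi>(1,2)]) (use le in \<open>auto intro!: ennreal_leI\<close>)
        also have "\<dots> = ennreal (K1 * (real N * t) ^ r * D)" using e R D by (intro ennreal_mult[symmetric]) auto
        finally have "\<bar>fdiff r ((1 / real r) *\<^sub>R (\<eta> - \<xi>)) P \<xi>\<bar> \<le> K1 * (real N * t) ^ r * D"
          using e R D by (subst (asm) ennreal_le_iff) auto
        also have "\<dots> \<le> K * (real N * t) ^ r * D" using K3 R D by (intro mult_right_mono) (auto simp: K_def)
        finally show ?thesis .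
      next
        case False
        have "\<bar>fdiff r ((1 / real r) *\<^sub>R (\<eta> - \<xi>)) P \<xi>\<bar> \<le> (\<Sum>j\<le>r. node_sum \<Omega> r P \<xi> \<eta> j)"
          using \<xi>(3) unfolding seg_def by (intro abs_fdiff_le_node_sum) auto
        also have "\<dots> \<le> (\<Sum>j\<le>r. real (r choose j) * D)"
          using \<xi>(3) le unfolding seg_def by (intro sum_mono) (auto simp: node_sum_def intro!: mult_left_mono)
        also have "\<dots> = real (\<Sum>j\<le>r. r choose j) * D" by (simp add: sum_distrib_right)
        also have "\<dots> = 2 ^ r * 1 * D" by (simp only: choose_row_sum) simp
        also have "\<dots> \<le> 2 ^ r * ((2 / e) ^ r * (real N * t) ^ r) * D"
          using trivial[OF False N] D by (intro mult_right_mono mult_left_mono) auto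
        also have "\<dots> = ((2 / e) ^ r * 2 ^ r) * (real N * t) ^ r * D" by (simp only: mult_ac)
        also have "\<dots> \<le> K * (real N * t) ^ r * D" using K3 R D e by (intro mult_right_mono) (auto simp: K_def)
        finally show ?thesis .
      qed
    qed
  qed
qed

end

section \<open>The Jackson-type inequality\<close>

lemma ennpowr_ennreal: "0 \<le> x \<Longrightarrow> ennpowr (ennreal x) a = ennreal (x powr a)"
  by (simp add: ennpowr_def)

lemma ennpowr_mono:
  assumes "x \<le> y" "0 \<le> a" shows "ennpowr x a \<le> ennpowr y a"
proof (cases y)
  case (real v)
  with assms(1) obtain u where "0 \<le> u" "x = ennreal u" by (cases x) (auto simp: top_unique)
  then show ?thesis using assms real by (auto simp: ennpowr_ennreal intro!: ennreal_leI powr_mono2)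
qed (simp add: ennpowr_def)

lemma ennpowr_inverse_le:
  assumes "ennpowr x (1 / p) \<le> ennreal e" "0 < p" "0 \<le> e" shows "x \<le> ennreal (e powr p)"
proof (cases x)
  case (real u)
  then have "u powr (1 / p) \<le> e" using assms by (simp add: ennpowr_ennreal)
  then have "(u powr (1 / p)) powr p \<le> e powr p" using assms by (intro powr_mono2) auto
  then show ?thesis using real assms by (simp add: powr_powr ennreal_leI)
qed (use assms in \<open>simp add: ennpowr_def top_unique\<close>)

text \<open>
  Jensen's inequality up to the factor \<open>2\<close>; it is this weak form that needs no measurability of the difference.
\<close>

lemma powr_split:
  fixes x y p q :: real
  assumes "0 \<le> x" "0 < y" "1 \<le> q" "q \<le> p"
  shows "x powr q \<le> y powr (q / p) * (1 + x powr p / y)"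
proof -
  define l where "l = y powr (1 / p)"
  have l: "0 < l" "l powr q = y powr (q / p)" "l powr p = y" using assms by (auto simp: l_def powr_powr)
  show ?thesis
  proof (cases "x \<le> l")
    case True
    then have "x powr q \<le> l powr q * 1" using assms by (simp add: powr_mono2)
    also have "\<dots> \<le> l powr q * (1 + x powr p / y)" using assms by (intro mult_left_mono) auto
    finally show ?thesis by (simp only: l)
  next
    case False
    then have "1 \<le> x / l" using l by simp
    then have "(x / l) powr q \<le> (x / l) powr p" using assms by (intro powr_mono) auto
    then have "l powr q * (x / l) powr q \<le> l powr q * (1 + (x / l) powr p)" by (intro mult_left_mono) auto
    also have "(x / l) powr p = x powr p / y" using l assms by (simp add: powr_divide)
    also have "l powr q * (x / l) powr q = x powr q" using l assms by (simp add: powr_divide)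
    finally show ?thesis by (simp only: l)
  qed
qed

text \<open>If y bounds the p-average, \<open>powr_split\<close> linearises the q-average and bounds
  it by twice y powr (q / p); after the q-th root the loss is at most 2. Measurability is asked of
  the majorant Y, and the integrals are compared by monotonicity.\<close>

lemma local_modulus_powr_le:
  fixes \<Omega> :: "'a::euclidean_space set"
  assumes \<Omega>: "closed \<Omega>" and q: "1 \<le> q" "q \<le> p" and p: "p < \<infinity>" and Y: "Y \<in> borel_measurable borel"
    and le: "\<And>\<eta>. \<eta> \<in> rho_ball \<Omega> \<xi> t \<Longrightarrow>
      ennreal (\<bar>fdiff_on r ((1 / real r) *\<^sub>R (\<eta> - \<xi>)) f \<Omega> \<xi>\<bar> powr enn2real p) \<le> Y \<eta>"
  shows "ennpowr (local_modulus \<Omega> r f \<xi> t q) (enn2real p) \<le> ennreal (2 powr enn2real p) *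
    ((\<integral>\<^sup>+\<eta>. Y \<eta> * indicator (rho_ball \<Omega> \<xi> t) \<eta> \<partial>lborel) / emeasure lborel (rho_ball \<Omega> \<xi> t))"
proof -
  define U where "U = rho_ball \<Omega> \<xi> t"
  define X where "X \<eta> = \<bar>fdiff_on r ((1 / real r) *\<^sub>R (\<eta> - \<xi>)) f \<Omega> \<xi>\<bar>" for \<eta>
  define a b where "a = enn2real q" and "b = enn2real p"
  have qf: "q < \<infinity>" using q p by (auto intro: le_less_trans)
  have a: "1 \<le> a" "a \<le> b" using q p qf unfolding a_def b_def
    by (auto intro!: enn2real_mono simp: enn2real_1[symmetric] simp del: enn2real_1)
  have U[measurable]: "U \<in> sets borel" unfolding U_def by (rule rho_ball_borel[OF \<Omega>])
  note [measurable] = Y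
  define V where "V = (\<integral>\<^sup>+\<eta>. Y \<eta> * indicator U \<eta> \<partial>lborel) / emeasure lborel U"
  have main: "ennpowr (local_modulus \<Omega> r f \<xi> t q) b \<le> ennreal (2 powr b * y)" if y: "0 < y" "V \<le>
    ennreal y" for y
  proof -
    define c where "c = y powr (a / b)"
    have c: "0 \<le> c" by (simp add: c_def)
    have "(\<integral>\<^sup>+\<eta>. ennpowr (ennreal (X \<eta>)) a * indicator U \<eta> \<partial>lborel) \<le>
      (\<integral>\<^sup>+\<eta>. ennreal c * (indicator U \<eta> + ennreal (1 / y) * (Y \<eta> * indicator U \<eta>)) \<partial>lborel)"
    proof (rule nn_integral_mono)
      fix \<eta>
      show "ennpowr (ennreal (X \<eta>)) a * indicator U \<eta> \<le>
        ennreal c * (indicator U \<eta> + ennreal (1 / y) * (Y \<eta> * indicator U \<eta>))"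
      proof (cases "\<eta> \<in> U")
        case True
        have "ennpowr (ennreal (X \<eta>)) a = ennreal (X \<eta> powr a)" by (simp add: X_def ennpowr_ennreal)
        also have "\<dots> \<le> ennreal (c * (1 + X \<eta> powr b / y))"
          unfolding c_def using y a by (intro ennreal_leI powr_split) (auto simp: X_def)
        also have "\<dots> = ennreal c * (1 + ennreal (1 / y) * ennreal (X \<eta> powr b))"
        proof -
          have "1 + ennreal (1 / y) * ennreal (X \<eta> powr b) = ennreal (1 + X \<eta> powr b / y)"
            using y by (simp add: ennreal_mult[symmetric])
          then show ?thesis using y c by (simp only: ennreal_mult) (rule ennreal_mult; simp)
        qed
        also have "\<dots> \<le> ennreal c * (1 + ennreal (1 / y) * Y \<eta>)"
          using le[of \<eta>] True by (intro mult_left_mono add_left_mono) (auto simp: U_def X_def b_def)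
        finally show ?thesis using True by simp
      qed simp
    qed
    also have "\<dots> = ennreal c * (emeasure lborel U + ennreal (1 / y) * (\<integral>\<^sup>+\<eta>. Y \<eta> * indicator U \<eta> \<partial>lborel))"
      by (simp add: nn_integral_cmult nn_integral_add)
    finally have "(\<integral>\<^sup>+\<eta>. ennpowr (ennreal (X \<eta>)) a * indicator U \<eta> \<partial>lborel) / emeasure lborel U \<le>
      ennreal c * (emeasure lborel U + ennreal (1 / y) *
        (\<integral>\<^sup>+\<eta>. Y \<eta> * indicator U \<eta> \<partial>lborel)) / emeasure lborel U"
      by (rule divide_right_mono_ennreal)
    also have "\<dots> = ennreal c * (emeasure lborel U / emeasure lborel U + ennreal (1 / y) * V)"
      by (simp only: V_def divide_ennreal_def distrib_right distrib_left mult.assoc)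
    also have "\<dots> \<le> ennreal c * (1 + ennreal (1 / y) * ennreal y)"
      using ennreal_mult_divide_le[of 1 "emeasure lborel U"] y by (intro mult_left_mono add_mono) auto
    also have "1 + ennreal (1 / y) * ennreal y = ennreal 2" using y by (simp add: ennreal_mult[symmetric])
    also have "ennreal c * ennreal 2 = ennreal (2 * c)" using c by (simp add: ennreal_mult mult.commute)
    finally have I: "(\<integral>\<^sup>+\<eta>. ennpowr (ennreal (X \<eta>)) a * indicator U \<eta> \<partial>lborel) / emeasure lborel U \<le>
      ennreal (2 * c)" .
    have "local_modulus \<Omega> r f \<xi> t q =
      ennpowr ((\<integral>\<^sup>+\<eta>. ennpowr (ennreal (X \<eta>)) a * indicator U \<eta> \<partial>lborel) / emeasure lborel U) (1 / a)"
    proof -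
      have "q \<noteq> \<infinity>" using qf by auto
      then show ?thesis using U by (simp add: local_modulus_def Let_def X_def U_def[symmetric] a_def nn_integral_completion)
    qed
    also have "\<dots> \<le> ennpowr (ennreal (2 * c)) (1 / a)" using I a by (intro ennpowr_mono) auto
    also have "\<dots> = ennreal (2 powr (1 / a) * y powr (1 / b))"
      using c a y by (simp add: ennpowr_ennreal powr_mult c_def powr_powr)
    also have "\<dots> \<le> ennreal (2 powr 1 * y powr (1 / b))"
      using a by (intro ennreal_leI mult_right_mono powr_mono) auto
    finally have "ennpowr (local_modulus \<Omega> r f \<xi> t q) b \<le> ennpowr (ennreal (2 * y powr (1 / b))) b"
      using a by (intro ennpowr_mono) auto
    also have "\<dots> = ennreal (2 powr b * y)" using a y by (simp add: ennpowr_ennreal powr_mult powr_powr)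
    finally show ?thesis .
  qed
  show ?thesis unfolding U_def[symmetric] V_def[symmetric] b_def[symmetric]
  proof (cases V)
    case (real v)
    show "ennpowr (local_modulus \<Omega> r f \<xi> t q) b \<le> ennreal (2 powr b) * V"
    proof (rule ennreal_le_epsilon)
      fix e :: real assume e: "0 < e"
      have "ennpowr (local_modulus \<Omega> r f \<xi> t q) b \<le> ennreal (2 powr b * (v + e / 2 powr b))"
        using real e by (intro main) (auto intro!: add_nonneg_pos ennreal_leI)
      also have "\<dots> = ennreal (2 powr b) * V + ennreal e"
        using real e by (simp add: distrib_left ennreal_mult[symmetric] ennreal_plus)
      finally show "ennpowr (local_modulus \<Omega> r f \<xi> t q) b \<le> ennreal (2 powr b) * V + ennreal e" .
    qed
  qed (simp add: ennreal_mult_eq_top_iff)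
qed

lemma tau_le_avg_int:
  fixes \<Omega> :: "'a::euclidean_space set"
  assumes \<Omega>: "closed \<Omega>" and q: "1 \<le> q" "q \<le> p" and p: "p < \<infinity>"
    and Y: "case_prod Y \<in> borel_measurable (borel \<Otimes>\<^sub>M borel)"
    and le: "\<And>\<xi> \<eta>. \<xi> \<in> \<Omega> \<Longrightarrow> \<eta> \<in> rho_ball \<Omega> \<xi> t \<Longrightarrow>
      ennreal (\<bar>fdiff_on r ((1 / real r) *\<^sub>R (\<eta> - \<xi>)) f \<Omega> \<xi>\<bar> powr enn2real p) \<le> Y \<xi> \<eta>"
    and A: "0 \<le> A" "avg_int \<Omega> \<Omega> t Y \<le> ennreal (A powr enn2real p)"
  shows "tau \<Omega> r f t p q \<le> ennreal (2 * A)"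
proof -
  define b where "b = enn2real p"
  have b: "1 \<le> b" using q p unfolding b_def
    by (auto intro!: enn2real_mono simp: enn2real_1[symmetric] simp del: enn2real_1)
  have [measurable]: "\<Omega> \<in> sets borel" using \<Omega> by simp
  note [measurable] = avg_measurable[OF \<Omega> Y, of t]
  have Y1: "Y \<xi> \<in> borel_measurable borel" for \<xi>
    using measurable_Pair2[OF Y, of \<xi>] by simp
  have "(\<integral>\<^sup>+\<xi>. ennpowr (local_modulus \<Omega> r f \<xi> t q) b * indicator \<Omega> \<xi> \<partial>lborel) \<le>
    (\<integral>\<^sup>+\<xi>. ennreal (2 powr b) * (indicator \<Omega> \<xi> *
      ((\<integral>\<^sup>+\<eta>. Y \<xi> \<eta> * indicator (rho_ball \<Omega> \<xi> t) \<eta> \<partial>lborel) / emeasure lborel (rho_ball \<Omega> \<xi> t))) \<partial>lborel)"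
  proof (rule nn_integral_mono)
    fix \<xi>
    show "ennpowr (local_modulus \<Omega> r f \<xi> t q) b * indicator \<Omega> \<xi> \<le> ennreal (2 powr b) *
      (indicator \<Omega> \<xi> * ((\<integral>\<^sup>+\<eta>. Y \<xi> \<eta> * indicator (rho_ball \<Omega> \<xi> t) \<eta> \<partial>lborel) / emeasure lborel (rho_ball \<Omega> \<xi> t)))"
    proof (cases "\<xi> \<in> \<Omega>")
      case True
      then show ?thesis using local_modulus_powr_le[OF \<Omega> q p Y1 le[OF True]] by (simp add: b_def)
    qed simp
  qed
  also have "\<dots> = ennreal (2 powr b) * avg_int \<Omega> \<Omega> t Y"
    unfolding avg_int_def by (rule nn_integral_cmult) measurable
  also have "\<dots> \<le> ennreal (2 powr b) * ennreal (A powr b)" using A by (intro mult_left_mono) (auto simp: b_def)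
  also have "\<dots> = ennreal ((2 * A) powr b)" using A by (simp add: powr_mult ennreal_mult)
  finally have I: "(\<integral>\<^sup>+\<xi>. ennpowr (local_modulus \<Omega> r f \<xi> t q) b * indicator \<Omega> \<xi> \<partial>lborel) \<le>
    ennreal ((2 * A) powr b)" .
  have "tau \<Omega> r f t p q = ennpowr (\<integral>\<^sup>+\<xi>. ennpowr (local_modulus \<Omega> r f \<xi> t q) b * indicator \<Omega> \<xi> \<partial>lborel) (1 / b)"
  proof -
    have "p \<noteq> \<infinity>" using p by auto
    then show ?thesis by (simp add: tau_def Lnorm_def b_def nn_integral_completion)
  qed
  also have "\<dots> \<le> ennpowr (ennreal ((2 * A) powr b)) (1 / b)" using I b by (intro ennpowr_mono) auto
  also have "\<dots> = ennreal (2 * A)" using A b by (simp add: ennpowr_ennreal powr_powr)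
  finally show ?thesis .
qed

text \<open>The uniform norm is a genuine supremum, so the bound has to hold at every pair of
  points; for this reason the Bernstein estimate is also carried in the pointwise form
  \<open>sup_bound\<close>.\<close>

lemma tau_top_le:
  assumes q: "1 \<le> q" and B: "0 \<le> B"
    and le: "\<And>\<xi> \<eta>. \<xi> \<in> \<Omega> \<Longrightarrow> \<eta> \<in> rho_ball \<Omega> \<xi> t \<Longrightarrow> \<bar>fdiff_on r ((1 / real r) *\<^sub>R (\<eta> - \<xi>)) f \<Omega> \<xi>\<bar> \<le> B"
    and \<Omega>: "closed \<Omega>"
  shows "tau \<Omega> r f t \<infinity> q \<le> ennreal B"
proof -
  have "local_modulus \<Omega> r f \<xi> t q \<le> ennreal B" if \<xi>: "\<xi> \<in> \<Omega>" for \<xi>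
  proof (cases "q = \<infinity>")
    case True
    then show ?thesis using le[OF \<xi>] by (auto simp: local_modulus_def intro!: SUP_least ennreal_leI)
  next
    case False
    define a where "a = enn2real q"
    have a: "1 \<le> a" using q False unfolding a_def
      by (auto intro!: enn2real_mono simp: enn2real_1[symmetric] top.not_eq_extremum simp del: enn2real_1)
    define U where "U = rho_ball \<Omega> \<xi> t"
    have U: "U \<in> sets borel" unfolding U_def by (rule rho_ball_borel[OF \<Omega>])
    define X where "X \<eta> = \<bar>fdiff_on r ((1 / real r) *\<^sub>R (\<eta> - \<xi>)) f \<Omega> \<xi>\<bar>" for \<eta>
    have "(\<integral>\<^sup>+\<eta>. ennpowr (ennreal (X \<eta>)) a * indicator U \<eta> \<partial>lebesgue) \<le>
      (\<integral>\<^sup>+\<eta>. ennreal (B powr a) * indicator U \<eta> \<partial>lebesgue)"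
      using le[OF \<xi>] a by (intro nn_integral_mono)
        (auto simp: ennpowr_ennreal X_def U_def intro!: ennreal_leI powr_mono2 split: split_indicator)
    also have "\<dots> = ennreal (B powr a) * emeasure lebesgue U" using U by (subst nn_integral_cmult_indicator) auto
    finally have "(\<integral>\<^sup>+\<eta>. ennpowr (ennreal (X \<eta>)) a * indicator U \<eta> \<partial>lebesgue) / emeasure lebesgue U \<le>
      ennreal (B powr a)"
      by (rule order_trans[OF divide_right_mono_ennreal ennreal_mult_divide_le])
    then have "ennpowr ((\<integral>\<^sup>+\<eta>. ennpowr (ennreal (X \<eta>)) a *
      indicator U \<eta> \<partial>lebesgue) / emeasure lebesgue U) (1 / a) \<le> ennpowr (ennreal (B powr a)) (1 / a)"
      using a by (intro ennpowr_mono) auto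
    also have "\<dots> = ennreal B" using a B by (simp add: ennpowr_ennreal powr_powr)
    finally show ?thesis using False by (simp add: local_modulus_def Let_def X_def U_def a_def)
  qed
  then show ?thesis by (auto simp: tau_def Lnorm_def intro!: SUP_least)
qed

text \<open>Block by block: between 2^m, excluded, and 2^(m+1) there are 2^m indices, each with
  weight at least 2^(m (r - 1)) and with F at least its value at the right end. The factor 4^r pays
  for the two doublings from 2^m to 2^(m+2).\<close>

lemma dyadic_sum_le:
  fixes F :: "nat \<Rightarrow> real"
  assumes r: "r \<ge> 1" and F0: "\<And>s. s \<le> n \<Longrightarrow> 0 \<le> F s" and F: "\<And>s s'. s \<le> s' \<Longrightarrow> s' \<le> n \<Longrightarrow> F s' \<le> F s"
    and m: "2 ^ m \<le> n"
  shows "F 0 + (\<Sum>k\<le>m. (2 ^ Suc k) ^ r * F (2 ^ k)) \<le> 4 ^ r * (\<Sum>s\<le>2 ^ m. real (s + 1) ^ (r - 1) * F s)"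
  using m
proof (induction m)
  case 0
  then have n: "1 \<le> n" by simp
  have "1 * F 0 \<le> 4 ^ r * F 0" using F0[of 0] by (intro mult_right_mono) auto
  moreover have "2 ^ r * F 1 \<le> 4 ^ r * (2 ^ (r - 1) * F 1)"
  proof -
    have "2 ^ r * 1 \<le> 4 ^ r * (2 ^ (r - 1) :: real)" by (intro mult_mono power_mono) auto
    from mult_right_mono[OF this, of "F 1"] show ?thesis using F0[OF n] by (simp add: mult.assoc)
  qed
  moreover have "{..2 ^ 0} = {0, 1::nat}" by auto
  ultimately show ?case by (simp add: distrib_left)
next
  case (Suc m)
  let ?w = "\<lambda>s. real (s + 1) ^ (r - 1) * F s"
  have le: "2 ^ m \<le> n" using Suc.prems by simp
  have split: "{..2 ^ Suc m} = {..2 ^ m} \<union> {2 ^ m<..(2::nat) ^ Suc m}" by auto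
  have "(2 ^ Suc (Suc m)) ^ r * F (2 ^ Suc m) = 4 ^ r * (2 ^ m * (2 ^ m) ^ (r - 1) * F (2 ^ Suc m))"
  proof -
    have "(2 ^ m) * (2 ^ m) ^ (r - 1) = ((2 ^ m) ^ r :: real)" using r by (cases r) auto
    moreover have "(2 ^ Suc (Suc m)) ^ r = 4 ^ r * ((2 ^ m) ^ r :: real)"
      unfolding power_mult_distrib[symmetric] by simp
    ultimately show ?thesis by simp
  qed
  also have "(2 ^ m * (2 ^ m) ^ (r - 1) * F (2 ^ Suc m)) =
    (\<Sum>s\<in>{2 ^ m<..(2::nat) ^ Suc m}. (2 ^ m) ^ (r - 1) * F (2 ^ Suc m))"
    by (simp add: mult.assoc)
  also have "\<dots> \<le> (\<Sum>s\<in>{2 ^ m<..(2::nat) ^ Suc m}. ?w s)"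
  proof (intro sum_mono mult_mono power_mono)
    fix s assume s: "s \<in> {2 ^ m<..(2::nat) ^ Suc m}"
    then show "F (2 ^ Suc m) \<le> F s" using Suc.prems by (intro F) auto
    have "real (2 ^ m) \<le> real (s + 1)" using s by (intro of_nat_mono) auto
    then show "2 ^ m \<le> real (s + 1)" by simp
  qed (use F0 Suc.prems in auto)
  finally have "(2 ^ Suc (Suc m)) ^ r * F (2 ^ Suc m) \<le> 4 ^ r * (\<Sum>s\<in>{2 ^ m<..(2::nat) ^ Suc m}. ?w s)" by simp
  moreover have "(\<Sum>s\<le>2 ^ Suc m. ?w s) = (\<Sum>s\<le>2 ^ m. ?w s) + (\<Sum>s\<in>{2 ^ m<..(2::nat) ^ Suc m}. ?w s)"
    unfolding split by (rule sum.union_disjoint) auto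
  ultimately show ?case using Suc.IH[OF le] by (simp only: sum.atMost_Suc distrib_left)
qed

lemma telescope_Polys:
  assumes "Q 0 \<in> Polys 0" "\<And>k. k \<le> m \<Longrightarrow> Q (Suc k) \<in> Polys (2 ^ k)" "k \<le> m"
  shows "(\<lambda>x. Q (Suc k) x - Q k x) \<in> Polys (2 ^ k)"
proof (rule Polys_diff)
  show "Q (Suc k) \<in> Polys (2 ^ k)" using assms by simp
  show "Q k \<in> Polys (2 ^ k)"
  proof (cases k)
    case 0
    then show ?thesis using assms(1) Polys_mono[of 0 "2 ^ k"] by auto
  next
    case (Suc j)
    then have "Q k \<in> Polys (2 ^ j)" using assms by simp
    then show ?thesis using Polys_mono[of "2 ^ j" "2 ^ k"] Suc by auto
  qed
qed

text \<open>Q 0 is constant and r >= 1, so its difference vanishes and the telescope has no initial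
  term.\<close>

lemma abs_fdiff_telescope:
  assumes "\<And>j. j \<le> r \<Longrightarrow> node r \<xi> \<eta> j \<in> \<Omega>" "Q 0 \<in> Polys 0" "r \<ge> 1"
  shows "\<bar>fdiff r ((1 / real r) *\<^sub>R (\<eta> - \<xi>)) f \<xi>\<bar> \<le> (\<Sum>j\<le>r. node_sum \<Omega> r (\<lambda>x. f x - Q (Suc m) x) \<xi> \<eta> j) +
    (\<Sum>k\<le>m. \<bar>fdiff r ((1 / real r) *\<^sub>R (\<eta> - \<xi>)) (\<lambda>x. Q (Suc k) x - Q k x) \<xi>\<bar>)"
proof -
  let ?d = "\<lambda>h. fdiff r ((1 / real r) *\<^sub>R (\<eta> - \<xi>)) h \<xi>"
  have "?d (Q (Suc m)) = (\<Sum>k\<le>m. ?d (\<lambda>x. Q (Suc k) x - Q k x))"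
    using sum_lessThan_telescope[of "\<lambda>k. ?d (Q k)" "Suc m"] fdiff_Polys_0[OF assms(2,3)]
    by (simp add: fdiff_diff lessThan_Suc_atMost)
  then have "\<bar>?d (Q (Suc m))\<bar> \<le> (\<Sum>k\<le>m. \<bar>?d (\<lambda>x. Q (Suc k) x - Q k x)\<bar>)" by (simp only: sum_abs)
  moreover have "\<bar>?d (\<lambda>x. f x - Q (Suc m) x)\<bar> \<le> (\<Sum>j\<le>r. node_sum \<Omega> r (\<lambda>x. f x - Q (Suc m) x) \<xi> \<eta> j)"
    by (rule abs_fdiff_le_node_sum[OF assms(1)])
  ultimately show ?thesis by (simp only: fdiff_diff)
qed

context covered
begin

text \<open>For finite p, f is replaced by a Borel function g that agrees with it on the domain
  outside a null set N. The exceptional pairs are those with some node in N; a majorant that is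
  infinite there has average zero by \<open>node_average\<close>. The remaining majorants, one per
  level and one for the remainder, are added by Minkowski's inequality.\<close>

lemma tau_telescope:
  obtains K where "1 \<le> K"
    "\<And>p q f t m Q e. 1 \<le> q \<Longrightarrow> q \<le> p \<Longrightarrow> f \<in> Lspace p \<Omega> \<Longrightarrow> 0 < t \<Longrightarrow> 2 ^ m * t \<le> 1 \<Longrightarrow>
       Q 0 \<in> Polys 0 \<Longrightarrow> (\<And>k. k \<le> m \<Longrightarrow> Q (Suc k) \<in> Polys (2 ^ k)) \<Longrightarrow> (\<And>k. 0 < e k) \<Longrightarrow>
       (\<And>k. k \<le> Suc m \<Longrightarrow> Lnorm p \<Omega> (\<lambda>x. ennreal \<bar>f x - Q k x\<bar>) \<le> ennreal (e k)) \<Longrightarrow>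
       tau \<Omega> r f t p q \<le> ennreal (K * (e (Suc m) + (\<Sum>k\<le>m. (2 ^ k * t) ^ r * (e (Suc k) + e k))))"
proof -
  obtain K1 where K1: "1 \<le> K1" and majorant: "majorant_bound K1" and sup: "sup_bound K1"
    by (rule polynomial_majorant)
  obtain K2 where K2: "1 \<le> K2" and node_sum: "node_sum_bound K2" by (rule node_sum_average)
  obtain K3 where K3: "\<And>t j Gf. 0 < t \<Longrightarrow> t \<le> 1 \<Longrightarrow> j \<le> r \<Longrightarrow> Gf \<in> borel_measurable borel \<Longrightarrow>
     avg_int \<Omega> \<Omega> t (\<lambda>\<xi> \<eta>. Gf (node r \<xi> \<eta> j)) \<le> ennreal K3 * (\<integral>\<^sup>+z. Gf z \<partial>lborel)"
    by (rule node_average) (rule that; blast)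
  \<comment> \<open>The coefficients 2^r and K1 serve p = \<infinity>. For finite p,
    \<open>tau_le_avg_int\<close> loses a factor 2, and the pieces carry the factor 4 from the bound
    on their norm, whence 2 K2 and 8 K1.\<close>
  define K where "K = 2 ^ r + 2 * K2 + 8 * K1"
  have K: "1 \<le> K" "2 ^ r \<le> K" "K1 \<le> K" using K1 K2 zero_le_power[of "2::real" r] unfolding K_def by linarith+
  show thesis
  proof
    show "1 \<le> K" by (rule K)
    fix p q and f :: "(real ^ 'd) \<times> real \<Rightarrow> real" and t :: real and m :: nat and Q and e :: "nat \<Rightarrow> real"
    assume q: "(1::ennreal) \<le> q" "q \<le> p" and f: "f \<in> Lspace p \<Omega>" and t: "0 < t" "2 ^ m * t \<le> 1"
      and Q: "Q 0 \<in> Polys 0" "\<And>k. k \<le> m \<Longrightarrow> Q (Suc k) \<in> Polys (2 ^ k)"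
      and e: "\<And>k. 0 < e k" and le: "\<And>k. k \<le> Suc m \<Longrightarrow> Lnorm p \<Omega> (\<lambda>x. ennreal \<bar>f x - Q k x\<bar>) \<le> ennreal (e k)"
    define S where "S = (\<Sum>k\<le>m. (2 ^ k * t) ^ r * (e (Suc k) + e k))"
    have S: "0 \<le> S" unfolding S_def using t e
      by (intro sum_nonneg mult_nonneg_nonneg add_nonneg_nonneg) (auto intro: less_imp_le)
    have nn: "0 \<le> K * (e (Suc m) + S)" using K e[of "Suc m"] S by simp
    have kt: "2 ^ k * t \<le> 1" if "k \<le> m" for k
    proof -
      have "2 ^ k * t \<le> 2 ^ m * t" using that t by (intro mult_right_mono power_increasing) auto
      then show ?thesis using t by linarith
    qed
    show "tau \<Omega> r f t p q \<le> ennreal (K * (e (Suc m) + (\<Sum>k\<le>m. (2 ^ k * t) ^ r * (e (Suc k) + e k))))"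
    proof (cases "p = \<infinity>")
      case True
      have lek: "\<bar>f x - Q k x\<bar> \<le> e k" if "x \<in> \<Omega>" "k \<le> Suc m" for x k
      proof -
        have "ennreal \<bar>f x - Q k x\<bar> \<le> ennreal (e k)"
          using le[OF that(2)] that(1) True by (auto simp: Lnorm_def SUP_le_iff)
        then show ?thesis using e[of k] by (subst (asm) ennreal_le_iff) auto
      qed
      show ?thesis unfolding True S_def[symmetric]
      proof (rule tau_top_le[OF q(1) _ _ clo])
        show "0 \<le> K * (e (Suc m) + S)" by (rule nn)
        fix \<xi> \<eta> assume \<xi>: "\<xi> \<in> \<Omega>" "\<eta> \<in> rho_ball \<Omega> \<xi> t"
        show "\<bar>fdiff_on r ((1 / real r) *\<^sub>R (\<eta> - \<xi>)) f \<Omega> \<xi>\<bar> \<le> K * (e (Suc m) + S)"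
        proof (cases "closed_segment \<xi> (\<xi> + real r *\<^sub>R ((1 / real r) *\<^sub>R (\<eta> - \<xi>))) \<subseteq> \<Omega>")
          case seg: True
          have sg: "node r \<xi> \<eta> j \<in> \<Omega>" if "j \<le> r" for j by (rule segment_nodes[OF seg r that])
          have "\<bar>fdiff r ((1 / real r) *\<^sub>R (\<eta> - \<xi>)) f \<xi>\<bar> \<le> (\<Sum>j\<le>r. node_sum \<Omega> r (\<lambda>x. f x - Q (Suc m) x) \<xi> \<eta> j) +
            (\<Sum>k\<le>m. \<bar>fdiff r ((1 / real r) *\<^sub>R (\<eta> - \<xi>)) (\<lambda>x. Q (Suc k) x - Q k x) \<xi>\<bar>)"
            by (rule abs_fdiff_telescope[where Q = Q, OF sg Q(1) r])
          also have "(\<Sum>j\<le>r. node_sum \<Omega> r (\<lambda>x. f x - Q (Suc m) x) \<xi> \<eta> j) \<le> (\<Sum>j\<le>r. real (r choose j) * e (Suc m))"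
            using sg lek by (intro sum_mono) (auto simp: node_sum_def intro!: mult_left_mono)
          also have "(\<Sum>j\<le>r. real (r choose j) * e (Suc m)) = 2 ^ r * e (Suc m)"
          proof -
            have "(\<Sum>j\<le>r. real (r choose j) * e (Suc m)) = real (\<Sum>j\<le>r. r choose j) * e (Suc m)"
              by (simp add: sum_distrib_right)
            then show ?thesis by (simp only: choose_row_sum) simp
          qed
          also have "(\<Sum>k\<le>m. \<bar>fdiff r ((1 / real r) *\<^sub>R (\<eta> - \<xi>)) (\<lambda>x. Q (Suc k) x - Q k x) \<xi>\<bar>) \<le>
            (\<Sum>k\<le>m. K1 * ((2 ^ k * t) ^ r * (e (Suc k) + e k)))"
          proof (rule sum_mono)
            fix k assume k: "k \<in> {..m}"
            have "2 ^ k * t \<le> 2 ^ m * t" using k t by (intro mult_right_mono power_increasing) auto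
            then have kt: "2 ^ k * t \<le> 1" using t by linarith
            have "\<bar>fdiff r ((1 / real r) *\<^sub>R (\<eta> - \<xi>)) (\<lambda>x. Q (Suc k) x - Q k x) \<xi>\<bar> \<le>
              K1 * (real (2 ^ k) * t) ^ r * (e (Suc k) + e k)"
            proof (rule sup[unfolded sup_bound_def, rule_format, OF _ t(1) _ telescope_Polys[OF Q(1) Q(2)] \<xi>])
              show "seg \<xi> \<eta>" using sg by (simp add: seg_def)
              fix z assume "z \<in> \<Omega>"
              then show "\<bar>Q (Suc k) z - Q k z\<bar> \<le> e (Suc k) + e k" using lek[of z k] lek[of z "Suc k"] k by simp
            qed (use k kt in auto)
            then show "\<bar>fdiff r ((1 / real r) *\<^sub>R (\<eta> - \<xi>)) (\<lambda>x. Q (Suc k) x - Q k x) \<xi>\<bar> \<le>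
              K1 * ((2 ^ k * t) ^ r * (e (Suc k) + e k))"
              by (simp add: mult.assoc)
          qed
          also have "\<dots> = K1 * S" by (simp add: S_def sum_distrib_left)
          also have "2 ^ r * e (Suc m) + K1 * S \<le> K * e (Suc m) + K * S"
            using K S e[of "Suc m"] by (intro add_mono mult_right_mono) auto
          also have "\<dots> = K * (e (Suc m) + S)" by (simp add: distrib_left)
          finally show ?thesis using seg by (simp add: fdiff_on_def)
        qed (use nn in \<open>simp add: fdiff_on_def\<close>)
      qed
    next
      case False
      then have pf: "p < \<infinity>" by (simp add: top.not_eq_extremum)
      define b where "b = enn2real p"
      have b: "1 \<le> b" using q pf unfolding b_def
        by (auto intro!: enn2real_mono simp: enn2real_1[symmetric] simp del: enn2real_1)
      have \<Omega>b[measurable]: "\<Omega> \<in> sets borel" using clo by simp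
      have "f \<in> borel_measurable (lebesgue_on \<Omega>)" using f False by (simp add: Lspace_def)
      then have "(\<lambda>x. if x \<in> \<Omega> then f x else 0) \<in> borel_measurable lebesgue"
        by (simp add: borel_measurable_if)
      then obtain g where g[measurable]: "g \<in> borel_measurable lborel"
        and "AE x in lborel. (if x \<in> \<Omega> then f x else 0) = g x"
        using completion_ex_borel_measurable_real by blast
      then obtain N where N: "N \<in> null_sets lborel" "{x. (if x \<in> \<Omega> then f x else 0) \<noteq> g x} \<subseteq> N"
        by (auto simp: eventually_ae_filter)
      have fg: "f x = g x" if "x \<in> \<Omega>" "x \<notin> N" for x
        using subsetD[OF N(2), of x] that by auto
      have Nb[measurable]: "N \<in> sets borel" using N(1) by auto
      have Q': "Q k \<in> borel_measurable borel" if "k \<le> Suc m" for k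
        using that Q Polys_measurable by (cases k) auto
      have gQ: "(\<integral>\<^sup>+z. indicator \<Omega> z * ennreal (\<bar>g z - Q k z\<bar> powr b) \<partial>lborel) \<le>
        ennreal (e k powr b)" if k: "k \<le> Suc m" for k
      proof (rule ennpowr_inverse_le)
        have "(\<integral>\<^sup>+z. indicator \<Omega> z * ennreal (\<bar>g z - Q k z\<bar> powr b) \<partial>lborel) =
          (\<integral>\<^sup>+z. ennpowr (ennreal \<bar>f z - Q k z\<bar>) b * indicator \<Omega> z \<partial>lborel)"
        proof (rule nn_integral_cong_AE)
          have "AE z in lborel. z \<notin> N" by (rule AE_not_in[OF N(1)])
          then show "AE z in lborel. indicator \<Omega> z * ennreal (\<bar>g z - Q k z\<bar> powr b) =
            ennpowr (ennreal \<bar>f z - Q k z\<bar>) b * indicator \<Omega> z"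
            by eventually_elim (auto simp: indicator_def fg ennpowr_ennreal)
        qed
        then show "ennpowr (\<integral>\<^sup>+z. indicator \<Omega> z * ennreal (\<bar>g z - Q k z\<bar> powr b) \<partial>lborel) (1 / b) \<le>
          ennreal (e k)"
          using le[OF k] False by (simp add: Lnorm_def b_def nn_integral_completion)
      qed (use b e[of k] in auto)
      define P where "P k x = Q (Suc k) x - Q k x" for k x
      have P: "P k \<in> Polys (2 ^ k)" if "k \<le> m" for k
        unfolding P_def [abs_def] by (rule telescope_Polys[OF Q that])
      \<comment> \<open>The indices up to m belong to the polynomial pieces, the index Suc m to the
        remainder f - Q (Suc m).\<close>
      define A where "A k = (if k \<le> m then K1 * (2 ^ k * t) ^ r * (4 * (e (Suc k) + e k)) else K2 * e k)" for k
      have A0: "0 < A k" for k using K1 K2 t e[of k] e[of "Suc k"] by (auto simp: A_def)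
      have "\<exists>Z. case_prod Z \<in> borel_measurable (borel \<Otimes>\<^sub>M borel) \<and> (\<forall>\<xi> \<eta>. 0 \<le> Z \<xi> \<eta>) \<and>
         (\<forall>\<xi> \<eta>. seg \<xi> \<eta> \<longrightarrow> \<bar>fdiff r ((1 / real r) *\<^sub>R (\<eta> - \<xi>)) (P k) \<xi>\<bar> \<le> Z \<xi> \<eta>) \<and>
         avg_int \<Omega> \<Omega> t (\<lambda>\<xi> \<eta>. ennreal (Z \<xi> \<eta> powr b)) \<le> ennreal (A k powr b)" if k: "k \<le> m" for k
      proof -
        \<comment> \<open>The 4 absorbs the crude triangle inequality for a single piece, since 2 *
          2 powr b <= 4 powr b. It is a fixed factor at each level and does not accumulate.\<close>
        define D where "D = 4 * (e (Suc k) + e k)"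
        have D: "0 < D" using e[of k] e[of "Suc k"] by (simp add: D_def)
        have [measurable]: "Q k \<in> borel_measurable borel" "Q (Suc k) \<in> borel_measurable borel"
          using Q' k by auto
        have "(\<integral>\<^sup>+z. indicator \<Omega> z * ennreal (\<bar>P k z\<bar> powr b) \<partial>lborel) \<le>
          (\<integral>\<^sup>+z. ennreal (2 powr b) * (indicator \<Omega> z * ennreal (\<bar>g z - Q (Suc k) z\<bar> powr b) +
            indicator \<Omega> z * ennreal (\<bar>g z - Q k z\<bar> powr b)) \<partial>lborel)"
        proof (rule nn_integral_mono)
          fix z
          define u v where "u = \<bar>g z - Q (Suc k) z\<bar>" and "v = \<bar>g z - Q k z\<bar>"
          have "\<bar>P k z\<bar> \<le> u + v" unfolding P_def u_def v_def by linarith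
          also have "\<dots> \<le> 2 * max u v" by linarith
          finally have "\<bar>P k z\<bar> powr b \<le> (2 * max u v) powr b" using b by (intro powr_mono2) auto
          also have "\<dots> = 2 powr b * max u v powr b" by (simp add: powr_mult u_def v_def)
          also have "\<dots> \<le> 2 powr b * (u powr b + v powr b)" by (intro mult_left_mono) (auto simp: max_def)
          finally have "ennreal (\<bar>P k z\<bar> powr b) \<le>
            ennreal (2 powr b) * (ennreal (u powr b) + ennreal (v powr b))"
            by (simp add: ennreal_mult[symmetric] ennreal_plus[symmetric] ennreal_leI del: ennreal_plus)
          then show "indicator \<Omega> z * ennreal (\<bar>P k z\<bar> powr b) \<le>
            ennreal (2 powr b) * (indicator \<Omega> z * ennreal (\<bar>g z - Q (Suc k) z\<bar> powr b) +
            indicator \<Omega> z * ennreal (\<bar>g z - Q k z\<bar> powr b))"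
            by (auto simp: indicator_def u_def v_def)
        qed
        also have "\<dots> = ennreal (2 powr b) * ((\<integral>\<^sup>+z. indicator \<Omega> z *
          ennreal (\<bar>g z - Q (Suc k) z\<bar> powr b) \<partial>lborel) +
          (\<integral>\<^sup>+z. indicator \<Omega> z * ennreal (\<bar>g z - Q k z\<bar> powr b) \<partial>lborel))"
          by (simp add: nn_integral_cmult nn_integral_add)
        also have "\<dots> \<le> ennreal (2 powr b) * (ennreal ((e (Suc k) + e k) powr b) + ennreal ((e (Suc k) +
          e k) powr b))"
        proof (intro mult_left_mono add_mono)
          have "e (Suc k) powr b \<le> (e (Suc k) + e k) powr b" "e k powr b \<le> (e (Suc k) + e k) powr b"
            using b e[of k] e[of "Suc k"] by (intro powr_mono2; simp)+
          from this[THEN ennreal_leI]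
          show "(\<integral>\<^sup>+z. indicator \<Omega> z * ennreal (\<bar>g z - Q (Suc k) z\<bar> powr b) \<partial>lborel) \<le>
            ennreal ((e (Suc k) + e k) powr b)"
            "(\<integral>\<^sup>+z. indicator \<Omega> z * ennreal (\<bar>g z - Q k z\<bar> powr b) \<partial>lborel) \<le>
              ennreal ((e (Suc k) + e k) powr b)"
            using gQ[of k] gQ[of "Suc k"] k by (auto intro: order_trans)
        qed simp
        also have "\<dots> = ennreal (2 powr b * (2 * (e (Suc k) + e k) powr b))"
          by (simp add: ennreal_mult[symmetric] ennreal_plus[symmetric] del: ennreal_plus)
        also have "\<dots> \<le> ennreal (D powr b)"
        proof (rule ennreal_leI)
          have "D powr b = (2 powr b * 2 powr b) * (e (Suc k) + e k) powr b"
            using e[of k] e[of "Suc k"] by (simp add: D_def powr_mult powr_mult[symmetric])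
          moreover have "2 powr b * 2 \<le> 2 powr b * (2 powr b :: real)"
            using b powr_mono[of 1 b 2] by (intro mult_left_mono) auto
          ultimately show "2 powr b * (2 * (e (Suc k) + e k) powr b) \<le> D powr b"
            by (simp only: mult.assoc[symmetric]) (rule mult_right_mono; simp)
        qed
        finally have I: "(\<integral>\<^sup>+z. indicator \<Omega> z * ennreal (\<bar>P k z\<bar> powr b) \<partial>lborel) \<le> ennreal (D powr b)" .
        show ?thesis using majorant[unfolded majorant_bound_def, rule_format, OF _ t(1) _ P[OF k] b D I] kt[OF k] k by (simp add: A_def D_def)
      qed
      then have "\<forall>k\<in>{..m}. \<exists>Z. case_prod Z \<in> borel_measurable (borel \<Otimes>\<^sub>M borel) \<and> (\<forall>\<xi> \<eta>. 0 \<le> Z \<xi> \<eta>) \<and>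
         (\<forall>\<xi> \<eta>. seg \<xi> \<eta> \<longrightarrow> \<bar>fdiff r ((1 / real r) *\<^sub>R (\<eta> - \<xi>)) (P k) \<xi>\<bar> \<le> Z \<xi> \<eta>) \<and>
         avg_int \<Omega> \<Omega> t (\<lambda>\<xi> \<eta>. ennreal (Z \<xi> \<eta> powr b)) \<le> ennreal (A k powr b)" by simp
      then obtain Z' where Za: "\<forall>k\<in>{..m}. case_prod (Z' k) \<in> borel_measurable (borel \<Otimes>\<^sub>M borel) \<and> (\<forall>\<xi> \<eta>. 0 \<le>
        Z' k \<xi> \<eta>) \<and>
         (\<forall>\<xi> \<eta>. seg \<xi> \<eta> \<longrightarrow> \<bar>fdiff r ((1 / real r) *\<^sub>R (\<eta> - \<xi>)) (P k) \<xi>\<bar> \<le> Z' k \<xi> \<eta>) \<and>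
         avg_int \<Omega> \<Omega> t (\<lambda>\<xi> \<eta>. ennreal (Z' k \<xi> \<eta> powr b)) \<le> ennreal (A k powr b)"
        by (elim bchoice[THEN exE])
      have Z': "case_prod (Z' k) \<in> borel_measurable (borel \<Otimes>\<^sub>M borel)" "0 \<le> Z' k \<xi> \<eta>"
        "seg \<xi> \<eta> \<Longrightarrow> \<bar>fdiff r ((1 / real r) *\<^sub>R (\<eta> - \<xi>)) (P k) \<xi>\<bar> \<le> Z' k \<xi> \<eta>"
        "avg_int \<Omega> \<Omega> t (\<lambda>\<xi> \<eta>. ennreal (Z' k \<xi> \<eta> powr b)) \<le> ennreal (A k powr b)" if "k \<le> m" for k \<xi> \<eta>
        using bspec[OF Za, of k] that by blast+
      define h where "h x = g x - Q (Suc m) x" for x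
      have hm[measurable]: "h \<in> borel_measurable borel"
        using Q'[of "Suc m"] unfolding h_def [abs_def] by measurable
      define Z where "Z k \<xi> \<eta> = (if k \<le> m then Z' k \<xi> \<eta> else (\<Sum>j\<le>r. node_sum \<Omega> r h \<xi> \<eta> j))" for k \<xi> \<eta>
      have Z0: "0 \<le> Z k \<xi> \<eta>" for k \<xi> \<eta>
        using Z'(2) by (auto simp: Z_def node_sum_def intro!: sum_nonneg)
      have Zm: "case_prod (Z k) \<in> borel_measurable (borel \<Otimes>\<^sub>M borel)" for k
      proof (cases "k \<le> m")
        case True
        then have "Z k = Z' k" by (simp add: Z_def fun_eq_iff)
        then show ?thesis using Z'(1)[OF True] by simp
      next
        case False
        then have "Z k = (\<lambda>\<xi> \<eta>. \<Sum>j\<le>r. node_sum \<Omega> r h \<xi> \<eta> j)" by (simp add: Z_def fun_eq_iff)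
        then show ?thesis by (simp add: node_sum_def split_beta')
      qed
      define Y1 where "Y1 \<xi> \<eta> = ennreal ((\<Sum>k\<le>Suc m. Z k \<xi> \<eta>) powr b)" for \<xi> \<eta>
      \<comment> \<open>Infinite as soon as one node falls into N, where f and g may differ.\<close>
      define Y2 where "Y2 \<xi> \<eta> = (\<Sum>j\<le>r. \<infinity> * indicator N (node r \<xi> \<eta> j) :: ennreal)" for \<xi> \<eta>
      have t1: "t \<le> 1" using kt[of 0] by simp
      have Y1m: "case_prod Y1 \<in> borel_measurable (borel \<Otimes>\<^sub>M borel)"
      proof -
        note [measurable] = Zm
        have "(\<lambda>z. ennreal ((\<Sum>k\<le>Suc m. case_prod (Z k) z) powr b)) \<in> borel_measurable (borel \<Otimes>\<^sub>M borel)" by measurable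
        then show ?thesis by (simp add: Y1_def split_beta')
      qed
      have Y2m: "case_prod Y2 \<in> borel_measurable (borel \<Otimes>\<^sub>M borel)"
        unfolding Y2_def split_beta' by measurable
      have Y1a: "avg_int \<Omega> \<Omega> t Y1 \<le> ennreal ((\<Sum>k\<le>Suc m. A k) powr b)"
        unfolding Y1_def
      proof (rule avg_int_minkowski[OF clo _ _ b, where Z = Z])
        fix k assume k: "k \<in> {..Suc m}"
        show "avg_int \<Omega> \<Omega> t (\<lambda>\<xi> \<eta>. ennreal (Z k \<xi> \<eta> powr b)) \<le> ennreal (A k powr b)"
        proof (cases "k \<le> m")
          case True
          then show ?thesis using Z'(4)[OF True] by (simp add: Z_def)
        next
          case False
          then have "k = Suc m" using k by simp
          then show ?thesis using node_sum[unfolded node_sum_bound_def, rule_format, OF t(1) t1 b hm e gQ[of "Suc m", folded h_def]] by (simp add: Z_def A_def)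
        qed
      qed (use Zm Z0 A0 in auto)
      have Y2a: "avg_int \<Omega> \<Omega> t Y2 = 0"
      proof -
        have "avg_int \<Omega> \<Omega> t (\<lambda>\<xi> \<eta>. \<infinity> * indicator N (node r \<xi> \<eta> j)) = 0" if "j \<le> r" for j
        proof -
          have "(\<integral>\<^sup>+z. \<infinity> * indicator N z \<partial>lborel) = 0" using N(1)
            by (subst nn_integral_cmult_indicator) (auto simp: null_sets_def)
          then show ?thesis using K3[OF t(1) t1 that, of "\<lambda>z. \<infinity> * indicator N z"] by simp
        qed
        then show ?thesis unfolding Y2_def by (subst avg_int_sum[OF clo]) (auto simp: split_beta')
      qed
      have "avg_int \<Omega> \<Omega> t (\<lambda>\<xi> \<eta>. Y1 \<xi> \<eta> + Y2 \<xi> \<eta>) \<le> ennreal ((\<Sum>k\<le>Suc m. A k) powr enn2real p)"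
        using Y1a by (simp only: avg_int_add[OF clo \<Omega>b Y1m Y2m] Y2a b_def add_0_right)
      moreover have "case_prod (\<lambda>\<xi> \<eta>. Y1 \<xi> \<eta> + Y2 \<xi> \<eta>) \<in> borel_measurable (borel \<Otimes>\<^sub>M borel)"
        using Y1m Y2m by (simp add: split_beta')
      moreover have "0 \<le> (\<Sum>k\<le>Suc m. A k)" using A0 by (intro sum_nonneg less_imp_le)
      moreover have "ennreal (\<bar>fdiff_on r ((1 / real r) *\<^sub>R (\<eta> - \<xi>)) f \<Omega> \<xi>\<bar> powr enn2real p) \<le>
        Y1 \<xi> \<eta> + Y2 \<xi> \<eta>" for \<xi> \<eta>
      proof (cases "closed_segment \<xi> (\<xi> + real r *\<^sub>R ((1 / real r) *\<^sub>R (\<eta> - \<xi>))) \<subseteq> \<Omega>")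
        case seg: True
        have sg: "node r \<xi> \<eta> j \<in> \<Omega>" if "j \<le> r" for j by (rule segment_nodes[OF seg r that])
        show ?thesis
        proof (cases "\<exists>j\<le>r. node r \<xi> \<eta> j \<in> N")
          case True
          then obtain j where "j \<le> r" "node r \<xi> \<eta> j \<in> N" by blast
          then have "Y2 \<xi> \<eta> = \<infinity>" unfolding Y2_def
            using member_le_sum[of j "{..r}" "\<lambda>j. \<infinity> * indicator N (node r \<xi> \<eta> j) :: ennreal"]
              by (simp add: top_unique)
          then show ?thesis by simp
        next
          case False
          have "\<bar>fdiff r ((1 / real r) *\<^sub>R (\<eta> - \<xi>)) f \<xi>\<bar> = \<bar>fdiff r ((1 / real r) *\<^sub>R (\<eta> - \<xi>)) g \<xi>\<bar>"
          proof -
            have "f (node r \<xi> \<eta> j) = g (node r \<xi> \<eta> j)" if "j \<in> {..r}" for j using that False sg fg by auto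
            then show ?thesis unfolding fdiff_node by (intro arg_cong[of _ _ abs] sum.cong refl) simp
          qed
          also have "\<dots> \<le> (\<Sum>j\<le>r. node_sum \<Omega> r h \<xi> \<eta> j) + (\<Sum>k\<le>m. \<bar>fdiff r ((1 / real r) *\<^sub>R (\<eta> - \<xi>)) (P k) \<xi>\<bar>)"
            unfolding h_def P_def by (rule abs_fdiff_telescope[where Q = Q, OF sg Q(1) r])
          also have "\<dots> \<le> (\<Sum>j\<le>r. node_sum \<Omega> r h \<xi> \<eta> j) + (\<Sum>k\<le>m. Z k \<xi> \<eta>)"
            using Z'(3) sg by (intro add_left_mono sum_mono) (auto simp: Z_def seg_def)
          also have "\<dots> = (\<Sum>k\<le>Suc m. Z k \<xi> \<eta>)" by (simp add: Z_def)
          finally have "ennreal (\<bar>fdiff r ((1 / real r) *\<^sub>R (\<eta> - \<xi>)) f \<xi>\<bar> powr b) \<le> Y1 \<xi> \<eta>"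
            unfolding Y1_def using b by (intro ennreal_leI powr_mono2) auto
          then show ?thesis using seg by (simp add: fdiff_on_def b_def add_increasing2)
        qed
      qed (simp add: fdiff_on_def)
      ultimately have "tau \<Omega> r f t p q \<le> ennreal (2 * (\<Sum>k\<le>Suc m. A k))"
        by (intro tau_le_avg_int[OF clo q pf]) auto
      also have "\<dots> \<le> ennreal (K * (e (Suc m) + S))"
      proof (rule ennreal_leI)
        have "2 * (\<Sum>k\<le>Suc m. A k) = 8 * K1 * S + 2 * K2 * e (Suc m)"
          by (simp add: A_def S_def sum_distrib_left sum_distrib_right algebra_simps)
        also have "\<dots> \<le> K * S + K * e (Suc m)"
          using K1 K2 S e[of "Suc m"] by (intro add_mono mult_right_mono) (auto simp: K_def)
        finally show "2 * (\<Sum>k\<le>Suc m. A k) \<le> K * (e (Suc m) + S)" by (simp add: distrib_left)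
      qed
      finally show ?thesis by (simp add: S_def)
    qed
  qed
qed

lemma best_approx_antimono: "m \<le> n \<Longrightarrow> best_approx \<Omega> n p f \<le> best_approx \<Omega> m p f"
  unfolding best_approx_def by (rule INF_superset_mono[OF Polys_mono]) auto

text \<open>The excess e has two purposes: the infimum is not claimed to be attained, and
  \<open>tau_telescope\<close> asks for strictly positive errors.\<close>

lemma near_best:
  assumes "best_approx \<Omega> n p f < \<infinity>" "0 < e"
  obtains Q where "Q \<in> Polys n" "Lnorm p \<Omega> (\<lambda>x. ennreal \<bar>f x - Q x\<bar>) \<le>
    ennreal (enn2real (best_approx \<Omega> n p f) + e)"
proof -
  have eq: "best_approx \<Omega> n p f = ennreal (enn2real (best_approx \<Omega> n p f))" using assms(1) by simp
  also have "\<dots> < ennreal (enn2real (best_approx \<Omega> n p f) + e)" using assms(2)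
    by (intro ennreal_lessI) (auto intro: add_nonneg_pos)
  finally have "(INF Q\<in>Polys n. Lnorm p \<Omega> (\<lambda>x. ennreal \<bar>f x - Q x\<bar>)) < ennreal (enn2real (best_approx \<Omega> n p f) + e)"
    by (simp only: best_approx_def)
  then show thesis using that by (auto simp: INF_less_iff intro: less_imp_le)
qed

text \<open>Apply the telescope with t = 1 / n up to the last power of two not exceeding n, and
  compare the dyadic sum with the full one by monotonicity of the errors. If some error of best
  approximation is infinite, so is the right-hand side.\<close>

lemma tau_jackson:
  obtains C where "0 < C"
    "\<And>p q f n. 1 \<le> q \<Longrightarrow> q \<le> p \<Longrightarrow> f \<in> Lspace p \<Omega> \<Longrightarrow> n \<ge> 1 \<Longrightarrow>
       tau \<Omega> r f (1 / real n) p q \<le> ennreal C * ennreal (1 / real n ^ r) *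
         (\<Sum>s=0..n. ennreal (real (s + 1) ^ (r - 1)) * best_approx \<Omega> s p f)"
proof -
  obtain K where K: "1 \<le> K" and tel: "\<And>p q f t m Q e. 1 \<le> q \<Longrightarrow> q \<le> p \<Longrightarrow> f \<in> Lspace p \<Omega> \<Longrightarrow> 0 < t \<Longrightarrow> 2 ^ m * t \<le> 1 \<Longrightarrow>
       Q 0 \<in> Polys 0 \<Longrightarrow> (\<And>k. k \<le> m \<Longrightarrow> Q (Suc k) \<in> Polys (2 ^ k)) \<Longrightarrow> (\<And>k. 0 < e k) \<Longrightarrow>
       (\<And>k. k \<le> Suc m \<Longrightarrow> Lnorm p \<Omega> (\<lambda>x. ennreal \<bar>f x - Q k x\<bar>) \<le> ennreal (e k)) \<Longrightarrow>
       tau \<Omega> r f t p q \<le> ennreal (K * (e (Suc m) + (\<Sum>k\<le>m. (2 ^ k * t) ^ r * (e (Suc k) + e k))))"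
    by (rule tau_telescope) (rule that; blast)
  define C where "C = K * (2 * 4 ^ r)"
  have C: "0 < C" using K by (simp add: C_def)
  show thesis
  proof
    show "0 < C" by (rule C)
    fix p q :: ennreal and f :: "(real ^ 'd) \<times> real \<Rightarrow> real" and n :: nat
    assume q: "1 \<le> q" "q \<le> p" and f: "f \<in> Lspace p \<Omega>" and n: "n \<ge> 1"
    define c where "c s = real (s + 1) ^ (r - 1)" for s
    have c: "0 < c s" for s by (simp add: c_def)
    show "tau \<Omega> r f (1 / real n) p q \<le> ennreal C * ennreal (1 / real n ^ r) *
         (\<Sum>s=0..n. ennreal (c s) * best_approx \<Omega> s p f)"
    proof (cases "\<exists>s\<le>n. best_approx \<Omega> s p f = \<infinity>")
      case True
      then obtain s where s: "s \<le> n" "best_approx \<Omega> s p f = \<infinity>" by blast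
      then have "ennreal (c s) * best_approx \<Omega> s p f = \<infinity>" using c[of s] by (simp add: ennreal_mult_eq_top_iff)
      moreover have "ennreal (c s) * best_approx \<Omega> s p f \<le> (\<Sum>s=0..n. ennreal (c s) * best_approx \<Omega> s p f)"
        using s(1) by (intro member_le_sum) auto
      ultimately have "(\<Sum>s=0..n. ennreal (c s) * best_approx \<Omega> s p f) = \<infinity>" by (simp add: top_unique)
      then show ?thesis using C n by (simp only:) (simp add: ennreal_mult_top ennreal_mult[symmetric])
    next
      case False
      define E where "E s = enn2real (best_approx \<Omega> s p f)" for s
      have fin: "best_approx \<Omega> s p f < \<infinity>" if "s \<le> n" for s using False that by (auto simp: top.not_eq_extremum)
      have E: "best_approx \<Omega> s p f = ennreal (E s)" if "s \<le> n" for s using fin[OF that] by (simp add: E_def)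
      have E0: "0 \<le> E s" for s by (simp add: E_def)
      have Emono: "E s' \<le> E s" if "s \<le> s'" "s' \<le> n" for s s'
        unfolding E_def using that by (intro enn2real_mono best_approx_antimono) (use fin[of s] in auto)
      obtain m where m: "2 ^ m \<le> n" "n < 2 ^ Suc m"
        using ex_power_ivl1[of 2 n] n by auto
      define t where "t = 1 / real n"
      have t: "0 < t" using n by (simp add: t_def)
      have m1: "2 ^ m * t \<le> 1" using of_nat_mono[OF m(1), where 'a = real] n by (simp add: t_def)
      \<comment> \<open>Since 2^(m+1) exceeds n, the remainder may be given this weight and becomes
        the last term of the dyadic sum.\<close>
      have m2: "1 \<le> (2 ^ Suc m * t) ^ r"
        using of_nat_mono[OF less_imp_le[OF m(2)], where 'a = real] n by (intro one_le_power) (simp add: t_def)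
      \<comment> \<open>Raising every error by \<epsilon> / W raises the bound by exactly
        \<epsilon>; this removes the slack of the near-best choices.\<close>
      define W where "W = C * t ^ r * (\<Sum>s\<le>n. c s)"
      have W: "0 < W" unfolding W_def using C t c by (intro mult_pos_pos sum_pos zero_less_power) auto
      have main: "tau \<Omega> r f t p q \<le> ennreal (C * t ^ r * (\<Sum>s\<le>n. c s * (E s + \<epsilon>)))" if \<epsilon>: "0 < \<epsilon>" for \<epsilon>
      proof -
        have "\<exists>Q\<in>Polys s. Lnorm p \<Omega> (\<lambda>x. ennreal \<bar>f x - Q x\<bar>) \<le> ennreal (E s + \<epsilon>)" if "s \<le> n" for s
          using near_best[OF fin[OF that] \<epsilon>] unfolding E_def by metis
        then obtain Q where Q: "\<And>s. s \<le> n \<Longrightarrow> Q s \<in> Polys s" "\<And>s. s \<le> n \<Longrightarrow>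
          Lnorm p \<Omega> (\<lambda>x. ennreal \<bar>f x - Q s x\<bar>) \<le> ennreal (E s + \<epsilon>)"
          by metis
        \<comment> \<open>The degrees 0, 1, 2, 4 and so on; the shift of the index by one makes room
          for the constants at level 0.\<close>
        define i where "i k = (case k of 0 \<Rightarrow> 0 | Suc k \<Rightarrow> (2::nat) ^ k)" for k
        have i: "i 0 = 0" "i (Suc k) = 2 ^ k" for k by (auto simp: i_def)
        have imono: "i k \<le> i (Suc k)" for k by (cases k) (auto simp: i)
        have in_n: "i k \<le> n" if "k \<le> Suc m" for k
        proof (cases k)
          case (Suc j)
          have "2 ^ j \<le> (2::nat) ^ m" using Suc that by (intro power_increasing) auto
          with m(1) have "2 ^ j \<le> n" by (rule order_trans[rotated])
          then show ?thesis using Suc by (simp add: i)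
        qed (simp add: i)
        define F where "F s = E s + \<epsilon>" for s
        have F: "0 < F s" for s using E0[of s] \<epsilon> by (simp add: F_def)
        have Fmono: "F s' \<le> F s" if "s \<le> s'" "s' \<le> n" for s s' using Emono[OF that] by (simp add: F_def)
        have "tau \<Omega> r f t p q \<le> ennreal (K * (F (i (Suc m)) + (\<Sum>k\<le>m. (2 ^ k * t) ^ r *
          (F (i (Suc k)) + F (i k)))))"
        proof (rule tel[OF q f t m1, where Q = "\<lambda>k. Q (i k)"])
          show "Q (i 0) \<in> Polys 0" using Q(1)[of 0] by (simp add: i)
          show "Q (i (Suc k)) \<in> Polys (2 ^ k)" if "k \<le> m" for k
            using Q(1)[OF in_n[of "Suc k"]] that by (simp add: i)
        qed (use Q(2)[OF in_n] F in \<open>auto simp: F_def\<close>)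
        also have "\<dots> \<le> ennreal (C * t ^ r * (\<Sum>s\<le>n. c s * F s))"
        proof (rule ennreal_leI)
          have "F (i (Suc m)) + (\<Sum>k\<le>m. (2 ^ k * t) ^ r * (F (i (Suc k)) + F (i k))) \<le>
            2 * (t ^ r * (2 ^ Suc m) ^ r * F (2 ^ m)) + (\<Sum>k\<le>m. 2 * (t ^ r * ((2 ^ k) ^ r * F (i k))))"
          proof (intro add_mono sum_mono)
            have "1 * F (2 ^ m) \<le> (2 ^ Suc m * t) ^ r * F (2 ^ m)" using m2 F[of "2 ^ m"]
              by (intro mult_right_mono) auto
            also have "\<dots> \<le> 2 * ((2 ^ Suc m * t) ^ r * F (2 ^ m))" using t F[of "2 ^ m"] by simp
            also have "\<dots> = 2 * (t ^ r * (2 ^ Suc m) ^ r * F (2 ^ m))" by (simp only: power_mult_distrib mult_ac)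
            finally show "F (i (Suc m)) \<le> 2 * (t ^ r * (2 ^ Suc m) ^ r * F (2 ^ m))" by (simp add: i)
            fix k assume k: "k \<in> {..m}"
            have "F (i (Suc k)) \<le> F (i k)" using k in_n by (intro Fmono imono) auto
            then have "(2 ^ k * t) ^ r * (F (i (Suc k)) + F (i k)) \<le> (2 ^ k * t) ^ r * (2 * F (i k))" using t
              by (intro mult_left_mono) auto
            also have "\<dots> = 2 * (t ^ r * ((2 ^ k) ^ r * F (i k)))" by (simp only: power_mult_distrib mult_ac)
            finally show "(2 ^ k * t) ^ r * (F (i (Suc k)) + F (i k)) \<le> 2 * (t ^ r * ((2 ^ k) ^ r * F (i k)))" .
          qed
          also have "\<dots> = 2 * t ^ r * (\<Sum>k\<le>Suc m. (2 ^ k) ^ r * F (i k))"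
            by (simp add: sum_distrib_left distrib_left i mult_ac)
          also have "(\<Sum>k\<le>Suc m. (2 ^ k) ^ r * F (i k)) = F 0 + (\<Sum>k\<le>m. (2 ^ Suc k) ^ r * F (2 ^ k))"
            by (simp only: sum.atMost_Suc_shift i) simp
          also have "\<dots> \<le> 4 ^ r * (\<Sum>s\<le>2 ^ m. real (s + 1) ^ (r - 1) * F s)"
            by (rule dyadic_sum_le[OF r _ _ m(1)]) (use F Fmono in \<open>auto intro: less_imp_le\<close>)
          also have "(\<Sum>s\<le>2 ^ m. real (s + 1) ^ (r - 1) * F s) \<le> (\<Sum>s\<le>n. c s * F s)"
            unfolding c_def using m F by (intro sum_mono2) (auto intro!: mult_nonneg_nonneg less_imp_le)
          finally have "F (i (Suc m)) + (\<Sum>k\<le>m. (2 ^ k * t) ^ r * (F (i (Suc k)) + F (i k))) \<le>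
            2 * t ^ r * (4 ^ r * (\<Sum>s\<le>n. c s * F s))"
            using t by (simp add: mult_left_mono)
          then have "K * (F (i (Suc m)) + (\<Sum>k\<le>m. (2 ^ k * t) ^ r * (F (i (Suc k)) + F (i k)))) \<le>
            K * (2 * t ^ r * (4 ^ r * (\<Sum>s\<le>n. c s * F s)))"
            using K by (intro mult_left_mono) auto
          also have "\<dots> = C * t ^ r * (\<Sum>s\<le>n. c s * F s)" by (simp only: C_def mult_ac)
          finally show "K * (F (i (Suc m)) + (\<Sum>k\<le>m. (2 ^ k * t) ^ r * (F (i (Suc k)) + F (i k)))) \<le>
            C * t ^ r * (\<Sum>s\<le>n. c s * F s)" .
        qed
        finally show ?thesis by (simp add: F_def)
      qed
      have "tau \<Omega> r f t p q \<le> ennreal (C * t ^ r * (\<Sum>s\<le>n. c s * E s))"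
      proof (rule ennreal_le_epsilon)
        fix \<epsilon> :: real assume \<epsilon>: "0 < \<epsilon>"
        have "tau \<Omega> r f t p q \<le> ennreal (C * t ^ r * (\<Sum>s\<le>n. c s * (E s + \<epsilon> / W)))" using \<epsilon> W
          by (intro main) simp
        also have "C * t ^ r * (\<Sum>s\<le>n. c s * (E s + \<epsilon> / W)) = C * t ^ r * (\<Sum>s\<le>n. c s * E s) + W * (\<epsilon> / W)"
          by (simp only: W_def distrib_left sum.distrib sum_distrib_right mult.assoc)
        also have "W * (\<epsilon> / W) = \<epsilon>" using W by simp
        also have "ennreal (C * t ^ r * (\<Sum>s\<le>n. c s * E s) + \<epsilon>) =
          ennreal (C * t ^ r * (\<Sum>s\<le>n. c s * E s)) + ennreal \<epsilon>"
          using C t c E0 \<epsilon> by (intro ennreal_plus mult_nonneg_nonneg sum_nonneg) (auto intro: less_imp_le)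
        finally show "tau \<Omega> r f t p q \<le> ennreal (C * t ^ r * (\<Sum>s\<le>n. c s * E s)) + ennreal \<epsilon>" .
      qed
      also have "\<dots> = ennreal C * ennreal (t ^ r) * (\<Sum>s\<le>n. ennreal (c s * E s))"
      proof -
        have nn: "0 \<le> c s * E s" for s using c[of s] E0[of s] by simp
        then have "0 \<le> (\<Sum>s\<le>n. c s * E s)" by (intro sum_nonneg)
        then show ?thesis using C t nn by (simp add: sum_ennreal ennreal_mult)
      qed
      also have "(\<Sum>s\<le>n. ennreal (c s * E s)) = (\<Sum>s=0..n. ennreal (c s) * best_approx \<Omega> s p f)"
        using c E0 by (intro sum.cong) (auto simp: E ennreal_mult less_imp_le)
      finally show ?thesis by (simp add: t_def power_one_over)
    qed
  qed
qed

end

theorem theorem1p15: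
  fixes \<Omega> G :: "((real ^ 'd) \<times> real) set" and r :: nat
  assumes "C2_domain G" and "\<Omega> = closure G" and "r \<ge> 1"
  shows "\<exists>C::real. C > 0 \<and>
    (\<forall>(p::ennreal) (q::ennreal) f (n::nat).
       1 \<le> q \<longrightarrow> q \<le> p \<longrightarrow> f \<in> Lspace p \<Omega> \<longrightarrow> n \<ge> 1 \<longrightarrow>
       tau \<Omega> r f (1 / real n) p q
         \<le> ennreal C * ennreal (1 / real n ^ r) *
           (\<Sum>s=0..n. ennreal (real (s + 1) ^ (r - 1)) * best_approx \<Omega> s p f))"
proof -
  obtain \<S> where S: "finite \<S>" "closure G \<subseteq> \<Union>\<S>" "\<And>S. S \<in> \<S> \<Longrightarrow> S \<in> sets borel"
    "\<And>S. S \<in> \<S> \<Longrightarrow> \<exists>a B f g \<kappa> M c C. patch (closure G) S a B f g \<kappa> M c C"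
    using C2_domain_patches[OF assms(1)] by blast
  have "bounded G" using assms(1) by (simp add: C2_domain_def)
  then interpret covered \<Omega> \<S> r
    using S assms(2,3) by unfold_locales (auto simp: compact_closure)
  show ?thesis by (rule tau_jackson) blast
qed

end
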